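(* Suppose that for some constant $\lambda\ge 0$ the matrix $\Phi_\lambda(s)$ admits a spectral factorization $\Phi_\lambda(s)=\Upsilon_\lambda(s)\Upsilon_\lambda(s)^H$ with $\Upsilon_\lambda$ as described in the context. Let $\bar\gamma>0$ lie in the feasible set of the problem $\inf\bar\gamma^2$ over $\bar\gamma^2$ and Hermitian $X_1,Y_1\in\mathbf{C}^{m\times m}$ subject to the constraints $$\bar\gamma^2>\lambda^2,\qquad X_1>0,\quad Y_1>0,\qquad A_\lambda X_1+X_1A_\lambda^\dagger+B_\lambda B_\lambda^\dagger<0,$$ $$\begin{bmatrix}N_c^\dagger&0\\ 0&I_n\end{bmatrix}\begin{bmatrix}A_\lambda^\dagger Y_1+Y_1A_\lambda&Y_1B_\lambda&C_{2,\lambda}^\dagger\\ B_\lambda^\dagger Y_1&-I_p&D_{2,\lambda}^\dagger\\ C_{2,\lambda}&D_{2,\lambda}&-\bar\gamma^2I_n\end{bmatrix}\begin{bmatrix}N_c&0\\ 0&I_n\end{bmatrix}<0,$$ $$\begin{bmatrix}X_1&I\\ I&Y_1\end{bmatrix}\ge0,\qquad\mathrm{rank}\begin{bmatrix}X_1&I\\ I&Y_1\end{bmatrix}\le m+m_{11}$$ (i.e. these constraints hold for this $\bar\gamma$ with some $X_1,Y_1$). If there exists $\theta>0$ such that, with $\gamma=(\bar\gamma^2-\lambda^2)^{1/2}$, $$\theta\left(\Phi(i\omega)-\gamma^2\begin{bmatrix}0&0\\ 0&I_n\end{bmatrix}\right)-\begin{bmatrix}I_{n_y}&0\\ 0&-I_n\end{bmatrix}>0\quad\forall\omega\in\bar{\mathbf{R}},$$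 then the set $\mathcal{H}_{11,\gamma}^-$ corresponding to this $\gamma$ is not empty and $\gamma\ge\gamma_\circ''=\gamma_\circ$. One transfer function which belongs to this set is given by $$H_{11}(s)=C_{11}(sI-A_{11})^{-1}B_{11}+J_{11},$$ where $A_{11},B_{11},C_{11},J_{11}$ (of dimensions $m_{11}\times m_{11}$, $m_{11}\times n_y$, $n\times m_{11}$, $n\times n_y$) are matrices which render the inequality $$\Sigma_{\hat X}+\Pi^\dagger K^\dagger\Lambda_{\hat X}+\Lambda_{\hat X}^\dagger K\Pi<0$$ true with the chosen $\bar\gamma$ and some $\hat X=\hat X^\dagger>0$. That is, $\gamma=(\bar\gamma^2-\lambda^2)^{1/2}$ and this $H_{11}(s)$ lie in the feasible set of the optimization problem $\gamma_\circ''=\inf\{\gamma>0:\mathcal{H}_{11,\gamma}^-\neq\emptyset\}$.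
   Context: Notation. $^\dagger$ is the complex conjugate transpose of a matrix, $^T$ the transpose, $X(s)^H\triangleq X(-s^* )^\dagger$ for a rational matrix function $X$, $I_k$ the $k\times k$ identity matrix. Inequalities between Hermitian matrices are in the positive (semi)definite order. $\bar{\mathbf{R}}=\mathbf{R}\cup\{\pm\infty\}$ (values at $\pm\infty$ are limits). Channel. $n,n_w,n_y,n_d$ are dimensions with $n_y+n_d=n+n_w$. The channel is given by complex matrices $A,B,C,D$, with $A$ Hurwitz, satisfying $A+A^\dagger+BB^\dagger=0$, $B=-C^\dagger D$, $D^\dagger D=DD^\dagger=I_{n+n_w}$, and $(A,B,C,D)$ is a minimal realization of the $(n_y+n_d)\times(n+n_w)$ transfer function $G(s)=D+C(sI-A)^{-1}B$. $G$ is partitioned as $G=\begin{bmatrix}G_{11}&G_{12}\\ G_{21}&G_{22}\end{bmatrix}$ with $G_{11}$ of size $n_y\times n$ and $G_{12}$ of size $n_y\times n_w$. $\Sigma_u$ ($n\times n$) and $\Sigma_w$ ($n_w\times n_w$) are Hermitian positive definite matrices. Define $$\Psi(s)=G_{11}(s)\Sigma_u^TG_{11}(s)^H+G_{12}(s)\Sigma_w^TG_{12}(s)^H,$$ $$\Phi(s)=\begin{bmatrix}\Psi(s)&-G_{11}(s)(I_n+\Sigma_u^T)\\ -(I_n+\Sigma_u^T)G_{11}(s)^H&\Sigma_u^T+2I_n\end{bmatrix},\qquad \Phi_\lambda(s)=\Phi(s)+\begin{bmatrix}0&0\\ 0&\lambda^2I_n\end{bmatrix}.$$ Filters. $\mathcal{H}_p$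 is the set of admissible equalizers: stable rational $n_f\times n_f$ transfer functions $H(s)$ in the Hardy space $H_\infty$, $n_f=n_y+n_z\ge n$ (the number $n_z$ is not fixed in advance), analytic in $\mathrm{Re}\,s>-\tau$ for some $\tau>0$, and paraunitary: $H(s)^HH(s)=H(s)H(s)^H=I$; $H_{11}$ denotes the top-left $n\times n_y$ block of $H$. For any $n\times n_y$ transfer function $H_{11}$, $$P_e(s)=\begin{bmatrix}H_{11}(s)&I_n\end{bmatrix}\Phi(s)\begin{bmatrix}H_{11}(s)^H\\ I_n\end{bmatrix}.$$ $\gamma_\circ$ is the infimum of all $\gamma>0$ for which there exists $H\in\mathcal{H}_p$ with $P_e(i\omega)<\gamma^2I_n$ for all $\omega\in\mathbf{R}$. For $\gamma>0$, $\mathcal{H}_{11,\gamma}^-$ is the set of proper rational $n\times n_y$ transfer functions $H_{11}$ such that: all poles of $H_{11}$ lie in the open left half-plane and $H_{11}$ is analytic in $\mathrm{Re}\,s>-\tau$ for some $\tau>0$; $P_e(i\omega)<\gamma^2I_n$ for all $\omega\in\mathbf{R}$; and $H_{11}(i\omega)H_{11}(i\omega)^\dagger<I_n$ for all $\omega\in\bar{\mathbf{R}}$. $\gamma_\circ''=\inf\{\gamma>0:\mathcal{H}_{11,\gamma}^-\ne\emptyset\}$. Spectral factor. $\Upsilon_\lambda(s)$ is an $(n_y+n)\times p$ rational matrix with all its poles in $\mathrm{Re}\,s<-\tau$ and analytic in $\mathrm{Re}\,s>-\tau$ for some $\tau>0$. $m$ is its McMillan degree and $$\Upsilon_\lambda(s)=\begin{bmatrix}C_{1,\lambda}\\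 C_{2,\lambda}\end{bmatrix}(sI_m-A_\lambda)^{-1}B_\lambda+\begin{bmatrix}D_{1,\lambda}\\ D_{2,\lambda}\end{bmatrix}$$ is a minimal realization, with $A_\lambda$ ($m\times m$, Hurwitz), $B_\lambda$ ($m\times p$), $C_{1,\lambda}$ ($n_y\times m$), $C_{2,\lambda}$ ($n\times m$), $D_{1,\lambda}$ ($n_y\times p$), $D_{2,\lambda}$ ($n\times p$). $N_c$ is a full rank matrix with $\mathrm{Im}\,N_c=\mathrm{Ker}\begin{bmatrix}C_{1,\lambda}&D_{1,\lambda}\end{bmatrix}$. The filter state dimension $m_{11}$ is fixed. Matrices in the design inequality ($\hat X$ is $(m+m_{11})\times(m+m_{11})$): $$K=\begin{bmatrix}A_{11}^\dagger&C_{11}^\dagger\\ B_{11}^\dagger&J_{11}^\dagger\end{bmatrix},\ \bar A=\begin{bmatrix}A_\lambda^\dagger&0\\ 0&0_{m_{11}\times m_{11}}\end{bmatrix},\ \bar B=\begin{bmatrix}C_{2,\lambda}^\dagger\\ 0_{m_{11}\times n}\end{bmatrix},\ \underline{B}=\begin{bmatrix}0_{m\times m_{11}}&C_{1,\lambda}^\dagger\\ I_{m_{11}}&0_{m_{11}\times n_y}\end{bmatrix},$$ $$\underline{C}=\begin{bmatrix}0_{m_{11}\times m}&I_{m_{11}}\\ 0_{n\times m}&0_{n\times m_{11}}\end{bmatrix},\ \underline{D}_{12}=\begin{bmatrix}0_{p\times m_{11}}&D_{1,\lambda}^\dagger\end{bmatrix},\ \bar C=\begin{bmatrix}B_\lambda^\dagger&0_{p\times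 m_{11}}\end{bmatrix},\ \bar D=D_{2,\lambda}^\dagger,\ \underline{D}_{21}=\begin{bmatrix}0_{m_{11}\times n}\\ I_n\end{bmatrix},$$ $$\Sigma_{\hat X}=\begin{bmatrix}\bar A^\dagger\hat X+\hat X\bar A&\hat X\bar B&\bar C^\dagger\\ \bar B^\dagger\hat X&-\bar\gamma^2I_n&\bar D^\dagger\\ \bar C&\bar D&-I_p\end{bmatrix},\quad\Lambda_{\hat X}=\begin{bmatrix}\underline{B}^\dagger\hat X&0_{(m_{11}+n_y)\times n}&\underline{D}_{12}^\dagger\end{bmatrix},\quad\Pi=\begin{bmatrix}\underline{C}&\underline{D}_{21}&0_{(m_{11}+n)\times p}\end{bmatrix}.$$ *)

theory Defs
  imports
    "HOL-Library.Extended_Real"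
    "HOL-Complex_Analysis.Complex_Singularities"
    "Jordan_Normal_Form.Gauss_Jordan_Elimination"
    "Jordan_Normal_Form.Char_Poly"
    "Jordan_Normal_Form.DL_Rank"
    "Jordan_Normal_Form.Matrix_Kernel"
    "Jordan_Normal_Form.Schur_Decomposition"
begin

section \<open>Matrices\<close>

notation mat_adjoint (\<open>_\<^sup>\<dagger>\<close> [1000] 1000)

definition append_cols :: "'a :: zero mat \<Rightarrow> 'a mat \<Rightarrow> 'a mat" (infixr \<open>@\<^sub>c\<close> 66) where
  "M @\<^sub>c N = four_block_mat M N (0\<^sub>m 0 (dim_col M)) (0\<^sub>m 0 (dim_col N))"

definition block3 :: "'a :: zero mat \<Rightarrow> 'a mat \<Rightarrow> 'a mat \<Rightarrow> 'a mat \<Rightarrow> 'a mat \<Rightarrow> 'a mat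
    \<Rightarrow> 'a mat \<Rightarrow> 'a mat \<Rightarrow> 'a mat \<Rightarrow> 'a mat" where
  "block3 M11 M12 M13 M21 M22 M23 M31 M32 M33 =
     (M11 @\<^sub>c M12 @\<^sub>c M13) @\<^sub>r (M21 @\<^sub>c M22 @\<^sub>c M23) @\<^sub>r (M31 @\<^sub>c M32 @\<^sub>c M33)"

text \<open>The order on type \<^typ>\<open>complex mat\<close> provided by the library is entrywise,
  so the definite (Loewner) order needs its own constants.  On \<^typ>\<open>complex\<close>,
  \<open>0 < z\<close> says that \<open>z\<close> is real and positive; the scalar below is
  the quadratic form of \<open>M\<close> at \<open>x\<close>.  The equation for the adjoint makes \<open>M\<close> square.\<close>

definition pos_def :: "complex mat \<Rightarrow> bool" where
  "pos_def M \<longleftrightarrow> M\<^sup>\<dagger> = M \<and>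
     (\<forall>x \<in> carrier_vec (dim_row M). x \<noteq> 0\<^sub>v (dim_row M) \<longrightarrow> 0 < (M *\<^sub>v x) \<bullet>c x)"

definition pos_semidef :: "complex mat \<Rightarrow> bool" where
  "pos_semidef M \<longleftrightarrow> M\<^sup>\<dagger> = M \<and> (\<forall>x \<in> carrier_vec (dim_row M). 0 \<le> (M *\<^sub>v x) \<bullet>c x)"

definition loewner_less :: "complex mat \<Rightarrow> complex mat \<Rightarrow> bool" (infix \<open>\<prec>\<close> 50) where
  "M \<prec> N \<longleftrightarrow> pos_def (N - M)"

definition neg_def :: "complex mat \<Rightarrow> bool" where
  "neg_def M \<longleftrightarrow> M \<prec> 0\<^sub>m (dim_row M) (dim_col M)"

definition hurwitz :: "complex mat \<Rightarrow> bool" where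
  "hurwitz M \<longleftrightarrow> (\<forall>z. eigenvalue M z \<longrightarrow> Re z < 0)"

section \<open>Rational matrix functions\<close>

text \<open>A rational matrix is represented by a function \<open>F\<close> from the complex plane to
  matrices.  The values at finitely many points (in particular at the poles) carry no information,
  so identities between rational matrices are required for all but finitely many arguments.
  Where \<open>F\<close> is required to be analytic, its values are the right ones.\<close>

definition rational_fun :: "(complex \<Rightarrow> complex) \<Rightarrow> bool" where
  "rational_fun f \<longleftrightarrow>
     (\<exists>p q. q \<noteq> 0 \<and> (\<forall>s. poly q s \<noteq> 0 \<longrightarrow> f s = poly p s / poly q s))"

definition proper_rational_fun :: "(complex \<Rightarrow> complex) \<Rightarrow> bool" where
  "proper_rational_fun f \<longleftrightarrow>
     (\<exists>p q. q \<noteq> 0 \<and> degree p \<le> degree q \<and> (\<forall>s. poly q s \<noteq> 0 \<longrightarrow> f s = poly p s / poly q s))"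

definition entrywise :: "nat \<Rightarrow> nat \<Rightarrow> ((complex \<Rightarrow> complex) \<Rightarrow> bool) \<Rightarrow> (complex \<Rightarrow> complex mat) \<Rightarrow> bool" where
  "entrywise r c Q F \<longleftrightarrow> (\<forall>s. F s \<in> carrier_mat r c) \<and> (\<forall>i<r. \<forall>j<c. Q (\<lambda>s. F s $$ (i, j)))"

definition stable_fun :: "(complex \<Rightarrow> complex) \<Rightarrow> bool" where
  "stable_fun f \<longleftrightarrow> (\<forall>z. is_pole f z \<longrightarrow> Re z < 0)"

definition hardy_inf_fun :: "(complex \<Rightarrow> complex) \<Rightarrow> bool" where
  "hardy_inf_fun f \<longleftrightarrow> f holomorphic_on {s. Re s > 0} \<and> bounded (f ` {s. Re s > 0})"

definition paraconj :: "(complex \<Rightarrow> complex mat) \<Rightarrow> complex \<Rightarrow> complex mat" where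
  "paraconj F s = (F (- cnj s))\<^sup>\<dagger>"

definition transfer_fun :: "complex mat \<Rightarrow> complex mat \<Rightarrow> complex mat \<Rightarrow> complex mat
    \<Rightarrow> complex \<Rightarrow> complex mat" where
  "transfer_fun A B C D s =
     D + C * the (mat_inverse (s \<cdot>\<^sub>m 1\<^sub>m (dim_row A) - A)) * B"

definition realization :: "nat \<Rightarrow> nat \<Rightarrow> nat \<Rightarrow> complex mat \<Rightarrow> complex mat \<Rightarrow> complex mat \<Rightarrow> complex mat
    \<Rightarrow> (complex \<Rightarrow> complex mat) \<Rightarrow> bool" where
  "realization q r c A B C D F \<longleftrightarrow>
     A \<in> carrier_mat q q \<and> B \<in> carrier_mat q c \<and> C \<in> carrier_mat r q \<and> D \<in> carrier_mat r c \<and>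
     (\<forall>\<^sub>F s in cofinite. F s = transfer_fun A B C D s)"

definition mcmillan_degree :: "nat \<Rightarrow> nat \<Rightarrow> (complex \<Rightarrow> complex mat) \<Rightarrow> nat" where
  "mcmillan_degree r c F = (LEAST q. \<exists>A B C D. realization q r c A B C D F)"

definition minimal_realization :: "nat \<Rightarrow> nat \<Rightarrow> nat \<Rightarrow> complex mat \<Rightarrow> complex mat \<Rightarrow> complex mat \<Rightarrow> complex mat
    \<Rightarrow> (complex \<Rightarrow> complex mat) \<Rightarrow> bool" where
  "minimal_realization q r c A B C D F \<longleftrightarrow>
     realization q r c A B C D F \<and> q = mcmillan_degree r c F"

text \<open>The value at the frequency \<open>\<omega>\<close> in the extended real line, that is, at the point
  \<open>\<i>\<omega>\<close> of the imaginary axis; at the two infinite frequencies the entrywise limit.\<close>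

definition freq_lim :: "(complex \<Rightarrow> complex mat) \<Rightarrow> real filter \<Rightarrow> complex mat" where
  "freq_lim F L = Matrix.mat (dim_row (F 0)) (dim_col (F 0))
     (\<lambda>(i, j). Lim L (\<lambda>\<omega>. F (\<i> * of_real \<omega>) $$ (i, j)))"

definition freq_val :: "(complex \<Rightarrow> complex mat) \<Rightarrow> ereal \<Rightarrow> complex mat" where
  "freq_val F \<omega> = (case \<omega> of
       ereal r \<Rightarrow> F (\<i> * of_real r)
     | PInfty \<Rightarrow> freq_lim F at_top
     | MInfty \<Rightarrow> freq_lim F at_bot)"

section \<open>Channel\<close>

definition quantum_channel :: "nat \<Rightarrow> nat \<Rightarrow> nat \<Rightarrow> nat \<Rightarrow> nat
    \<Rightarrow> complex mat \<Rightarrow> complex mat \<Rightarrow> complex mat \<Rightarrow> complex mat \<Rightarrow> bool" where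
  "quantum_channel n nw ny nd q A B C D \<longleftrightarrow>
     ny + nd = n + nw \<and>
     hurwitz A \<and>
     A + A\<^sup>\<dagger> + B * B\<^sup>\<dagger> = 0\<^sub>m q q \<and>
     B = - (C\<^sup>\<dagger> * D) \<and>
     D\<^sup>\<dagger> * D = 1\<^sub>m (n + nw) \<and> D * D\<^sup>\<dagger> = 1\<^sub>m (n + nw) \<and>
     minimal_realization q (ny + nd) (n + nw) A B C D (transfer_fun A B C D)"

definition block11 :: "nat \<Rightarrow> nat \<Rightarrow> (complex \<Rightarrow> complex mat) \<Rightarrow> complex \<Rightarrow> complex mat" where
  "block11 r c F s = (case split_block (F s) r c of (F11, F12, F21, F22) \<Rightarrow> F11)"

definition block12 :: "nat \<Rightarrow> nat \<Rightarrow> (complex \<Rightarrow> complex mat) \<Rightarrow> complex \<Rightarrow> complex mat" where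
  "block12 r c F s = (case split_block (F s) r c of (F11, F12, F21, F22) \<Rightarrow> F12)"

definition Psi :: "nat \<Rightarrow> nat \<Rightarrow> (complex \<Rightarrow> complex mat) \<Rightarrow> complex mat \<Rightarrow> complex mat
    \<Rightarrow> complex \<Rightarrow> complex mat" where
  "Psi n ny G \<Sigma>u \<Sigma>w s =
     block11 ny n G s * transpose_mat \<Sigma>u * paraconj (block11 ny n G) s +
     block12 ny n G s * transpose_mat \<Sigma>w * paraconj (block12 ny n G) s"

definition Phi :: "nat \<Rightarrow> nat \<Rightarrow> (complex \<Rightarrow> complex mat) \<Rightarrow> complex mat \<Rightarrow> complex mat
    \<Rightarrow> complex \<Rightarrow> complex mat" where
  "Phi n ny G \<Sigma>u \<Sigma>w s = four_block_mat
     (Psi n ny G \<Sigma>u \<Sigma>w s)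
     (- (block11 ny n G s * (1\<^sub>m n + transpose_mat \<Sigma>u)))
     (- ((1\<^sub>m n + transpose_mat \<Sigma>u) * paraconj (block11 ny n G) s))
     (transpose_mat \<Sigma>u + 2 \<cdot>\<^sub>m 1\<^sub>m n)"

definition lower_id :: "nat \<Rightarrow> nat \<Rightarrow> complex mat" where
  "lower_id ny n = four_block_mat (0\<^sub>m ny ny) (0\<^sub>m ny n) (0\<^sub>m n ny) (1\<^sub>m n)"

definition signature_mat :: "nat \<Rightarrow> nat \<Rightarrow> complex mat" where
  "signature_mat ny n = four_block_mat (1\<^sub>m ny) (0\<^sub>m ny n) (0\<^sub>m n ny) (- 1\<^sub>m n)"

definition Phi_lambda :: "nat \<Rightarrow> nat \<Rightarrow> (complex \<Rightarrow> complex mat) \<Rightarrow> complex mat \<Rightarrow> complex mat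
    \<Rightarrow> real \<Rightarrow> complex \<Rightarrow> complex mat" where
  "Phi_lambda n ny G \<Sigma>u \<Sigma>w lam s =
     Phi n ny G \<Sigma>u \<Sigma>w s + complex_of_real (lam\<^sup>2) \<cdot>\<^sub>m lower_id ny n"

section \<open>Equalizers\<close>

text \<open>In this section \<open>\<Phi>\<close> is the \<open>(ny + n) \<times> (ny + n)\<close> matrix \<^const>\<open>Phi\<close> of the channel.
  The set \<open>contractive_equalizers n ny \<Phi> \<gamma>\<close> below is \<open>\<H>\<close> with subscript \<open>11,\<gamma>\<close> and
  superscript minus; the constants \<open>gamma_opt\<close> and \<open>gamma_opt_contractive\<close> are the optimal values
  written as gamma with subscript circle, without and with two primes.\<close>

definition error_psd :: "nat \<Rightarrow> (complex \<Rightarrow> complex mat) \<Rightarrow> (complex \<Rightarrow> complex mat)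
    \<Rightarrow> complex \<Rightarrow> complex mat" where
  "error_psd n \<Phi> H11 s = (H11 s @\<^sub>c 1\<^sub>m n) * \<Phi> s * (paraconj H11 s @\<^sub>r 1\<^sub>m n)"

definition error_below :: "nat \<Rightarrow> (complex \<Rightarrow> complex mat) \<Rightarrow> (complex \<Rightarrow> complex mat) \<Rightarrow> real \<Rightarrow> bool" where
  "error_below n \<Phi> H11 \<gamma> \<longleftrightarrow>
     (\<forall>\<omega>::real. error_psd n \<Phi> H11 (\<i> * of_real \<omega>) \<prec> complex_of_real (\<gamma>\<^sup>2) \<cdot>\<^sub>m 1\<^sub>m n)"

definition admissible_equalizers :: "nat \<Rightarrow> nat \<Rightarrow> (complex \<Rightarrow> complex mat) set" where
  "admissible_equalizers n ny = {H. \<exists>nz nf. nf = ny + nz \<and> n \<le> nf \<and>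
     entrywise nf nf rational_fun H \<and>
     entrywise nf nf stable_fun H \<and>
     entrywise nf nf hardy_inf_fun H \<and>
     (\<exists>\<tau>>0. entrywise nf nf (\<lambda>f. f analytic_on {s. Re s > - \<tau>}) H) \<and>
     (\<forall>\<^sub>F s in cofinite. paraconj H s * H s = 1\<^sub>m nf \<and> H s * paraconj H s = 1\<^sub>m nf)}"

definition gamma_opt :: "nat \<Rightarrow> nat \<Rightarrow> (complex \<Rightarrow> complex mat) \<Rightarrow> real" where
  "gamma_opt n ny \<Phi> =
     Inf {\<gamma>. \<gamma> > 0 \<and> (\<exists>H \<in> admissible_equalizers n ny. error_below n \<Phi> (block11 n ny H) \<gamma>)}"

definition contractive_equalizers :: "nat \<Rightarrow> nat \<Rightarrow> (complex \<Rightarrow> complex mat) \<Rightarrow> real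
    \<Rightarrow> (complex \<Rightarrow> complex mat) set" where
  "contractive_equalizers n ny \<Phi> \<gamma> = {H11.
     entrywise n ny proper_rational_fun H11 \<and>
     entrywise n ny stable_fun H11 \<and>
     (\<exists>\<tau>>0. entrywise n ny (\<lambda>f. f analytic_on {s. Re s > - \<tau>}) H11) \<and>
     error_below n \<Phi> H11 \<gamma> \<and>
     (\<forall>\<omega>::ereal. freq_val H11 \<omega> * (freq_val H11 \<omega>)\<^sup>\<dagger> \<prec> 1\<^sub>m n)}"

definition gamma_opt_contractive :: "nat \<Rightarrow> nat \<Rightarrow> (complex \<Rightarrow> complex mat) \<Rightarrow> real" where
  "gamma_opt_contractive n ny \<Phi> = Inf {\<gamma>. \<gamma> > 0 \<and> contractive_equalizers n ny \<Phi> \<gamma> \<noteq> {}}"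

section \<open>Spectral factor and linear matrix inequalities\<close>

definition spectral_factor :: "nat \<Rightarrow> nat \<Rightarrow> (complex \<Rightarrow> complex mat) \<Rightarrow> (complex \<Rightarrow> complex mat) \<Rightarrow> bool" where
  "spectral_factor r p F \<Upsilon> \<longleftrightarrow>
     entrywise r p rational_fun \<Upsilon> \<and>
     (\<exists>\<tau>>0. entrywise r p (\<lambda>f. (\<forall>z. is_pole f z \<longrightarrow> Re z < - \<tau>) \<and> f analytic_on {s. Re s > - \<tau>}) \<Upsilon>) \<and>
     (\<forall>\<^sub>F s in cofinite. F s = \<Upsilon> s * paraconj \<Upsilon> s)"

text \<open>\<open>N\<close> has full rank and its range is the kernel of \<open>M\<close>.\<close>

definition full_rank_kernel_mat :: "complex mat \<Rightarrow> complex mat \<Rightarrow> bool" where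
  "full_rank_kernel_mat M N \<longleftrightarrow>
     dim_row N = dim_col M \<and>
     vec_space.rank (dim_row N) N = min (dim_row N) (dim_col N) \<and>
     (\<lambda>v. N *\<^sub>v v) ` carrier_vec (dim_col N) = mat_kernel M"

text \<open>In the remaining definitions \<open>A, B, C1, C2, D1, D2\<close> is the realization of the spectral
  factor, with \<open>m\<close> states, \<open>p\<close> inputs and \<open>ny + n\<close> outputs.\<close>

definition coupling_mat :: "nat \<Rightarrow> complex mat \<Rightarrow> complex mat \<Rightarrow> complex mat" where
  "coupling_mat m X Y = four_block_mat X (1\<^sub>m m) (1\<^sub>m m) Y"

definition dual_lmi :: "nat \<Rightarrow> nat \<Rightarrow> nat \<Rightarrow> complex mat \<Rightarrow> complex mat \<Rightarrow> complex mat \<Rightarrow> complex mat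
    \<Rightarrow> complex mat \<Rightarrow> real \<Rightarrow> complex mat \<Rightarrow> complex mat" where
  "dual_lmi m p n A B C2 D2 Nc \<gamma>b Y =
     four_block_mat (Nc\<^sup>\<dagger>) (0\<^sub>m (dim_col Nc) n) (0\<^sub>m n (m + p)) (1\<^sub>m n) *
     block3 (A\<^sup>\<dagger> * Y + Y * A) (Y * B)             (C2\<^sup>\<dagger>)
            (B\<^sup>\<dagger> * Y)          (- 1\<^sub>m p)           (D2\<^sup>\<dagger>)
            C2                 D2                  (- (complex_of_real (\<gamma>b\<^sup>2) \<cdot>\<^sub>m 1\<^sub>m n)) *
     four_block_mat Nc (0\<^sub>m (m + p) n) (0\<^sub>m n (dim_col Nc)) (1\<^sub>m n)"

definition lmi_feasible :: "nat \<Rightarrow> nat \<Rightarrow> nat \<Rightarrow> nat \<Rightarrow> complex mat \<Rightarrow> complex mat \<Rightarrow> complex mat \<Rightarrow> complex mat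
    \<Rightarrow> complex mat \<Rightarrow> real \<Rightarrow> real \<Rightarrow> bool" where
  "lmi_feasible m p n m11 A B C2 D2 Nc lam \<gamma>b \<longleftrightarrow>
     \<gamma>b\<^sup>2 > lam\<^sup>2 \<and>
     (\<exists>X1 \<in> carrier_mat m m. \<exists>Y1 \<in> carrier_mat m m.
        pos_def X1 \<and> pos_def Y1 \<and>
        neg_def (A * X1 + X1 * A\<^sup>\<dagger> + B * B\<^sup>\<dagger>) \<and>
        neg_def (dual_lmi m p n A B C2 D2 Nc \<gamma>b Y1) \<and>
        pos_semidef (coupling_mat m X1 Y1) \<and>
        vec_space.rank (m + m) (coupling_mat m X1 Y1) \<le> m + m11)"

definition K_mat :: "complex mat \<Rightarrow> complex mat \<Rightarrow> complex mat \<Rightarrow> complex mat \<Rightarrow> complex mat" where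
  "K_mat A11 B11 C11 J11 = four_block_mat (A11\<^sup>\<dagger>) (C11\<^sup>\<dagger>) (B11\<^sup>\<dagger>) (J11\<^sup>\<dagger>)"

definition Sigma_mat :: "nat \<Rightarrow> nat \<Rightarrow> nat \<Rightarrow> nat \<Rightarrow> complex mat \<Rightarrow> complex mat \<Rightarrow> complex mat \<Rightarrow> complex mat
    \<Rightarrow> real \<Rightarrow> complex mat \<Rightarrow> complex mat" where
  "Sigma_mat m p n m11 A B C2 D2 \<gamma>b X =
     (let Ab = four_block_mat (A\<^sup>\<dagger>) (0\<^sub>m m m11) (0\<^sub>m m11 m) (0\<^sub>m m11 m11);
          Bb = C2\<^sup>\<dagger> @\<^sub>r 0\<^sub>m m11 n;
          Cb = B\<^sup>\<dagger> @\<^sub>c 0\<^sub>m p m11;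
          Db = D2\<^sup>\<dagger>
      in block3 (Ab\<^sup>\<dagger> * X + X * Ab) (X * Bb)                             (Cb\<^sup>\<dagger>)
                (Bb\<^sup>\<dagger> * X)          (- (complex_of_real (\<gamma>b\<^sup>2) \<cdot>\<^sub>m 1\<^sub>m n))  (Db\<^sup>\<dagger>)
                Cb                   Db                                   (- 1\<^sub>m p))"

definition Lambda_mat :: "nat \<Rightarrow> nat \<Rightarrow> nat \<Rightarrow> nat \<Rightarrow> nat \<Rightarrow> complex mat \<Rightarrow> complex mat
    \<Rightarrow> complex mat \<Rightarrow> complex mat" where
  "Lambda_mat m p n ny m11 C1 D1 X =
     (let Bu = four_block_mat (0\<^sub>m m m11) (C1\<^sup>\<dagger>) (1\<^sub>m m11) (0\<^sub>m m11 ny);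
          D12u = 0\<^sub>m p m11 @\<^sub>c D1\<^sup>\<dagger>
      in Bu\<^sup>\<dagger> * X @\<^sub>c 0\<^sub>m (m11 + ny) n @\<^sub>c D12u\<^sup>\<dagger>)"

definition Pi_mat :: "nat \<Rightarrow> nat \<Rightarrow> nat \<Rightarrow> nat \<Rightarrow> complex mat" where
  "Pi_mat m p n m11 =
     (let Cu = four_block_mat (0\<^sub>m m11 m) (1\<^sub>m m11) (0\<^sub>m n m) (0\<^sub>m n m11);
          D21u = 0\<^sub>m m11 n @\<^sub>r 1\<^sub>m n
      in Cu @\<^sub>c D21u @\<^sub>c 0\<^sub>m (m11 + n) p)"

definition design_inequality :: "nat \<Rightarrow> nat \<Rightarrow> nat \<Rightarrow> nat \<Rightarrow> nat
    \<Rightarrow> complex mat \<Rightarrow> complex mat \<Rightarrow> complex mat \<Rightarrow> complex mat \<Rightarrow> complex mat \<Rightarrow> complex mat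
    \<Rightarrow> real \<Rightarrow> complex mat \<Rightarrow> complex mat \<Rightarrow> bool" where
  "design_inequality m p n ny m11 A B C1 C2 D1 D2 \<gamma>b X K \<longleftrightarrow>
     (let S = Sigma_mat m p n m11 A B C2 D2 \<gamma>b X;
          L = Lambda_mat m p n ny m11 C1 D1 X;
          P = Pi_mat m p n m11
      in neg_def (S + P\<^sup>\<dagger> * K\<^sup>\<dagger> * L + L\<^sup>\<dagger> * K * P))"

definition is_design :: "nat \<Rightarrow> nat \<Rightarrow> nat \<Rightarrow> nat \<Rightarrow> nat
    \<Rightarrow> complex mat \<Rightarrow> complex mat \<Rightarrow> complex mat \<Rightarrow> complex mat \<Rightarrow> complex mat \<Rightarrow> complex mat \<Rightarrow> real
    \<Rightarrow> complex mat \<Rightarrow> complex mat \<Rightarrow> complex mat \<Rightarrow> complex mat \<Rightarrow> bool" where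
  "is_design m p n ny m11 A B C1 C2 D1 D2 \<gamma>b A11 B11 C11 J11 \<longleftrightarrow>
     A11 \<in> carrier_mat m11 m11 \<and> B11 \<in> carrier_mat m11 ny \<and>
     C11 \<in> carrier_mat n m11 \<and> J11 \<in> carrier_mat n ny \<and>
     (\<exists>X \<in> carrier_mat (m + m11) (m + m11). pos_def X \<and>
        design_inequality m p n ny m11 A B C1 C2 D1 D2 \<gamma>b X (K_mat A11 B11 C11 J11))"

end

theory Submission
  imports Defs
begin

text \<open>
  There are two independent halves: every design solves the contractive problem at level \<open>\<gamma>\<close> and a
  design exists; and the contractive problem has the same optimal value as the paraunitary one.

  Designs.  Everything is expressed by quadratic forms.  The adjoint systems of the spectral factor
  and of the filter, connected in cascade, form one closed loop, and the design inequality is its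
  dissipation inequality with storage \<open>X\<close> (\<open>closed_loop_dissipation\<close>).  Without input it shows that the
  filter is stable (\<open>design_hurwitz\<close>); at \<open>s = \<i>\<omega>\<close> it becomes a bound by \<open>\<gamma>b\<^sup>2\<close> on
  \<open>[H11, 1] \<Upsilon> \<Upsilon>\<^sup>\<dagger> [H11, 1]\<^sup>\<dagger>\<close> (\<open>design_frequency_bound\<close>).  The matrix in the middle is \<open>\<Phi>\<close> plus
  \<open>lam\<^sup>2\<close> in its lower block, so the error spectrum stays below \<open>\<gamma>b\<^sup>2 - lam\<^sup>2 = \<gamma>\<^sup>2\<close>.
  The condition with \<open>\<theta>\<close> turns such a bound into strict contractivity of \<open>H11\<close>, and because it holds
  at the infinite frequencies as well, so does the contractivity (\<open>contractive_if_error_bounded\<close>).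

  Existence of a design is the elimination of the controller from a linear matrix inequality
  (\<open>elimination\<close>, from Finsler's lemma): only the inequalities on the kernels of \<open>\<Pi>\<close> and of \<open>\<Lambda>\<close> matter.
  The coupling and rank constraints make \<open>X1 - Y1\<^sup>-\<^sup>1\<close> a product \<open>N N\<^sup>\<dagger>\<close> with \<open>m11\<close> columns
  (\<open>coupling_factor\<close>); with \<open>X = [X1, N; N\<^sup>\<dagger>, 1]\<close> the first kernel condition is the Lyapunov inequality
  and the second one the dual inequality (\<open>design_exists\<close>).

  Optimal values.  If \<open>H\<close> is paraunitary, its block \<open>H11\<close> is a contraction on the imaginary axis, and
  \<open>t H11\<close> with \<open>t < 1\<close> close to \<open>1\<close> is a strict one whose error is larger by as little as desired
  (\<open>scaled_block_contractive\<close>).  Conversely a strict contraction extends to a paraunitary matrix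
  (\<open>contractive_completion\<close>), which leaves the error unchanged.  For this the half-plane is mapped to the
  disc by the Cayley transform, which turns \<open>H11\<close> into \<open>P / q\<close> with polynomials \<open>P\<close> and a polynomial \<open>q\<close>
  without zeros in the closed disc.  A matrix version of the Fejer-Riesz theorem for positive definite
  trigonometric polynomials, with a rectangular factor, writes \<open>|q|\<^sup>2 - P P\<^sup>\<dagger>\<close> on the circle as \<open>U U\<^sup>\<dagger>\<close>
  with polynomial \<open>U\<close> (\<open>circle_sum_of_squares\<close>): the matrix polynomial is reweighted, sampled at roots
  of unity, factorized there, and recovered on the circle by means of Dirichlet kernels.  The rows of
  \<open>[P, U] / q\<close> are orthonormal on the circle, and an explicit stable unitary completion exists
  (\<open>polynomial_completion\<close>).
\<close>

unbundle no vec_syntax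

section \<open>Hermitian forms\<close>

lemma adjoint_dim [simp]: "dim_row (A\<^sup>\<dagger>) = dim_col A" "dim_col (A\<^sup>\<dagger>) = dim_row A"
  by (auto simp: mat_adjoint_def)

lemma adjoint_carrier [simp, intro]: "A \<in> carrier_mat r c \<Longrightarrow> A\<^sup>\<dagger> \<in> carrier_mat c r"
  by (metis adjoint_dim carrier_matD carrier_matI)

lemma adjoint_index [simp]:
  "i < dim_col A \<Longrightarrow> j < dim_row A \<Longrightarrow> A\<^sup>\<dagger> $$ (i, j) = cnj (A $$ (j, i))"
  for A :: "complex mat"
  by (auto simp: mat_adjoint_def mat_of_rows_def)

lemma adjoint_adjoint [simp]: "(A\<^sup>\<dagger>)\<^sup>\<dagger> = A" for A :: "complex mat"
  by (rule eq_matI) auto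

lemma inner_sum: "y \<in> carrier_vec n \<Longrightarrow> x \<bullet>c y = (\<Sum>i<n. x $ i * cnj (y $ i))"
  by (auto simp: scalar_prod_def lessThan_atLeast0 intro!: sum.cong)

lemma mult_mat_vec_sum:
  "A \<in> carrier_mat r c \<Longrightarrow> x \<in> carrier_vec c \<Longrightarrow> i < r \<Longrightarrow> (A *\<^sub>v x) $ i = (\<Sum>j<c. A $$ (i, j) * x $ j)"
  by (auto simp: scalar_prod_def lessThan_atLeast0 intro!: sum.cong)

lemma mult_mat_sum:
  "A \<in> carrier_mat r k \<Longrightarrow> B \<in> carrier_mat k c \<Longrightarrow> i < r \<Longrightarrow> j < c \<Longrightarrow>
    (A * B) $$ (i, j) = (\<Sum>l<k. A $$ (i, l) * B $$ (l, j))"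
  by (auto simp: scalar_prod_def lessThan_atLeast0 intro!: sum.cong)

lemma mult_vec_carrier [simp]: "dim_row A = r \<Longrightarrow> A *\<^sub>v x \<in> carrier_vec r"
  by (simp only: carrier_vec_def mem_Collect_eq dim_mult_mat_vec)

lemma mult_mat_zero_vec [simp]: "A \<in> carrier_mat r c \<Longrightarrow> A *\<^sub>v 0\<^sub>v c = (0\<^sub>v r :: complex vec)"
  by (rule eq_vecI) auto

lemma smult_mat_mult_vec:
  fixes A :: "complex mat"
  assumes "A \<in> carrier_mat r c" "x \<in> carrier_vec c"
  shows "(k \<cdot>\<^sub>m A) *\<^sub>v x = k \<cdot>\<^sub>v (A *\<^sub>v x)"
  using assms
  by (intro eq_vecI) (auto simp: mult_mat_vec_sum[of _ r c] sum_distrib_left algebra_simps simp del: index_mult_mat_vec)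

lemma inner_adjoint:
  fixes A :: "complex mat"
  assumes A: "A \<in> carrier_mat r c" and x: "x \<in> carrier_vec c" and y: "y \<in> carrier_vec r"
  shows "(A *\<^sub>v x) \<bullet>c y = x \<bullet>c (A\<^sup>\<dagger> *\<^sub>v y)"
proof -
  have "(A *\<^sub>v x) \<bullet>c y = (\<Sum>i<r. \<Sum>j<c. A $$ (i, j) * x $ j * cnj (y $ i))"
    using assms by (simp add: inner_sum[OF y] mult_mat_vec_sum[OF A x] sum_distrib_right del: index_mult_mat_vec)
  also have "\<dots> = (\<Sum>j<c. \<Sum>i<r. A $$ (i, j) * x $ j * cnj (y $ i))"
    by (rule sum.swap)
  also have "\<dots> = (\<Sum>j<c. x $ j * cnj ((A\<^sup>\<dagger> *\<^sub>v y) $ j))"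
  proof (rule sum.cong[OF refl])
    fix j assume "j \<in> {..<c}"
    then have j: "j < c" by simp
    show "(\<Sum>i<r. A $$ (i, j) * x $ j * cnj (y $ i)) = x $ j * cnj ((A\<^sup>\<dagger> *\<^sub>v y) $ j)"
      using A j by (simp add: mult_mat_vec_sum[OF adjoint_carrier[OF A] y j] sum_distrib_left algebra_simps del: index_mult_mat_vec)
  qed
  also have "\<dots> = x \<bullet>c (A\<^sup>\<dagger> *\<^sub>v y)"
    using A y by (subst inner_sum[of _ c]) (auto simp del: index_mult_mat_vec)
  finally show ?thesis .
qed

lemma inner_adjoint':
  fixes A :: "complex mat"
  assumes A: "A \<in> carrier_mat r c" and x: "x \<in> carrier_vec r" and y: "y \<in> carrier_vec c"
  shows "(A\<^sup>\<dagger> *\<^sub>v x) \<bullet>c y = x \<bullet>c (A *\<^sub>v y)"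
  using inner_adjoint[OF adjoint_carrier[OF A] x y] by simp

lemma adjoint_mult:
  fixes A B :: "complex mat"
  assumes "A \<in> carrier_mat r k" "B \<in> carrier_mat k c"
  shows "(A * B)\<^sup>\<dagger> = B\<^sup>\<dagger> * A\<^sup>\<dagger>"
  using assms by (intro eq_matI) (auto simp: scalar_prod_def intro!: sum.cong)

lemma inner_add_left:
  "x \<in> carrier_vec n \<Longrightarrow> y \<in> carrier_vec n \<Longrightarrow> z \<in> carrier_vec n \<Longrightarrow> (x + y) \<bullet>c z = x \<bullet>c z + y \<bullet>c z"
  for x y z :: "complex vec"
  by (simp add: inner_sum sum.distrib algebra_simps)

lemma inner_add_right:
  "x \<in> carrier_vec n \<Longrightarrow> y \<in> carrier_vec n \<Longrightarrow> z \<in> carrier_vec n \<Longrightarrow> x \<bullet>c (y + z) = x \<bullet>c y + x \<bullet>c z"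
  for x y z :: "complex vec"
  by (subst (1 2 3) inner_sum[of _ n]) (auto simp: sum.distrib algebra_simps)

lemma inner_smult_left:
  "x \<in> carrier_vec n \<Longrightarrow> y \<in> carrier_vec n \<Longrightarrow> (a \<cdot>\<^sub>v x) \<bullet>c y = a * (x \<bullet>c y)"
  for x y :: "complex vec"
  by (simp add: inner_sum sum_distrib_left algebra_simps)

lemma inner_smult_right:
  "x \<in> carrier_vec n \<Longrightarrow> y \<in> carrier_vec n \<Longrightarrow> x \<bullet>c (a \<cdot>\<^sub>v y) = cnj a * (x \<bullet>c y)"
  for x y :: "complex vec"
  by (subst (1 2) inner_sum[of _ n]) (auto simp: sum_distrib_left algebra_simps)

lemma inner_commute:
  "x \<in> carrier_vec n \<Longrightarrow> y \<in> carrier_vec n \<Longrightarrow> x \<bullet>c y = cnj (y \<bullet>c x)"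
  for x y :: "complex vec"
  by (simp add: inner_sum[of _ n] mult.commute)

lemma inner_append:
  fixes x y x' y' :: "complex vec"
  assumes "x \<in> carrier_vec n" "x' \<in> carrier_vec n'" "y \<in> carrier_vec n" "y' \<in> carrier_vec n'"
  shows "(x @\<^sub>v x') \<bullet>c (y @\<^sub>v y') = x \<bullet>c y + x' \<bullet>c y'"
proof -
  have "conjugate (y @\<^sub>v y') = conjugate y @\<^sub>v conjugate y'"
    by (rule eq_vecI) auto
  then show ?thesis
    using assms by (simp add: scalar_prod_append[of _ n _ n'])
qed

lemma inner_zero_left: "y \<in> carrier_vec n \<Longrightarrow> (0\<^sub>v n :: complex vec) \<bullet>c y = 0"
  by (simp add: inner_sum)

lemma inner_zero_right: "x \<in> carrier_vec n \<Longrightarrow> (x :: complex vec) \<bullet>c 0\<^sub>v n = 0"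
  by (simp add: inner_sum[of _ n])

definition sqnorm :: "complex vec \<Rightarrow> real" where
  "sqnorm x = Re (x \<bullet>c x)"

lemma sqnorm_sum: "x \<in> carrier_vec n \<Longrightarrow> sqnorm x = (\<Sum>i<n. (cmod (x $ i))\<^sup>2)"
  unfolding sqnorm_def by (simp add: inner_sum complex_mult_cnj cmod_power2)

lemma inner_self: "x \<bullet>c x = complex_of_real (sqnorm x)"
  using inner_sum[of x "dim_vec x" x] sqnorm_sum[of x "dim_vec x"]
  by (simp add: complex_mult_cnj cmod_power2)

lemma sqnorm_nonneg [simp]: "0 \<le> sqnorm x"
  using sqnorm_sum[of x "dim_vec x"] by (simp add: sum_nonneg)

lemma sqnorm_eq_0: "x \<in> carrier_vec n \<Longrightarrow> sqnorm x = 0 \<longleftrightarrow> x = 0\<^sub>v n"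
  by (auto simp: sqnorm_sum sum_nonneg_eq_0_iff)

lemma sqnorm_pos: "x \<in> carrier_vec n \<Longrightarrow> 0 < sqnorm x \<longleftrightarrow> x \<noteq> 0\<^sub>v n"
  using sqnorm_eq_0[of x n] sqnorm_nonneg[of x] by linarith

lemma sqnorm_smult: "sqnorm (a \<cdot>\<^sub>v x) = (cmod a)\<^sup>2 * sqnorm x"
  by (simp add: sqnorm_sum[of _ "dim_vec x"] norm_mult power_mult_distrib sum_distrib_left)

lemma sqnorm_append: "sqnorm (x @\<^sub>v y) = sqnorm x + sqnorm y"
  unfolding sqnorm_def by (subst inner_append[of _ "dim_vec x" _ "dim_vec y"]) auto

lemma sqnorm_add:
  assumes "x \<in> carrier_vec n" "y \<in> carrier_vec n"
  shows "sqnorm (x + y) = sqnorm x + 2 * Re (x \<bullet>c y) + sqnorm y"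
  using inner_commute[OF assms]
  by (simp add: sqnorm_def inner_add_left[of _ n] inner_add_right[of _ n] assms)

lemma append_vec_cases:
  assumes "z \<in> carrier_vec (n + n')"
  obtains x y where "x \<in> carrier_vec n" "y \<in> carrier_vec n'" "z = x @\<^sub>v y"
proof
  show "z = vec n (\<lambda>i. z $ i) @\<^sub>v vec n' (\<lambda>i. z $ (n + i))"
    using assms by (intro eq_vecI) auto
qed auto

lemma append_vec_zero: "0\<^sub>v (n + n') = 0\<^sub>v n @\<^sub>v 0\<^sub>v n'"
  by (rule eq_vecI) auto

lemma append_vec_eq_0:
  assumes "x \<in> carrier_vec n" "y \<in> carrier_vec n'"
  shows "x @\<^sub>v y = 0\<^sub>v (n + n') \<longleftrightarrow> x = 0\<^sub>v n \<and> y = 0\<^sub>v n'"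
  using assms by (simp add: append_vec_zero append_vec_eq[of _ n])

lemma mult_unit_vec_index:
  assumes "M \<in> carrier_mat r c" "j < c" "i < r"
  shows "(M *\<^sub>v unit_vec c j) $ i = (M $$ (i, j) :: complex)"
  using assms by (simp add: mult_mat_vec_sum unit_vec_def if_distrib cong: if_cong del: index_mult_mat_vec)

lemma inner_unit_vec:
  "x \<in> carrier_vec n \<Longrightarrow> i < n \<Longrightarrow> x \<bullet>c unit_vec n i = (x $ i :: complex)"
  by (simp add: inner_sum unit_vec_def if_distrib cong: if_cong)

text \<open>Polarisation: a complex matrix is determined by its quadratic form, so real values of the form
  force it to be Hermitian, and definiteness can be read off from the form alone.\<close>

lemma hermitian_if_form_real:
  assumes M: "M \<in> carrier_mat n n"
    and real: "\<And>x. x \<in> carrier_vec n \<Longrightarrow> Im ((M *\<^sub>v x) \<bullet>c x) = 0"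
  shows "M\<^sup>\<dagger> = M"
proof (rule eq_matI)
  fix i j assume "i < dim_row M" "j < dim_col M"
  then have ij: "i < n" "j < n" using M by auto
  let ?e = "\<lambda>i. unit_vec n i :: complex vec"
  have expand: "(M *\<^sub>v (?e j + a \<cdot>\<^sub>v ?e i)) \<bullet>c (?e j + a \<cdot>\<^sub>v ?e i)
      = M $$ (j, j) + cnj a * M $$ (i, j) + a * M $$ (j, i) + a * cnj a * M $$ (i, i)" for a
    using M ij
    by (simp add: mult_add_distrib_mat_vec[OF M] mult_mat_vec[OF M] inner_add_left[of _ n] inner_add_right[of _ n]
        inner_smult_left[of _ n] inner_smult_right[of _ n] inner_unit_vec mult_unit_vec_index[OF M] algebra_simps
        del: index_mult_mat_vec)
  have "Im (M $$ (j, j) + cnj a * M $$ (i, j) + a * M $$ (j, i) + a * cnj a * M $$ (i, i)) = 0" for a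
    using real[of "?e j + a \<cdot>\<^sub>v ?e i"] ij unfolding expand by simp
  from this[of 0] this[of 1] this[of \<i>] real[of "?e i"]
  have "Im (M $$ (i, j)) = - Im (M $$ (j, i))" "Re (M $$ (i, j)) = Re (M $$ (j, i))"
    using M ij by (auto simp: mult_unit_vec_index[OF M] inner_unit_vec[of _ n] simp del: index_mult_mat_vec)
  then have "cnj (M $$ (j, i)) = M $$ (i, j)"
    by (auto simp: complex_eq_iff)
  then show "M\<^sup>\<dagger> $$ (i, j) = M $$ (i, j)"
    using M ij by simp
qed (use M in auto)

lemma pos_def_iff:
  assumes M: "M \<in> carrier_mat n n"
  shows "pos_def M \<longleftrightarrow> (\<forall>x \<in> carrier_vec n. x \<noteq> 0\<^sub>v n \<longrightarrow> 0 < (M *\<^sub>v x) \<bullet>c x)"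
proof -
  have "M\<^sup>\<dagger> = M" if *: "\<forall>x \<in> carrier_vec n. x \<noteq> 0\<^sub>v n \<longrightarrow> 0 < (M *\<^sub>v x) \<bullet>c x"
  proof (rule hermitian_if_form_real[OF M])
    fix x :: "complex vec" assume x: "x \<in> carrier_vec n"
    show "Im ((M *\<^sub>v x) \<bullet>c x) = 0"
      using * x M by (cases "x = 0\<^sub>v n") (auto simp: less_complex_def inner_zero_right[of _ n])
  qed
  then show ?thesis
    using M by (auto simp: pos_def_def)
qed

lemma pos_semidef_iff:
  assumes M: "M \<in> carrier_mat n n"
  shows "pos_semidef M \<longleftrightarrow> (\<forall>x \<in> carrier_vec n. 0 \<le> (M *\<^sub>v x) \<bullet>c x)"
  using hermitian_if_form_real[OF M] M unfolding pos_semidef_def by (auto simp: less_eq_complex_def)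

lemma minus_mult_distrib_inner:
  assumes "M \<in> carrier_mat n n" "N \<in> carrier_mat n n" "x \<in> carrier_vec n"
  shows "((N - M) *\<^sub>v x) \<bullet>c x = (N *\<^sub>v x) \<bullet>c x - (M *\<^sub>v x) \<bullet>c (x :: complex vec)"
proof -
  have "((N - M) *\<^sub>v x) $ i = (N *\<^sub>v x) $ i - (M *\<^sub>v x) $ i" if "i < n" for i
    using assms that
    by (simp add: mult_mat_vec_sum[of _ n n] sum_subtractf algebra_simps del: index_mult_mat_vec)
  then show ?thesis
    using assms by (simp add: inner_sum[of _ n] sum_subtractf[symmetric] algebra_simps del: index_mult_mat_vec)
qed

lemma loewner_less_iff:
  assumes M: "M \<in> carrier_mat n n" and N: "N \<in> carrier_mat n n"
  shows "M \<prec> N \<longleftrightarrow> (\<forall>x \<in> carrier_vec n. x \<noteq> 0\<^sub>v n \<longrightarrow> (M *\<^sub>v x) \<bullet>c x < (N *\<^sub>v x) \<bullet>c x)"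
proof -
  have "N - M \<in> carrier_mat n n" using M N by auto
  then show ?thesis
    unfolding loewner_less_def using minus_mult_distrib_inner[OF M N]
    by (auto simp: pos_def_iff less_complex_def)
qed

lemma neg_def_iff:
  assumes M: "M \<in> carrier_mat n n"
  shows "neg_def M \<longleftrightarrow> (\<forall>x \<in> carrier_vec n. x \<noteq> 0\<^sub>v n \<longrightarrow> (M *\<^sub>v x) \<bullet>c x < 0)"
proof -
  have "(0\<^sub>m n n *\<^sub>v x) \<bullet>c x = 0" if "x \<in> carrier_vec n" for x :: "complex vec"
  proof -
    have "(0\<^sub>m n n *\<^sub>v x) = 0\<^sub>v n" using that by (intro eq_vecI) auto
    then show ?thesis using that by (simp add: inner_zero_left)
  qed
  then show ?thesis
    unfolding neg_def_def using M by (subst loewner_less_iff[of _ n]) auto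
qed

lemma hermitian_inner:
  assumes "M \<in> carrier_mat n n" "M\<^sup>\<dagger> = M" "x \<in> carrier_vec n" "y \<in> carrier_vec n"
  shows "(M *\<^sub>v x) \<bullet>c y = x \<bullet>c (M *\<^sub>v (y :: complex vec))"
  using inner_adjoint[of M n n x y] assms by simp

lemma pos_def_hermitian: "pos_def M \<Longrightarrow> M\<^sup>\<dagger> = M"
  by (simp add: pos_def_def)

lemma pos_def_pos:
  assumes "M \<in> carrier_mat n n" "pos_def M" "x \<in> carrier_vec n" "x \<noteq> 0\<^sub>v n"
  shows "0 < Re ((M *\<^sub>v x) \<bullet>c x)"
  using assms by (auto simp: pos_def_iff less_complex_def)

lemma hermitian_form_real:
  assumes "M \<in> carrier_mat n n" "M\<^sup>\<dagger> = M" "x \<in> carrier_vec n"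
  shows "Im ((M *\<^sub>v x) \<bullet>c x) = 0"
proof -
  have "(M *\<^sub>v x) \<bullet>c x = x \<bullet>c (M *\<^sub>v x)"
    by (rule hermitian_inner[OF assms assms(3)])
  also have "\<dots> = cnj ((M *\<^sub>v x) \<bullet>c x)"
    by (rule inner_commute[OF assms(3) mult_mat_vec_carrier[OF assms(1,3)]])
  finally show ?thesis by (simp add: complex_eq_iff)
qed

lemma pos_def_if_hermitian:
  assumes M: "M \<in> carrier_mat n n" "M\<^sup>\<dagger> = M"
    and pos: "\<And>x. x \<in> carrier_vec n \<Longrightarrow> x \<noteq> 0\<^sub>v n \<Longrightarrow> 0 < Re ((M *\<^sub>v x) \<bullet>c x)"
  shows "pos_def M"
  using pos hermitian_form_real[OF M] by (simp add: pos_def_iff[OF M(1)] less_complex_def)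

lemma mult_mat_vec_uminus:
  fixes M :: "complex mat"
  assumes "M \<in> carrier_mat r c" "x \<in> carrier_vec c"
  shows "M *\<^sub>v (- x) = - (M *\<^sub>v x)"
  using assms by (intro eq_vecI) (auto simp: mult_mat_vec_sum[of _ r c] sum_negf simp del: index_mult_mat_vec)

lemma add_uminus_cancel_vec:
  fixes x y :: "complex vec"
  assumes "x \<in> carrier_vec n" "y \<in> carrier_vec n"
  shows "x + (- x + y) = y"
  using assms by (intro eq_vecI) auto

lemma vec_add_eq_0D:
  fixes x y :: "complex vec"
  assumes x: "x \<in> carrier_vec n" and y: "y \<in> carrier_vec n" and 0: "x + y = 0\<^sub>v n"
  shows "y = - x"
proof (rule eq_vecI)
  fix i assume "i < dim_vec (- x)"
  then have i: "i < n" using x by simp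
  have "x $ i + y $ i = (x + y) $ i" using x y i by simp
  then show "y $ i = (- x) $ i" unfolding 0 using x i by (simp add: eq_neg_iff_add_eq_0 add.commute)
qed (use x y in simp)

lemma minus_mult_mat_vec:
  fixes M N :: "complex mat"
  assumes M: "M \<in> carrier_mat r c" and N: "N \<in> carrier_mat r c" and x: "x \<in> carrier_vec c"
  shows "(M - N) *\<^sub>v x = M *\<^sub>v x + - (N *\<^sub>v x)"
proof (rule eq_vecI)
  fix i assume "i < dim_vec (M *\<^sub>v x + - (N *\<^sub>v x))"
  then have i: "i < r" using N by simp
  have "((M - N) *\<^sub>v x) $ i = (\<Sum>j<c. (M - N) $$ (i, j) * x $ j)"
    by (rule mult_mat_vec_sum[OF minus_carrier_mat[OF N] x i])
  also have "\<dots> = (\<Sum>j<c. M $$ (i, j) * x $ j) - (\<Sum>j<c. N $$ (i, j) * x $ j)"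
    unfolding sum_subtractf[symmetric]
    by (rule sum.cong[OF refl]) (use M N i in \<open>simp add: left_diff_distrib\<close>)
  also have "\<dots> = (M *\<^sub>v x) $ i - (N *\<^sub>v x) $ i"
    unfolding mult_mat_vec_sum[OF M x i] mult_mat_vec_sum[OF N x i] ..
  also have "\<dots> = (M *\<^sub>v x + - (N *\<^sub>v x)) $ i"
    using N i by (simp del: index_mult_mat_vec)
  finally show "((M - N) *\<^sub>v x) $ i = (M *\<^sub>v x + - (N *\<^sub>v x)) $ i" .
qed (use N in simp)

section \<open>Inverses and kernels\<close>

text \<open>The inverse is stated together with the value of \<open>mat_inverse\<close>, through which transfer functions are defined.\<close>

lemma inverse_if_injective:
  fixes M :: "complex mat"
  assumes M: "M \<in> carrier_mat n n"
    and inj: "\<And>x. x \<in> carrier_vec n \<Longrightarrow> M *\<^sub>v x = 0\<^sub>v n \<Longrightarrow> x = 0\<^sub>v n"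
  obtains N where "N \<in> carrier_mat n n" "M * N = 1\<^sub>m n" "N * M = 1\<^sub>m n" "mat_inverse M = Some N"
proof -
  have "Determinant.det M \<noteq> 0"
    using det_0_iff_vec_prod_zero_field[OF M] inj by blast
  then have "M \<in> Units (ring_mat TYPE(complex) n undefined)"
    by (rule det_non_zero_imp_unit[OF M])
  then obtain N where "mat_inverse M = Some N"
    using mat_inverse(1)[OF M, of undefined] by (cases "mat_inverse M") auto
  then show ?thesis
    using mat_inverse(2)[OF M] that by blast
qed

lemma pos_def_injective:
  assumes M: "M \<in> carrier_mat n n" "pos_def M" and x: "x \<in> carrier_vec n" "M *\<^sub>v x = 0\<^sub>v n"
  shows "x = 0\<^sub>v n"
  using pos_def_pos[OF M x(1)] x by (auto simp: inner_zero_left)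

text \<open>Padding with zero rows gives a square matrix of determinant \<open>0\<close>.\<close>

lemma wide_kernel:
  fixes H :: "complex mat"
  assumes H: "H \<in> carrier_mat r k" and "r < k"
  obtains y where "y \<in> carrier_vec k" "y \<noteq> 0\<^sub>v k" "H *\<^sub>v y = 0\<^sub>v r"
proof -
  define S where "S = mat k k (\<lambda>(i, j). if i < r then H $$ (i, j) else 0)"
  have S: "S \<in> carrier_mat k k" by (simp add: S_def)
  have "Determinant.det S = 0"
    using laplace_expansion_row[OF S \<open>r < k\<close>] \<open>r < k\<close> by (simp add: S_def)
  then obtain y where y: "y \<in> carrier_vec k" "y \<noteq> 0\<^sub>v k" "S *\<^sub>v y = 0\<^sub>v k"
    using det_0_iff_vec_prod_zero_field[OF S] by auto
  have "H *\<^sub>v y = 0\<^sub>v r"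
  proof (rule eq_vecI)
    fix i assume "i < dim_vec (0\<^sub>v r :: complex vec)"
    then have i: "i < r" by simp
    have "S $$ (i, j) = H $$ (i, j)" if "j < k" for j
      using that i \<open>r < k\<close> by (simp add: S_def)
    then have "(H *\<^sub>v y) $ i = (S *\<^sub>v y) $ i"
      using i y(1) \<open>r < k\<close>
      by (simp add: mult_mat_vec_sum[OF H] mult_mat_vec_sum[OF S] del: index_mult_mat_vec)
    then show "(H *\<^sub>v y) $ i = 0\<^sub>v r $ i"
      using y i \<open>r < k\<close> by simp
  qed (use H in auto)
  with y that show ?thesis by blast
qed

section \<open>Finsler's lemma and the elimination of the controller\<close>

text \<open>Bolzano-Weierstrass, one coordinate at a time.\<close>

lemma bounded_vec_subsequence:
  fixes x :: "nat \<Rightarrow> complex vec"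
  assumes "\<And>k i. i < n \<Longrightarrow> cmod (x k $ i) \<le> B"
  obtains l r where "l \<in> carrier_vec n" "strict_mono (r :: nat \<Rightarrow> nat)"
    "\<And>i. i < n \<Longrightarrow> (\<lambda>k. x (r k) $ i) \<longlonglongrightarrow> l $ i"
proof -
  have "\<exists>l r. strict_mono (r :: nat \<Rightarrow> nat) \<and> (\<forall>i<n. (\<lambda>k. x (r k) $ i) \<longlonglongrightarrow> l i)"
    using assms
  proof (induction n)
    case 0
    have "strict_mono (id :: nat \<Rightarrow> nat)" by (simp add: strict_mono_def)
    then show ?case by blast
  next
    case (Suc n)
    then obtain l r where lr: "strict_mono (r :: nat \<Rightarrow> nat)" "\<forall>i<n. (\<lambda>k. x (r k) $ i) \<longlonglongrightarrow> l i"
      by (metis less_SucI)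
    have "bounded (range (\<lambda>k. x (r k) $ n))"
      using Suc.prems by (auto simp: bounded_iff intro!: exI[of _ B])
    then obtain a r' where r': "strict_mono (r' :: nat \<Rightarrow> nat)" "((\<lambda>k. x (r k) $ n) \<circ> r') \<longlonglongrightarrow> a"
      using bounded_imp_convergent_subsequence by blast
    have "(\<lambda>k. x (r (r' k)) $ i) \<longlonglongrightarrow> (if i = n then a else l i)" if "i < Suc n" for i
      using r' LIMSEQ_subseq_LIMSEQ[OF lr(2)[rule_format] r'(1), of i] that
      by (auto simp: o_def less_Suc_eq)
    then show ?case
      using lr(1) r'(1)
      by (intro exI[of _ "\<lambda>i. if i = n then a else l i"] exI[of _ "r \<circ> r'"]) (auto simp: strict_mono_def)
  qed
  then obtain l r where lr: "strict_mono (r :: nat \<Rightarrow> nat)" "\<forall>i<n. (\<lambda>k. x (r k) $ i) \<longlonglongrightarrow> l i"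
    by blast
  show ?thesis
    by (rule that[of "vec n l" r]) (use lr in auto)
qed

lemma cmod_index_le_sqnorm:
  assumes "x \<in> carrier_vec n" "i < n"
  shows "(cmod (x $ i))\<^sup>2 \<le> sqnorm x"
  using assms by (auto simp: sqnorm_sum intro: member_le_sum)

lemma mult_mat_vec_tendsto:
  assumes M: "M \<in> carrier_mat r n" and x: "\<And>k. x k \<in> carrier_vec n" "l \<in> carrier_vec n"
    and lim: "\<And>i. i < n \<Longrightarrow> ((\<lambda>k. x k $ i) \<longlongrightarrow> l $ i) F" and "i < r"
  shows "((\<lambda>k. (M *\<^sub>v x k) $ i) \<longlongrightarrow> ((M *\<^sub>v l) $ i :: complex)) F"
  using assms by (auto simp: mult_mat_vec_sum[OF M] simp del: index_mult_mat_vec intro!: tendsto_intros)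

lemma inner_tendsto:
  fixes x y :: "'a \<Rightarrow> complex vec"
  assumes x: "\<And>i. i < n \<Longrightarrow> ((\<lambda>k. x k $ i) \<longlongrightarrow> l $ i) F"
    and y: "\<And>i. i < n \<Longrightarrow> ((\<lambda>k. y k $ i) \<longlongrightarrow> l' $ i) F"
    and c: "\<And>k. y k \<in> carrier_vec n" "l' \<in> carrier_vec n"
  shows "((\<lambda>k. x k \<bullet>c y k) \<longlongrightarrow> l \<bullet>c l') F"
  unfolding inner_sum[OF c(1)] inner_sum[OF c(2)] by (intro tendsto_intros x y) auto

lemma sqnorm_tendsto:
  fixes x :: "'a \<Rightarrow> complex vec"
  assumes x: "\<And>i. i < n \<Longrightarrow> ((\<lambda>k. x k $ i) \<longlongrightarrow> l $ i) F"
    and c: "\<And>k. x k \<in> carrier_vec n" "l \<in> carrier_vec n"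
  shows "((\<lambda>k. sqnorm (x k)) \<longlongrightarrow> sqnorm l) F"
  unfolding sqnorm_def by (intro tendsto_intros inner_tendsto[OF x x c])

text \<open>Without a suitable multiplier there are unit vectors \<open>x\<^sub>k\<close> at which the form of \<open>Q\<close> is at least
  \<open>k\<close> times the square norm of \<open>U x\<^sub>k\<close>; a limit point lies in the kernel of \<open>U\<close> and the form is
  nonnegative there.\<close>

lemma finsler:
  fixes Q U :: "complex mat"
  assumes Q: "Q \<in> carrier_mat n n" and U: "U \<in> carrier_mat b n"
    and neg: "\<And>x. x \<in> carrier_vec n \<Longrightarrow> x \<noteq> 0\<^sub>v n \<Longrightarrow> U *\<^sub>v x = 0\<^sub>v b \<Longrightarrow> Re ((Q *\<^sub>v x) \<bullet>c x) < 0"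
  obtains \<sigma> where "\<And>x. x \<in> carrier_vec n \<Longrightarrow> x \<noteq> 0\<^sub>v n \<Longrightarrow> Re ((Q *\<^sub>v x) \<bullet>c x) < \<sigma> * sqnorm (U *\<^sub>v x)"
proof (rule ccontr)
  assume "\<not> thesis"
  then have "\<exists>x. x \<in> carrier_vec n \<and> x \<noteq> 0\<^sub>v n \<and> real k * sqnorm (U *\<^sub>v x) \<le> Re ((Q *\<^sub>v x) \<bullet>c x)" for k :: nat
    using that by (meson not_le)
  then obtain y where y: "\<And>k. y k \<in> carrier_vec n" "\<And>k. y k \<noteq> 0\<^sub>v n"
    "\<And>k. real k * sqnorm (U *\<^sub>v y k) \<le> Re ((Q *\<^sub>v y k) \<bullet>c y k)"
    by metis
  define x where "x k = complex_of_real (1 / sqrt (sqnorm (y k))) \<cdot>\<^sub>v y k" for k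
  have x: "x k \<in> carrier_vec n" for k
    using y by (simp add: x_def)
  have pos: "sqnorm (y k) > 0" for k
    using y sqnorm_pos by blast
  have unit: "sqnorm (x k) = 1" for k
    using pos[of k] by (simp add: x_def sqnorm_smult norm_divide power_divide)
  have form: "real k * sqnorm (U *\<^sub>v x k) \<le> Re ((Q *\<^sub>v x k) \<bullet>c x k)" for k
  proof -
    have "sqnorm (U *\<^sub>v x k) = sqnorm (U *\<^sub>v y k) / sqnorm (y k)"
      using pos[of k] y(1)[of k] U
      by (simp add: x_def mult_mat_vec[of _ b n] sqnorm_smult norm_divide power_divide)
    moreover have "Re ((Q *\<^sub>v x k) \<bullet>c x k) = Re ((Q *\<^sub>v y k) \<bullet>c y k) / sqnorm (y k)"
      using pos[of k] y(1)[of k] Q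
      by (simp add: x_def mult_mat_vec[of _ n n] inner_smult_left[of _ n] inner_smult_right[of _ n]
          flip: of_real_mult of_real_divide)
    ultimately show ?thesis
      using y(3)[of k] pos[of k] by (simp add: divide_right_mono)
  qed
  have "cmod (x k $ i) \<le> 1" if "i < n" for k i
    using cmod_index_le_sqnorm[OF x that, of k] unit[of k] by (simp add: power_le_one_iff)
  then obtain l r where l: "l \<in> carrier_vec n" and r: "strict_mono (r :: nat \<Rightarrow> nat)"
    and lim: "\<And>i. i < n \<Longrightarrow> (\<lambda>k. x (r k) $ i) \<longlonglongrightarrow> l $ i"
    using bounded_vec_subsequence[of n x 1] by blast
  have "(\<lambda>k. sqnorm (x (r k))) \<longlonglongrightarrow> sqnorm l"
    by (rule sqnorm_tendsto[OF lim x l])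
  then have "sqnorm l = 1"
    unfolding unit using LIMSEQ_unique tendsto_const by metis
  then have l0: "l \<noteq> 0\<^sub>v n"
    using sqnorm_eq_0[OF l] by auto
  have Qlim: "(\<lambda>k. Re ((Q *\<^sub>v x (r k)) \<bullet>c x (r k))) \<longlonglongrightarrow> Re ((Q *\<^sub>v l) \<bullet>c l)"
    using Q x l by (intro tendsto_intros inner_tendsto[of n] mult_mat_vec_tendsto[of _ n n] lim) auto
  have Ulim: "(\<lambda>k. sqnorm (U *\<^sub>v x (r k))) \<longlonglongrightarrow> sqnorm (U *\<^sub>v l)"
    using U x l by (intro sqnorm_tendsto[of b] mult_mat_vec_tendsto[of _ b n] lim) auto
  have inv: "(\<lambda>k. inverse (real (r k))) \<longlonglongrightarrow> 0"
    using LIMSEQ_subseq_LIMSEQ[OF lim_inverse_n r] by (simp add: o_def)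
  have "(\<lambda>k. Re ((Q *\<^sub>v x (r k)) \<bullet>c x (r k)) * inverse (real (r k))) \<longlonglongrightarrow> Re ((Q *\<^sub>v l) \<bullet>c l) * 0"
    by (intro tendsto_mult Qlim inv)
  moreover have "sqnorm (U *\<^sub>v x (r k)) \<le> Re ((Q *\<^sub>v x (r k)) \<bullet>c x (r k)) * inverse (real (r k))" if "k \<ge> 1" for k
  proof -
    have "r k \<ge> 1" using seq_suble[OF r, of k] that by linarith
    then show ?thesis using form[of "r k"] by (simp add: field_simps)
  qed
  ultimately have "sqnorm (U *\<^sub>v l) \<le> Re ((Q *\<^sub>v l) \<bullet>c l) * 0"
    using Ulim by (intro tendsto_le[OF sequentially_bot]) (auto simp: eventually_sequentially)
  then have "sqnorm (U *\<^sub>v l) = 0"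
    using sqnorm_nonneg[of "U *\<^sub>v l"] by simp
  then have "U *\<^sub>v l = 0\<^sub>v b"
    using sqnorm_eq_0[of "U *\<^sub>v l" b] U by simp
  then have "Re ((Q *\<^sub>v l) \<bullet>c l) < 0"
    using neg[OF l l0] by simp
  moreover have "0 \<le> Re ((Q *\<^sub>v x (r k)) \<bullet>c x (r k))" for k
    using form[of "r k"] by (smt (verit) mult_nonneg_nonneg of_nat_0_le_iff sqnorm_nonneg)
  then have "0 \<le> Re ((Q *\<^sub>v l) \<bullet>c l)"
    using LIMSEQ_le_const[OF Qlim] by blast
  ultimately show False by simp
qed

text \<open>The solvability of a matrix inequality \<open>Q + \<Pi>\<^sup>\<dagger> K\<^sup>\<dagger> \<Lambda> + \<Lambda>\<^sup>\<dagger> K \<Pi> < 0\<close> in \<open>K\<close>, for \<open>\<Pi>\<close> of full row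
  rank.  By Finsler's lemma \<open>P = \<sigma> \<Lambda>\<^sup>\<dagger> \<Lambda> - Q\<close> is positive definite for some \<open>\<sigma>\<close>.  Let \<open>E\<close> send a value
  of \<open>\<Pi>\<close> to its preimage of least \<open>P\<close>-norm, so that every \<open>x\<close> is \<open>E (\<Pi> x)\<close> plus a \<open>P\<close>-orthogonal
  vector of the kernel of \<open>\<Pi>\<close>.  The choice \<open>K = - \<sigma> \<Lambda> E\<close> decouples the two summands.\<close>

lemma elimination:
  fixes Q Pi Lam :: "complex mat"
  assumes Q: "Q \<in> carrier_mat N N" and herm: "Q\<^sup>\<dagger> = Q"
    and Pi: "Pi \<in> carrier_mat a N" and Lam: "Lam \<in> carrier_mat b N"
    and full: "\<And>y. y \<in> carrier_vec a \<Longrightarrow> Pi\<^sup>\<dagger> *\<^sub>v y = 0\<^sub>v N \<Longrightarrow> y = 0\<^sub>v a"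
    and kerP: "\<And>x. x \<in> carrier_vec N \<Longrightarrow> x \<noteq> 0\<^sub>v N \<Longrightarrow> Pi *\<^sub>v x = 0\<^sub>v a \<Longrightarrow> Re ((Q *\<^sub>v x) \<bullet>c x) < 0"
    and kerL: "\<And>x. x \<in> carrier_vec N \<Longrightarrow> x \<noteq> 0\<^sub>v N \<Longrightarrow> Lam *\<^sub>v x = 0\<^sub>v b \<Longrightarrow> Re ((Q *\<^sub>v x) \<bullet>c x) < 0"
  obtains K where "K \<in> carrier_mat b a"
    "\<And>x. x \<in> carrier_vec N \<Longrightarrow> x \<noteq> 0\<^sub>v N \<Longrightarrow>
       Re ((Q *\<^sub>v x) \<bullet>c x) + 2 * Re ((K *\<^sub>v (Pi *\<^sub>v x)) \<bullet>c (Lam *\<^sub>v x)) < 0"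
proof -
  obtain \<sigma>' where \<sigma>': "\<And>x. x \<in> carrier_vec N \<Longrightarrow> x \<noteq> 0\<^sub>v N \<Longrightarrow> Re ((Q *\<^sub>v x) \<bullet>c x) < \<sigma>' * sqnorm (Lam *\<^sub>v x)"
    using finsler[OF Q Lam kerL] by blast
  \<comment> \<open>Finsler's multiplier may be negative; the argument below uses its sign\<close>
  define \<sigma> where "\<sigma> = \<bar>\<sigma>'\<bar>"
  have \<sigma>: "Re ((Q *\<^sub>v x) \<bullet>c x) < \<sigma> * sqnorm (Lam *\<^sub>v x)" if "x \<in> carrier_vec N" "x \<noteq> 0\<^sub>v N" for x
  proof -
    have "\<sigma>' * sqnorm (Lam *\<^sub>v x) \<le> \<sigma> * sqnorm (Lam *\<^sub>v x)"
      by (rule mult_right_mono) (auto simp: \<sigma>_def)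
    then show ?thesis using \<sigma>'[OF that] by simp
  qed
  define P where "P = complex_of_real \<sigma> \<cdot>\<^sub>m (Lam\<^sup>\<dagger> * Lam) - Q"
  have P: "P \<in> carrier_mat N N" using Q Lam by (auto simp: P_def)
  have Pform: "(P *\<^sub>v x) \<bullet>c x = complex_of_real (\<sigma> * sqnorm (Lam *\<^sub>v x)) - (Q *\<^sub>v x) \<bullet>c x"
    if x: "x \<in> carrier_vec N" for x
  proof -
    have LL: "Lam\<^sup>\<dagger> * Lam \<in> carrier_mat N N" using Lam by auto
    have "((complex_of_real \<sigma> \<cdot>\<^sub>m (Lam\<^sup>\<dagger> * Lam)) *\<^sub>v x) = complex_of_real \<sigma> \<cdot>\<^sub>v (Lam\<^sup>\<dagger> *\<^sub>v (Lam *\<^sub>v x))"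
      using LL Lam x assoc_mult_mat_vec[OF adjoint_carrier[OF Lam] Lam x]
      by (simp add: smult_mat_mult_vec[OF LL x])
    moreover have "(Lam\<^sup>\<dagger> *\<^sub>v (Lam *\<^sub>v x)) \<bullet>c x = complex_of_real (sqnorm (Lam *\<^sub>v x))"
      using inner_adjoint'[OF Lam, of "Lam *\<^sub>v x" x] Lam x by (simp add: inner_self)
    ultimately show ?thesis
      unfolding P_def using Lam Q x LL
      by (subst minus_mult_distrib_inner[of _ N]) (auto simp: inner_smult_left[of _ N])
  qed
  have Ppos: "0 < Re ((P *\<^sub>v x) \<bullet>c x)" if "x \<in> carrier_vec N" "x \<noteq> 0\<^sub>v N" for x
    using \<sigma>[OF that] Pform[OF that(1)] by simp
  have Pinj: "x = 0\<^sub>v N" if "x \<in> carrier_vec N" "P *\<^sub>v x = 0\<^sub>v N" for x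
    using Ppos[OF that(1)] that by (auto simp: inner_zero_left)
  obtain R where R: "R \<in> carrier_mat N N" "P * R = 1\<^sub>m N"
    using inverse_if_injective[OF P] Pinj by metis
  have PR: "P *\<^sub>v (R *\<^sub>v x) = x" if "x \<in> carrier_vec N" for x
    using assoc_mult_mat_vec[OF P R(1) that] R(2) that by simp
  \<comment> \<open>\<open>R\<close> is the inverse of \<open>P\<close>, and \<open>E = R \<Pi>\<^sup>\<dagger> (\<Pi> R \<Pi>\<^sup>\<dagger>)\<^sup>-\<^sup>1\<close> is the \<open>P\<close>-minimal right inverse of \<open>\<Pi>\<close>\<close>
  define W where "W = Pi * (R * Pi\<^sup>\<dagger>)"
  have W: "W \<in> carrier_mat a a" using Pi R by (auto simp: W_def)
  have Wv: "W *\<^sub>v y = Pi *\<^sub>v (R *\<^sub>v (Pi\<^sup>\<dagger> *\<^sub>v y))" if "y \<in> carrier_vec a" for y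
  proof -
    have "W *\<^sub>v y = Pi *\<^sub>v ((R * Pi\<^sup>\<dagger>) *\<^sub>v y)"
      unfolding W_def by (rule assoc_mult_mat_vec) (use Pi R that in auto)
    also have "(R * Pi\<^sup>\<dagger>) *\<^sub>v y = R *\<^sub>v (Pi\<^sup>\<dagger> *\<^sub>v y)"
      by (rule assoc_mult_mat_vec) (use Pi R that in auto)
    finally show ?thesis .
  qed
  have Winj: "y = 0\<^sub>v a" if y: "y \<in> carrier_vec a" and 0: "W *\<^sub>v y = 0\<^sub>v a" for y
  proof -
    define z where "z = R *\<^sub>v (Pi\<^sup>\<dagger> *\<^sub>v y)"
    have z: "z \<in> carrier_vec N" using R by (simp add: z_def)
    have "P *\<^sub>v z = Pi\<^sup>\<dagger> *\<^sub>v y" using Pi by (simp add: z_def PR)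
    moreover have "(Pi\<^sup>\<dagger> *\<^sub>v y) \<bullet>c z = y \<bullet>c (Pi *\<^sub>v z)"
      by (rule inner_adjoint'[OF Pi y z])
    ultimately have "Re ((P *\<^sub>v z) \<bullet>c z) = 0"
      using 0 y by (simp add: Wv z_def[symmetric] inner_zero_right)
    then have "z = 0\<^sub>v N" using Ppos[OF z] by force
    then have "Pi\<^sup>\<dagger> *\<^sub>v y = 0\<^sub>v N" using \<open>P *\<^sub>v z = _\<close> P by simp
    then show ?thesis using full y by blast
  qed
  obtain Z where Z: "Z \<in> carrier_mat a a" "W * Z = 1\<^sub>m a"
    using inverse_if_injective[OF W] Winj by metis
  define E where "E = R * Pi\<^sup>\<dagger> * Z"
  have E: "E \<in> carrier_mat N a" using R Pi Z by (auto simp: E_def)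
  have Ev: "E *\<^sub>v e = R *\<^sub>v (Pi\<^sup>\<dagger> *\<^sub>v (Z *\<^sub>v e))" if "e \<in> carrier_vec a" for e
  proof -
    have "E *\<^sub>v e = (R * Pi\<^sup>\<dagger>) *\<^sub>v (Z *\<^sub>v e)"
      unfolding E_def by (rule assoc_mult_mat_vec) (use Pi R Z that in auto)
    also have "\<dots> = R *\<^sub>v (Pi\<^sup>\<dagger> *\<^sub>v (Z *\<^sub>v e))"
      by (rule assoc_mult_mat_vec) (use Pi R Z that in auto)
    finally show ?thesis .
  qed
  have PiE: "Pi *\<^sub>v (E *\<^sub>v e) = e" if e: "e \<in> carrier_vec a" for e
    using assoc_mult_mat_vec[OF W Z(1) e] Z e Wv[of "Z *\<^sub>v e"] Ev[OF e] by simp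
  have PE: "P *\<^sub>v (E *\<^sub>v e) = Pi\<^sup>\<dagger> *\<^sub>v (Z *\<^sub>v e)" if "e \<in> carrier_vec a" for e
    using Ev[OF that] Pi by (simp add: PR)
  define K where "K = complex_of_real (- \<sigma>) \<cdot>\<^sub>m (Lam * E)"
  show ?thesis
  proof (rule that[of K])
    show "K \<in> carrier_mat b a" using Lam E by (auto simp: K_def)
  next
    fix x :: "complex vec" assume x: "x \<in> carrier_vec N" "x \<noteq> 0\<^sub>v N"
    define e where "e = Pi *\<^sub>v x"
    define g where "g = E *\<^sub>v e"
    define f where "f = x - g"
    have e: "e \<in> carrier_vec a" using Pi by (simp add: e_def)
    have g: "g \<in> carrier_vec N" using E by (simp add: g_def)
    have f: "f \<in> carrier_vec N" using x g by (simp add: f_def)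
    have xgf: "x = g + f" using x g by (auto simp: f_def)
    have "Pi *\<^sub>v x = Pi *\<^sub>v g + Pi *\<^sub>v f"
      unfolding xgf by (rule mult_add_distrib_mat_vec[OF Pi g f])
    then have "e = e + Pi *\<^sub>v f" using PiE[OF e] by (simp add: e_def[symmetric] g_def)
    have "(Pi *\<^sub>v f) $ i = 0" if "i < a" for i
    proof -
      have "e $ i = e $ i + (Pi *\<^sub>v f) $ i"
        using \<open>e = e + Pi *\<^sub>v f\<close> e that Pi by (metis carrier_matD(1) dim_mult_mat_vec index_add_vec(1))
      then show ?thesis by simp
    qed
    then have Pif: "Pi *\<^sub>v f = 0\<^sub>v a" using Pi by (intro eq_vecI) auto
    have cross: "(P *\<^sub>v g) \<bullet>c f = 0"
      using PE[OF e] inner_adjoint'[OF Pi, of "Z *\<^sub>v e" f] Z f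
      by (simp add: g_def[symmetric] Pif inner_zero_right[of _ a])
    have "P\<^sup>\<dagger> = P"
    proof (rule hermitian_if_form_real[OF P])
      fix x :: "complex vec" assume x: "x \<in> carrier_vec N"
      have "(Q *\<^sub>v x) \<bullet>c x = cnj ((Q *\<^sub>v x) \<bullet>c x)"
        using inner_commute[of "Q *\<^sub>v x" N x] hermitian_inner[OF Q herm x x] Q x by simp
      then have "Im ((Q *\<^sub>v x) \<bullet>c x) = 0" by (simp add: complex_eq_iff)
      then show "Im ((P *\<^sub>v x) \<bullet>c x) = 0" using Pform[OF x] by simp
    qed
    then have cross': "(P *\<^sub>v f) \<bullet>c g = 0"
      using hermitian_inner[OF P _ f g] inner_commute[of f N "P *\<^sub>v g"] P f cross by simp
    have "(P *\<^sub>v x) \<bullet>c x = (P *\<^sub>v g) \<bullet>c g + (P *\<^sub>v f) \<bullet>c f"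
      unfolding xgf using P g f cross cross'
      by (simp add: mult_add_distrib_mat_vec[OF P] inner_add_left[of _ N] inner_add_right[of _ N])
    then have Px: "Re ((P *\<^sub>v x) \<bullet>c x) = Re ((P *\<^sub>v g) \<bullet>c g) + Re ((P *\<^sub>v f) \<bullet>c f)"
      by simp
    have Lg: "Lam *\<^sub>v g \<in> carrier_vec b" and Lf: "Lam *\<^sub>v f \<in> carrier_vec b" using Lam by auto
    have Lx: "Lam *\<^sub>v x = Lam *\<^sub>v g + Lam *\<^sub>v f"
      unfolding xgf by (rule mult_add_distrib_mat_vec[OF Lam g f])
    have Ke: "K *\<^sub>v e = complex_of_real (- \<sigma>) \<cdot>\<^sub>v (Lam *\<^sub>v g)"
      unfolding K_def g_def using Lam E e
      by (subst smult_mat_mult_vec[of _ b a]) (auto simp: assoc_mult_mat_vec[OF Lam E e])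
    have KL: "Re ((K *\<^sub>v e) \<bullet>c (Lam *\<^sub>v x)) = - \<sigma> * (sqnorm (Lam *\<^sub>v g) + Re ((Lam *\<^sub>v g) \<bullet>c (Lam *\<^sub>v f)))"
      unfolding Ke Lx using Lg Lf
      by (simp add: inner_smult_left[of _ b] inner_add_right[of _ b] inner_self algebra_simps)
    have Lxn: "sqnorm (Lam *\<^sub>v x) = sqnorm (Lam *\<^sub>v g) + 2 * Re ((Lam *\<^sub>v g) \<bullet>c (Lam *\<^sub>v f)) + sqnorm (Lam *\<^sub>v f)"
      unfolding Lx by (rule sqnorm_add[OF Lg Lf])
    have Qx: "Re ((Q *\<^sub>v x) \<bullet>c x) = \<sigma> * sqnorm (Lam *\<^sub>v x) - Re ((P *\<^sub>v x) \<bullet>c x)"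
      using Pform[OF x(1)] by simp
    have Qf: "Re ((Q *\<^sub>v f) \<bullet>c f) = \<sigma> * sqnorm (Lam *\<^sub>v f) - Re ((P *\<^sub>v f) \<bullet>c f)"
      using Pform[OF f] by simp
    have total: "Re ((Q *\<^sub>v x) \<bullet>c x) + 2 * Re ((K *\<^sub>v e) \<bullet>c (Lam *\<^sub>v x))
        = - \<sigma> * sqnorm (Lam *\<^sub>v g) - Re ((P *\<^sub>v g) \<bullet>c g) + Re ((Q *\<^sub>v f) \<bullet>c f)"
      unfolding Qx Px KL Lxn Qf by (simp add: algebra_simps)
    have "0 \<le> \<sigma> * sqnorm (Lam *\<^sub>v g)" by (simp add: \<sigma>_def)
    moreover have "0 < Re ((P *\<^sub>v g) \<bullet>c g) \<or> g = 0\<^sub>v N" using Ppos g by blast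
    moreover have "Re ((Q *\<^sub>v f) \<bullet>c f) < 0 \<or> f = 0\<^sub>v N" using kerP[OF f _ Pif] by blast
    moreover have "\<not> (g = 0\<^sub>v N \<and> f = 0\<^sub>v N)" using xgf x(2) by auto
    moreover have "Re ((P *\<^sub>v 0\<^sub>v N) \<bullet>c 0\<^sub>v N) = 0" "Re ((Q *\<^sub>v 0\<^sub>v N) \<bullet>c 0\<^sub>v N) = 0"
      using P Q by (simp_all add: inner_zero_right[of _ N])
    ultimately show "Re ((Q *\<^sub>v x) \<bullet>c x) + 2 * Re ((K *\<^sub>v (Pi *\<^sub>v x)) \<bullet>c (Lam *\<^sub>v x)) < 0"
      unfolding total[unfolded e_def] by (auto simp: e_def)
  qed
qed

section \<open>Factorization of semidefinite matrices and rank\<close>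

text \<open>Cauchy-Schwarz for a semidefinite form, in the degenerate case: an isotropic vector lies in the radical.\<close>

lemma psd_cauchy_schwarz_zero:
  assumes S: "S \<in> carrier_mat n n" "S\<^sup>\<dagger> = S"
    and psd: "\<And>x. x \<in> carrier_vec n \<Longrightarrow> 0 \<le> Re ((S *\<^sub>v x) \<bullet>c x)"
    and x: "x \<in> carrier_vec n" "y \<in> carrier_vec n" and 0: "Re ((S *\<^sub>v x) \<bullet>c x) = 0"
  shows "(S *\<^sub>v x) \<bullet>c y = 0"
proof (rule ccontr)
  define w where "w = (S *\<^sub>v x) \<bullet>c y"
  define b where "b = Re ((S *\<^sub>v y) \<bullet>c y)"
  assume "(S *\<^sub>v x) \<bullet>c y \<noteq> 0"
  then have w: "cmod w > 0" by (simp add: w_def)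
  have w': "(S *\<^sub>v y) \<bullet>c x = cnj w"
    using hermitian_inner[OF S x(2) x(1)] inner_commute[of y n "S *\<^sub>v x"] S x by (simp add: w_def)
  have "Re ((S *\<^sub>v (y + a \<cdot>\<^sub>v x)) \<bullet>c (y + a \<cdot>\<^sub>v x)) = b + 2 * Re (a * w)" for a
  proof -
    have "(S *\<^sub>v (y + a \<cdot>\<^sub>v x)) \<bullet>c (y + a \<cdot>\<^sub>v x)
        = (S *\<^sub>v y) \<bullet>c y + cnj a * cnj w + a * w + a * cnj a * ((S *\<^sub>v x) \<bullet>c x)"
      using S x w' by (simp add: mult_add_distrib_mat_vec[OF S(1)] mult_mat_vec[OF S(1)] inner_add_left[of _ n]
          inner_add_right[of _ n] inner_smult_left[of _ n] inner_smult_right[of _ n] w_def[symmetric] algebra_simps)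
    moreover have "a * cnj a = complex_of_real ((cmod a)\<^sup>2)" by (simp add: complex_mult_cnj cmod_power2)
    ultimately show ?thesis using 0 by (simp add: b_def)
  qed
  then have *: "0 \<le> b + 2 * Re (a * w)" for a
    using psd[of "y + a \<cdot>\<^sub>v x"] x by simp
  define t where "t = (\<bar>b\<bar> + 1) / (cmod w)\<^sup>2"
  have "t * ((Re w)\<^sup>2 + (Im w)\<^sup>2) = \<bar>b\<bar> + 1"
    using w by (simp add: t_def flip: cmod_power2)
  then have "Re (complex_of_real (- t) * cnj w * w) = - (\<bar>b\<bar> + 1)"
    by (simp add: power2_eq_square algebra_simps)
  with *[of "complex_of_real (- t) * cnj w"] show False by linarith
qed

text \<open>Symmetric Gaussian elimination.  After the pivots with index less than \<open>i\<close> have been cleared,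
  the remainder is still semidefinite and vanishes on the first \<open>i\<close> rows; a pivot that is zero clears
  its whole row.  Each column produced starts at its own pivot row, so the columns are independent.\<close>

lemma psd_elimination_step:
  assumes S: "S \<in> carrier_mat n n" and psd: "pos_semidef S"
  shows "i \<le> n \<Longrightarrow> \<exists>(k::nat) v. (\<forall>j<k. v j \<in> carrier_vec n) \<and>
    (\<forall>x \<in> carrier_vec n. (\<Sum>j<k. (cmod (x \<bullet>c v j))\<^sup>2) \<le> Re ((S *\<^sub>v x) \<bullet>c x)) \<and>
    (\<forall>a<i. \<forall>b<n. S $$ (a, b) = (\<Sum>j<k. v j $ a * cnj (v j $ b))) \<and>
    (\<forall>y. (\<forall>a<i. (\<Sum>j<k. y j * v j $ a) = 0) \<longrightarrow> (\<forall>j<k. y j = 0))"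
proof (induction i)
  case 0
  show ?case
    using psd by (intro exI[of _ "0::nat"]) (auto simp: pos_semidef_iff[OF S] less_eq_complex_def)
next
  case (Suc i)
  then have i: "i < n" by simp
  from Suc.IH[OF Suc_leD[OF Suc.prems]] obtain k :: nat and v where vs: "\<forall>j<k. v j \<in> carrier_vec n"
    and les: "\<forall>x \<in> carrier_vec n. (\<Sum>j<k. (cmod (x \<bullet>c v j))\<^sup>2) \<le> Re ((S *\<^sub>v x) \<bullet>c x)"
    and rowss: "\<forall>a<i. \<forall>b<n. S $$ (a, b) = (\<Sum>j<k. v j $ a * cnj (v j $ b))"
    and indeps: "\<forall>y. (\<forall>a<i. (\<Sum>j<k. y j * v j $ a) = 0) \<longrightarrow> (\<forall>j<k. y j = 0)"
    by (elim exE conjE)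
  note v = vs[rule_format] and le = les[rule_format] and rows = rowss[rule_format]
  have indep: "\<forall>j<k. y j = 0" if "\<And>a. a < i \<Longrightarrow> (\<Sum>j<k. y j * v j $ a) = 0" for y
    using indeps that by blast
  have Sh: "S\<^sup>\<dagger> = S" using psd by (simp add: pos_semidef_def)
  \<comment> \<open>the remainder after \<open>i\<close> pivots; its rows with index less than \<open>i\<close> vanish\<close>
  define T where "T = mat n n (\<lambda>(a, b). S $$ (a, b) - (\<Sum>j<k. v j $ a * cnj (v j $ b)))"
  have T: "T \<in> carrier_mat n n" by (simp add: T_def)
  have Tij: "T $$ (a, b) = S $$ (a, b) - (\<Sum>j<k. v j $ a * cnj (v j $ b))" if "a < n" "b < n" for a b
    using that by (simp add: T_def)
  have Tv: "(T *\<^sub>v x) $ a = (S *\<^sub>v x) $ a - (\<Sum>j<k. v j $ a * (x \<bullet>c v j))" if "a < n" "x \<in> carrier_vec n" for a x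
  proof -
    have "(\<Sum>b<n. \<Sum>j<k. v j $ a * cnj (v j $ b) * x $ b) = (\<Sum>j<k. \<Sum>b<n. v j $ a * cnj (v j $ b) * x $ b)"
      by (rule sum.swap)
    also have "\<dots> = (\<Sum>j<k. v j $ a * (x \<bullet>c v j))"
      by (rule sum.cong[OF refl]) (auto simp: inner_sum[OF v] sum_distrib_left algebra_simps)
    finally show ?thesis
      using that S T
      by (simp add: mult_mat_vec_sum[OF T] mult_mat_vec_sum[OF S] Tij left_diff_distrib sum_subtractf sum_distrib_right
          del: index_mult_mat_vec)
  qed
  have Tform: "(T *\<^sub>v x) \<bullet>c y = (S *\<^sub>v x) \<bullet>c y - (\<Sum>j<k. (x \<bullet>c v j) * cnj (y \<bullet>c v j))"
    if "x \<in> carrier_vec n" "y \<in> carrier_vec n" for x y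
  proof -
    have "(\<Sum>a<n. \<Sum>j<k. v j $ a * (x \<bullet>c v j) * cnj (y $ a)) = (\<Sum>j<k. \<Sum>a<n. v j $ a * (x \<bullet>c v j) * cnj (y $ a))"
      by (rule sum.swap)
    also have "\<dots> = (\<Sum>j<k. (x \<bullet>c v j) * (v j \<bullet>c y))"
      by (rule sum.cong[OF refl]) (auto simp: inner_sum[OF that(2)] sum_distrib_left algebra_simps)
    also have "\<dots> = (\<Sum>j<k. (x \<bullet>c v j) * cnj (y \<bullet>c v j))"
    proof (rule sum.cong[OF refl])
      fix j assume "j \<in> {..<k}"
      then show "(x \<bullet>c v j) * (v j \<bullet>c y) = (x \<bullet>c v j) * cnj (y \<bullet>c v j)"
        using inner_commute[of "v j" n y] v that by simp
    qed
    finally show ?thesis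
      using that by (simp add: inner_sum[OF that(2)] Tv left_diff_distrib sum_subtractf sum_distrib_right
          del: index_mult_mat_vec)
  qed
  have Tself: "Re ((T *\<^sub>v x) \<bullet>c x) = Re ((S *\<^sub>v x) \<bullet>c x) - (\<Sum>j<k. (cmod (x \<bullet>c v j))\<^sup>2)"
    if "x \<in> carrier_vec n" for x
  proof -
    have "Re (\<Sum>j<k. (x \<bullet>c v j) * cnj (x \<bullet>c v j)) = (\<Sum>j<k. (cmod (x \<bullet>c v j))\<^sup>2)"
      by (simp add: complex_mult_cnj cmod_power2)
    then show ?thesis using Tform[OF that that] by simp
  qed
  have Tpsd: "0 \<le> Re ((T *\<^sub>v x) \<bullet>c x)" if "x \<in> carrier_vec n" for x
    using le[OF that] Tself[OF that] by simp
  have "T\<^sup>\<dagger> = T"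
  proof (rule hermitian_if_form_real[OF T])
    fix x :: "complex vec" assume x: "x \<in> carrier_vec n"
    have "(x \<bullet>c v j) * cnj (x \<bullet>c v j) = complex_of_real ((cmod (x \<bullet>c v j))\<^sup>2)" for j
      by (simp add: complex_mult_cnj cmod_power2)
    then have "Im (\<Sum>j<k. (x \<bullet>c v j) * cnj (x \<bullet>c v j)) = 0" by simp
    moreover have "Im ((S *\<^sub>v x) \<bullet>c x) = 0"
      using psd x by (auto simp: pos_semidef_iff[OF S] less_eq_complex_def)
    ultimately show "Im ((T *\<^sub>v x) \<bullet>c x) = 0" using Tform[OF x x] by simp
  qed
  have Tadj: "T $$ (b, a) = cnj (T $$ (a, b))" if "a < n" "b < n" for a b
    using adjoint_index[of b T a] T that \<open>T\<^sup>\<dagger> = T\<close> by simp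
  have T0: "T $$ (a, b) = 0" if "a < i" "b < n" for a b
    using rows[OF that] Tij[of a b] that i by simp
  define e where "e = (unit_vec n i :: complex vec)"
  have e: "e \<in> carrier_vec n" by (simp add: e_def)
  have Te: "(T *\<^sub>v e) $ a = T $$ (a, i)" if "a < n" for a
    unfolding e_def using mult_unit_vec_index[OF T i that] .
  have Tei: "(T *\<^sub>v e) \<bullet>c e = T $$ (i, i)"
    using inner_unit_vec[of "T *\<^sub>v e" n i] T i Te[OF i] by (simp add: e_def)
  define d where "d = Re (T $$ (i, i))"
  have d: "T $$ (i, i) = complex_of_real d" "d \<ge> 0"
    using Tadj[OF i i] Tpsd[OF e] Tei by (auto simp: d_def complex_eq_iff)
  show ?case
  proof (cases "d = 0")
    case True
    have Ti0: "T $$ (i, b) = 0" if "b < n" for b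
    proof -
      have "(T *\<^sub>v e) \<bullet>c unit_vec n b = 0"
        by (rule psd_cauchy_schwarz_zero[OF T \<open>T\<^sup>\<dagger> = T\<close> Tpsd e]) (use Tei d True in auto)
      then have "T $$ (b, i) = 0"
        using inner_unit_vec[of "T *\<^sub>v e" n b] T that Te[OF that] by simp
      then show ?thesis using Tadj[OF that i] by simp
    qed
    have c1: "S $$ (a, b) = (\<Sum>j<k. v j $ a * cnj (v j $ b))" if "a < Suc i" "b < n" for a b
    proof (cases "a = i")
      case True then show ?thesis using Ti0[OF that(2)] Tij[OF i that(2)] by simp
    next
      case False then show ?thesis using rows that by simp
    qed
    have c2: "\<forall>j<k. y j = 0" if "\<forall>a<Suc i. (\<Sum>j<k. y j * v j $ a) = 0" for y
      using that by (intro indep) simp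
    show ?thesis
    proof (intro exI[of _ k] exI[of _ v] conjI)
      show "\<forall>a<Suc i. \<forall>b<n. S $$ (a, b) = (\<Sum>j<k. v j $ a * cnj (v j $ b))" using c1 by blast
      show "\<forall>y. (\<forall>a<Suc i. (\<Sum>j<k. y j * v j $ a) = 0) \<longrightarrow> (\<forall>j<k. y j = 0)" using c2 by blast
    qed (fact vs les)+
  next
    case False
    then have dpos: "d > 0" using d by simp
    \<comment> \<open>\<open>T - w w\<^sup>\<dagger>\<close> is the Schur complement of the pivot \<open>d\<close>\<close>
    define w where "w = complex_of_real (1 / sqrt d) \<cdot>\<^sub>v (T *\<^sub>v e)"
    have w: "w \<in> carrier_vec n" using T by (simp add: w_def)
    have wa: "w $ a = T $$ (a, i) / complex_of_real (sqrt d)" if "a < n" for a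
      using T that Te[OF that] by (simp add: w_def del: index_mult_mat_vec)
    define v' where "v' j = (if j = k then w else v j)" for j
    have sum': "(\<Sum>j<Suc k. f j (v' j)) = (\<Sum>j<k. f j (v j)) + f k w" for f :: "nat \<Rightarrow> complex vec \<Rightarrow> complex"
      by (simp add: v'_def)
    have sum'': "(\<Sum>j<Suc k. f j (v' j)) = (\<Sum>j<k. f j (v j)) + f k w" for f :: "nat \<Rightarrow> complex vec \<Rightarrow> real"
      by (simp add: v'_def)
    have sq: "complex_of_real (sqrt d) * complex_of_real (sqrt d) = complex_of_real d"
      using d by (simp flip: of_real_mult)
    have c0: "(\<Sum>j<Suc k. (cmod (x \<bullet>c v' j))\<^sup>2) \<le> Re ((S *\<^sub>v x) \<bullet>c x)" if x: "x \<in> carrier_vec n" for x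
    proof -
      define c where "c = (T *\<^sub>v x) \<bullet>c e"
      have c': "x \<bullet>c (T *\<^sub>v e) = c"
        using hermitian_inner[OF T \<open>T\<^sup>\<dagger> = T\<close> x e] by (simp add: c_def)
      have ce: "(T *\<^sub>v e) \<bullet>c x = cnj c"
        using inner_commute[of "T *\<^sub>v e" n x] c' T x by simp
      \<comment> \<open>the minimiser of the form of \<open>T\<close> on the line through \<open>x\<close> in the direction of the pivot vector\<close>
      define s where "s = - c / complex_of_real d"
      have "(T *\<^sub>v (x + s \<cdot>\<^sub>v e)) \<bullet>c (x + s \<cdot>\<^sub>v e)
        = (T *\<^sub>v x) \<bullet>c x + cnj s * c + s * cnj c + s * cnj s * complex_of_real d"
        using T x e ce Tei d(1) by (simp add: mult_add_distrib_mat_vec[OF T] mult_mat_vec[OF T] inner_add_left[of _ n]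
          inner_add_right[of _ n] inner_smult_left[of _ n] inner_smult_right[of _ n] c_def[symmetric] algebra_simps)
      also have "\<dots> = (T *\<^sub>v x) \<bullet>c x - complex_of_real ((cmod c)\<^sup>2 / d)"
      proof -
        have "cnj s * c = - complex_of_real ((cmod c)\<^sup>2 / d)" "s * cnj c = - complex_of_real ((cmod c)\<^sup>2 / d)"
          unfolding s_def of_real_divide complex_norm_square by simp_all
        moreover have "s * cnj s * complex_of_real d = complex_of_real ((cmod c)\<^sup>2 / d)"
          using dpos unfolding s_def of_real_divide complex_norm_square by simp
        ultimately show ?thesis by simp
      qed
      finally have "(cmod c)\<^sup>2 / d \<le> Re ((T *\<^sub>v x) \<bullet>c x)"
        using Tpsd[of "x + s \<cdot>\<^sub>v e"] x e by simp
      moreover have "x \<bullet>c w = c / complex_of_real (sqrt d)"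
        using T x c' by (simp add: w_def inner_smult_right[of _ n])
      then have "(cmod (x \<bullet>c w))\<^sup>2 = (cmod c)\<^sup>2 / d"
        using dpos by (simp add: norm_divide power_divide)
      ultimately show ?thesis
        using Tself[OF x] by (simp only: sum''[of "\<lambda>j u. (cmod (x \<bullet>c u))\<^sup>2"])
    qed
    have c1: "S $$ (a, b) = (\<Sum>j<Suc k. v' j $ a * cnj (v' j $ b))" if "a < Suc i" "b < n" for a b
    proof -
      have "T $$ (a, b) = w $ a * cnj (w $ b)"
      proof (cases "a = i")
        case True
        have "w $ i * cnj (w $ b) = complex_of_real d * T $$ (i, b) / (complex_of_real (sqrt d) * complex_of_real (sqrt d))"
          using Tadj[OF that(2) i] by (simp add: wa[OF i] wa[OF that(2)] d(1))
        then show ?thesis using True dpos by (simp add: sq)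
      next
        case False
        then show ?thesis using T0[of a] that i by (simp add: wa)
      qed
      moreover have "S $$ (a, b) = (\<Sum>j<k. v j $ a * cnj (v j $ b)) + T $$ (a, b)"
        using Tij[of a b] that i by simp
      ultimately show ?thesis
        by (simp only: sum'[of "\<lambda>j u. u $ a * cnj (u $ b)"])
    qed
    have c2: "\<forall>j<Suc k. y j = 0" if y: "\<forall>a<Suc i. (\<Sum>j<Suc k. y j * v' j $ a) = 0" for y
    proof -
      have y': "(\<Sum>j<k. y j * v j $ a) + y k * w $ a = 0" if "a < Suc i" for a
        using y[rule_format, OF that] by (simp only: sum'[of "\<lambda>j u. y j * u $ a"])
      have "(\<Sum>j<k. y j * v j $ a) = 0" if "a < i" for a
        using y'[of a] T0[OF that i] that i by (simp add: wa)
      then have y0: "\<forall>j<k. y j = 0" by (rule indep)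
      then have "y k * w $ i = 0" using y'[of i] by simp
      moreover have "w $ i \<noteq> 0" using dpos by (simp add: wa[OF i] d(1))
      ultimately show ?thesis using y0 by (auto simp: less_Suc_eq)
    qed
    have c3: "v' j \<in> carrier_vec n" if "j < Suc k" for j
      using v[of j] w that by (cases "j = k") (auto simp: v'_def)
    show ?thesis
    proof (intro exI[of _ "Suc k"] exI[of _ v'] conjI)
      show "\<forall>j<Suc k. v' j \<in> carrier_vec n" using c3 by blast
      show "\<forall>x\<in>carrier_vec n. (\<Sum>j<Suc k. (cmod (x \<bullet>c v' j))\<^sup>2) \<le> Re ((S *\<^sub>v x) \<bullet>c x)" using c0 by blast
      show "\<forall>a<Suc i. \<forall>b<n. S $$ (a, b) = (\<Sum>j<Suc k. v' j $ a * cnj (v' j $ b))" using c1 by blast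
      show "\<forall>y. (\<forall>a<Suc i. (\<Sum>j<Suc k. y j * v' j $ a) = 0) \<longrightarrow> (\<forall>j<Suc k. y j = 0)" using c2 by blast
    qed
  qed
qed

lemma psd_factorization:
  assumes S: "S \<in> carrier_mat n n" and psd: "pos_semidef S"
  obtains k V where "V \<in> carrier_mat n k" "S = V * V\<^sup>\<dagger>"
    "\<And>y. y \<in> carrier_vec k \<Longrightarrow> V *\<^sub>v y = 0\<^sub>v n \<Longrightarrow> y = 0\<^sub>v k"
proof -
  obtain k :: nat and v where v: "\<forall>j<k. v j \<in> carrier_vec n"
    and S': "\<forall>a<n. \<forall>b<n. S $$ (a, b) = (\<Sum>j<k. v j $ a * cnj (v j $ b))"
    and indep: "\<forall>y. (\<forall>a<n. (\<Sum>j<k. y j * v j $ a) = 0) \<longrightarrow> (\<forall>j<k. y j = 0)"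
    using psd_elimination_step[OF S psd order_refl] by (elim exE conjE)
  define V where "V = mat n k (\<lambda>(a, j). v j $ a)"
  have V: "V \<in> carrier_mat n k" by (simp add: V_def)
  show ?thesis
  proof (rule that[OF V])
    show "S = V * V\<^sup>\<dagger>"
    proof (rule eq_matI)
      fix a b assume "a < dim_row (V * V\<^sup>\<dagger>)" "b < dim_col (V * V\<^sup>\<dagger>)"
      then have ab: "a < n" "b < n" using V by auto
      have "(V * V\<^sup>\<dagger>) $$ (a, b) = (\<Sum>j<k. V $$ (a, j) * V\<^sup>\<dagger> $$ (j, b))"
        by (rule mult_mat_sum[OF V adjoint_carrier[OF V] ab])
      also have "\<dots> = (\<Sum>j<k. v j $ a * cnj (v j $ b))"
        by (rule sum.cong[OF refl]) (use V ab in \<open>simp add: V_def\<close>)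
      finally show "S $$ (a, b) = (V * V\<^sup>\<dagger>) $$ (a, b)" using S' ab by metis
    qed (use S V in auto)
    fix y :: "complex vec" assume y: "y \<in> carrier_vec k" "V *\<^sub>v y = 0\<^sub>v n"
    have "(\<Sum>j<k. y $ j * v j $ a) = 0" if "a < n" for a
    proof -
      have "(V *\<^sub>v y) $ a = (\<Sum>j<k. V $$ (a, j) * y $ j)"
        by (rule mult_mat_vec_sum[OF V y(1) that])
      moreover have "(\<Sum>j<k. V $$ (a, j) * y $ j) = (\<Sum>j<k. y $ j * v j $ a)"
        by (rule sum.cong[OF refl]) (use that in \<open>simp add: V_def\<close>)
      ultimately show ?thesis using y(2) that by (simp del: index_mult_mat_vec)
    qed
    then have "\<forall>j<k. y $ j = 0" using indep[rule_format, of "\<lambda>j. y $ j"] by blast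
    then show "y = 0\<^sub>v k" using y(1) by (intro eq_vecI) auto
  qed
qed

text \<open>\<open>H\<close> holds the coordinates of the columns of \<open>M\<close> with respect to a maximal independent set of
  columns, so \<open>M\<close> factors through \<open>H\<close>.\<close>

lemma rank_kernel:
  fixes M :: "complex mat"
  assumes M: "M \<in> carrier_mat N N'"
  obtains H where "H \<in> carrier_mat (vec_space.rank N M) N'"
    "\<And>x. x \<in> carrier_vec N' \<Longrightarrow> H *\<^sub>v x = 0\<^sub>v (vec_space.rank N M) \<Longrightarrow> M *\<^sub>v x = 0\<^sub>v N"
proof -
  interpret vec_space "TYPE(complex)" N .
  define r where "r = vec_space.rank N M"
  have cols: "set (cols M) \<subseteq> carrier_vec N" using M cols_dim by blast
  have "\<exists>S. finite S \<and> maximal S (\<lambda>T. T \<subseteq> set (cols M) \<and> lin_indpt T) \<and> {} \<subseteq> S"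
    by (rule maximal_exists_superset[of "set (cols M)"]) (auto simp: finite_lin_indpt2)
  then obtain S where S: "finite S" "maximal S (\<lambda>T. T \<subseteq> set (cols M) \<and> lin_indpt T)" by blast
  have card: "card S = r" using rank_card_indpt[OF M S(2)] by (simp add: r_def)
  have Sc: "S \<subseteq> set (cols M)" "lin_indpt S" using S(2) by (auto simp: maximal_def)
  then have SN: "S \<subseteq> carrier_vec N" using cols by blast
  have "c \<in> span S" if c: "c \<in> set (cols M)" for c
  proof (rule ccontr)
    assume ns: "c \<notin> span S"
    have cN: "c \<in> carrier_vec N" using c cols by blast
    have "c \<notin> S" using ns in_own_span[OF SN] by blast
    have "lin_indpt (insert c S)"
      using lin_dep_iff_in_span[OF _ Sc(2), of c] ns SN cN \<open>c \<notin> S\<close> by simp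
    then have "insert c S = S"
      using S(2) c Sc unfolding maximal_def by (metis insert_subset subset_insertI subset_antisym)
    then show False using \<open>c \<notin> S\<close> by blast
  qed
  then have "\<exists>a. c = lincomb a S" if "c \<in> set (cols M)" for c
    using finite_in_span[OF S(1), of c] SN that by auto
  then obtain co where co: "\<And>c. c \<in> set (cols M) \<Longrightarrow> c = lincomb (co c) S" by metis
  obtain f where f: "bij_betw f {..<r} S"
    using ex_bij_betw_nat_finite[OF S(1)] card by (auto simp: lessThan_atLeast0)
  define H where "H = mat r N' (\<lambda>(i, j). co (col M j) (f i))"
  have H: "H \<in> carrier_mat r N'" by (simp add: H_def)
  have Mij: "M $$ (i, j) = (\<Sum>l<r. H $$ (l, j) * f l $ i)" if "i < N" "j < N'" for i j
  proof -
    have "col M j \<in> set (cols M)" using M that by (auto simp: cols_def)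
    then have "col M j $ i = (\<Sum>s\<in>S. co (col M j) s * s $ i)"
      using co[of "col M j"] lincomb_index[OF that(1) SN, of "co (col M j)"] by simp
    also have "\<dots> = (\<Sum>l<r. co (col M j) (f l) * f l $ i)"
      by (rule sum.reindex_bij_betw[OF f, symmetric])
    finally show ?thesis using M that by (simp add: H_def)
  qed
  show ?thesis
  proof (rule that[of H, folded r_def])
    show "H \<in> carrier_mat r N'" by (rule H)
    fix x :: "complex vec" assume x: "x \<in> carrier_vec N'" "H *\<^sub>v x = 0\<^sub>v r"
    show "M *\<^sub>v x = 0\<^sub>v N"
    proof (rule eq_vecI)
      fix i assume "i < dim_vec (0\<^sub>v N :: complex vec)"
      then have i: "i < N" by simp
      have "(M *\<^sub>v x) $ i = (\<Sum>j<N'. \<Sum>l<r. H $$ (l, j) * f l $ i * x $ j)"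
        using i x M by (simp add: mult_mat_vec_sum[OF M] Mij sum_distrib_right del: index_mult_mat_vec)
      also have "\<dots> = (\<Sum>l<r. \<Sum>j<N'. H $$ (l, j) * f l $ i * x $ j)" by (rule sum.swap)
      also have "\<dots> = (\<Sum>l<r. f l $ i * (H *\<^sub>v x) $ l)"
        using x(1) by (intro sum.cong[OF refl]) (simp add: mult_mat_vec_sum[OF H] sum_distrib_left algebra_simps del: index_mult_mat_vec)
      also have "\<dots> = 0" using x by simp
      finally show "(M *\<^sub>v x) $ i = 0\<^sub>v N $ i" using i by simp
    qed (use M in auto)
  qed
qed

section \<open>Block matrices\<close>

lemma append_cols_carrier:
  "M \<in> carrier_mat r c1 \<Longrightarrow> N \<in> carrier_mat r c2 \<Longrightarrow> M @\<^sub>c N \<in> carrier_mat r (c1 + c2)"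
  unfolding append_cols_def using four_block_carrier_mat[of M r c1 "0\<^sub>m 0 (dim_col N)" 0 c2] by auto

lemma append_vec_nil [simp]: "x @\<^sub>v vNil = x"
  by (rule eq_vecI) auto

lemma append_cols_mult:
  fixes M N :: "complex mat"
  assumes M: "M \<in> carrier_mat r c1" and N: "N \<in> carrier_mat r c2"
    and x: "x \<in> carrier_vec c1" and y: "y \<in> carrier_vec c2"
  shows "(M @\<^sub>c N) *\<^sub>v (x @\<^sub>v y) = M *\<^sub>v x + N *\<^sub>v y"
proof -
  have "(M @\<^sub>c N) *\<^sub>v (x @\<^sub>v y) = (M *\<^sub>v x + N *\<^sub>v y) @\<^sub>v (0\<^sub>m 0 (dim_col M) *\<^sub>v x + 0\<^sub>m 0 (dim_col N) *\<^sub>v y)"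
    unfolding append_cols_def using assms
    by (intro four_block_mat_mult_vec[of _ r c1 _ c2 _ 0]) auto
  also have "0\<^sub>m 0 (dim_col M) *\<^sub>v x + 0\<^sub>m 0 (dim_col N) *\<^sub>v y = 0\<^sub>v 0"
    by (rule eq_vecI) auto
  finally show ?thesis by simp
qed

lemma append_rows_mult:
  fixes M N :: "complex mat"
  assumes M: "M \<in> carrier_mat r1 c" and N: "N \<in> carrier_mat r2 c" and x: "x \<in> carrier_vec c"
  shows "(M @\<^sub>r N) *\<^sub>v x = M *\<^sub>v x @\<^sub>v N *\<^sub>v x"
proof -
  have "(M @\<^sub>r N) *\<^sub>v (x @\<^sub>v 0\<^sub>v 0)
      = (M *\<^sub>v x + 0\<^sub>m (dim_row M) 0 *\<^sub>v 0\<^sub>v 0) @\<^sub>v (N *\<^sub>v x + 0\<^sub>m (dim_row N) 0 *\<^sub>v 0\<^sub>v 0)"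
    unfolding append_rows_def using assms
    by (intro four_block_mat_mult_vec[of _ r1 c _ 0 _ r2]) auto
  also have "M *\<^sub>v x + 0\<^sub>m (dim_row M) 0 *\<^sub>v 0\<^sub>v 0 = M *\<^sub>v x"
    by (rule eq_vecI) auto
  also have "N *\<^sub>v x + 0\<^sub>m (dim_row N) 0 *\<^sub>v 0\<^sub>v 0 = N *\<^sub>v x"
    by (rule eq_vecI) auto
  finally show ?thesis by simp
qed

lemma adjoint_four_block:
  fixes A B C D :: "complex mat"
  assumes "A \<in> carrier_mat r1 c1" "B \<in> carrier_mat r1 c2" "C \<in> carrier_mat r2 c1" "D \<in> carrier_mat r2 c2"
  shows "(four_block_mat A B C D)\<^sup>\<dagger> = four_block_mat (A\<^sup>\<dagger>) (C\<^sup>\<dagger>) (B\<^sup>\<dagger>) (D\<^sup>\<dagger>)"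
proof (rule eq_matI)
  fix i j
  assume "i < dim_row (four_block_mat (A\<^sup>\<dagger>) (C\<^sup>\<dagger>) (B\<^sup>\<dagger>) (D\<^sup>\<dagger>))" "j < dim_col (four_block_mat (A\<^sup>\<dagger>) (C\<^sup>\<dagger>) (B\<^sup>\<dagger>) (D\<^sup>\<dagger>))"
  then have ij: "i < c1 + c2" "j < r1 + r2" using assms by auto
  then show "(four_block_mat A B C D)\<^sup>\<dagger> $$ (i, j) = four_block_mat (A\<^sup>\<dagger>) (C\<^sup>\<dagger>) (B\<^sup>\<dagger>) (D\<^sup>\<dagger>) $$ (i, j)"
    using assms by (subst adjoint_index) auto
qed (use assms in auto)

lemma adjoint_zero [simp]: "(0\<^sub>m r c)\<^sup>\<dagger> = (0\<^sub>m c r :: complex mat)"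
  by (rule eq_matI) auto

lemma adjoint_one [simp]: "(1\<^sub>m n)\<^sup>\<dagger> = (1\<^sub>m n :: complex mat)"
  by (rule eq_matI) auto

lemma zero_mult_vec [simp]: "x \<in> carrier_vec c \<Longrightarrow> 0\<^sub>m r c *\<^sub>v x = (0\<^sub>v r :: complex vec)"
  by (rule eq_vecI) auto

lemma adjoint_append_cols:
  fixes M N :: "complex mat"
  assumes "M \<in> carrier_mat r c1" "N \<in> carrier_mat r c2"
  shows "(M @\<^sub>c N)\<^sup>\<dagger> = M\<^sup>\<dagger> @\<^sub>r N\<^sup>\<dagger>"
  unfolding append_cols_def append_rows_def using assms
  by (subst adjoint_four_block[of _ r c1 _ c2 _ 0]) auto

lemma adjoint_append_rows:
  fixes M N :: "complex mat"
  assumes "M \<in> carrier_mat r1 c" "N \<in> carrier_mat r2 c"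
  shows "(M @\<^sub>r N)\<^sup>\<dagger> = M\<^sup>\<dagger> @\<^sub>c N\<^sup>\<dagger>"
  unfolding append_cols_def append_rows_def using assms
  by (subst adjoint_four_block[of _ r1 c _ 0 _ r2]) auto

lemma block3_carrier:
  fixes M11 :: "'a :: zero mat"
  assumes "M11 \<in> carrier_mat r1 c1" "M12 \<in> carrier_mat r1 c2" "M13 \<in> carrier_mat r1 c3"
    "M21 \<in> carrier_mat r2 c1" "M22 \<in> carrier_mat r2 c2" "M23 \<in> carrier_mat r2 c3"
    "M31 \<in> carrier_mat r3 c1" "M32 \<in> carrier_mat r3 c2" "M33 \<in> carrier_mat r3 c3"
  shows "block3 M11 M12 M13 M21 M22 M23 M31 M32 M33 \<in> carrier_mat (r1 + (r2 + r3)) (c1 + (c2 + c3))"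
  unfolding block3_def using assms by (intro carrier_append_rows append_cols_carrier)

lemma block3_mult:
  fixes M11 :: "complex mat"
  assumes "M11 \<in> carrier_mat r1 c1" "M12 \<in> carrier_mat r1 c2" "M13 \<in> carrier_mat r1 c3"
    "M21 \<in> carrier_mat r2 c1" "M22 \<in> carrier_mat r2 c2" "M23 \<in> carrier_mat r2 c3"
    "M31 \<in> carrier_mat r3 c1" "M32 \<in> carrier_mat r3 c2" "M33 \<in> carrier_mat r3 c3"
    and x: "x \<in> carrier_vec c1" and y: "y \<in> carrier_vec c2" and z: "z \<in> carrier_vec c3"
  shows "block3 M11 M12 M13 M21 M22 M23 M31 M32 M33 *\<^sub>v (x @\<^sub>v y @\<^sub>v z) =
    (M11 *\<^sub>v x + (M12 *\<^sub>v y + M13 *\<^sub>v z)) @\<^sub>v (M21 *\<^sub>v x + (M22 *\<^sub>v y + M23 *\<^sub>v z)) @\<^sub>v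
    (M31 *\<^sub>v x + (M32 *\<^sub>v y + M33 *\<^sub>v z))"
proof -
  have row: "(M @\<^sub>c N @\<^sub>c L) *\<^sub>v (x @\<^sub>v y @\<^sub>v z) = M *\<^sub>v x + (N *\<^sub>v y + L *\<^sub>v z)"
    if "M \<in> carrier_mat r c1" "N \<in> carrier_mat r c2" "L \<in> carrier_mat r c3" for M N L :: "complex mat" and r
    unfolding append_cols_mult[OF that(1) append_cols_carrier[OF that(2,3)] x append_carrier_vec[OF y z]]
      append_cols_mult[OF that(2,3) y z] ..
  define R1 R2 R3 where "R1 = M11 @\<^sub>c M12 @\<^sub>c M13" and "R2 = M21 @\<^sub>c M22 @\<^sub>c M23" and "R3 = M31 @\<^sub>c M32 @\<^sub>c M33"
  have R: "R1 \<in> carrier_mat r1 (c1 + (c2 + c3))" "R2 \<in> carrier_mat r2 (c1 + (c2 + c3))" "R3 \<in> carrier_mat r3 (c1 + (c2 + c3))"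
    unfolding R1_def R2_def R3_def
    using append_cols_carrier[OF assms(1) append_cols_carrier[OF assms(2,3)]]
      append_cols_carrier[OF assms(4) append_cols_carrier[OF assms(5,6)]]
      append_cols_carrier[OF assms(7) append_cols_carrier[OF assms(8,9)]] by simp_all
  have v: "x @\<^sub>v y @\<^sub>v z \<in> carrier_vec (c1 + (c2 + c3))"
    using x y z by auto
  have "block3 M11 M12 M13 M21 M22 M23 M31 M32 M33 *\<^sub>v (x @\<^sub>v y @\<^sub>v z) =
      R1 *\<^sub>v (x @\<^sub>v y @\<^sub>v z) @\<^sub>v R2 *\<^sub>v (x @\<^sub>v y @\<^sub>v z) @\<^sub>v R3 *\<^sub>v (x @\<^sub>v y @\<^sub>v z)"
    unfolding block3_def R1_def[symmetric] R2_def[symmetric] R3_def[symmetric]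
      append_rows_mult[OF R(1) carrier_append_rows[OF R(2,3)] v] append_rows_mult[OF R(2,3) v] ..
  then show ?thesis
    unfolding R1_def R2_def R3_def row[OF assms(1-3)] row[OF assms(4-6)] row[OF assms(7-9)] .
qed

text \<open>The quadratic form behind every bounded-real inequality below: the derivative of the storage
  \<open>Y\<close> along the system \<open>(A, B, C, D)\<close>, its output paired with \<open>v\<close>, and the forms of the last two
  diagonal blocks.\<close>

lemma bounded_real_form:
  fixes A Y B C D E F :: "complex mat"
  assumes A: "A \<in> carrier_mat N N" and Y: "Y \<in> carrier_mat N N" "Y\<^sup>\<dagger> = Y"
    and B: "B \<in> carrier_mat N k" and C: "C \<in> carrier_mat l N" and D: "D \<in> carrier_mat l k"
    and E: "E \<in> carrier_mat k k" and F: "F \<in> carrier_mat l l"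
    and x: "x \<in> carrier_vec N" and u: "u \<in> carrier_vec k" and v: "v \<in> carrier_vec l"
  shows "(block3 (A\<^sup>\<dagger> * Y + Y * A) (Y * B) (C\<^sup>\<dagger>) (B\<^sup>\<dagger> * Y) E (D\<^sup>\<dagger>) C D F *\<^sub>v (x @\<^sub>v u @\<^sub>v v)) \<bullet>c (x @\<^sub>v u @\<^sub>v v)
    = complex_of_real (2 * Re ((A *\<^sub>v x + B *\<^sub>v u) \<bullet>c (Y *\<^sub>v x) + (C *\<^sub>v x + D *\<^sub>v u) \<bullet>c v)) + (E *\<^sub>v u) \<bullet>c u + (F *\<^sub>v v) \<bullet>c v"
proof -
  have [simp]: "x \<in> carrier_vec N" "u \<in> carrier_vec k" "v \<in> carrier_vec l" by fact+
  have dims [simp]: "dim_row A = N" "dim_row Y = N" "dim_row B = N" "dim_row C = l" "dim_row D = l" "dim_row E = k"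
      "dim_row F = l" "dim_col A = N" "dim_col Y = N" "dim_col B = k" "dim_col C = N" "dim_col D = k"
    using A Y(1) B C D E F by (simp_all only: carrier_matD)
  have m1: "(A\<^sup>\<dagger> * Y + Y * A) *\<^sub>v x = A\<^sup>\<dagger> *\<^sub>v (Y *\<^sub>v x) + Y *\<^sub>v (A *\<^sub>v x)"
    unfolding add_mult_distrib_mat_vec[OF mult_carrier_mat[OF adjoint_carrier[OF A] Y(1)] mult_carrier_mat[OF Y(1) A] x]
      assoc_mult_mat_vec[OF adjoint_carrier[OF A] Y(1) x] assoc_mult_mat_vec[OF Y(1) A x] ..
  have m2: "(Y * B) *\<^sub>v u = Y *\<^sub>v (B *\<^sub>v u)" by (rule assoc_mult_mat_vec[OF Y(1) B u])
  have m3: "(B\<^sup>\<dagger> * Y) *\<^sub>v x = B\<^sup>\<dagger> *\<^sub>v (Y *\<^sub>v x)" by (rule assoc_mult_mat_vec[OF adjoint_carrier[OF B] Y(1) x])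
  have i1: "(A\<^sup>\<dagger> *\<^sub>v (Y *\<^sub>v x)) \<bullet>c x = (Y *\<^sub>v x) \<bullet>c (A *\<^sub>v x)" by (rule inner_adjoint'[OF A]) auto
  have i2: "(Y *\<^sub>v (A *\<^sub>v x)) \<bullet>c x = (A *\<^sub>v x) \<bullet>c (Y *\<^sub>v x)" by (rule hermitian_inner[OF Y]) auto
  have i3: "(Y *\<^sub>v (B *\<^sub>v u)) \<bullet>c x = (B *\<^sub>v u) \<bullet>c (Y *\<^sub>v x)" by (rule hermitian_inner[OF Y]) auto
  have i4: "(C\<^sup>\<dagger> *\<^sub>v v) \<bullet>c x = v \<bullet>c (C *\<^sub>v x)" by (rule inner_adjoint'[OF C]) auto
  have i5: "(B\<^sup>\<dagger> *\<^sub>v (Y *\<^sub>v x)) \<bullet>c u = (Y *\<^sub>v x) \<bullet>c (B *\<^sub>v u)" by (rule inner_adjoint'[OF B]) auto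
  have i6: "(D\<^sup>\<dagger> *\<^sub>v v) \<bullet>c u = v \<bullet>c (D *\<^sub>v u)" by (rule inner_adjoint'[OF D]) auto
  have c1: "(Y *\<^sub>v x) \<bullet>c (A *\<^sub>v x) = cnj ((A *\<^sub>v x) \<bullet>c (Y *\<^sub>v x))" by (rule inner_commute[of _ N]) auto
  have c2: "(Y *\<^sub>v x) \<bullet>c (B *\<^sub>v u) = cnj ((B *\<^sub>v u) \<bullet>c (Y *\<^sub>v x))" by (rule inner_commute[of _ N]) auto
  have c3: "v \<bullet>c (C *\<^sub>v x) = cnj ((C *\<^sub>v x) \<bullet>c v)" by (rule inner_commute[of _ l]) auto
  have c4: "v \<bullet>c (D *\<^sub>v u) = cnj ((D *\<^sub>v u) \<bullet>c v)" by (rule inner_commute[of _ l]) auto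
  have "block3 (A\<^sup>\<dagger> * Y + Y * A) (Y * B) (C\<^sup>\<dagger>) (B\<^sup>\<dagger> * Y) E (D\<^sup>\<dagger>) C D F *\<^sub>v (x @\<^sub>v u @\<^sub>v v)
    = ((A\<^sup>\<dagger> *\<^sub>v (Y *\<^sub>v x) + Y *\<^sub>v (A *\<^sub>v x)) + (Y *\<^sub>v (B *\<^sub>v u) + C\<^sup>\<dagger> *\<^sub>v v)) @\<^sub>v
      (B\<^sup>\<dagger> *\<^sub>v (Y *\<^sub>v x) + (E *\<^sub>v u + D\<^sup>\<dagger> *\<^sub>v v)) @\<^sub>v (C *\<^sub>v x + (D *\<^sub>v u + F *\<^sub>v v))"
    unfolding m1[symmetric] m2[symmetric] m3[symmetric]
    by (rule block3_mult[OF add_carrier_mat[OF mult_carrier_mat[OF Y(1) A]] mult_carrier_mat[OF Y(1) B] adjoint_carrier[OF C]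
        mult_carrier_mat[OF adjoint_carrier[OF B] Y(1)] E adjoint_carrier[OF D] C D F x u v])
  also have "\<dots> \<bullet>c (x @\<^sub>v u @\<^sub>v v) =
      ((A\<^sup>\<dagger> *\<^sub>v (Y *\<^sub>v x)) \<bullet>c x + (Y *\<^sub>v (A *\<^sub>v x)) \<bullet>c x) + ((Y *\<^sub>v (B *\<^sub>v u)) \<bullet>c x + (C\<^sup>\<dagger> *\<^sub>v v) \<bullet>c x) +
      ((B\<^sup>\<dagger> *\<^sub>v (Y *\<^sub>v x)) \<bullet>c u + ((E *\<^sub>v u) \<bullet>c u + (D\<^sup>\<dagger> *\<^sub>v v) \<bullet>c u) +
      ((C *\<^sub>v x) \<bullet>c v + ((D *\<^sub>v u) \<bullet>c v + (F *\<^sub>v v) \<bullet>c v)))"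
    by (simp add: inner_append[of _ N _ "k + l"] inner_append[of _ k _ l] inner_add_left[of _ N]
        inner_add_left[of _ k] inner_add_left[of _ l])
  also have "\<dots> = ((A *\<^sub>v x) \<bullet>c (Y *\<^sub>v x) + cnj ((A *\<^sub>v x) \<bullet>c (Y *\<^sub>v x))) + ((B *\<^sub>v u) \<bullet>c (Y *\<^sub>v x) + cnj ((B *\<^sub>v u) \<bullet>c (Y *\<^sub>v x)))
     + ((C *\<^sub>v x) \<bullet>c v + cnj ((C *\<^sub>v x) \<bullet>c v)) + ((D *\<^sub>v u) \<bullet>c v + cnj ((D *\<^sub>v u) \<bullet>c v)) + (E *\<^sub>v u) \<bullet>c u + (F *\<^sub>v v) \<bullet>c v"
    unfolding i1 i2 i3 i4 i5 i6 c1 c2 c3 c4 by (simp only: add_ac)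
  also have "\<dots> = complex_of_real (2 * Re ((A *\<^sub>v x + B *\<^sub>v u) \<bullet>c (Y *\<^sub>v x) + (C *\<^sub>v x + D *\<^sub>v u) \<bullet>c v)) + (E *\<^sub>v u) \<bullet>c u + (F *\<^sub>v v) \<bullet>c v"
    unfolding complex_add_cnj
    by (simp add: inner_add_left[of _ N] inner_add_left[of _ l])
  finally show ?thesis .
qed

lemma inner_neg_one: "x \<in> carrier_vec n \<Longrightarrow> ((- 1\<^sub>m n) *\<^sub>v x) \<bullet>c x = complex_of_real (- sqnorm x)"
proof -
  assume x: "x \<in> carrier_vec n"
  have "(- 1\<^sub>m n) *\<^sub>v x = (- 1 :: complex) \<cdot>\<^sub>v x"
    using x by (intro eq_vecI) auto
  then show ?thesis using x by (simp add: inner_smult_left[of _ n] inner_self)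
qed

lemma inner_neg_smult_one:
  "x \<in> carrier_vec n \<Longrightarrow> ((- (complex_of_real c \<cdot>\<^sub>m 1\<^sub>m n)) *\<^sub>v x) \<bullet>c x = complex_of_real (- (c * sqnorm x))"
proof -
  assume x: "x \<in> carrier_vec n"
  have "- (complex_of_real c \<cdot>\<^sub>m 1\<^sub>m n) = complex_of_real (- c) \<cdot>\<^sub>m 1\<^sub>m n"
    by (rule eq_matI) auto
  then show ?thesis using x by (simp add: smult_mat_mult_vec[of _ n n] inner_smult_left[of _ n] inner_self)
qed

section \<open>The design inequality as a bounded-real form\<close>

lemma smult_one_carrier: "- (complex_of_real c \<cdot>\<^sub>m 1\<^sub>m n) \<in> carrier_mat n n"
  by simp

text \<open>The dimensions are fixed once for the realization \<open>(A, B, [C1; C2], [D1; D2])\<close> of the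
  spectral factor.\<close>

locale factor_realization =
  fixes m p n ny m11 :: nat and A B C1 C2 D1 D2 :: "complex mat"
  assumes A: "A \<in> carrier_mat m m" and B: "B \<in> carrier_mat m p"
    and C1: "C1 \<in> carrier_mat ny m" and C2: "C2 \<in> carrier_mat n m"
    and D1: "D1 \<in> carrier_mat ny p" and D2: "D2 \<in> carrier_mat n p"
begin

text \<open>The part of the form without the controller.\<close>

definition open_form :: "real \<Rightarrow> complex mat \<Rightarrow> complex vec \<Rightarrow> complex vec \<Rightarrow> complex vec \<Rightarrow> complex vec \<Rightarrow> real" where
  "open_form \<gamma>b X x1 x2 u v = (let w = X *\<^sub>v (x1 @\<^sub>v x2) in
     2 * Re (((A\<^sup>\<dagger> *\<^sub>v x1 + C2\<^sup>\<dagger> *\<^sub>v u) @\<^sub>v 0\<^sub>v m11) \<bullet>c w + (B\<^sup>\<dagger> *\<^sub>v x1 + D2\<^sup>\<dagger> *\<^sub>v u) \<bullet>c v) - \<gamma>b\<^sup>2 * sqnorm u - sqnorm v)"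

lemma Sigma_mat_carrier:
  assumes X: "X \<in> carrier_mat (m + m11) (m + m11)"
  shows "Sigma_mat m p n m11 A B C2 D2 \<gamma>b X \<in> carrier_mat ((m + m11) + (n + p)) ((m + m11) + (n + p))"
proof -
  let ?Ab = "four_block_mat (A\<^sup>\<dagger>) (0\<^sub>m m m11) (0\<^sub>m m11 m) (0\<^sub>m m11 m11) :: complex mat"
  have Ab: "?Ab \<in> carrier_mat (m + m11) (m + m11)"
    by (rule four_block_carrier_mat) (use A in auto)
  have Bb: "C2\<^sup>\<dagger> @\<^sub>r 0\<^sub>m m11 n \<in> carrier_mat (m + m11) n"
    by (rule carrier_append_rows) (use C2 in auto)
  have Cb: "B\<^sup>\<dagger> @\<^sub>c 0\<^sub>m p m11 \<in> carrier_mat p (m + m11)"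
    by (rule append_cols_carrier) (use B in auto)
  show ?thesis
    unfolding Sigma_mat_def Let_def
    by (rule block3_carrier[OF add_carrier_mat[OF mult_carrier_mat[OF X Ab]] mult_carrier_mat[OF X Bb] adjoint_carrier[OF Cb]
        mult_carrier_mat[OF adjoint_carrier[OF Bb] X] smult_one_carrier adjoint_carrier[OF adjoint_carrier[OF D2]] Cb adjoint_carrier[OF D2]]) simp
qed

text \<open>\<open>Sigma_mat\<close> is a bounded-real matrix of the uncontrolled adjoint system, whose state \<open>x2\<close> in the filter is idle.\<close>

lemma Sigma_mat_form:
  assumes X: "X \<in> carrier_mat (m + m11) (m + m11)" "X\<^sup>\<dagger> = X"
    and x1: "x1 \<in> carrier_vec m" and x2: "x2 \<in> carrier_vec m11"
    and u: "u \<in> carrier_vec n" and v: "v \<in> carrier_vec p"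
  shows "(Sigma_mat m p n m11 A B C2 D2 \<gamma>b X *\<^sub>v ((x1 @\<^sub>v x2) @\<^sub>v u @\<^sub>v v)) \<bullet>c ((x1 @\<^sub>v x2) @\<^sub>v u @\<^sub>v v)
    = complex_of_real (open_form \<gamma>b X x1 x2 u v)"
proof -
  let ?Ab = "four_block_mat (A\<^sup>\<dagger>) (0\<^sub>m m m11) (0\<^sub>m m11 m) (0\<^sub>m m11 m11) :: complex mat"
  let ?Bb = "C2\<^sup>\<dagger> @\<^sub>r 0\<^sub>m m11 n" and ?Cb = "B\<^sup>\<dagger> @\<^sub>c 0\<^sub>m p m11"
  note A' = adjoint_carrier[OF A] and B' = adjoint_carrier[OF B] and C2' = adjoint_carrier[OF C2] and D2' = adjoint_carrier[OF D2]
  have Ab: "?Ab \<in> carrier_mat (m + m11) (m + m11)"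
    by (rule four_block_carrier_mat[OF A']) simp
  have Bb: "?Bb \<in> carrier_mat (m + m11) n"
    by (rule carrier_append_rows[OF C2']) simp
  have Cb: "?Cb \<in> carrier_mat p (m + m11)"
    by (rule append_cols_carrier[OF B']) simp
  have x: "x1 @\<^sub>v x2 \<in> carrier_vec (m + m11)" using x1 x2 by (rule append_carrier_vec)
  have Au: "A\<^sup>\<dagger> *\<^sub>v x1 \<in> carrier_vec m" "C2\<^sup>\<dagger> *\<^sub>v u \<in> carrier_vec m" "B\<^sup>\<dagger> *\<^sub>v x1 \<in> carrier_vec p"
    by (rule mult_mat_vec_carrier[OF A' x1] mult_mat_vec_carrier[OF C2' u] mult_mat_vec_carrier[OF B' x1])+
  have "?Ab *\<^sub>v (x1 @\<^sub>v x2) = (A\<^sup>\<dagger> *\<^sub>v x1 + 0\<^sub>m m m11 *\<^sub>v x2) @\<^sub>v (0\<^sub>m m11 m *\<^sub>v x1 + 0\<^sub>m m11 m11 *\<^sub>v x2)"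
    by (rule four_block_mat_mult_vec[OF A' _ _ _ x1 x2]) auto
  also have "\<dots> = A\<^sup>\<dagger> *\<^sub>v x1 @\<^sub>v 0\<^sub>v m11"
    using x1 x2 Au(1) by (simp add: zero_mult_vec)
  finally have 1: "?Ab *\<^sub>v (x1 @\<^sub>v x2) = A\<^sup>\<dagger> *\<^sub>v x1 @\<^sub>v 0\<^sub>v m11" .
  have "?Bb *\<^sub>v u = C2\<^sup>\<dagger> *\<^sub>v u @\<^sub>v 0\<^sub>m m11 n *\<^sub>v u"
    by (rule append_rows_mult[OF C2' zero_carrier_mat u])
  then have 2: "?Bb *\<^sub>v u = C2\<^sup>\<dagger> *\<^sub>v u @\<^sub>v 0\<^sub>v m11"
    using u by simp
  have "?Ab *\<^sub>v (x1 @\<^sub>v x2) + ?Bb *\<^sub>v u = (A\<^sup>\<dagger> *\<^sub>v x1 + C2\<^sup>\<dagger> *\<^sub>v u) @\<^sub>v (0\<^sub>v m11 + 0\<^sub>v m11)"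
    unfolding 1 2 by (rule append_vec_add[OF Au(1,2) zero_carrier_vec zero_carrier_vec])
  then have sA: "?Ab *\<^sub>v (x1 @\<^sub>v x2) + ?Bb *\<^sub>v u = (A\<^sup>\<dagger> *\<^sub>v x1 + C2\<^sup>\<dagger> *\<^sub>v u) @\<^sub>v 0\<^sub>v m11"
    by simp
  have "?Cb *\<^sub>v (x1 @\<^sub>v x2) = B\<^sup>\<dagger> *\<^sub>v x1 + 0\<^sub>m p m11 *\<^sub>v x2"
    by (rule append_cols_mult[OF B' _ x1 x2]) simp
  then have sC: "?Cb *\<^sub>v (x1 @\<^sub>v x2) = B\<^sup>\<dagger> *\<^sub>v x1"
    using x2 Au(3) by simp
  show ?thesis
    unfolding Sigma_mat_def Let_def open_form_def
    unfolding bounded_real_form[OF Ab X Bb Cb D2' smult_one_carrier uminus_carrier_mat[OF one_carrier_mat] x u v] sA sC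
      inner_neg_smult_one[OF u] inner_neg_one[OF v]
    by simp
qed

lemma Lambda_mat_carrier:
  assumes X: "X \<in> carrier_mat (m + m11) (m + m11)"
  shows "Lambda_mat m p n ny m11 C1 D1 X \<in> carrier_mat (m11 + ny) ((m + m11) + (n + p))"
proof -
  note C1' = adjoint_carrier[OF C1] and D1' = adjoint_carrier[OF D1]
  have Bu: "four_block_mat (0\<^sub>m m m11) (C1\<^sup>\<dagger>) (1\<^sub>m m11) (0\<^sub>m m11 ny) \<in> carrier_mat (m + m11) (m11 + ny)"
    by (rule four_block_carrier_mat) simp_all
  have Du: "0\<^sub>m p m11 @\<^sub>c D1\<^sup>\<dagger> \<in> carrier_mat p (m11 + ny)"
    by (rule append_cols_carrier[OF _ D1']) simp
  show ?thesis
    unfolding Lambda_mat_def Let_def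
    by (rule append_cols_carrier[OF mult_carrier_mat[OF adjoint_carrier[OF Bu] X] append_cols_carrier[OF _ adjoint_carrier[OF Du]]]) simp
qed

text \<open>The quantities dual to the control inputs, in terms of the co-state \<open>w = X x\<close> and of \<open>v\<close>.\<close>

lemma Lambda_mat_mult:
  assumes X: "X \<in> carrier_mat (m + m11) (m + m11)"
    and x: "x \<in> carrier_vec (m + m11)" "X *\<^sub>v x = w1 @\<^sub>v w2"
    and w1: "w1 \<in> carrier_vec m" and w2: "w2 \<in> carrier_vec m11"
    and u: "u \<in> carrier_vec n" and v: "v \<in> carrier_vec p"
  shows "Lambda_mat m p n ny m11 C1 D1 X *\<^sub>v (x @\<^sub>v u @\<^sub>v v) = w2 @\<^sub>v (C1 *\<^sub>v w1 + D1 *\<^sub>v v)"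
proof -
  note C1' = adjoint_carrier[OF C1] and D1' = adjoint_carrier[OF D1]
  let ?Bu = "four_block_mat (0\<^sub>m m m11) (C1\<^sup>\<dagger>) (1\<^sub>m m11) (0\<^sub>m m11 ny)"
  let ?Du = "0\<^sub>m p m11 @\<^sub>c D1\<^sup>\<dagger>"
  have Bu: "?Bu \<in> carrier_mat (m + m11) (m11 + ny)"
    by (rule four_block_carrier_mat) simp_all
  have Du: "?Du \<in> carrier_mat p (m11 + ny)"
    by (rule append_cols_carrier[OF _ D1']) simp
  have Bu': "?Bu\<^sup>\<dagger> = four_block_mat (0\<^sub>m m11 m) (1\<^sub>m m11) C1 (0\<^sub>m ny m11)"
    by (subst adjoint_four_block[of _ m m11 _ ny _ m11]) (use C1' in simp_all)
  have Du': "?Du\<^sup>\<dagger> = 0\<^sub>m m11 p @\<^sub>r D1"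
    by (subst adjoint_append_cols[OF _ D1']) auto
  have c: "C1 *\<^sub>v w1 \<in> carrier_vec ny" "D1 *\<^sub>v v \<in> carrier_vec ny"
    by (rule mult_mat_vec_carrier[OF C1 w1] mult_mat_vec_carrier[OF D1 v])+
  have "(?Bu\<^sup>\<dagger> * X) *\<^sub>v x = ?Bu\<^sup>\<dagger> *\<^sub>v (w1 @\<^sub>v w2)"
    unfolding assoc_mult_mat_vec[OF adjoint_carrier[OF Bu] X x(1)] x(2) ..
  also have "\<dots> = (0\<^sub>m m11 m *\<^sub>v w1 + 1\<^sub>m m11 *\<^sub>v w2) @\<^sub>v (C1 *\<^sub>v w1 + 0\<^sub>m ny m11 *\<^sub>v w2)"
    unfolding Bu' by (rule four_block_mat_mult_vec[OF _ _ C1 _ w1 w2]) auto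
  also have "\<dots> = w2 @\<^sub>v C1 *\<^sub>v w1"
    using w1 w2 c by simp
  finally have 1: "(?Bu\<^sup>\<dagger> * X) *\<^sub>v x = w2 @\<^sub>v C1 *\<^sub>v w1" .
  have 2: "?Du\<^sup>\<dagger> *\<^sub>v v = 0\<^sub>v m11 @\<^sub>v D1 *\<^sub>v v"
    unfolding Du' append_rows_mult[OF zero_carrier_mat D1 v] using v by simp
  have "(0\<^sub>m (m11 + ny) n @\<^sub>c ?Du\<^sup>\<dagger>) *\<^sub>v (u @\<^sub>v v) = 0\<^sub>m (m11 + ny) n *\<^sub>v u + ?Du\<^sup>\<dagger> *\<^sub>v v"
    by (rule append_cols_mult[OF zero_carrier_mat adjoint_carrier[OF Du] u v])
  also have "\<dots> = 0\<^sub>v m11 @\<^sub>v D1 *\<^sub>v v"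
    unfolding 2 using u c(2) by (simp add: left_zero_vec[OF append_carrier_vec[OF zero_carrier_vec c(2)]])
  finally have 3: "(0\<^sub>m (m11 + ny) n @\<^sub>c ?Du\<^sup>\<dagger>) *\<^sub>v (u @\<^sub>v v) = 0\<^sub>v m11 @\<^sub>v D1 *\<^sub>v v" .
  have "Lambda_mat m p n ny m11 C1 D1 X *\<^sub>v (x @\<^sub>v u @\<^sub>v v) = (w2 @\<^sub>v C1 *\<^sub>v w1) + (0\<^sub>v m11 @\<^sub>v D1 *\<^sub>v v)"
    unfolding Lambda_mat_def Let_def 1[symmetric] 3[symmetric]
    by (rule append_cols_mult[OF mult_carrier_mat[OF adjoint_carrier[OF Bu] X] append_cols_carrier[OF zero_carrier_mat adjoint_carrier[OF Du]]
       x(1) append_carrier_vec[OF u v]])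
  also have "\<dots> = (w2 + 0\<^sub>v m11) @\<^sub>v (C1 *\<^sub>v w1 + D1 *\<^sub>v v)"
    by (rule append_vec_add[OF w2 zero_carrier_vec c])
  also have "\<dots> = w2 @\<^sub>v (C1 *\<^sub>v w1 + D1 *\<^sub>v v)"
    using w2 by simp
  finally show ?thesis .
qed

lemma Pi_mat_carrier: "Pi_mat m p n m11 \<in> carrier_mat (m11 + n) ((m + m11) + (n + p))"
proof -
  have Cu: "four_block_mat (0\<^sub>m m11 m) (1\<^sub>m m11) (0\<^sub>m n m) (0\<^sub>m n m11) \<in> carrier_mat (m11 + n) (m + m11)"
    by (rule four_block_carrier_mat) simp_all
  have Du: "0\<^sub>m m11 n @\<^sub>r 1\<^sub>m n \<in> carrier_mat (m11 + n) n"
    by (rule carrier_append_rows) simp_all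
  show ?thesis
    unfolding Pi_mat_def Let_def
    by (rule append_cols_carrier[OF Cu append_cols_carrier[OF Du zero_carrier_mat]])
qed

lemma Pi_mat_mult:
  assumes x1: "x1 \<in> carrier_vec m" and x2: "x2 \<in> carrier_vec m11"
    and u: "u \<in> carrier_vec n" and v: "v \<in> carrier_vec p"
  shows "Pi_mat m p n m11 *\<^sub>v ((x1 @\<^sub>v x2) @\<^sub>v u @\<^sub>v v) = x2 @\<^sub>v u"
proof -
  let ?Cu = "four_block_mat (0\<^sub>m m11 m) (1\<^sub>m m11) (0\<^sub>m n m) (0\<^sub>m n m11) :: complex mat"
  let ?Du = "0\<^sub>m m11 n @\<^sub>r 1\<^sub>m n :: complex mat"
  have Cu: "?Cu \<in> carrier_mat (m11 + n) (m + m11)"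
    by (rule four_block_carrier_mat) simp_all
  have Du: "?Du \<in> carrier_mat (m11 + n) n"
    by (rule carrier_append_rows) simp_all
  have "?Cu *\<^sub>v (x1 @\<^sub>v x2) = (0\<^sub>m m11 m *\<^sub>v x1 + 1\<^sub>m m11 *\<^sub>v x2) @\<^sub>v (0\<^sub>m n m *\<^sub>v x1 + 0\<^sub>m n m11 *\<^sub>v x2)"
    by (rule four_block_mat_mult_vec[OF _ _ _ _ x1 x2]) auto
  also have "\<dots> = x2 @\<^sub>v 0\<^sub>v n" using x1 x2 by simp
  finally have 1: "?Cu *\<^sub>v (x1 @\<^sub>v x2) = x2 @\<^sub>v 0\<^sub>v n" .
  have 2: "?Du *\<^sub>v u = 0\<^sub>v m11 @\<^sub>v u"
    unfolding append_rows_mult[OF zero_carrier_mat one_carrier_mat u] using u by simp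
  have "(?Du @\<^sub>c 0\<^sub>m (m11 + n) p) *\<^sub>v (u @\<^sub>v v) = ?Du *\<^sub>v u + 0\<^sub>m (m11 + n) p *\<^sub>v v"
    by (rule append_cols_mult[OF Du zero_carrier_mat u v])
  also have "\<dots> = 0\<^sub>v m11 @\<^sub>v u"
    unfolding 2 using v u by (simp add: right_zero_vec[OF append_carrier_vec[OF zero_carrier_vec u]])
  finally have 3: "(?Du @\<^sub>c 0\<^sub>m (m11 + n) p) *\<^sub>v (u @\<^sub>v v) = 0\<^sub>v m11 @\<^sub>v u" .
  have "Pi_mat m p n m11 *\<^sub>v ((x1 @\<^sub>v x2) @\<^sub>v u @\<^sub>v v) = (x2 @\<^sub>v 0\<^sub>v n) + (0\<^sub>v m11 @\<^sub>v u)"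
    unfolding Pi_mat_def Let_def 1[symmetric] 3[symmetric]
    by (rule append_cols_mult[OF Cu append_cols_carrier[OF Du zero_carrier_mat] append_carrier_vec[OF x1 x2] append_carrier_vec[OF u v]])
  also have "\<dots> = (x2 + 0\<^sub>v m11) @\<^sub>v (0\<^sub>v n + u)"
    by (rule append_vec_add) (use x2 u in auto)
  also have "\<dots> = x2 @\<^sub>v u" using x2 u by simp
  finally show ?thesis .
qed

lemma design_matrix_form:
  fixes K :: "complex mat" and \<gamma>b :: real
  assumes X: "X \<in> carrier_mat (m + m11) (m + m11)" "X\<^sup>\<dagger> = X" and K: "K \<in> carrier_mat (m11 + ny) (m11 + n)"
    and x1: "x1 \<in> carrier_vec m" and x2: "x2 \<in> carrier_vec m11"
    and u: "u \<in> carrier_vec n" and v: "v \<in> carrier_vec p"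
  defines "S \<equiv> Sigma_mat m p n m11 A B C2 D2 \<gamma>b X" and "L \<equiv> Lambda_mat m p n ny m11 C1 D1 X" and "P \<equiv> Pi_mat m p n m11"
  defines "z \<equiv> (x1 @\<^sub>v x2) @\<^sub>v u @\<^sub>v v"
  shows "((S + P\<^sup>\<dagger> * K\<^sup>\<dagger> * L + L\<^sup>\<dagger> * K * P) *\<^sub>v z) \<bullet>c z
    = complex_of_real (open_form \<gamma>b X x1 x2 u v + 2 * Re ((K *\<^sub>v (x2 @\<^sub>v u)) \<bullet>c (L *\<^sub>v z)))"
proof -
  let ?N = "(m + m11) + (n + p)"
  have S: "S \<in> carrier_mat ?N ?N" unfolding S_def by (rule Sigma_mat_carrier[OF X(1)])
  have L: "L \<in> carrier_mat (m11 + ny) ?N" unfolding L_def by (rule Lambda_mat_carrier[OF X(1)])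
  have P: "P \<in> carrier_mat (m11 + n) ?N" unfolding P_def by (rule Pi_mat_carrier)
  have z: "z \<in> carrier_vec ?N"
    unfolding z_def by (rule append_carrier_vec[OF append_carrier_vec[OF x1 x2] append_carrier_vec[OF u v]])
  have Pz: "P *\<^sub>v z = x2 @\<^sub>v u" unfolding P_def z_def by (rule Pi_mat_mult[OF x1 x2 u v])
  note P' = adjoint_carrier[OF P] and K' = adjoint_carrier[OF K] and L' = adjoint_carrier[OF L]
  note PK = mult_carrier_mat[OF P' K'] and LK = mult_carrier_mat[OF L' K]
  note PKL = mult_carrier_mat[OF PK L] and LKP = mult_carrier_mat[OF LK P]
  have Lz: "L *\<^sub>v z \<in> carrier_vec (m11 + ny)" by (rule mult_mat_vec_carrier[OF L z])
  have Pzc: "P *\<^sub>v z \<in> carrier_vec (m11 + n)" by (rule mult_mat_vec_carrier[OF P z])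
  have Kz: "K *\<^sub>v (P *\<^sub>v z) \<in> carrier_vec (m11 + ny)" by (rule mult_mat_vec_carrier[OF K Pzc])
  have s1: "(S + P\<^sup>\<dagger> * K\<^sup>\<dagger> * L + L\<^sup>\<dagger> * K * P) *\<^sub>v z
      = S *\<^sub>v z + P\<^sup>\<dagger> *\<^sub>v (K\<^sup>\<dagger> *\<^sub>v (L *\<^sub>v z)) + L\<^sup>\<dagger> *\<^sub>v (K *\<^sub>v (P *\<^sub>v z))"
    unfolding add_mult_distrib_mat_vec[OF add_carrier_mat[OF PKL] LKP z] add_mult_distrib_mat_vec[OF S PKL z]
      assoc_mult_mat_vec[OF PK L z] assoc_mult_mat_vec[OF LK P z]
      assoc_mult_mat_vec[OF P' K' Lz] assoc_mult_mat_vec[OF L' K Pzc] ..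
  have c1: "S *\<^sub>v z \<in> carrier_vec ?N" by (rule mult_mat_vec_carrier[OF S z])
  have c2: "P\<^sup>\<dagger> *\<^sub>v (K\<^sup>\<dagger> *\<^sub>v (L *\<^sub>v z)) \<in> carrier_vec ?N" by (rule mult_mat_vec_carrier[OF P' mult_mat_vec_carrier[OF K' Lz]])
  have c3: "L\<^sup>\<dagger> *\<^sub>v (K *\<^sub>v (P *\<^sub>v z)) \<in> carrier_vec ?N" by (rule mult_mat_vec_carrier[OF L' Kz])
  have i2: "(P\<^sup>\<dagger> *\<^sub>v (K\<^sup>\<dagger> *\<^sub>v (L *\<^sub>v z))) \<bullet>c z = cnj ((K *\<^sub>v (P *\<^sub>v z)) \<bullet>c (L *\<^sub>v z))"
    unfolding inner_adjoint'[OF P mult_mat_vec_carrier[OF K' Lz] z] inner_adjoint'[OF K Lz Pzc]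
    by (rule inner_commute[OF Lz Kz])
  have i3: "(L\<^sup>\<dagger> *\<^sub>v (K *\<^sub>v (P *\<^sub>v z))) \<bullet>c z = (K *\<^sub>v (P *\<^sub>v z)) \<bullet>c (L *\<^sub>v z)"
    by (rule inner_adjoint'[OF L Kz z])
  have Sz: "(S *\<^sub>v z) \<bullet>c z = complex_of_real (open_form \<gamma>b X x1 x2 u v)"
    unfolding S_def z_def by (rule Sigma_mat_form[OF X x1 x2 u v])
  have "((S + P\<^sup>\<dagger> * K\<^sup>\<dagger> * L + L\<^sup>\<dagger> * K * P) *\<^sub>v z) \<bullet>c z
      = complex_of_real (open_form \<gamma>b X x1 x2 u v) + cnj ((K *\<^sub>v (P *\<^sub>v z)) \<bullet>c (L *\<^sub>v z)) + (K *\<^sub>v (P *\<^sub>v z)) \<bullet>c (L *\<^sub>v z)"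
    unfolding s1 inner_add_left[OF add_carrier_vec[OF c1 c2] c3 z] inner_add_left[OF c1 c2 z] i2 i3 Sz ..
  also have "\<dots> = complex_of_real (open_form \<gamma>b X x1 x2 u v) + ((K *\<^sub>v (P *\<^sub>v z)) \<bullet>c (L *\<^sub>v z) + cnj ((K *\<^sub>v (P *\<^sub>v z)) \<bullet>c (L *\<^sub>v z)))"
    by (simp only: add_ac)
  finally show ?thesis
    unfolding complex_add_cnj Pz by simp
qed

text \<open>The controller enters through the filter state \<open>x2\<close> and the input \<open>u\<close> alone, the range of \<open>\<Pi>\<close>; the form therefore splits into an open-loop part and a term bilinear in \<open>K\<close>.\<close>

lemma design_inequality_iff:
  fixes K :: "complex mat"
  assumes X: "X \<in> carrier_mat (m + m11) (m + m11)" "X\<^sup>\<dagger> = X" and K: "K \<in> carrier_mat (m11 + ny) (m11 + n)"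
  shows "design_inequality m p n ny m11 A B C1 C2 D1 D2 \<gamma>b X K \<longleftrightarrow>
    (\<forall>x1 \<in> carrier_vec m. \<forall>x2 \<in> carrier_vec m11. \<forall>u \<in> carrier_vec n. \<forall>v \<in> carrier_vec p.
      (x1 @\<^sub>v x2) @\<^sub>v u @\<^sub>v v \<noteq> 0\<^sub>v ((m + m11) + (n + p)) \<longrightarrow>
      open_form \<gamma>b X x1 x2 u v
        + 2 * Re ((K *\<^sub>v (x2 @\<^sub>v u)) \<bullet>c (Lambda_mat m p n ny m11 C1 D1 X *\<^sub>v ((x1 @\<^sub>v x2) @\<^sub>v u @\<^sub>v v))) < 0)"
proof -
  let ?N = "(m + m11) + (n + p)"
  define S where "S = Sigma_mat m p n m11 A B C2 D2 \<gamma>b X"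
  define L where "L = Lambda_mat m p n ny m11 C1 D1 X"
  define P where "P = (Pi_mat m p n m11 :: complex mat)"
  have L: "L \<in> carrier_mat (m11 + ny) ?N" unfolding L_def by (rule Lambda_mat_carrier[OF X(1)])
  have P: "P \<in> carrier_mat (m11 + n) ?N" unfolding P_def by (rule Pi_mat_carrier)
  have M: "S + P\<^sup>\<dagger> * K\<^sup>\<dagger> * L + L\<^sup>\<dagger> * K * P \<in> carrier_mat ?N ?N"
    by (rule add_carrier_mat[OF mult_carrier_mat[OF mult_carrier_mat[OF adjoint_carrier[OF L] K] P]])
  have neg: "complex_of_real c < 0 \<longleftrightarrow> c < 0" for c by (simp add: less_complex_def)
  have ball: "(\<forall>z \<in> carrier_vec ?N. Q z) \<longleftrightarrow> (\<forall>x1 \<in> carrier_vec m. \<forall>x2 \<in> carrier_vec m11. \<forall>u \<in> carrier_vec n. \<forall>v \<in> carrier_vec p.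
      Q ((x1 @\<^sub>v x2) @\<^sub>v u @\<^sub>v v))" for Q :: "complex vec \<Rightarrow> bool"
    by (metis append_vec_cases append_carrier_vec)
  show ?thesis
    unfolding design_inequality_def Let_def S_def[symmetric] L_def[symmetric] P_def[symmetric] neg_def_iff[OF M] ball
    unfolding S_def L_def P_def
    by (intro ball_cong refl) (simp only: design_matrix_form[OF X K] neg)
qed

end

section \<open>Existence of a design\<close>

text \<open>The coupling constraint: the Schur complement of \<open>Y\<close> in the coupling matrix is
  \<open>X - Y\<^sup>-\<^sup>1\<close>, so this matrix is semidefinite, and its rank is that of the coupling matrix less \<open>m\<close>.\<close>

lemma coupling_factor:
  assumes X: "X \<in> carrier_mat m m" and Y: "Y \<in> carrier_mat m m" "pos_def Y"
    and psd: "pos_semidef (coupling_mat m X Y)"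
    and rank: "vec_space.rank (m + m) (coupling_mat m X Y) \<le> m + l"
    and R: "R \<in> carrier_mat m m" "Y * R = 1\<^sub>m m"
  obtains N where "N \<in> carrier_mat m l" "N * N\<^sup>\<dagger> = X - R"
proof -
  define M where "M = coupling_mat m X Y"
  have M: "M \<in> carrier_mat (m + m) (m + m)"
    unfolding M_def coupling_mat_def by (rule four_block_carrier_mat[OF X Y(1)])
  have Mv: "M *\<^sub>v (a @\<^sub>v b) = (X *\<^sub>v a + b) @\<^sub>v (a + Y *\<^sub>v b)" if "a \<in> carrier_vec m" "b \<in> carrier_vec m" for a b
  proof -
    have "M *\<^sub>v (a @\<^sub>v b) = (X *\<^sub>v a + 1\<^sub>m m *\<^sub>v b) @\<^sub>v (1\<^sub>m m *\<^sub>v a + Y *\<^sub>v b)"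
      unfolding M_def coupling_mat_def
      by (rule four_block_mat_mult_vec[OF X one_carrier_mat one_carrier_mat Y(1) that])
    then show ?thesis using that by simp
  qed
  have YR: "Y *\<^sub>v (R *\<^sub>v a) = a" if "a \<in> carrier_vec m" for a
    using assoc_mult_mat_vec[OF Y(1) R(1) that] R(2) that by simp
  define S where "S = X - R"
  have S: "S \<in> carrier_mat m m" unfolding S_def by (rule minus_carrier_mat[OF R(1)])
  have Sv: "S *\<^sub>v a = X *\<^sub>v a + - (R *\<^sub>v a)" if "a \<in> carrier_vec m" for a
    unfolding S_def by (rule minus_mult_mat_vec[OF X R(1) that])
  have MS: "M *\<^sub>v (a @\<^sub>v - (R *\<^sub>v a)) = S *\<^sub>v a @\<^sub>v 0\<^sub>v m" if a: "a \<in> carrier_vec m" for a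
  proof -
    have Ra: "R *\<^sub>v a \<in> carrier_vec m" by (rule mult_mat_vec_carrier[OF R(1) a])
    have "a + Y *\<^sub>v (- (R *\<^sub>v a)) = 0\<^sub>v m"
      unfolding mult_mat_vec_uminus[OF Y(1) Ra] YR[OF a] by (rule uminus_r_inv_vec[OF a])
    then show ?thesis
      using Mv[OF a uminus_carrier_vec[THEN iffD2, OF Ra]] Sv[OF a] by simp
  qed
  have Spsd: "pos_semidef S"
    unfolding pos_semidef_iff[OF S]
  proof
    fix a :: "complex vec" assume a: "a \<in> carrier_vec m"
    have Ra: "- (R *\<^sub>v a) \<in> carrier_vec m" using mult_mat_vec_carrier[OF R(1) a] by simp
    have "0 \<le> (M *\<^sub>v (a @\<^sub>v - (R *\<^sub>v a))) \<bullet>c (a @\<^sub>v - (R *\<^sub>v a))"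
      using psd append_carrier_vec[OF a Ra] unfolding M_def[symmetric] pos_semidef_iff[OF M] by blast
    also have "\<dots> = (S *\<^sub>v a) \<bullet>c a"
      unfolding MS[OF a] using inner_append[OF mult_mat_vec_carrier[OF S a] zero_carrier_vec a Ra] inner_zero_left[OF Ra]
      by simp
    finally show "0 \<le> (S *\<^sub>v a) \<bullet>c a" .
  qed
  obtain k V where V: "V \<in> carrier_mat m k" "S = V * V\<^sup>\<dagger>"
    and inj: "\<And>y. y \<in> carrier_vec k \<Longrightarrow> V *\<^sub>v y = 0\<^sub>v m \<Longrightarrow> y = 0\<^sub>v k"
    using psd_factorization[OF S Spsd] by metis
  have "k \<le> l"
  proof (rule ccontr)
    assume "\<not> k \<le> l"
    define r where "r = vec_space.rank (m + m) M"
    have r: "r < k + m" using rank \<open>\<not> k \<le> l\<close> by (simp add: r_def M_def)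
    obtain H where H: "H \<in> carrier_mat r (m + m)"
      and HM: "\<And>x. x \<in> carrier_vec (m + m) \<Longrightarrow> H *\<^sub>v x = 0\<^sub>v r \<Longrightarrow> M *\<^sub>v x = 0\<^sub>v (m + m)"
      using rank_kernel[OF M] unfolding r_def by metis
    \<comment> \<open>\<open>T\<close> injects \<open>k + m\<close> dimensions into a complement of the kernel of \<open>M\<close>, so \<open>M\<close> has rank at least \<open>k + m\<close>\<close>
    define T where "T = four_block_mat V (0\<^sub>m m m) (- (R * V)) (1\<^sub>m m)"
    have RV: "- (R * V) \<in> carrier_mat m k" using mult_carrier_mat[OF R(1) V(1)] by simp
    have T: "T \<in> carrier_mat (m + m) (k + m)"
      unfolding T_def by (rule four_block_carrier_mat[OF V(1) one_carrier_mat])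
    obtain y where y: "y \<in> carrier_vec (k + m)" "y \<noteq> 0\<^sub>v (k + m)" "(H * T) *\<^sub>v y = 0\<^sub>v r"
      using wide_kernel[OF mult_carrier_mat[OF H T] r] by metis
    obtain y1 y2 where y12: "y1 \<in> carrier_vec k" "y2 \<in> carrier_vec m" "y = y1 @\<^sub>v y2"
      using append_vec_cases[OF y(1)] by metis
    define c where "c = V *\<^sub>v y1"
    have c: "c \<in> carrier_vec m" unfolding c_def by (rule mult_mat_vec_carrier[OF V(1) y12(1)])
    have Rc: "R *\<^sub>v c \<in> carrier_vec m" by (rule mult_mat_vec_carrier[OF R(1) c])
    have "(- (R * V)) *\<^sub>v y1 = - (R *\<^sub>v c)"
      unfolding c_def assoc_mult_mat_vec[OF R(1) V(1) y12(1), symmetric]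
      using uminus_mult_mat_vec[of y1 "R * V"] y12(1) V(1) by simp
    moreover have "T *\<^sub>v y = (V *\<^sub>v y1 + 0\<^sub>m m m *\<^sub>v y2) @\<^sub>v ((- (R * V)) *\<^sub>v y1 + 1\<^sub>m m *\<^sub>v y2)"
      unfolding T_def y12(3)
      by (rule four_block_mat_mult_vec[OF V(1) zero_carrier_mat RV one_carrier_mat y12(1,2)])
    ultimately have Ty: "T *\<^sub>v y = c @\<^sub>v (- (R *\<^sub>v c) + y2)"
      using c y12(2) by (simp add: c_def[symmetric])
    define d where "d = - (R *\<^sub>v c) + y2"
    have d: "d \<in> carrier_vec m" unfolding d_def using Rc y12(2) by simp
    have "M *\<^sub>v (c @\<^sub>v d) = 0\<^sub>v (m + m)"
      using HM[OF append_carrier_vec[OF c d]] y(3) unfolding assoc_mult_mat_vec[OF H T y(1)] Ty d_def[symmetric] by blast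
    then have Mcd: "X *\<^sub>v c + d = 0\<^sub>v m" "c + Y *\<^sub>v d = 0\<^sub>v m"
      unfolding Mv[OF c d] using append_vec_eq_0[of "X *\<^sub>v c + d" m "c + Y *\<^sub>v d" m]
        add_carrier_vec[OF mult_mat_vec_carrier[OF X c] d] add_carrier_vec[OF c mult_mat_vec_carrier[OF Y(1) d]] by simp_all
    have "Y *\<^sub>v d = - c + Y *\<^sub>v y2"
      unfolding d_def mult_add_distrib_mat_vec[OF Y(1) uminus_carrier_vec[THEN iffD2, OF Rc] y12(2)]
        mult_mat_vec_uminus[OF Y(1) Rc] YR[OF c] ..
    then have "Y *\<^sub>v y2 = 0\<^sub>v m"
      using Mcd(2) c mult_mat_vec_carrier[OF Y(1) y12(2)] add_uminus_cancel_vec by metis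
    then have y2: "y2 = 0\<^sub>v m" by (rule pos_def_injective[OF Y y12(2)])
    then have "S *\<^sub>v c = 0\<^sub>v m"
      using Mcd(1) Sv[OF c] Rc by (simp add: d_def)
    then have "V *\<^sub>v (V\<^sup>\<dagger> *\<^sub>v c) = 0\<^sub>v m"
      unfolding V(2) assoc_mult_mat_vec[OF V(1) adjoint_carrier[OF V(1)] c] .
    then have "V\<^sup>\<dagger> *\<^sub>v c = 0\<^sub>v k"
      by (rule inj[OF mult_mat_vec_carrier[OF adjoint_carrier[OF V(1)] c]])
    then have "c \<bullet>c c = 0"
      using inner_adjoint'[OF V(1) c y12(1)] inner_zero_left[OF y12(1)] by (simp add: c_def[symmetric])
    then have "c = 0\<^sub>v m" using conjugate_square_eq_0_vec[OF c] by blast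
    then have "y1 = 0\<^sub>v k" using inj[OF y12(1)] by (simp add: c_def)
    then show False using y(2) y2 y12(3) append_vec_eq_0[OF y12(1,2)] by blast
  qed
  \<comment> \<open>\<open>V\<close> padded with zero columns to the prescribed width\<close>
  define N where "N = mat m l (\<lambda>(i, j). if j < k then V $$ (i, j) else 0)"
  have N: "N \<in> carrier_mat m l" by (simp add: N_def)
  have "N * N\<^sup>\<dagger> = S"
  proof (rule eq_matI)
    fix i j assume "i < dim_row S" "j < dim_col S"
    then have ij: "i < m" "j < m" using S by auto
    have Nc: "N\<^sup>\<dagger> $$ (a, j) = cnj (N $$ (j, a))" if "a < l" for a
      using N ij that by (subst adjoint_index) auto
    have Vc: "V\<^sup>\<dagger> $$ (a, j) = cnj (V $$ (j, a))" if "a < k" for a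
      using V(1) ij that by (subst adjoint_index) auto
    have "(N * N\<^sup>\<dagger>) $$ (i, j) = (\<Sum>a<l. N $$ (i, a) * N\<^sup>\<dagger> $$ (a, j))"
      by (rule mult_mat_sum[OF N adjoint_carrier[OF N] ij])
    also have "\<dots> = (\<Sum>a<l. if a < k then V $$ (i, a) * cnj (V $$ (j, a)) else 0)"
      by (rule sum.cong[OF refl]) (use Nc ij in \<open>auto simp: N_def\<close>)
    also have "\<dots> = (\<Sum>a<k. V $$ (i, a) * cnj (V $$ (j, a)))"
      using \<open>k \<le> l\<close> by (intro sum.mono_neutral_cong_right) auto
    also have "\<dots> = (V * V\<^sup>\<dagger>) $$ (i, j)"
      unfolding mult_mat_sum[OF V(1) adjoint_carrier[OF V(1)] ij] by (rule sum.cong[OF refl]) (use Vc in simp)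
    finally show "(N * N\<^sup>\<dagger>) $$ (i, j) = S $$ (i, j)" by (simp add: V(2))
  qed (use N S in auto)
  then show ?thesis using that N by (simp add: S_def)
qed

context factor_realization
begin

text \<open>On the kernel of \<open>[C1 D1]\<close>, which \<open>N\<^sub>c\<close> parametrises, the dual inequality is again a
  bounded-real form, now with the roles of input and output exchanged.\<close>

lemma dual_lmi_form:
  assumes Nc: "Nc \<in> carrier_mat (m + p) k" and Y: "Y \<in> carrier_mat m m" "Y\<^sup>\<dagger> = Y"
    and t: "t \<in> carrier_vec k" and u: "u \<in> carrier_vec n"
    and wv: "Nc *\<^sub>v t = w @\<^sub>v v" "w \<in> carrier_vec m" "v \<in> carrier_vec p"
  shows "(dual_lmi m p n A B C2 D2 Nc \<gamma>b Y *\<^sub>v (t @\<^sub>v u)) \<bullet>c (t @\<^sub>v u) = complex_of_real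
     (2 * Re ((A *\<^sub>v w + B *\<^sub>v v) \<bullet>c (Y *\<^sub>v w) + (C2 *\<^sub>v w + D2 *\<^sub>v v) \<bullet>c u) - sqnorm v - \<gamma>b\<^sup>2 * sqnorm u)"
    and "dual_lmi m p n A B C2 D2 Nc \<gamma>b Y \<in> carrier_mat (k + n) (k + n)"
proof -
  let ?F2 = "four_block_mat Nc (0\<^sub>m (m + p) n) (0\<^sub>m n k) (1\<^sub>m n)"
  let ?F1 = "four_block_mat (Nc\<^sup>\<dagger>) (0\<^sub>m k n) (0\<^sub>m n (m + p)) (1\<^sub>m n)"
  let ?Mid = "block3 (A\<^sup>\<dagger> * Y + Y * A) (Y * B) (C2\<^sup>\<dagger>) (B\<^sup>\<dagger> * Y) (- 1\<^sub>m p) (D2\<^sup>\<dagger>) C2 D2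
     (- (complex_of_real (\<gamma>b\<^sup>2) \<cdot>\<^sub>m 1\<^sub>m n))"
  have k: "dim_col Nc = k" using Nc by simp
  have F2: "?F2 \<in> carrier_mat ((m + p) + n) (k + n)"
    by (rule four_block_carrier_mat[OF Nc one_carrier_mat])
  have F1: "?F1 = ?F2\<^sup>\<dagger>"
    by (subst adjoint_four_block[OF Nc zero_carrier_mat zero_carrier_mat one_carrier_mat]) simp
  have "?Mid \<in> carrier_mat (m + (p + n)) (m + (p + n))"
    by (rule block3_carrier[OF add_carrier_mat[OF mult_carrier_mat[OF Y(1) A]] mult_carrier_mat[OF Y(1) B] adjoint_carrier[OF C2]
        mult_carrier_mat[OF adjoint_carrier[OF B] Y(1)] uminus_carrier_mat[OF one_carrier_mat] adjoint_carrier[OF D2] C2 D2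
        smult_one_carrier])
  then have Mid: "?Mid \<in> carrier_mat ((m + p) + n) ((m + p) + n)" by (simp only: add.assoc)
  have F1c: "?F1 \<in> carrier_mat (k + n) ((m + p) + n)" unfolding F1 by (rule adjoint_carrier[OF F2])
  show "dual_lmi m p n A B C2 D2 Nc \<gamma>b Y \<in> carrier_mat (k + n) (k + n)"
    unfolding dual_lmi_def k by (rule mult_carrier_mat[OF mult_carrier_mat[OF F1c Mid] F2])
  have z: "t @\<^sub>v u \<in> carrier_vec (k + n)" by (rule append_carrier_vec[OF t u])
  have Nt: "Nc *\<^sub>v t \<in> carrier_vec (m + p)" by (rule mult_mat_vec_carrier[OF Nc t])
  have "?F2 *\<^sub>v (t @\<^sub>v u) = (Nc *\<^sub>v t + 0\<^sub>m (m + p) n *\<^sub>v u) @\<^sub>v (0\<^sub>m n k *\<^sub>v t + 1\<^sub>m n *\<^sub>v u)"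
    by (rule four_block_mat_mult_vec[OF Nc zero_carrier_mat zero_carrier_mat one_carrier_mat t u])
  also have "\<dots> = (Nc *\<^sub>v t) @\<^sub>v u" using t u Nt by simp
  also have "\<dots> = w @\<^sub>v v @\<^sub>v u" unfolding wv(1) by (rule eq_vecI) auto
  finally have F2z: "?F2 *\<^sub>v (t @\<^sub>v u) = w @\<^sub>v v @\<^sub>v u" .
  have F2zc: "?F2 *\<^sub>v (t @\<^sub>v u) \<in> carrier_vec ((m + p) + n)" by (rule mult_mat_vec_carrier[OF F2 z])
  have "(dual_lmi m p n A B C2 D2 Nc \<gamma>b Y *\<^sub>v (t @\<^sub>v u)) \<bullet>c (t @\<^sub>v u) = (?F2\<^sup>\<dagger> *\<^sub>v (?Mid *\<^sub>v (?F2 *\<^sub>v (t @\<^sub>v u)))) \<bullet>c (t @\<^sub>v u)"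
    unfolding dual_lmi_def k assoc_mult_mat_vec[OF mult_carrier_mat[OF F1c Mid] F2 z] assoc_mult_mat_vec[OF F1c Mid F2zc]
    unfolding F1 ..
  also have "\<dots> = (?Mid *\<^sub>v (w @\<^sub>v v @\<^sub>v u)) \<bullet>c (w @\<^sub>v v @\<^sub>v u)"
    unfolding inner_adjoint'[OF F2 mult_mat_vec_carrier[OF Mid F2zc] z] unfolding F2z ..
  also have "\<dots> = complex_of_real (2 * Re ((A *\<^sub>v w + B *\<^sub>v v) \<bullet>c (Y *\<^sub>v w) + (C2 *\<^sub>v w + D2 *\<^sub>v v) \<bullet>c u)) +
      complex_of_real (- sqnorm v) + complex_of_real (- (\<gamma>b\<^sup>2 * sqnorm u))"
    unfolding bounded_real_form[OF A Y B C2 D2 uminus_carrier_mat[OF one_carrier_mat] smult_one_carrier wv(2,3) u]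
      inner_neg_smult_one[OF u] inner_neg_one[OF wv(3)] ..
  finally show "(dual_lmi m p n A B C2 D2 Nc \<gamma>b Y *\<^sub>v (t @\<^sub>v u)) \<bullet>c (t @\<^sub>v u) = complex_of_real
     (2 * Re ((A *\<^sub>v w + B *\<^sub>v v) \<bullet>c (Y *\<^sub>v w) + (C2 *\<^sub>v w + D2 *\<^sub>v v) \<bullet>c u) - sqnorm v - \<gamma>b\<^sup>2 * sqnorm u)"
    by simp
qed

text \<open>Completing the square in \<open>v\<close>: the maximum over \<open>v\<close> is at \<open>v = B\<^sup>\<dagger> x\<close> and equals the Lyapunov form.\<close>

lemma lyapunov_form_neg:
  assumes X: "X \<in> carrier_mat m m" "X\<^sup>\<dagger> = X" and neg: "neg_def (A * X + X * A\<^sup>\<dagger> + B * B\<^sup>\<dagger>)"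
    and x: "x \<in> carrier_vec m" "x \<noteq> 0\<^sub>v m" and v: "v \<in> carrier_vec p"
  shows "2 * Re ((A\<^sup>\<dagger> *\<^sub>v x) \<bullet>c (X *\<^sub>v x) + (B\<^sup>\<dagger> *\<^sub>v x) \<bullet>c v) - sqnorm v < 0"
proof -
  note A' = adjoint_carrier[OF A] and B' = adjoint_carrier[OF B]
  note AX = mult_carrier_mat[OF A X(1)] and XA = mult_carrier_mat[OF X(1) A'] and BB = mult_carrier_mat[OF B B']
  have c: "A\<^sup>\<dagger> *\<^sub>v x \<in> carrier_vec m" "X *\<^sub>v x \<in> carrier_vec m" "B\<^sup>\<dagger> *\<^sub>v x \<in> carrier_vec p"
    by (rule mult_mat_vec_carrier[OF A' x(1)] mult_mat_vec_carrier[OF X(1) x(1)] mult_mat_vec_carrier[OF B' x(1)])+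
  have M: "A * X + X * A\<^sup>\<dagger> + B * B\<^sup>\<dagger> \<in> carrier_mat m m" by (rule add_carrier_mat[OF BB])
  have s: "(A * X + X * A\<^sup>\<dagger> + B * B\<^sup>\<dagger>) *\<^sub>v x = A *\<^sub>v (X *\<^sub>v x) + X *\<^sub>v (A\<^sup>\<dagger> *\<^sub>v x) + B *\<^sub>v (B\<^sup>\<dagger> *\<^sub>v x)"
    unfolding add_mult_distrib_mat_vec[OF add_carrier_mat[OF XA] BB x(1)] add_mult_distrib_mat_vec[OF AX XA x(1)]
      assoc_mult_mat_vec[OF A X(1) x(1)] assoc_mult_mat_vec[OF X(1) A' x(1)] assoc_mult_mat_vec[OF B B' x(1)] ..
  have i1: "(A *\<^sub>v (X *\<^sub>v x)) \<bullet>c x = cnj ((A\<^sup>\<dagger> *\<^sub>v x) \<bullet>c (X *\<^sub>v x))"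
    unfolding inner_adjoint[OF A c(2) x(1)] by (rule inner_commute[OF c(2,1)])
  have i2: "(X *\<^sub>v (A\<^sup>\<dagger> *\<^sub>v x)) \<bullet>c x = (A\<^sup>\<dagger> *\<^sub>v x) \<bullet>c (X *\<^sub>v x)" by (rule hermitian_inner[OF X c(1) x(1)])
  have i3: "(B *\<^sub>v (B\<^sup>\<dagger> *\<^sub>v x)) \<bullet>c x = complex_of_real (sqnorm (B\<^sup>\<dagger> *\<^sub>v x))"
    unfolding inner_adjoint[OF B c(3) x(1)] by (rule inner_self)
  have "((A * X + X * A\<^sup>\<dagger> + B * B\<^sup>\<dagger>) *\<^sub>v x) \<bullet>c x
      = cnj ((A\<^sup>\<dagger> *\<^sub>v x) \<bullet>c (X *\<^sub>v x)) + (A\<^sup>\<dagger> *\<^sub>v x) \<bullet>c (X *\<^sub>v x) + complex_of_real (sqnorm (B\<^sup>\<dagger> *\<^sub>v x))"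
    unfolding s inner_add_left[OF add_carrier_vec[OF mult_mat_vec_carrier[OF A c(2)] mult_mat_vec_carrier[OF X(1) c(1)]]
        mult_mat_vec_carrier[OF B c(3)] x(1)]
      inner_add_left[OF mult_mat_vec_carrier[OF A c(2)] mult_mat_vec_carrier[OF X(1) c(1)] x(1)] i1 i2 i3 ..
  then have "2 * Re ((A\<^sup>\<dagger> *\<^sub>v x) \<bullet>c (X *\<^sub>v x)) + sqnorm (B\<^sup>\<dagger> *\<^sub>v x) < 0"
    using neg x unfolding neg_def_iff[OF M] by (auto simp: less_complex_def)
  moreover have "0 \<le> sqnorm (B\<^sup>\<dagger> *\<^sub>v x) - 2 * Re ((B\<^sup>\<dagger> *\<^sub>v x) \<bullet>c v) + sqnorm v"
  proof -
    have nv: "(-1) \<cdot>\<^sub>v v \<in> carrier_vec p" using v by simp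
    have "sqnorm (B\<^sup>\<dagger> *\<^sub>v x + (-1) \<cdot>\<^sub>v v) = sqnorm (B\<^sup>\<dagger> *\<^sub>v x) - 2 * Re ((B\<^sup>\<dagger> *\<^sub>v x) \<bullet>c v) + sqnorm v"
      unfolding sqnorm_add[OF c(3) nv] inner_smult_right[OF c(3) v] sqnorm_smult by simp
    then show ?thesis using sqnorm_nonneg by metis
  qed
  ultimately show ?thesis by simp
qed

text \<open>The storage \<open>X = [X1, N; N\<^sup>\<dagger>, 1]\<close> has the corner \<open>X1\<close>, and its inverse has the corner \<open>(X1 - N N\<^sup>\<dagger>)\<^sup>-\<^sup>1 = Y1\<close>.  On the
  kernel of \<open>\<Pi>\<close> the design form is that of the Lyapunov inequality for \<open>X1\<close>; on the kernel of \<open>\<Lambda>\<close>, in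
  the co-state \<open>w = X x\<close>, it is that of the dual inequality for \<open>Y1\<close>.\<close>

lemma design_exists:
  assumes Nc: "full_rank_kernel_mat (C1 @\<^sub>c D1) Nc"
    and feasible: "lmi_feasible m p n m11 A B C2 D2 Nc lam \<gamma>b"
  shows "\<exists>A11 B11 C11 J11. is_design m p n ny m11 A B C1 C2 D1 D2 \<gamma>b A11 B11 C11 J11"
proof -
  obtain X1 Y1 where X1: "X1 \<in> carrier_mat m m" "pos_def X1" and Y1: "Y1 \<in> carrier_mat m m" "pos_def Y1"
    and lyap: "neg_def (A * X1 + X1 * A\<^sup>\<dagger> + B * B\<^sup>\<dagger>)"
    and dual: "neg_def (dual_lmi m p n A B C2 D2 Nc \<gamma>b Y1)"
    and psd: "pos_semidef (coupling_mat m X1 Y1)"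
    and rank: "vec_space.rank (m + m) (coupling_mat m X1 Y1) \<le> m + m11"
    using feasible unfolding lmi_feasible_def by blast
  note X1h = pos_def_hermitian[OF X1(2)] and Y1h = pos_def_hermitian[OF Y1(2)]
  obtain R where R: "R \<in> carrier_mat m m" "Y1 * R = 1\<^sub>m m" "R * Y1 = 1\<^sub>m m"
    using inverse_if_injective[OF Y1(1) pos_def_injective[OF Y1]] by metis
  have YR: "Y1 *\<^sub>v (R *\<^sub>v a) = a" if "a \<in> carrier_vec m" for a
    using assoc_mult_mat_vec[OF Y1(1) R(1) that] R(2) that by simp
  obtain N where N: "N \<in> carrier_mat m m11" "N * N\<^sup>\<dagger> = X1 - R"
    using coupling_factor[OF X1(1) Y1 psd rank R(1,2)] by metis
  note N' = adjoint_carrier[OF N(1)]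
  have NN: "N *\<^sub>v (N\<^sup>\<dagger> *\<^sub>v a) = X1 *\<^sub>v a + - (R *\<^sub>v a)" if "a \<in> carrier_vec m" for a
    unfolding assoc_mult_mat_vec[OF N(1) N' that, symmetric] N(2) by (rule minus_mult_mat_vec[OF X1(1) R(1) that])
  define X where "X = four_block_mat X1 N (N\<^sup>\<dagger>) (1\<^sub>m m11)"
  have X: "X \<in> carrier_mat (m + m11) (m + m11)"
    unfolding X_def by (rule four_block_carrier_mat[OF X1(1) one_carrier_mat])
  have Xh: "X\<^sup>\<dagger> = X"
    unfolding X_def by (simp add: adjoint_four_block[OF X1(1) N(1) N' one_carrier_mat] X1h)
  have Xv: "X *\<^sub>v (x1 @\<^sub>v x2) = (X1 *\<^sub>v x1 + N *\<^sub>v x2) @\<^sub>v (N\<^sup>\<dagger> *\<^sub>v x1 + x2)"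
    if "x1 \<in> carrier_vec m" "x2 \<in> carrier_vec m11" for x1 x2
    unfolding X_def four_block_mat_mult_vec[OF X1(1) N(1) N' one_carrier_mat that] using that by simp
  have Xpos: "pos_def X"
  proof (rule pos_def_if_hermitian[OF X Xh])
    fix x :: "complex vec" assume x: "x \<in> carrier_vec (m + m11)" "x \<noteq> 0\<^sub>v (m + m11)"
    obtain x1 x2 where x12: "x1 \<in> carrier_vec m" "x2 \<in> carrier_vec m11" "x = x1 @\<^sub>v x2"
      using append_vec_cases[OF x(1)] by metis
    define y where "y = R *\<^sub>v x1"
    have y: "y \<in> carrier_vec m" unfolding y_def by (rule mult_mat_vec_carrier[OF R(1) x12(1)])
    have c: "X1 *\<^sub>v x1 \<in> carrier_vec m" "N *\<^sub>v x2 \<in> carrier_vec m" "N\<^sup>\<dagger> *\<^sub>v x1 \<in> carrier_vec m11"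
      by (rule mult_mat_vec_carrier[OF X1(1) x12(1)] mult_mat_vec_carrier[OF N(1) x12(2)] mult_mat_vec_carrier[OF N' x12(1)])+
    have "(X *\<^sub>v x) \<bullet>c x = ((X1 *\<^sub>v x1) \<bullet>c x1 + (N *\<^sub>v x2) \<bullet>c x1) + ((N\<^sup>\<dagger> *\<^sub>v x1) \<bullet>c x2 + x2 \<bullet>c x2)"
      unfolding x12(3) Xv[OF x12(1,2)] inner_append[OF add_carrier_vec[OF c(1,2)] add_carrier_vec[OF c(3) x12(2)] x12(1,2)]
        inner_add_left[OF c(1,2) x12(1)] inner_add_left[OF c(3) x12(2) x12(2)] ..
    moreover have "(N *\<^sub>v x2) \<bullet>c x1 = cnj ((N\<^sup>\<dagger> *\<^sub>v x1) \<bullet>c x2)"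
      unfolding inner_adjoint[OF N(1) x12(2,1)] by (rule inner_commute[OF x12(2) c(3)])
    moreover have "sqnorm (N\<^sup>\<dagger> *\<^sub>v x1) = Re ((X1 *\<^sub>v x1) \<bullet>c x1) - Re (y \<bullet>c x1)"
    proof -
      have "complex_of_real (sqnorm (N\<^sup>\<dagger> *\<^sub>v x1)) = (N *\<^sub>v (N\<^sup>\<dagger> *\<^sub>v x1)) \<bullet>c x1"
        unfolding inner_adjoint[OF N(1) c(3) x12(1)] by (rule inner_self[symmetric])
      also have "\<dots> = (X1 *\<^sub>v x1) \<bullet>c x1 + (- y) \<bullet>c x1"
        unfolding NN[OF x12(1)] y_def[symmetric] using y by (intro inner_add_left[OF c(1) _ x12(1)]) simp
      also have "(- y) \<bullet>c x1 = - (y \<bullet>c x1)"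
        using y x12(1) by (simp add: inner_sum[OF x12(1)] sum_negf)
      finally have "Re (complex_of_real (sqnorm (N\<^sup>\<dagger> *\<^sub>v x1))) = Re ((X1 *\<^sub>v x1) \<bullet>c x1 + - (y \<bullet>c x1))" by simp
      then show ?thesis by simp
    qed
    ultimately have form: "Re ((X *\<^sub>v x) \<bullet>c x) = Re (y \<bullet>c x1) + sqnorm (N\<^sup>\<dagger> *\<^sub>v x1 + x2)"
      unfolding sqnorm_add[OF c(3) x12(2)] by (simp add: inner_self)
    have yx: "Re (y \<bullet>c x1) = Re ((Y1 *\<^sub>v y) \<bullet>c y)"
      using inner_commute[OF y x12(1)] YR[OF x12(1)] by (simp add: y_def[symmetric])
    show "0 < Re ((X *\<^sub>v x) \<bullet>c x)"
    proof (cases "y = 0\<^sub>v m")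
      case True
      then have x1: "x1 = 0\<^sub>v m" using YR[OF x12(1)] Y1(1) by (simp add: y_def[symmetric])
      then have "x2 \<noteq> 0\<^sub>v m11" using x x12 append_vec_eq_0[OF x12(1,2)] by blast
      moreover have "N\<^sup>\<dagger> *\<^sub>v x1 + x2 = x2" using x1 N' x12(2) by simp
      ultimately show ?thesis
        unfolding form using sqnorm_pos[OF x12(2)] True x12(1) by (simp add: inner_zero_left)
    next
      case False
      then show ?thesis unfolding form yx using pos_def_pos[OF Y1 y] sqnorm_nonneg[of "N\<^sup>\<dagger> *\<^sub>v x1 + x2"] by linarith
    qed
  qed
  let ?Nd = "(m + m11) + (n + p)"
  define Q where "Q = Sigma_mat m p n m11 A B C2 D2 \<gamma>b X"
  define Lam where "Lam = Lambda_mat m p n ny m11 C1 D1 X"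
  define P where "P = (Pi_mat m p n m11 :: complex mat)"
  have Q: "Q \<in> carrier_mat ?Nd ?Nd" unfolding Q_def by (rule Sigma_mat_carrier[OF X])
  have Lam: "Lam \<in> carrier_mat (m11 + ny) ?Nd" unfolding Lam_def by (rule Lambda_mat_carrier[OF X])
  have P: "P \<in> carrier_mat (m11 + n) ?Nd" unfolding P_def by (rule Pi_mat_carrier)
  have split: thesis if z: "z \<in> carrier_vec ?Nd"
    and *: "\<And>x1 x2 u v. x1 \<in> carrier_vec m \<Longrightarrow> x2 \<in> carrier_vec m11 \<Longrightarrow> u \<in> carrier_vec n \<Longrightarrow> v \<in> carrier_vec p \<Longrightarrow>
      z = (x1 @\<^sub>v x2) @\<^sub>v u @\<^sub>v v \<Longrightarrow> (Q *\<^sub>v z) \<bullet>c z = complex_of_real (open_form \<gamma>b X x1 x2 u v) \<Longrightarrow> thesis"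
    for z :: "complex vec" and thesis
  proof -
    obtain x y where xy: "x \<in> carrier_vec (m + m11)" "y \<in> carrier_vec (n + p)" "z = x @\<^sub>v y"
      using append_vec_cases[OF z] by metis
    obtain x1 x2 where x12: "x1 \<in> carrier_vec m" "x2 \<in> carrier_vec m11" "x = x1 @\<^sub>v x2"
      using append_vec_cases[OF xy(1)] by metis
    obtain u v where uv: "u \<in> carrier_vec n" "v \<in> carrier_vec p" "y = u @\<^sub>v v"
      using append_vec_cases[OF xy(2)] by metis
    show ?thesis
      by (rule *[OF x12(1,2) uv(1,2)]) (simp_all only: xy x12 uv Q_def Sigma_mat_form[OF X Xh x12(1,2) uv(1,2)])
  qed
  have zero_iff: "(x1 @\<^sub>v x2) @\<^sub>v u @\<^sub>v v = 0\<^sub>v ?Nd \<longleftrightarrow> x1 = 0\<^sub>v m \<and> x2 = 0\<^sub>v m11 \<and> u = 0\<^sub>v n \<and> v = 0\<^sub>v p"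
    if "x1 \<in> carrier_vec m" "x2 \<in> carrier_vec m11" "u \<in> carrier_vec n" "v \<in> carrier_vec p" for x1 x2 u v :: "complex vec"
    unfolding append_vec_eq_0[OF append_carrier_vec[OF that(1,2)] append_carrier_vec[OF that(3,4)]]
      append_vec_eq_0[OF that(1,2)] append_vec_eq_0[OF that(3,4)] by blast
  have Qh: "Q\<^sup>\<dagger> = Q"
  proof (rule hermitian_if_form_real[OF Q])
    fix z :: "complex vec" assume "z \<in> carrier_vec ?Nd"
    then show "Im ((Q *\<^sub>v z) \<bullet>c z) = 0" by (rule split) simp
  qed
  have full: "y = 0\<^sub>v (m11 + n)" if y: "y \<in> carrier_vec (m11 + n)" "P\<^sup>\<dagger> *\<^sub>v y = 0\<^sub>v ?Nd" for y
  proof -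
    obtain x2 u where xu: "x2 \<in> carrier_vec m11" "u \<in> carrier_vec n" "y = x2 @\<^sub>v u"
      using append_vec_cases[OF y(1)] by metis
    define z :: "complex vec" where "z = (0\<^sub>v m @\<^sub>v x2) @\<^sub>v u @\<^sub>v 0\<^sub>v p"
    have z: "z \<in> carrier_vec ?Nd" unfolding z_def using xu by (intro append_carrier_vec) auto
    have "P *\<^sub>v z = y" unfolding P_def z_def xu(3) by (rule Pi_mat_mult[OF zero_carrier_vec xu(1,2) zero_carrier_vec])
    then have "y \<bullet>c y = 0"
      using inner_adjoint'[OF P y(1) z] y(2) inner_zero_left[OF z] by simp
    then show ?thesis using conjugate_square_eq_0_vec[OF y(1)] by blast
  qed
  \<comment> \<open>\<open>\<Pi> z = 0\<close> means \<open>x2 = 0\<close> and \<open>u = 0\<close>, which leaves the Lyapunov form\<close>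
  have kerP: "Re ((Q *\<^sub>v z) \<bullet>c z) < 0" if z: "z \<in> carrier_vec ?Nd" "z \<noteq> 0\<^sub>v ?Nd" "P *\<^sub>v z = 0\<^sub>v (m11 + n)" for z
  proof (rule split[OF z(1)])
    fix x1 x2 u v
    assume x1: "x1 \<in> carrier_vec m" and x2: "x2 \<in> carrier_vec m11" and u: "u \<in> carrier_vec n" and v: "v \<in> carrier_vec p"
      and zeq: "z = (x1 @\<^sub>v x2) @\<^sub>v u @\<^sub>v v" and form: "(Q *\<^sub>v z) \<bullet>c z = complex_of_real (open_form \<gamma>b X x1 x2 u v)"
    have "x2 @\<^sub>v u = 0\<^sub>v (m11 + n)" using z(3) unfolding P_def zeq Pi_mat_mult[OF x1 x2 u v] .
    then have 0: "x2 = 0\<^sub>v m11" "u = 0\<^sub>v n" using append_vec_eq_0[OF x2 u] by blast+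
    have c: "A\<^sup>\<dagger> *\<^sub>v x1 \<in> carrier_vec m" "X1 *\<^sub>v x1 \<in> carrier_vec m" "B\<^sup>\<dagger> *\<^sub>v x1 \<in> carrier_vec p" "N\<^sup>\<dagger> *\<^sub>v x1 \<in> carrier_vec m11"
      by (rule mult_mat_vec_carrier[OF adjoint_carrier[OF A] x1] mult_mat_vec_carrier[OF X1(1) x1]
        mult_mat_vec_carrier[OF adjoint_carrier[OF B] x1] mult_mat_vec_carrier[OF N' x1])+
    have "X *\<^sub>v (x1 @\<^sub>v 0\<^sub>v m11) = X1 *\<^sub>v x1 @\<^sub>v N\<^sup>\<dagger> *\<^sub>v x1"
      unfolding Xv[OF x1 zero_carrier_vec] mult_mat_zero_vec[OF N(1)] using c by simp
    moreover have "A\<^sup>\<dagger> *\<^sub>v x1 + C2\<^sup>\<dagger> *\<^sub>v 0\<^sub>v n = A\<^sup>\<dagger> *\<^sub>v x1" "B\<^sup>\<dagger> *\<^sub>v x1 + D2\<^sup>\<dagger> *\<^sub>v 0\<^sub>v n = B\<^sup>\<dagger> *\<^sub>v x1"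
      unfolding mult_mat_zero_vec[OF adjoint_carrier[OF C2]] mult_mat_zero_vec[OF adjoint_carrier[OF D2]] using c by simp_all
    moreover have "sqnorm (0\<^sub>v n) = 0" using sqnorm_eq_0[of "0\<^sub>v n" n] by simp
    ultimately have "open_form \<gamma>b X x1 x2 u v = 2 * Re ((A\<^sup>\<dagger> *\<^sub>v x1) \<bullet>c (X1 *\<^sub>v x1) + (B\<^sup>\<dagger> *\<^sub>v x1) \<bullet>c v) - sqnorm v"
      unfolding open_form_def Let_def 0 using inner_append[OF c(1) zero_carrier_vec c(2,4)] inner_zero_left[OF c(4)] by simp
    moreover have "\<dots> < 0"
    proof (cases "x1 = 0\<^sub>v m")
      case True
      then have "v \<noteq> 0\<^sub>v p" using z(2) zero_iff[OF x1 x2 u v] 0 unfolding zeq by blast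
      moreover have "A\<^sup>\<dagger> *\<^sub>v x1 = 0\<^sub>v m" "B\<^sup>\<dagger> *\<^sub>v x1 = 0\<^sub>v p"
        unfolding True mult_mat_zero_vec[OF adjoint_carrier[OF A]] mult_mat_zero_vec[OF adjoint_carrier[OF B]] by simp_all
      ultimately show ?thesis using sqnorm_pos[OF v] inner_zero_left[OF c(2)] inner_zero_left[OF v] by simp
    next
      case False
      then show ?thesis using lyapunov_form_neg[OF X1(1) X1h lyap x1 _ v] by blast
    qed
    ultimately show "Re ((Q *\<^sub>v z) \<bullet>c z) < 0" unfolding form by simp
  qed
  have Ncc: "Nc \<in> carrier_mat (m + p) (dim_col Nc)"
    and Nck: "(\<lambda>v. Nc *\<^sub>v v) ` carrier_vec (dim_col Nc) = mat_kernel (C1 @\<^sub>c D1)"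
    using Nc append_cols_carrier[OF C1 D1] unfolding full_rank_kernel_mat_def by auto
  \<comment> \<open>\<open>\<Lambda> z = 0\<close> means that the co-state is \<open>(w1, 0)\<close> with \<open>x1 = Y1 w1\<close>, and that \<open>(w1, v)\<close> is in the range of \<open>Nc\<close>\<close>
  have kerL: "Re ((Q *\<^sub>v z) \<bullet>c z) < 0" if z: "z \<in> carrier_vec ?Nd" "z \<noteq> 0\<^sub>v ?Nd" "Lam *\<^sub>v z = 0\<^sub>v (m11 + ny)" for z
  proof (rule split[OF z(1)])
    fix x1 x2 u v
    assume x1: "x1 \<in> carrier_vec m" and x2: "x2 \<in> carrier_vec m11" and u: "u \<in> carrier_vec n" and v: "v \<in> carrier_vec p"
      and zeq: "z = (x1 @\<^sub>v x2) @\<^sub>v u @\<^sub>v v" and form: "(Q *\<^sub>v z) \<bullet>c z = complex_of_real (open_form \<gamma>b X x1 x2 u v)"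
    define w1 where "w1 = X1 *\<^sub>v x1 + N *\<^sub>v x2"
    define w2 where "w2 = N\<^sup>\<dagger> *\<^sub>v x1 + x2"
    have c: "N\<^sup>\<dagger> *\<^sub>v x1 \<in> carrier_vec m11" "N *\<^sub>v x2 \<in> carrier_vec m" "X1 *\<^sub>v x1 \<in> carrier_vec m" "R *\<^sub>v x1 \<in> carrier_vec m"
      by (rule mult_mat_vec_carrier[OF N' x1] mult_mat_vec_carrier[OF N(1) x2] mult_mat_vec_carrier[OF X1(1) x1]
        mult_mat_vec_carrier[OF R(1) x1])+
    have w1: "w1 \<in> carrier_vec m" unfolding w1_def by (rule add_carrier_vec[OF c(3,2)])
    have w2: "w2 \<in> carrier_vec m11" unfolding w2_def by (rule add_carrier_vec[OF c(1) x2])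
    have Xw: "X *\<^sub>v (x1 @\<^sub>v x2) = w1 @\<^sub>v w2" unfolding w1_def w2_def by (rule Xv[OF x1 x2])
    have CD: "C1 *\<^sub>v w1 + D1 *\<^sub>v v \<in> carrier_vec ny"
      by (rule add_carrier_vec[OF mult_mat_vec_carrier[OF C1 w1] mult_mat_vec_carrier[OF D1 v]])
    have "w2 @\<^sub>v (C1 *\<^sub>v w1 + D1 *\<^sub>v v) = 0\<^sub>v (m11 + ny)"
      using z(3) unfolding Lam_def zeq Lambda_mat_mult[OF X append_carrier_vec[OF x1 x2] Xw w1 w2 u v] .
    then have w20: "w2 = 0\<^sub>v m11" and CD0: "C1 *\<^sub>v w1 + D1 *\<^sub>v v = 0\<^sub>v ny"
      using append_vec_eq_0[OF w2 CD] by blast+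
    have x2eq: "x2 = - (N\<^sup>\<dagger> *\<^sub>v x1)"
      using w20 unfolding w2_def by (rule vec_add_eq_0D[OF c(1) x2])
    have "w1 = R *\<^sub>v x1"
      unfolding w1_def x2eq mult_mat_vec_uminus[OF N(1) c(1)] NN[OF x1] using c(3,4) by (intro eq_vecI) auto
    then have xw: "x1 = Y1 *\<^sub>v w1" using YR[OF x1] by simp
    have "(C1 @\<^sub>c D1) *\<^sub>v (w1 @\<^sub>v v) = 0\<^sub>v ny"
      unfolding append_cols_mult[OF C1 D1 w1 v] by (rule CD0)
    then have "w1 @\<^sub>v v \<in> mat_kernel (C1 @\<^sub>c D1)"
      by (rule mat_kernelI[OF append_cols_carrier[OF C1 D1] append_carrier_vec[OF w1 v]])
    then obtain t where t: "t \<in> carrier_vec (dim_col Nc)" and Nt: "Nc *\<^sub>v t = w1 @\<^sub>v v"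
      unfolding Nck[symmetric] by (metis imageE)
    have "t @\<^sub>v u \<noteq> 0\<^sub>v (dim_col Nc + n)"
    proof
      assume "t @\<^sub>v u = 0\<^sub>v (dim_col Nc + n)"
      then have "t = 0\<^sub>v (dim_col Nc)" and u0: "u = 0\<^sub>v n" using append_vec_eq_0[OF t u] by blast+
      then have "w1 @\<^sub>v v = 0\<^sub>v (m + p)" using Nt mult_mat_zero_vec[OF Ncc] by simp
      then have "w1 = 0\<^sub>v m" and v0: "v = 0\<^sub>v p" using append_vec_eq_0[OF w1 v] by blast+
      then have x10: "x1 = 0\<^sub>v m" using xw mult_mat_zero_vec[OF Y1(1)] by simp
      then have "x2 = 0\<^sub>v m11" using x2eq mult_mat_zero_vec[OF N'] by simp
      then show False using x10 u0 v0 z(2) zero_iff[OF x1 x2 u v] zeq by blast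
    qed
    then have neg: "2 * Re ((A *\<^sub>v w1 + B *\<^sub>v v) \<bullet>c (Y1 *\<^sub>v w1) + (C2 *\<^sub>v w1 + D2 *\<^sub>v v) \<bullet>c u) - sqnorm v - \<gamma>b\<^sup>2 * sqnorm u < 0"
      using dual append_carrier_vec[OF t u] unfolding neg_def_iff[OF dual_lmi_form(2)[OF Ncc Y1(1) Y1h t u Nt w1 v]]
      by (auto simp: dual_lmi_form(1)[OF Ncc Y1(1) Y1h t u Nt w1 v] less_complex_def)
    have d: "A\<^sup>\<dagger> *\<^sub>v x1 \<in> carrier_vec m" "C2\<^sup>\<dagger> *\<^sub>v u \<in> carrier_vec m" "B\<^sup>\<dagger> *\<^sub>v x1 \<in> carrier_vec p" "D2\<^sup>\<dagger> *\<^sub>v u \<in> carrier_vec p"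
      "A *\<^sub>v w1 \<in> carrier_vec m" "B *\<^sub>v v \<in> carrier_vec m" "C2 *\<^sub>v w1 \<in> carrier_vec n" "D2 *\<^sub>v v \<in> carrier_vec n"
      by (rule mult_mat_vec_carrier[OF adjoint_carrier[OF A] x1] mult_mat_vec_carrier[OF adjoint_carrier[OF C2] u]
        mult_mat_vec_carrier[OF adjoint_carrier[OF B] x1] mult_mat_vec_carrier[OF adjoint_carrier[OF D2] u]
        mult_mat_vec_carrier[OF A w1] mult_mat_vec_carrier[OF B v] mult_mat_vec_carrier[OF C2 w1] mult_mat_vec_carrier[OF D2 v])+
    have j1: "(A\<^sup>\<dagger> *\<^sub>v x1) \<bullet>c w1 = cnj ((A *\<^sub>v w1) \<bullet>c x1)"
      unfolding inner_adjoint'[OF A x1 w1] by (rule inner_commute[OF x1 d(5)])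
    have j2: "(C2\<^sup>\<dagger> *\<^sub>v u) \<bullet>c w1 = cnj ((C2 *\<^sub>v w1) \<bullet>c u)"
      unfolding inner_adjoint'[OF C2 u w1] by (rule inner_commute[OF u d(7)])
    have j3: "(B\<^sup>\<dagger> *\<^sub>v x1) \<bullet>c v = cnj ((B *\<^sub>v v) \<bullet>c x1)"
      unfolding inner_adjoint'[OF B x1 v] by (rule inner_commute[OF x1 d(6)])
    have j4: "(D2\<^sup>\<dagger> *\<^sub>v u) \<bullet>c v = cnj ((D2 *\<^sub>v v) \<bullet>c u)"
      unfolding inner_adjoint'[OF D2 u v] by (rule inner_commute[OF u d(8)])
    have "open_form \<gamma>b X x1 x2 u v = 2 * Re (((A\<^sup>\<dagger> *\<^sub>v x1) \<bullet>c w1 + (C2\<^sup>\<dagger> *\<^sub>v u) \<bullet>c w1) + ((B\<^sup>\<dagger> *\<^sub>v x1) \<bullet>c v + (D2\<^sup>\<dagger> *\<^sub>v u) \<bullet>c v))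
        - \<gamma>b\<^sup>2 * sqnorm u - sqnorm v"
      unfolding open_form_def Let_def Xw inner_append[OF add_carrier_vec[OF d(1,2)] zero_carrier_vec w1 w2]
        inner_add_left[OF d(1,2) w1] inner_add_left[OF d(3,4) v] inner_zero_left[OF w2] by simp
    also have "\<dots> = 2 * Re (((A *\<^sub>v w1) \<bullet>c x1 + (B *\<^sub>v v) \<bullet>c x1) + ((C2 *\<^sub>v w1) \<bullet>c u + (D2 *\<^sub>v v) \<bullet>c u)) - sqnorm v - \<gamma>b\<^sup>2 * sqnorm u"
      unfolding j1 j2 j3 j4 by simp
    also have "\<dots> < 0"
      using neg unfolding xw[symmetric] inner_add_left[OF d(5,6) x1] inner_add_left[OF d(7,8) u] .
    finally show "Re ((Q *\<^sub>v z) \<bullet>c z) < 0" unfolding form by simp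
  qed
  have "\<exists>K \<in> carrier_mat (m11 + ny) (m11 + n). \<forall>z \<in> carrier_vec ?Nd. z \<noteq> 0\<^sub>v ?Nd \<longrightarrow>
      Re ((Q *\<^sub>v z) \<bullet>c z) + 2 * Re ((K *\<^sub>v (P *\<^sub>v z)) \<bullet>c (Lam *\<^sub>v z)) < 0"
  proof (rule elimination[OF Q Qh P Lam])
    show "y = 0\<^sub>v (m11 + n)" if "y \<in> carrier_vec (m11 + n)" "P\<^sup>\<dagger> *\<^sub>v y = 0\<^sub>v ?Nd" for y by (rule full[OF that])
    show "Re ((Q *\<^sub>v z) \<bullet>c z) < 0" if "z \<in> carrier_vec ?Nd" "z \<noteq> 0\<^sub>v ?Nd" "P *\<^sub>v z = 0\<^sub>v (m11 + n)" for z
      by (rule kerP[OF that])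
    show "Re ((Q *\<^sub>v z) \<bullet>c z) < 0" if "z \<in> carrier_vec ?Nd" "z \<noteq> 0\<^sub>v ?Nd" "Lam *\<^sub>v z = 0\<^sub>v (m11 + ny)" for z
      by (rule kerL[OF that])
  next
    fix K assume 1: "K \<in> carrier_mat (m11 + ny) (m11 + n)"
      and 2: "\<And>z. z \<in> carrier_vec ?Nd \<Longrightarrow> z \<noteq> 0\<^sub>v ?Nd \<Longrightarrow>
        Re ((Q *\<^sub>v z) \<bullet>c z) + 2 * Re ((K *\<^sub>v (P *\<^sub>v z)) \<bullet>c (Lam *\<^sub>v z)) < 0"
    show ?thesis by (intro bexI[OF _ 1] ballI impI 2)
  qed
  then obtain K where K: "K \<in> carrier_mat (m11 + ny) (m11 + n)"
    and neg: "\<And>z. z \<in> carrier_vec ?Nd \<Longrightarrow> z \<noteq> 0\<^sub>v ?Nd \<Longrightarrow>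
      Re ((Q *\<^sub>v z) \<bullet>c z) + 2 * Re ((K *\<^sub>v (P *\<^sub>v z)) \<bullet>c (Lam *\<^sub>v z)) < 0"
    by blast
  have design: "design_inequality m p n ny m11 A B C1 C2 D1 D2 \<gamma>b X K"
    unfolding design_inequality_iff[OF X Xh K]
  proof (intro ballI impI)
    fix x1 x2 u v :: "complex vec"
    assume x1: "x1 \<in> carrier_vec m" and x2: "x2 \<in> carrier_vec m11" and u: "u \<in> carrier_vec n" and v: "v \<in> carrier_vec p"
      and nz: "(x1 @\<^sub>v x2) @\<^sub>v u @\<^sub>v v \<noteq> 0\<^sub>v ?Nd"
    show "open_form \<gamma>b X x1 x2 u v
        + 2 * Re ((K *\<^sub>v (x2 @\<^sub>v u)) \<bullet>c (Lambda_mat m p n ny m11 C1 D1 X *\<^sub>v ((x1 @\<^sub>v x2) @\<^sub>v u @\<^sub>v v))) < 0"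
      using neg[OF append_carrier_vec[OF append_carrier_vec[OF x1 x2] append_carrier_vec[OF u v]] nz]
      unfolding Q_def Lam_def P_def Sigma_mat_form[OF X Xh x1 x2 u v] Pi_mat_mult[OF x1 x2 u v] by simp
  qed
  define K11 where "K11 = mat m11 m11 (\<lambda>(i, j). K $$ (i, j))"
  define K12 where "K12 = mat m11 n (\<lambda>(i, j). K $$ (i, m11 + j))"
  define K21 where "K21 = mat ny m11 (\<lambda>(i, j). K $$ (m11 + i, j))"
  define K22 where "K22 = mat ny n (\<lambda>(i, j). K $$ (m11 + i, m11 + j))"
  have "K = four_block_mat K11 K12 K21 K22"
    using K by (intro eq_matI) (auto simp: K11_def K12_def K21_def K22_def)
  then have "K = K_mat (K11\<^sup>\<dagger>) (K21\<^sup>\<dagger>) (K12\<^sup>\<dagger>) (K22\<^sup>\<dagger>)" by (simp add: K_mat_def)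
  moreover have "K11\<^sup>\<dagger> \<in> carrier_mat m11 m11" "K21\<^sup>\<dagger> \<in> carrier_mat m11 ny" "K12\<^sup>\<dagger> \<in> carrier_mat n m11" "K22\<^sup>\<dagger> \<in> carrier_mat n ny"
    by (rule adjoint_carrier, simp add: K11_def K12_def K21_def K22_def)+
  ultimately show ?thesis
    unfolding is_design_def using X Xpos design by blast
qed

end

section \<open>Stable proper rational functions\<close>

text \<open>The scalar functions that occur as entries: quotients of polynomials without poles in the
  closed right half-plane, infinity included.\<close>

definition stable_proper :: "(complex \<Rightarrow> complex) \<Rightarrow> bool" where
  "stable_proper f \<longleftrightarrow> (\<exists>p q. (\<forall>z. 0 \<le> Re z \<longrightarrow> poly q z \<noteq> 0) \<and> degree p \<le> degree q \<and>
     (\<forall>s. poly q s \<noteq> 0 \<longrightarrow> f s = poly p s / poly q s))"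

lemma stable_properE:
  assumes "stable_proper f"
  obtains p q where "\<And>z. 0 \<le> Re z \<Longrightarrow> poly q z \<noteq> 0" "q \<noteq> 0" "degree p \<le> degree q"
    "\<And>s. poly q s \<noteq> 0 \<Longrightarrow> f s = poly p s / poly q s"
proof -
  obtain p q where pq: "\<forall>z. 0 \<le> Re z \<longrightarrow> poly q z \<noteq> 0" "degree p \<le> degree q"
     "\<forall>s. poly q s \<noteq> 0 \<longrightarrow> f s = poly p s / poly q s"
    using assms unfolding stable_proper_def by blast
  have "poly q 0 \<noteq> 0" using pq(1) by simp
  then have "q \<noteq> 0" by auto
  then show ?thesis using that pq by blast
qed

lemma stable_proper_proper_rational: "stable_proper f \<Longrightarrow> proper_rational_fun f"
  unfolding proper_rational_fun_def by (metis stable_properE)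

text \<open>Finitely many poles in the open left half-plane keep a distance from the axis.\<close>

lemma finite_left_margin:
  assumes "finite R" "\<And>z. z \<in> R \<Longrightarrow> Re z < 0"
  obtains \<tau> where "\<tau> > 0" "\<And>z. z \<in> R \<Longrightarrow> Re z < - \<tau>"
proof -
  define \<tau> where "\<tau> = Min (insert 1 ((\<lambda>z. - Re z) ` R)) / 2"
  have pos: "0 < Min (insert 1 ((\<lambda>z. - Re z) ` R))"
    using assms by (subst Min_gr_iff) auto
  have "Re z < - \<tau>" if "z \<in> R" for z
  proof -
    have "Min (insert 1 ((\<lambda>z. - Re z) ` R)) \<le> - Re z"
      using assms(1) that by (intro Min_le) auto
    then show ?thesis using pos by (simp add: \<tau>_def)
  qed
  then show ?thesis using that[of \<tau>] pos by (simp add: \<tau>_def)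
qed

lemma open_right_of: "open {s. Re s > (t::real)}"
  by (simp add: open_halfspace_Re_gt)

lemma quotient_analytic:
  assumes "\<And>s. Re s > - \<tau> \<Longrightarrow> poly q s \<noteq> 0" "\<And>s. poly q s \<noteq> 0 \<Longrightarrow> f s = poly p s / poly q s"
  shows "f analytic_on {s. Re s > - \<tau>}"
proof -
  have "(\<lambda>s. poly p s / poly q s) holomorphic_on {s. Re s > - \<tau>}"
    using assms(1) by (intro holomorphic_intros) auto
  then have "f holomorphic_on {s. Re s > - \<tau>}"
    by (rule holomorphic_transform) (use assms in auto)
  then show ?thesis by (simp add: analytic_on_open open_right_of)
qed

lemma stable_proper_analytic:
  assumes "stable_proper f"
  obtains \<tau> where "\<tau> > 0" "f analytic_on {s. Re s > - \<tau>}"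
proof -
  obtain p q where pq: "\<And>z. 0 \<le> Re z \<Longrightarrow> poly q z \<noteq> 0" "q \<noteq> 0"
    "\<And>s. poly q s \<noteq> 0 \<Longrightarrow> f s = poly p s / poly q s"
    using stable_properE[OF assms] by metis
  have "finite {z. poly q z = 0}" using pq(2) by (rule poly_roots_finite)
  moreover have "Re z < 0" if "z \<in> {z. poly q z = 0}" for z
    using pq(1)[of z] that by (meson linorder_not_le mem_Collect_eq)
  ultimately obtain \<tau> where \<tau>: "\<tau> > 0" "\<And>z. z \<in> {z. poly q z = 0} \<Longrightarrow> Re z < - \<tau>"
    using finite_left_margin by metis
  have "f analytic_on {s. Re s > - \<tau>}"
  proof (rule quotient_analytic[OF _ pq(3)])
    fix s assume "- \<tau> < Re s"
    then show "poly q s \<noteq> 0" using \<tau>(2)[of s] by auto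
  qed
  then show ?thesis using \<tau>(1) that by blast
qed

lemma stable_fun_if_analytic:
  assumes "\<tau> > 0" "f analytic_on {s. Re s > - \<tau>}"
  shows "stable_fun f"
  unfolding stable_fun_def
proof (intro allI impI)
  fix z assume "is_pole f z"
  show "Re z < 0"
  proof (rule ccontr)
    assume "\<not> Re z < 0"
    then have "f analytic_on {z}" using assms by (intro analytic_on_subset[OF assms(2)]) auto
    then show False using \<open>is_pole f z\<close> analytic_at_imp_no_pole by blast
  qed
qed

lemma axis_continuous_if_analytic:
  assumes "\<tau> > 0" "f analytic_on {s. Re s > - \<tau>}"
  shows "continuous_on UNIV (\<lambda>\<omega>. f (\<i> * complex_of_real \<omega>))"
proof -
  have "continuous_on {s. Re s > - \<tau>} f"
    using assms(2) by (intro holomorphic_on_imp_continuous_on analytic_imp_holomorphic)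
  then show ?thesis
    by (rule continuous_on_compose2) (use assms(1) in \<open>auto intro!: continuous_intros\<close>)
qed

lemma poly_over_power_tendsto:
  fixes p :: "complex poly"
  assumes "degree p \<le> n"
  shows "((\<lambda>s. poly p s / s ^ n) \<longlongrightarrow> coeff p n) at_infinity"
proof -
  have ev: "\<forall>\<^sub>F s in at_infinity. (\<Sum>k\<le>n. coeff p k * inverse s ^ (n - k)) = poly p s / s ^ n"
    using eventually_not_equal_at_infinity[of 0]
  proof eventually_elim
    case (elim s)
    have "poly p s = (\<Sum>k\<le>n. coeff p k * s ^ k)"
      unfolding poly_altdef by (rule sum.mono_neutral_left) (use assms in \<open>auto simp: coeff_eq_0\<close>)
    moreover have "coeff p k * s ^ k / s ^ n = coeff p k * inverse s ^ (n - k)" if "k \<le> n" for k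
      using elim that by (simp add: power_diff power_inverse field_simps)
    ultimately show ?case by (simp add: sum_divide_distrib)
  qed
  have "((\<lambda>s. \<Sum>k\<le>n. coeff p k * inverse s ^ (n - k)) \<longlongrightarrow> (\<Sum>k\<le>n. coeff p k * 0 ^ (n - k))) at_infinity"
    by (intro tendsto_intros tendsto_inverse_0)
  moreover have "(\<Sum>k\<le>n. coeff p k * 0 ^ (n - k)) = (\<Sum>k\<in>{n}. coeff p k * 0 ^ (n - k))"
    by (rule sum.mono_neutral_right) auto
  ultimately show ?thesis
    using Lim_transform_eventually[OF _ ev] by simp
qed

lemma quotient_tendsto_at_infinity:
  fixes p q :: "complex poly"
  assumes "q \<noteq> 0" "degree p \<le> degree q"
  shows "((\<lambda>s. poly p s / poly q s) \<longlongrightarrow> coeff p (degree q) / lead_coeff q) at_infinity"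
proof -
  have "((\<lambda>s. (poly p s / s ^ degree q) / (poly q s / s ^ degree q)) \<longlongrightarrow> coeff p (degree q) / lead_coeff q) at_infinity"
    using assms by (intro tendsto_divide poly_over_power_tendsto) auto
  moreover have "\<forall>\<^sub>F s in at_infinity. (poly p s / s ^ degree q) / (poly q s / s ^ degree q) = poly p s / poly q s"
    using eventually_not_equal_at_infinity[of 0] by eventually_elim auto
  ultimately show ?thesis by (rule Lim_transform_eventually)
qed

lemma axis_at_infinity:
  "filterlim (\<lambda>\<omega>. \<i> * complex_of_real \<omega>) at_infinity at_top"
  "filterlim (\<lambda>\<omega>. \<i> * complex_of_real \<omega>) at_infinity at_bot"
proof -
  have "filterlim (\<lambda>\<omega>. norm (\<omega> :: real)) at_top at_top"
    by (rule filterlim_mono[OF filterlim_norm_at_top order_refl at_top_le_at_infinity])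
  then show "filterlim (\<lambda>\<omega>. \<i> * complex_of_real \<omega>) at_infinity at_top"
    by (simp add: filterlim_at_infinity_conv_norm_at_top norm_mult)
  have "filterlim (\<lambda>\<omega>. norm (\<omega> :: real)) at_top at_bot"
    by (rule filterlim_mono[OF filterlim_norm_at_top order_refl at_bot_le_at_infinity])
  then show "filterlim (\<lambda>\<omega>. \<i> * complex_of_real \<omega>) at_infinity at_bot"
    by (simp add: filterlim_at_infinity_conv_norm_at_top norm_mult)
qed

lemma stable_proper_axis_limit:
  assumes "stable_proper f"
  obtains L where "((\<lambda>\<omega>. f (\<i> * complex_of_real \<omega>)) \<longlongrightarrow> L) at_top" "((\<lambda>\<omega>. f (\<i> * complex_of_real \<omega>)) \<longlongrightarrow> L) at_bot"
proof -
  obtain p q where pq: "\<And>z. 0 \<le> Re z \<Longrightarrow> poly q z \<noteq> 0" "q \<noteq> 0" "degree p \<le> degree q"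
    "\<And>s. poly q s \<noteq> 0 \<Longrightarrow> f s = poly p s / poly q s"
    using stable_properE[OF assms] by metis
  have "f (\<i> * complex_of_real \<omega>) = poly p (\<i> * complex_of_real \<omega>) / poly q (\<i> * complex_of_real \<omega>)" for \<omega>
    by (rule pq(4)) (simp add: pq(1))
  then show ?thesis
    using that filterlim_compose[OF quotient_tendsto_at_infinity[OF pq(2,3)] axis_at_infinity(1)]
      filterlim_compose[OF quotient_tendsto_at_infinity[OF pq(2,3)] axis_at_infinity(2)] by simp
qed

text \<open>A pole in the closed right half-plane can only be apparent: a common root of numerator and
  denominator, which cancels without changing the difference of the degrees.\<close>

lemma cancel_right_roots:
  fixes p q :: "complex poly"
  assumes "q \<noteq> 0" and "\<And>s. poly q s \<noteq> 0 \<Longrightarrow> f s = poly p s / poly q s"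
    and "\<And>z. 0 \<le> Re z \<Longrightarrow> isCont f z"
  shows "\<exists>p' q'. (\<forall>z. 0 \<le> Re z \<longrightarrow> poly q' z \<noteq> 0) \<and> (degree p \<le> degree q \<longrightarrow> degree p' \<le> degree q') \<and>
     (\<forall>s. poly q' s \<noteq> 0 \<longrightarrow> f s = poly p' s / poly q' s)"
  using assms
proof (induction "degree q" arbitrary: p q rule: less_induct)
  case less
  show ?case
  proof (cases "\<exists>z. 0 \<le> Re z \<and> poly q z = 0")
    case False
    then show ?thesis using less.prems by blast
  next
    case True
    then obtain z where z: "0 \<le> Re z" "poly q z = 0" by blast
    then obtain q1 where q1: "q = [:- z, 1:] * q1" by (metis dvdE poly_eq_0_iff_dvd)
    have q10: "q1 \<noteq> 0" using less.prems(1) q1 by auto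
    have ev: "\<forall>\<^sub>F s in at z. poly q s \<noteq> 0"
    proof -
      have "open (- ({s. poly q s = 0} - {z}))"
        by (intro open_Compl finite_imp_closed finite_Diff poly_roots_finite less.prems(1))
      then show ?thesis
        unfolding eventually_at_topological by (intro exI[of _ "- ({s. poly q s = 0} - {z})"]) auto
    qed
    have contf: "(f \<longlongrightarrow> f z) (at z)" using less.prems(3)[OF z(1)] by (simp add: isCont_def)
    have "((\<lambda>s. f s * poly q s) \<longlongrightarrow> f z * poly q z) (at z)"
      by (intro tendsto_mult contf) (rule isCont_tendsto_compose[OF _ tendsto_ident_at], simp)
    moreover have "\<forall>\<^sub>F s in at z. f s * poly q s = poly p s"
      using ev by eventually_elim (simp add: less.prems(2))
    ultimately have "(poly p \<longlongrightarrow> f z * poly q z) (at z)" by (rule Lim_transform_eventually)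
    moreover have "(poly p \<longlongrightarrow> poly p z) (at z)"
      by (rule isCont_tendsto_compose[OF _ tendsto_ident_at]) simp
    ultimately have "poly p z = 0" using z(2) tendsto_unique[OF at_neq_bot] by fastforce
    then obtain p1 where p1: "p = [:- z, 1:] * p1" by (metis dvdE poly_eq_0_iff_dvd)
    have dq: "degree q = Suc (degree q1)" using q10 unfolding q1 by (subst degree_mult_eq) auto
    have dp: "degree p = Suc (degree p1) \<or> p1 = 0" unfolding p1 by (cases "p1 = 0") (auto simp: degree_mult_eq simp del: mult_pCons_left)
    have eq: "f s = poly p1 s / poly q1 s" if "poly q1 s \<noteq> 0" for s
    proof (cases "s = z")
      case False
      then show ?thesis using less.prems(2)[of s] that by (simp add: q1 p1 del: mult_pCons_left)
    next
      case True
      have "((\<lambda>s. poly p1 s / poly q1 s) \<longlongrightarrow> poly p1 z / poly q1 z) (at z)"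
        using that True by (intro tendsto_divide isCont_tendsto_compose[OF _ tendsto_ident_at]) auto
      moreover have "\<forall>\<^sub>F s in at z. poly p1 s / poly q1 s = f s"
        using ev by eventually_elim (use less.prems(2) in \<open>simp add: q1 p1 del: mult_pCons_left\<close>)
      ultimately have "(f \<longlongrightarrow> poly p1 z / poly q1 z) (at z)" by (rule Lim_transform_eventually)
      then show ?thesis using contf True tendsto_unique[OF at_neq_bot] by blast
    qed
    obtain p' q' where "\<forall>z. 0 \<le> Re z \<longrightarrow> poly q' z \<noteq> 0" "degree p1 \<le> degree q1 \<longrightarrow> degree p' \<le> degree q'"
     "\<forall>s. poly q' s \<noteq> 0 \<longrightarrow> f s = poly p' s / poly q' s"
      using less.hyps[of q1 p1] dq q10 eq less.prems(3) by auto
    moreover have "degree p1 \<le> degree q1" if "degree p \<le> degree q" using that dp dq by auto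
    ultimately show ?thesis by blast
  qed
qed

lemma isCont_right_if_analytic:
  assumes "\<tau> > 0" "f analytic_on {s. Re s > - \<tau>}" "0 \<le> Re z"
  shows "isCont f z"
proof -
  have "f analytic_on {z}" using assms by (intro analytic_on_subset[OF assms(2)]) auto
  then show ?thesis by (rule analytic_at_imp_isCont)
qed

lemma stable_proper_if_proper:
  assumes "proper_rational_fun f" "\<tau> > 0" "f analytic_on {s. Re s > - \<tau>}"
  shows "stable_proper f"
proof -
  obtain p q where pq: "q \<noteq> 0" "degree p \<le> degree q" "\<forall>s. poly q s \<noteq> 0 \<longrightarrow> f s = poly p s / poly q s"
    using assms(1) unfolding proper_rational_fun_def by blast
  show ?thesis
    unfolding stable_proper_def
    using cancel_right_roots[OF pq(1), of f p] pq isCont_right_if_analytic[OF assms(2,3)] by blast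
qed

text \<open>Divide by \<open>x\<close> to the degree of \<open>p\<close>: if this exceeds the degree of \<open>q\<close>, the bound forces the leading coefficient of \<open>p\<close> to be \<open>0\<close>.\<close>

lemma degree_le_if_bounded:
  fixes p q :: "complex poly"
  assumes "q \<noteq> 0" and b: "\<And>x::real. x > 0 \<Longrightarrow> poly q (complex_of_real x) \<noteq> 0 \<Longrightarrow>
     cmod (poly p (complex_of_real x) / poly q (complex_of_real x)) \<le> b"
  shows "degree p \<le> degree q"
proof (rule ccontr)
  assume "\<not> degree p \<le> degree q"
  then have d: "degree q < degree p" by simp
  have inf: "filterlim complex_of_real at_infinity at_top"
    by (rule filterlim_of_real_at_infinity)
  have P: "((\<lambda>x. poly p (complex_of_real x) / complex_of_real x ^ degree p) \<longlongrightarrow> lead_coeff p) at_top"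
    by (rule filterlim_compose[OF poly_over_power_tendsto inf]) simp
  have "((\<lambda>x. poly q (complex_of_real x) / complex_of_real x ^ degree p) \<longlongrightarrow> coeff q (degree p)) at_top"
    by (rule filterlim_compose[OF poly_over_power_tendsto inf]) (use d in simp)
  then have Q: "((\<lambda>x. poly q (complex_of_real x) / complex_of_real x ^ degree p) \<longlongrightarrow> 0) at_top"
    using d by (simp add: coeff_eq_0)
  have nz: "\<forall>\<^sub>F x in at_top. poly q (complex_of_real x) \<noteq> 0"
  proof -
    define S where "S = insert 0 (complex_of_real -` {z. poly q z = 0})"
    have "finite (complex_of_real -` {z. poly q z = 0})"
      using poly_roots_finite[OF assms(1)] by (rule finite_vimageI) (simp add: inj_def)
    then have S: "finite S" by (simp add: S_def)
    show ?thesis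
      using eventually_gt_at_top[of "Max S"]
    proof eventually_elim
      case (elim x)
      then have "x \<notin> S" using Max_ge[OF S, of x] by linarith
      then show ?case by (simp add: S_def)
    qed
  qed
  have "((\<lambda>x. cmod (poly p (complex_of_real x) / complex_of_real x ^ degree p)) \<longlongrightarrow> 0) at_top"
  proof (rule tendsto_sandwich)
    show "\<forall>\<^sub>F x in at_top. 0 \<le> cmod (poly p (complex_of_real x) / complex_of_real x ^ degree p)" by simp
    show "\<forall>\<^sub>F x in at_top. cmod (poly p (complex_of_real x) / complex_of_real x ^ degree p)
        \<le> b * cmod (poly q (complex_of_real x) / complex_of_real x ^ degree p)"
      using nz eventually_gt_at_top[of 0]
    proof eventually_elim
      case (elim x)
      have "cmod (poly p (complex_of_real x)) \<le> b * cmod (poly q (complex_of_real x))"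
        using b[OF elim(2,1)] elim by (simp add: norm_divide field_simps)
      then show ?case by (simp add: norm_divide divide_right_mono)
    qed
    have "((\<lambda>x. b * cmod (poly q (complex_of_real x) / complex_of_real x ^ degree p)) \<longlongrightarrow> b * cmod 0) at_top"
      by (intro tendsto_intros Q)
    then show "((\<lambda>x. b * cmod (poly q (complex_of_real x) / complex_of_real x ^ degree p)) \<longlongrightarrow> 0) at_top" by simp
  qed simp
  moreover have "((\<lambda>x. cmod (poly p (complex_of_real x) / complex_of_real x ^ degree p)) \<longlongrightarrow> cmod (lead_coeff p)) at_top"
    by (intro tendsto_norm P)
  ultimately have "cmod (lead_coeff p) = 0" using tendsto_unique[OF trivial_limit_at_top_linorder] by blast
  then show False using d by auto
qed

text \<open>Boundedness on the positive reals gives properness.\<close>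

lemma stable_proper_if_hardy:
  assumes "rational_fun f" "\<tau> > 0" "f analytic_on {s. Re s > - \<tau>}" "hardy_inf_fun f"
  shows "stable_proper f"
proof -
  obtain p0 q0 where pq0: "q0 \<noteq> 0" "\<forall>s. poly q0 s \<noteq> 0 \<longrightarrow> f s = poly p0 s / poly q0 s"
    using assms(1) unfolding rational_fun_def by blast
  obtain p q where pq: "\<forall>z. 0 \<le> Re z \<longrightarrow> poly q z \<noteq> 0" "\<forall>s. poly q s \<noteq> 0 \<longrightarrow> f s = poly p s / poly q s"
    using cancel_right_roots[OF pq0(1), of f p0] pq0 isCont_right_if_analytic[OF assms(2,3)] by blast
  obtain b where b: "\<And>s. Re s > 0 \<Longrightarrow> cmod (f s) \<le> b"
    using assms(4) unfolding hardy_inf_fun_def bounded_iff by auto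
  have "q \<noteq> 0" using pq(1)[rule_format, of 0] by auto
  then have "degree p \<le> degree q"
    using b pq by (intro degree_le_if_bounded[of q p b]) (metis Re_complex_of_real)+
  then show ?thesis unfolding stable_proper_def using pq by blast
qed

section \<open>Transfer functions\<close>

lemma degree_det_le:
  fixes M :: "complex poly mat"
  assumes M: "M \<in> carrier_mat n n" and deg: "\<And>i j. i < n \<Longrightarrow> j < n \<Longrightarrow> degree (M $$ (i, j)) \<le> 1"
  shows "degree (Determinant.det M) \<le> n"
proof -
  have "degree (signof \<pi> * (\<Prod>i = 0..<n. M $$ (i, \<pi> i))) \<le> n" if \<pi>: "\<pi> permutes {0..<n}" for \<pi>
  proof -
    have "degree (\<Prod>i = 0..<n. M $$ (i, \<pi> i)) \<le> sum (degree \<circ> (\<lambda>i. M $$ (i, \<pi> i))) {0..<n}"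
      by (rule degree_prod_sum_le) simp
    also have "\<dots> \<le> (\<Sum>i = 0..<n. 1)"
    proof (rule sum_mono)
      fix i assume i: "i \<in> {0..<n}"
      then have "\<pi> i \<in> {0..<n}" using permutes_in_image[OF \<pi>] by blast
      then show "(degree \<circ> (\<lambda>i. M $$ (i, \<pi> i))) i \<le> 1" using deg[of i "\<pi> i"] i by simp
    qed
    finally show ?thesis by simp
  qed
  then show ?thesis
    unfolding det_def'[OF M] by (intro degree_sum_le) (auto simp: finite_permutations)
qed

definition resolvent :: "complex mat \<Rightarrow> complex \<Rightarrow> complex mat" where
  "resolvent A s = the (mat_inverse (s \<cdot>\<^sub>m 1\<^sub>m (dim_row A) - A))"

lemma char_poly_det:
  fixes A :: "complex mat"
  assumes A: "A \<in> carrier_mat n n"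
  shows "poly (char_poly A) s = Determinant.det (s \<cdot>\<^sub>m 1\<^sub>m n - A)"
proof -
  have "- char_matrix A s = s \<cdot>\<^sub>m 1\<^sub>m n - A"
    using A by (intro eq_matI) (auto simp: char_matrix_def)
  then show ?thesis using char_poly_matrix[OF A] by simp
qed

lemma resolvent_inverse:
  fixes A :: "complex mat"
  assumes A: "A \<in> carrier_mat n n" and s: "poly (char_poly A) s \<noteq> 0"
  shows "resolvent A s \<in> carrier_mat n n" "(s \<cdot>\<^sub>m 1\<^sub>m n - A) * resolvent A s = 1\<^sub>m n"
    "resolvent A s * (s \<cdot>\<^sub>m 1\<^sub>m n - A) = 1\<^sub>m n"
proof -
  have M: "s \<cdot>\<^sub>m 1\<^sub>m n - A \<in> carrier_mat n n" using A by (rule minus_carrier_mat)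
  have inj: "x = 0\<^sub>v n" if "x \<in> carrier_vec n" "(s \<cdot>\<^sub>m 1\<^sub>m n - A) *\<^sub>v x = 0\<^sub>v n" for x
    using det_0_iff_vec_prod_zero_field[OF M] s that unfolding char_poly_det[OF A] by blast
  obtain N where N: "N \<in> carrier_mat n n" "(s \<cdot>\<^sub>m 1\<^sub>m n - A) * N = 1\<^sub>m n" "N * (s \<cdot>\<^sub>m 1\<^sub>m n - A) = 1\<^sub>m n"
      "mat_inverse (s \<cdot>\<^sub>m 1\<^sub>m n - A) = Some N"
    using inverse_if_injective[OF M inj] by metis
  then have "resolvent A s = N" using A by (simp add: resolvent_def)
  then show "resolvent A s \<in> carrier_mat n n" "(s \<cdot>\<^sub>m 1\<^sub>m n - A) * resolvent A s = 1\<^sub>m n"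
    "resolvent A s * (s \<cdot>\<^sub>m 1\<^sub>m n - A) = 1\<^sub>m n" using N by simp_all
qed

text \<open>Cramer's rule: the entries of the resolvent share the characteristic polynomial as their
  denominator.\<close>

lemma resolvent_entries:
  fixes A :: "complex mat"
  assumes A: "A \<in> carrier_mat n n"
  obtains P where "\<And>i j. i < n \<Longrightarrow> j < n \<Longrightarrow> degree (P i j) \<le> n"
    "\<And>s i j. poly (char_poly A) s \<noteq> 0 \<Longrightarrow> i < n \<Longrightarrow> j < n \<Longrightarrow>
      resolvent A s $$ (i, j) = poly (P i j) s / poly (char_poly A) s"
proof -
  define P where "P i j = cofactor (char_poly_matrix A) j i" for i j
  have cM: "char_poly_matrix A \<in> carrier_mat n n" using A by simp
  have dims: "dim_row (char_poly_matrix A) = n" "dim_col (char_poly_matrix A) = n" using cM by auto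
  have entry: "char_poly_matrix A $$ (i, j) = (if i = j then [:- A $$ (i, j), 1:] else [:- A $$ (i, j):])" if "i < n" "j < n" for i j
    using A that by (simp add: char_poly_matrix_def)
  have "degree (P i j) \<le> n" if ij: "i < n" "j < n" for i j
  proof -
    let ?D = "mat_delete (char_poly_matrix A) j i"
    have D: "?D \<in> carrier_mat (n - 1) (n - 1)" using mat_delete_carrier[OF cM] .
    have "degree (Determinant.det ?D) \<le> n - 1"
    proof (rule degree_det_le[OF D])
      fix a b assume ab: "a < n - 1" "b < n - 1"
      have "?D $$ (a, b) = char_poly_matrix A $$ (if a < j then a else Suc a, if b < i then b else Suc b)"
        using ab cM by (simp add: mat_delete_def)
      also have "degree \<dots> \<le> 1" using ab by (subst entry) (auto split: if_splits)
      finally show "degree (?D $$ (a, b)) \<le> 1" .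
    qed
    moreover have "degree (P i j) = degree (Determinant.det ?D)"
      unfolding P_def cofactor_def by (cases "even (i + j)") (auto simp: add.commute)
    ultimately show ?thesis by simp
  qed
  moreover have "resolvent A s $$ (i, j) = poly (P i j) s / poly (char_poly A) s"
    if s: "poly (char_poly A) s \<noteq> 0" and ij: "i < n" "j < n" for s i j
  proof -
    let ?M = "s \<cdot>\<^sub>m 1\<^sub>m n - A"
    note R = resolvent_inverse[OF A s]
    have M: "?M \<in> carrier_mat n n" using A by (rule minus_carrier_mat)
    note adj = adj_mat[OF M]
    have "resolvent A s * (?M * adj_mat ?M) = adj_mat ?M"
      unfolding assoc_mult_mat[OF R(1) M adj(1), symmetric] R(3) using adj(1) by simp
    moreover have "resolvent A s * (?M * adj_mat ?M) = Determinant.det ?M \<cdot>\<^sub>m resolvent A s"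
      unfolding adj(2) using mult_smult_distrib[OF R(1) one_carrier_mat, of "Determinant.det ?M"] R(1) by simp
    ultimately have "Determinant.det ?M * resolvent A s $$ (i, j) = adj_mat ?M $$ (i, j)"
      using R(1) ij by (metis carrier_matD index_smult_mat(1))
    moreover have "adj_mat ?M $$ (i, j) = cofactor ?M j i"
      using ij A by (simp add: adj_mat_def)
    moreover have "cofactor ?M j i = poly (P i j) s"
    proof -
      have "poly (Determinant.det (mat_delete (char_poly_matrix A) j i)) s = Determinant.det (mat_delete ?M j i)"
      proof (rule poly_det_cong[OF mat_delete_carrier[OF M] mat_delete_carrier[OF cM]])
        fix a b assume ab: "a < n - 1" "b < n - 1"
        show "poly (mat_delete (char_poly_matrix A) j i $$ (a, b)) s = mat_delete ?M j i $$ (a, b)"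
          using ab A dims by (simp add: mat_delete_def entry)
      qed
      then show ?thesis by (simp add: P_def cofactor_def poly_power)
    qed
    ultimately show ?thesis using s unfolding char_poly_det[OF A] by (simp add: field_simps)
  qed
  ultimately show ?thesis using that by blast
qed

lemma transfer_fun_carrier:
  assumes "B \<in> carrier_mat q c" "C \<in> carrier_mat r q" "D \<in> carrier_mat r c"
  shows "transfer_fun A B C D s \<in> carrier_mat r c"
  using assms unfolding transfer_fun_def by auto

lemma transfer_fun_stable_proper:
  assumes A: "A \<in> carrier_mat q q" and B: "B \<in> carrier_mat q c" and C: "C \<in> carrier_mat r q" and D: "D \<in> carrier_mat r c"
    and h: "hurwitz A" and ij: "i < r" "j < c"
  shows "stable_proper (\<lambda>s. transfer_fun A B C D s $$ (i, j))"
proof -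
  obtain P where P: "\<And>i j. i < q \<Longrightarrow> j < q \<Longrightarrow> degree (P i j) \<le> q"
    "\<And>s i j. poly (char_poly A) s \<noteq> 0 \<Longrightarrow> i < q \<Longrightarrow> j < q \<Longrightarrow>
      resolvent A s $$ (i, j) = poly (P i j) s / poly (char_poly A) s"
    using resolvent_entries[OF A] by metis
  define N where "N = Polynomial.smult (D $$ (i, j)) (char_poly A) + (\<Sum>l<q. \<Sum>k<q. Polynomial.smult (C $$ (i, k) * B $$ (l, j)) (P k l))"
  have deg: "degree (char_poly A) = q" using degree_monic_char_poly[OF A] by simp
  have "degree N \<le> q"
    unfolding N_def
    by (intro degree_add_le degree_sum_le order_trans[OF degree_smult_le] P(1)) (auto simp: deg)
  moreover have "poly (char_poly A) z \<noteq> 0" if "0 \<le> Re z" for z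
    using h that unfolding hurwitz_def eigenvalue_root_char_poly[OF A] by force
  moreover have "transfer_fun A B C D s $$ (i, j) = poly N s / poly (char_poly A) s" if s: "poly (char_poly A) s \<noteq> 0" for s
  proof -
    note R = resolvent_inverse(1)[OF A s]
    have "transfer_fun A B C D s $$ (i, j) = D $$ (i, j) + (C * resolvent A s * B) $$ (i, j)"
      using B C D R ij unfolding transfer_fun_def resolvent_def[symmetric] by simp
    also have "(C * resolvent A s * B) $$ (i, j) = (\<Sum>l<q. (\<Sum>k<q. C $$ (i, k) * resolvent A s $$ (k, l)) * B $$ (l, j))"
      using mult_mat_sum[OF mult_carrier_mat[OF C R] B ij] mult_mat_sum[OF C R ij(1)] by simp
    also have "\<dots> = (\<Sum>l<q. \<Sum>k<q. C $$ (i, k) * B $$ (l, j) * poly (P k l) s) / poly (char_poly A) s"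
      unfolding sum_divide_distrib sum_distrib_right by (intro sum.cong refl) (simp add: P(2)[OF s])
    also have "D $$ (i, j) + \<dots> = poly N s / poly (char_poly A) s"
      using s by (simp add: N_def poly_sum field_simps)
    finally show ?thesis .
  qed
  ultimately show ?thesis
    unfolding stable_proper_def by (intro exI[of _ N] exI[of _ "char_poly A"]) (simp add: deg)
qed

text \<open>The adjoint of a transfer function is driven by the adjoint system.\<close>

lemma adjoint_resolvent:
  fixes A :: "complex mat"
  assumes A: "A \<in> carrier_mat q q" and s: "poly (char_poly A) s \<noteq> 0" and b: "b \<in> carrier_vec q"
  shows "cnj s \<cdot>\<^sub>v ((resolvent A s)\<^sup>\<dagger> *\<^sub>v b) = A\<^sup>\<dagger> *\<^sub>v ((resolvent A s)\<^sup>\<dagger> *\<^sub>v b) + b"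
proof -
  note R = resolvent_inverse[OF A s]
  have M: "s \<cdot>\<^sub>m 1\<^sub>m q - A \<in> carrier_mat q q" using A by (rule minus_carrier_mat)
  define x where "x = (resolvent A s)\<^sup>\<dagger> *\<^sub>v b"
  have x: "x \<in> carrier_vec q" unfolding x_def by (rule mult_mat_vec_carrier[OF adjoint_carrier[OF R(1)] b])
  have "(s \<cdot>\<^sub>m 1\<^sub>m q - A)\<^sup>\<dagger> * (resolvent A s)\<^sup>\<dagger> = 1\<^sub>m q"
    unfolding adjoint_mult[OF R(1) M, symmetric] R(3) by simp
  then have "(s \<cdot>\<^sub>m 1\<^sub>m q - A)\<^sup>\<dagger> *\<^sub>v x = b"
    unfolding x_def assoc_mult_mat_vec[OF adjoint_carrier[OF M] adjoint_carrier[OF R(1)] b, symmetric] using b by simp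
  moreover have "(s \<cdot>\<^sub>m 1\<^sub>m q - A)\<^sup>\<dagger> = cnj s \<cdot>\<^sub>m 1\<^sub>m q - A\<^sup>\<dagger>"
  proof (rule eq_matI)
    fix i j assume "i < dim_row (cnj s \<cdot>\<^sub>m 1\<^sub>m q - A\<^sup>\<dagger>)" "j < dim_col (cnj s \<cdot>\<^sub>m 1\<^sub>m q - A\<^sup>\<dagger>)"
    then have ij: "i < q" "j < q" using A by auto
    then show "(s \<cdot>\<^sub>m 1\<^sub>m q - A)\<^sup>\<dagger> $$ (i, j) = (cnj s \<cdot>\<^sub>m 1\<^sub>m q - A\<^sup>\<dagger>) $$ (i, j)"
      using A by (subst adjoint_index) auto
  qed (use A in auto)
  moreover have "(cnj s \<cdot>\<^sub>m 1\<^sub>m q) *\<^sub>v x = cnj s \<cdot>\<^sub>v x"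
    using smult_mat_mult_vec[OF one_carrier_mat x] x by simp
  ultimately have b': "b = cnj s \<cdot>\<^sub>v x + - (A\<^sup>\<dagger> *\<^sub>v x)"
    using minus_mult_mat_vec[OF smult_carrier_mat[OF one_carrier_mat] adjoint_carrier[OF A] x] by simp
  have "A\<^sup>\<dagger> *\<^sub>v x \<in> carrier_vec q" by (rule mult_mat_vec_carrier[OF adjoint_carrier[OF A] x])
  then have "cnj s \<cdot>\<^sub>v x = A\<^sup>\<dagger> *\<^sub>v x + b"
    unfolding b' using x A by (intro eq_vecI) auto
  then show ?thesis by (simp add: x_def)
qed

lemma transfer_fun_adjoint:
  fixes A B C D :: "complex mat"
  assumes A: "A \<in> carrier_mat q q" and B: "B \<in> carrier_mat q c" and C: "C \<in> carrier_mat r q" and D: "D \<in> carrier_mat r c"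
    and s: "poly (char_poly A) s \<noteq> 0" and y: "y \<in> carrier_vec r"
  obtains x where "x \<in> carrier_vec q" "cnj s \<cdot>\<^sub>v x = A\<^sup>\<dagger> *\<^sub>v x + C\<^sup>\<dagger> *\<^sub>v y"
    "(transfer_fun A B C D s)\<^sup>\<dagger> *\<^sub>v y = B\<^sup>\<dagger> *\<^sub>v x + D\<^sup>\<dagger> *\<^sub>v y"
proof -
  note R = resolvent_inverse[OF A s]
  note R' = adjoint_carrier[OF R(1)] and C' = adjoint_carrier[OF C] and B' = adjoint_carrier[OF B] and D' = adjoint_carrier[OF D]
  define x where "x = (resolvent A s)\<^sup>\<dagger> *\<^sub>v (C\<^sup>\<dagger> *\<^sub>v y)"
  have Cy: "C\<^sup>\<dagger> *\<^sub>v y \<in> carrier_vec q" by (rule mult_mat_vec_carrier[OF C' y])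
  have x: "x \<in> carrier_vec q" unfolding x_def by (rule mult_mat_vec_carrier[OF R' Cy])
  note CR = mult_carrier_mat[OF C R(1)]
  have adj: "(transfer_fun A B C D s)\<^sup>\<dagger> = D\<^sup>\<dagger> + B\<^sup>\<dagger> * ((resolvent A s)\<^sup>\<dagger> * C\<^sup>\<dagger>)"
  proof -
    have "(transfer_fun A B C D s)\<^sup>\<dagger> = D\<^sup>\<dagger> + (C * resolvent A s * B)\<^sup>\<dagger>"
    proof (rule eq_matI)
      fix i j assume "i < dim_row (D\<^sup>\<dagger> + (C * resolvent A s * B)\<^sup>\<dagger>)" "j < dim_col (D\<^sup>\<dagger> + (C * resolvent A s * B)\<^sup>\<dagger>)"
      then have ij: "i < c" "j < r" using B C by auto
      have T: "transfer_fun A B C D s = D + C * resolvent A s * B"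
        by (simp add: transfer_fun_def resolvent_def)
      show "(transfer_fun A B C D s)\<^sup>\<dagger> $$ (i, j) = (D\<^sup>\<dagger> + (C * resolvent A s * B)\<^sup>\<dagger>) $$ (i, j)"
        unfolding T using B C D ij by (simp add: adjoint_index del: index_mult_mat(1))
    qed (use B C D in \<open>auto simp: transfer_fun_def\<close>)
    also have "(C * resolvent A s * B)\<^sup>\<dagger> = B\<^sup>\<dagger> * ((resolvent A s)\<^sup>\<dagger> * C\<^sup>\<dagger>)"
      unfolding adjoint_mult[OF CR B] adjoint_mult[OF C R(1)] ..
    finally show ?thesis .
  qed
  note RC = mult_carrier_mat[OF R' C']
  have Bx: "B\<^sup>\<dagger> *\<^sub>v x \<in> carrier_vec c" and Dy: "D\<^sup>\<dagger> *\<^sub>v y \<in> carrier_vec c"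
    by (rule mult_mat_vec_carrier[OF B' x], rule mult_mat_vec_carrier[OF D' y])
  have "(transfer_fun A B C D s)\<^sup>\<dagger> *\<^sub>v y = D\<^sup>\<dagger> *\<^sub>v y + B\<^sup>\<dagger> *\<^sub>v x"
    unfolding adj add_mult_distrib_mat_vec[OF D' mult_carrier_mat[OF B' RC] y] assoc_mult_mat_vec[OF B' RC y]
      assoc_mult_mat_vec[OF R' C' y] x_def ..
  also have "\<dots> = B\<^sup>\<dagger> *\<^sub>v x + D\<^sup>\<dagger> *\<^sub>v y" by (rule comm_add_vec[OF Dy Bx])
  finally show ?thesis using that[OF x] adjoint_resolvent[OF A s Cy] by (simp add: x_def)
qed

section \<open>The closed loop\<close>

context factor_realization
begin

text \<open>Along a trajectory \<open>exp (cnj s * t)\<close> of the adjoint closed loop the design form is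
  \<open>2 Re s\<close> times the storage, plus the output energy, less \<open>\<gamma>b\<^sup>2\<close> times the input energy.\<close>

lemma closed_loop_dissipation:
  assumes X: "X \<in> carrier_mat (m + m11) (m + m11)" "X\<^sup>\<dagger> = X"
    and dims: "A11 \<in> carrier_mat m11 m11" "B11 \<in> carrier_mat m11 ny" "C11 \<in> carrier_mat n m11" "J11 \<in> carrier_mat n ny"
    and ineq: "design_inequality m p n ny m11 A B C1 C2 D1 D2 \<gamma>b X (K_mat A11 B11 C11 J11)"
    and x1: "x1 \<in> carrier_vec m" and x2: "x2 \<in> carrier_vec m11" and u: "u \<in> carrier_vec n"
    and k: "k = B11\<^sup>\<dagger> *\<^sub>v x2 + J11\<^sup>\<dagger> *\<^sub>v u"
    and v: "v = B\<^sup>\<dagger> *\<^sub>v x1 + (D1\<^sup>\<dagger> *\<^sub>v k + D2\<^sup>\<dagger> *\<^sub>v u)"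
    and eq1: "cnj s \<cdot>\<^sub>v x1 = A\<^sup>\<dagger> *\<^sub>v x1 + (C1\<^sup>\<dagger> *\<^sub>v k + C2\<^sup>\<dagger> *\<^sub>v u)"
    and eq2: "cnj s \<cdot>\<^sub>v x2 = A11\<^sup>\<dagger> *\<^sub>v x2 + C11\<^sup>\<dagger> *\<^sub>v u"
    and nz: "x2 \<noteq> 0\<^sub>v m11 \<or> u \<noteq> 0\<^sub>v n"
  shows "2 * Re s * Re ((X *\<^sub>v (x1 @\<^sub>v x2)) \<bullet>c (x1 @\<^sub>v x2)) + sqnorm v < \<gamma>b\<^sup>2 * sqnorm u"
proof -
  note A' = adjoint_carrier[OF A] and B' = adjoint_carrier[OF B] and C1' = adjoint_carrier[OF C1]
    and C2' = adjoint_carrier[OF C2] and D1' = adjoint_carrier[OF D1] and D2' = adjoint_carrier[OF D2]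
  note A11' = adjoint_carrier[OF dims(1)] and B11' = adjoint_carrier[OF dims(2)]
    and C11' = adjoint_carrier[OF dims(3)] and J11' = adjoint_carrier[OF dims(4)]
  have kc: "k \<in> carrier_vec ny"
    unfolding k by (rule add_carrier_vec[OF mult_mat_vec_carrier[OF B11' x2] mult_mat_vec_carrier[OF J11' u]])
  have c: "A\<^sup>\<dagger> *\<^sub>v x1 \<in> carrier_vec m" "C2\<^sup>\<dagger> *\<^sub>v u \<in> carrier_vec m" "C1\<^sup>\<dagger> *\<^sub>v k \<in> carrier_vec m"
    "B\<^sup>\<dagger> *\<^sub>v x1 \<in> carrier_vec p" "D2\<^sup>\<dagger> *\<^sub>v u \<in> carrier_vec p" "D1\<^sup>\<dagger> *\<^sub>v k \<in> carrier_vec p"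
    by (rule mult_mat_vec_carrier[OF A' x1] mult_mat_vec_carrier[OF C2' u] mult_mat_vec_carrier[OF C1' kc]
      mult_mat_vec_carrier[OF B' x1] mult_mat_vec_carrier[OF D2' u] mult_mat_vec_carrier[OF D1' kc])+
  have vc: "v \<in> carrier_vec p" unfolding v by (rule add_carrier_vec[OF c(4) add_carrier_vec[OF c(6,5)]])
  have x: "x1 @\<^sub>v x2 \<in> carrier_vec (m + m11)" by (rule append_carrier_vec[OF x1 x2])
  obtain w1 w2 where w1: "w1 \<in> carrier_vec m" and w2: "w2 \<in> carrier_vec m11" and Xw: "X *\<^sub>v (x1 @\<^sub>v x2) = w1 @\<^sub>v w2"
    using append_vec_cases[OF mult_mat_vec_carrier[OF X(1) x]] by metis
  have K: "K_mat A11 B11 C11 J11 \<in> carrier_mat (m11 + ny) (m11 + n)"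
    unfolding K_mat_def by (rule four_block_carrier_mat[OF A11' J11'])
  have Kv: "K_mat A11 B11 C11 J11 *\<^sub>v (x2 @\<^sub>v u) = (cnj s \<cdot>\<^sub>v x2) @\<^sub>v k"
    unfolding K_mat_def four_block_mat_mult_vec[OF A11' C11' B11' J11' x2 u] eq2 k ..
  have nz': "(x1 @\<^sub>v x2) @\<^sub>v u @\<^sub>v v \<noteq> 0\<^sub>v ((m + m11) + (n + p))"
    using nz unfolding append_vec_eq_0[OF x append_carrier_vec[OF u vc]] append_vec_eq_0[OF x1 x2] append_vec_eq_0[OF u vc] by blast
  have D1v: "D1 *\<^sub>v v \<in> carrier_vec ny" and C1w: "C1 *\<^sub>v w1 \<in> carrier_vec ny"
    by (rule mult_mat_vec_carrier[OF D1 vc], rule mult_mat_vec_carrier[OF C1 w1])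
  have e1: "open_form \<gamma>b X x1 x2 u v + 2 * Re (((cnj s \<cdot>\<^sub>v x2) @\<^sub>v k) \<bullet>c (w2 @\<^sub>v (C1 *\<^sub>v w1 + D1 *\<^sub>v v))) < 0"
    using ineq[unfolded design_inequality_iff[OF X K], rule_format, OF x1 x2 u vc nz']
    unfolding Kv Lambda_mat_mult[OF X(1) x Xw w1 w2 u vc] .
  have e2: "((cnj s \<cdot>\<^sub>v x2) @\<^sub>v k) \<bullet>c (w2 @\<^sub>v (C1 *\<^sub>v w1 + D1 *\<^sub>v v))
      = cnj s * (x2 \<bullet>c w2) + ((C1\<^sup>\<dagger> *\<^sub>v k) \<bullet>c w1 + (D1\<^sup>\<dagger> *\<^sub>v k) \<bullet>c v)"
    unfolding inner_append[OF smult_carrier_vec[THEN iffD2, OF x2] kc w2 add_carrier_vec[OF C1w D1v]] inner_smult_left[OF x2 w2]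
      inner_add_right[OF kc C1w D1v] inner_adjoint'[OF C1 kc w1] inner_adjoint'[OF D1 kc vc] ..
  have e3: "open_form \<gamma>b X x1 x2 u v
      = 2 * Re (((A\<^sup>\<dagger> *\<^sub>v x1) \<bullet>c w1 + (C2\<^sup>\<dagger> *\<^sub>v u) \<bullet>c w1) + ((B\<^sup>\<dagger> *\<^sub>v x1) \<bullet>c v + (D2\<^sup>\<dagger> *\<^sub>v u) \<bullet>c v)) - \<gamma>b\<^sup>2 * sqnorm u - sqnorm v"
    unfolding open_form_def Let_def Xw inner_append[OF add_carrier_vec[OF c(1,2)] zero_carrier_vec w1 w2]
      inner_add_left[OF c(1,2) w1] inner_add_left[OF c(4,5) vc] inner_zero_left[OF w2] by simp
  have e4: "(A\<^sup>\<dagger> *\<^sub>v x1) \<bullet>c w1 + ((C1\<^sup>\<dagger> *\<^sub>v k) \<bullet>c w1 + (C2\<^sup>\<dagger> *\<^sub>v u) \<bullet>c w1) = cnj s * (x1 \<bullet>c w1)"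
    unfolding inner_smult_left[OF x1 w1, symmetric] eq1 inner_add_left[OF c(1) add_carrier_vec[OF c(3,2)] w1]
      inner_add_left[OF c(3,2) w1] ..
  have e5: "(B\<^sup>\<dagger> *\<^sub>v x1) \<bullet>c v + ((D1\<^sup>\<dagger> *\<^sub>v k) \<bullet>c v + (D2\<^sup>\<dagger> *\<^sub>v u) \<bullet>c v) = complex_of_real (sqnorm v)"
    unfolding inner_self[symmetric] inner_add_left[OF c(6,5) vc, symmetric]
      inner_add_left[OF c(4) add_carrier_vec[OF c(6,5)] vc, symmetric] unfolding v[symmetric] ..
  have neg: "2 * (Re (cnj s * (x1 \<bullet>c w1)) + Re (cnj s * (x2 \<bullet>c w2))) + sqnorm v - \<gamma>b\<^sup>2 * sqnorm u < 0"
  proof -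
    \<comment> \<open>linear in the real parts of the inner products; abstracting them keeps the terms small\<close>
    have arith: "2 * (y + a) + e - g < 0"
      if "f + 2 * t < 0" "t = a + (b + c)" "f = 2 * (b1 + b2 + (c1 + c2)) - g - e" "b1 + (b + b2) = y" "c1 + (c + c2) = e"
      for y a e g f t b c b1 b2 c1 c2 :: real
      using that(1) unfolding that(4,5)[symmetric] that(2,3) by (simp add: algebra_simps)
    show ?thesis
      by (rule arith[OF e1 arg_cong[OF e2, of Re, unfolded plus_complex.sel] e3[unfolded plus_complex.sel]
        arg_cong[OF e4, of Re, unfolded plus_complex.sel] arg_cong[OF e5, of Re, unfolded plus_complex.sel Re_complex_of_real]])
  qed
  have form: "(X *\<^sub>v (x1 @\<^sub>v x2)) \<bullet>c (x1 @\<^sub>v x2) = cnj (x1 \<bullet>c w1 + x2 \<bullet>c w2)"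
    unfolding Xw inner_append[OF w1 w2 x1 x2] using inner_commute[OF w1 x1] inner_commute[OF w2 x2] by simp
  have "Im ((X *\<^sub>v (x1 @\<^sub>v x2)) \<bullet>c (x1 @\<^sub>v x2)) = 0" by (rule hermitian_form_real[OF X x])
  \<comment> \<open>so the imaginary part of \<open>cnj s\<close> does not contribute\<close>
  then have im: "Im (x1 \<bullet>c w1) + Im (x2 \<bullet>c w2) = 0" unfolding form by simp
  have "Re (cnj s * (x1 \<bullet>c w1)) + Re (cnj s * (x2 \<bullet>c w2))
      = Re s * (Re (x1 \<bullet>c w1) + Re (x2 \<bullet>c w2)) + Im s * (Im (x1 \<bullet>c w1) + Im (x2 \<bullet>c w2))"
    by (simp add: algebra_simps)
  then show ?thesis using neg unfolding im form by simp
qed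

text \<open>At an eigenvalue of the filter in the closed right half-plane the dissipation inequality
  without input would contradict the positivity of the storage.\<close>

lemma design_hurwitz:
  assumes X: "X \<in> carrier_mat (m + m11) (m + m11)" "pos_def X"
    and dims: "A11 \<in> carrier_mat m11 m11" "B11 \<in> carrier_mat m11 ny" "C11 \<in> carrier_mat n m11" "J11 \<in> carrier_mat n ny"
    and ineq: "design_inequality m p n ny m11 A B C1 C2 D1 D2 \<gamma>b X (K_mat A11 B11 C11 J11)"
    and h: "hurwitz A"
  shows "hurwitz A11"
  unfolding hurwitz_def
proof (intro allI impI)
  fix z assume "eigenvalue A11 z"
  then have det0: "poly (char_poly A11) z = 0" using eigenvalue_root_char_poly[OF dims(1)] by blast
  let ?M = "z \<cdot>\<^sub>m 1\<^sub>m m11 - A11"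
  have M: "?M \<in> carrier_mat m11 m11" using dims(1) by (rule minus_carrier_mat)
  have "\<exists>x2 \<in> carrier_vec m11. x2 \<noteq> 0\<^sub>v m11 \<and> ?M\<^sup>\<dagger> *\<^sub>v x2 = 0\<^sub>v m11"
  proof (rule ccontr)
    assume "\<not> ?thesis"
    then have inj: "x = 0\<^sub>v m11" if "x \<in> carrier_vec m11" "?M\<^sup>\<dagger> *\<^sub>v x = 0\<^sub>v m11" for x using that by blast
    obtain N where N: "N \<in> carrier_mat m11 m11" "N * ?M\<^sup>\<dagger> = 1\<^sub>m m11"
      using inverse_if_injective[OF adjoint_carrier[OF M] inj] by metis
    have "?M * N\<^sup>\<dagger> = 1\<^sub>m m11"
      using adjoint_mult[OF N(1) adjoint_carrier[OF M]] unfolding N(2) by simp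
    then have "Determinant.det ?M * Determinant.det (N\<^sup>\<dagger>) = 1"
      using det_mult[OF M adjoint_carrier[OF N(1)]] by simp
    then show False using det0 unfolding char_poly_det[OF dims(1)] by simp
  qed
  then obtain x2 where x2: "x2 \<in> carrier_vec m11" "x2 \<noteq> 0\<^sub>v m11" "?M\<^sup>\<dagger> *\<^sub>v x2 = 0\<^sub>v m11" by blast
  show "Re z < 0"
  proof (rule ccontr)
    assume "\<not> Re z < 0"
    then have z: "0 \<le> Re z" by simp
    then have sA: "poly (char_poly A) z \<noteq> 0"
      using h unfolding hurwitz_def eigenvalue_root_char_poly[OF A] by force
    define k where "k = B11\<^sup>\<dagger> *\<^sub>v x2 + J11\<^sup>\<dagger> *\<^sub>v 0\<^sub>v n"
    have kc: "k \<in> carrier_vec ny" unfolding k_def using dims by (intro add_carrier_vec mult_vec_carrier) auto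
    define b where "b = C1\<^sup>\<dagger> *\<^sub>v k + C2\<^sup>\<dagger> *\<^sub>v 0\<^sub>v n"
    have b: "b \<in> carrier_vec m" unfolding b_def using C1 C2 by (intro add_carrier_vec mult_vec_carrier) auto
    define x1 where "x1 = (resolvent A z)\<^sup>\<dagger> *\<^sub>v b"
    have x1: "x1 \<in> carrier_vec m"
      unfolding x1_def by (rule mult_mat_vec_carrier[OF adjoint_carrier[OF resolvent_inverse(1)[OF A sA]] b])
    have eq1: "cnj z \<cdot>\<^sub>v x1 = A\<^sup>\<dagger> *\<^sub>v x1 + (C1\<^sup>\<dagger> *\<^sub>v k + C2\<^sup>\<dagger> *\<^sub>v 0\<^sub>v n)"
      unfolding x1_def b_def[symmetric] by (rule adjoint_resolvent[OF A sA b])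
    have Ax: "A11\<^sup>\<dagger> *\<^sub>v x2 \<in> carrier_vec m11" by (rule mult_mat_vec_carrier[OF adjoint_carrier[OF dims(1)] x2(1)])
    have eq2: "cnj z \<cdot>\<^sub>v x2 = A11\<^sup>\<dagger> *\<^sub>v x2 + C11\<^sup>\<dagger> *\<^sub>v 0\<^sub>v n"
    proof -
      have Madj: "?M\<^sup>\<dagger> = cnj z \<cdot>\<^sub>m 1\<^sub>m m11 - A11\<^sup>\<dagger>"
      proof (rule eq_matI)
        fix i j assume "i < dim_row (cnj z \<cdot>\<^sub>m 1\<^sub>m m11 - A11\<^sup>\<dagger>)" "j < dim_col (cnj z \<cdot>\<^sub>m 1\<^sub>m m11 - A11\<^sup>\<dagger>)"
        then have ij: "i < m11" "j < m11" using dims(1) by auto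
        then show "?M\<^sup>\<dagger> $$ (i, j) = (cnj z \<cdot>\<^sub>m 1\<^sub>m m11 - A11\<^sup>\<dagger>) $$ (i, j)"
          using dims(1) by (subst adjoint_index) auto
      qed (use dims(1) in auto)
      have zx: "cnj z \<cdot>\<^sub>v x2 \<in> carrier_vec m11" using x2(1) by simp
      have "(cnj z \<cdot>\<^sub>m 1\<^sub>m m11) *\<^sub>v x2 = cnj z \<cdot>\<^sub>v x2"
        using smult_mat_mult_vec[OF one_carrier_mat x2(1)] x2(1) by simp
      then have "cnj z \<cdot>\<^sub>v x2 + - (A11\<^sup>\<dagger> *\<^sub>v x2) = 0\<^sub>v m11"
        using x2(3) minus_mult_mat_vec[OF smult_carrier_mat[OF one_carrier_mat] adjoint_carrier[OF dims(1)] x2(1)]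
        unfolding Madj by simp
      then have "- (A11\<^sup>\<dagger> *\<^sub>v x2) = - (cnj z \<cdot>\<^sub>v x2)"
        using vec_add_eq_0D[OF zx uminus_carrier_vec[THEN iffD2, OF Ax]] by simp
      then have "A11\<^sup>\<dagger> *\<^sub>v x2 = cnj z \<cdot>\<^sub>v x2" by (metis uminus_uminus_vec)
      then show ?thesis unfolding mult_mat_zero_vec[OF adjoint_carrier[OF dims(3)]] using zx by simp
    qed
    define v where "v = B\<^sup>\<dagger> *\<^sub>v x1 + (D1\<^sup>\<dagger> *\<^sub>v k + D2\<^sup>\<dagger> *\<^sub>v 0\<^sub>v n)"
    have "2 * Re z * Re ((X *\<^sub>v (x1 @\<^sub>v x2)) \<bullet>c (x1 @\<^sub>v x2)) + sqnorm v < \<gamma>b\<^sup>2 * sqnorm (0\<^sub>v n)"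
      by (rule closed_loop_dissipation[OF X(1) pos_def_hermitian[OF X(2)] dims ineq x1 x2(1) zero_carrier_vec k_def v_def eq1 eq2])
        (use x2 in blast)
    moreover have "sqnorm (0\<^sub>v n) = 0" using sqnorm_eq_0[of "0\<^sub>v n" n] by simp
    moreover have "0 < Re ((X *\<^sub>v (x1 @\<^sub>v x2)) \<bullet>c (x1 @\<^sub>v x2))"
      by (rule pos_def_pos[OF X append_carrier_vec[OF x1 x2(1)]]) (use append_vec_eq_0[OF x1 x2(1)] x2(2) in blast)
    then have "0 \<le> 2 * Re z * Re ((X *\<^sub>v (x1 @\<^sub>v x2)) \<bullet>c (x1 @\<^sub>v x2))" using z by simp
    ultimately show False using sqnorm_nonneg[of v] by simp
  qed
qed

text \<open>On the imaginary axis the storage term has the factor \<open>2 Re s = 0\<close>.\<close>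

lemma design_frequency_bound:
  fixes \<omega> :: real
  assumes X: "X \<in> carrier_mat (m + m11) (m + m11)" "pos_def X"
    and dims: "A11 \<in> carrier_mat m11 m11" "B11 \<in> carrier_mat m11 ny" "C11 \<in> carrier_mat n m11" "J11 \<in> carrier_mat n ny"
    and ineq: "design_inequality m p n ny m11 A B C1 C2 D1 D2 \<gamma>b X (K_mat A11 B11 C11 J11)"
    and h: "hurwitz A" and u: "u \<in> carrier_vec n" "u \<noteq> 0\<^sub>v n"
  defines "s \<equiv> \<i> * complex_of_real \<omega>"
  shows "sqnorm ((transfer_fun A B (C1 @\<^sub>r C2) (D1 @\<^sub>r D2) s)\<^sup>\<dagger> *\<^sub>v ((transfer_fun A11 B11 C11 J11 s)\<^sup>\<dagger> *\<^sub>v u @\<^sub>v u)) < \<gamma>b\<^sup>2 * sqnorm u"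
proof -
  have s0: "Re s = 0" by (simp add: s_def)
  have sA: "poly (char_poly A) s \<noteq> 0"
    using h s0 unfolding hurwitz_def eigenvalue_root_char_poly[OF A] by force
  have sA11: "poly (char_poly A11) s \<noteq> 0"
    using design_hurwitz[OF X dims ineq h] s0 unfolding hurwitz_def eigenvalue_root_char_poly[OF dims(1)] by force
  define k where "k = (transfer_fun A11 B11 C11 J11 s)\<^sup>\<dagger> *\<^sub>v u"
  obtain x2 where x2: "x2 \<in> carrier_vec m11" "cnj s \<cdot>\<^sub>v x2 = A11\<^sup>\<dagger> *\<^sub>v x2 + C11\<^sup>\<dagger> *\<^sub>v u"
    and k: "k = B11\<^sup>\<dagger> *\<^sub>v x2 + J11\<^sup>\<dagger> *\<^sub>v u"
    using transfer_fun_adjoint[OF dims sA11 u(1)] unfolding k_def by metis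
  have kc: "k \<in> carrier_vec ny" unfolding k using dims by (intro add_carrier_vec mult_vec_carrier) auto
  note ku = append_carrier_vec[OF kc u(1)]
  obtain x1 where x1: "x1 \<in> carrier_vec m" "cnj s \<cdot>\<^sub>v x1 = A\<^sup>\<dagger> *\<^sub>v x1 + (C1 @\<^sub>r C2)\<^sup>\<dagger> *\<^sub>v (k @\<^sub>v u)"
    and v: "(transfer_fun A B (C1 @\<^sub>r C2) (D1 @\<^sub>r D2) s)\<^sup>\<dagger> *\<^sub>v (k @\<^sub>v u) = B\<^sup>\<dagger> *\<^sub>v x1 + (D1 @\<^sub>r D2)\<^sup>\<dagger> *\<^sub>v (k @\<^sub>v u)"
    using transfer_fun_adjoint[OF A B carrier_append_rows[OF C1 C2] carrier_append_rows[OF D1 D2] sA ku] by metis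
  have Ck: "(C1 @\<^sub>r C2)\<^sup>\<dagger> *\<^sub>v (k @\<^sub>v u) = C1\<^sup>\<dagger> *\<^sub>v k + C2\<^sup>\<dagger> *\<^sub>v u"
    unfolding adjoint_append_rows[OF C1 C2] by (rule append_cols_mult[OF adjoint_carrier[OF C1] adjoint_carrier[OF C2] kc u(1)])
  have Dk: "(D1 @\<^sub>r D2)\<^sup>\<dagger> *\<^sub>v (k @\<^sub>v u) = D1\<^sup>\<dagger> *\<^sub>v k + D2\<^sup>\<dagger> *\<^sub>v u"
    unfolding adjoint_append_rows[OF D1 D2] by (rule append_cols_mult[OF adjoint_carrier[OF D1] adjoint_carrier[OF D2] kc u(1)])
  have "2 * Re s * Re ((X *\<^sub>v (x1 @\<^sub>v x2)) \<bullet>c (x1 @\<^sub>v x2))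
      + sqnorm ((transfer_fun A B (C1 @\<^sub>r C2) (D1 @\<^sub>r D2) s)\<^sup>\<dagger> *\<^sub>v (k @\<^sub>v u)) < \<gamma>b\<^sup>2 * sqnorm u"
    by (rule closed_loop_dissipation[OF X(1) pos_def_hermitian[OF X(2)] dims ineq x1(1) x2(1) u(1) k v[unfolded Dk] x1(2)[unfolded Ck] x2(2)])
      (use u(2) in blast)
  then show ?thesis using s0 by (simp add: k_def[symmetric])
qed

end

section \<open>The imaginary axis with its two points at infinity\<close>

text \<open>Limits along this filter give the value at a point of the extended axis, finite or not, so
  that both kinds of frequency are treated at once.\<close>

definition axis_filter :: "ereal \<Rightarrow> real filter" where
  "axis_filter \<omega> = (case \<omega> of ereal r \<Rightarrow> nhds r | PInfty \<Rightarrow> at_top | MInfty \<Rightarrow> at_bot)"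

lemma axis_filter_nontrivial [simp]: "axis_filter \<omega> \<noteq> bot"
  by (cases \<omega>) (auto simp: axis_filter_def)

text \<open>The limits at both ends make the value \<open>Lim\<close> at an infinite frequency a genuine limit.\<close>

definition axis_scalar :: "(real \<Rightarrow> complex) \<Rightarrow> bool" where
  "axis_scalar f \<longleftrightarrow> continuous_on UNIV f \<and> (\<exists>L. (f \<longlongrightarrow> L) at_top) \<and> (\<exists>L. (f \<longlongrightarrow> L) at_bot)"

lemma axis_scalar_const: "axis_scalar (\<lambda>\<omega>. c)"
  unfolding axis_scalar_def by (auto intro: tendsto_const)

lemma axis_scalar_add: "axis_scalar f \<Longrightarrow> axis_scalar g \<Longrightarrow> axis_scalar (\<lambda>\<omega>. f \<omega> + g \<omega>)"
  unfolding axis_scalar_def by (blast intro: continuous_on_add tendsto_add)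

lemma axis_scalar_mult: "axis_scalar f \<Longrightarrow> axis_scalar g \<Longrightarrow> axis_scalar (\<lambda>\<omega>. f \<omega> * g \<omega>)"
  unfolding axis_scalar_def by (blast intro: continuous_on_mult tendsto_mult)

lemma axis_scalar_uminus: "axis_scalar f \<Longrightarrow> axis_scalar (\<lambda>\<omega>. - f \<omega>)"
  unfolding axis_scalar_def by (blast intro: continuous_on_minus tendsto_minus)

lemma axis_scalar_cnj: "axis_scalar f \<Longrightarrow> axis_scalar (\<lambda>\<omega>. cnj (f \<omega>))"
  unfolding axis_scalar_def by (blast intro: continuous_on_cnj tendsto_cnj)

lemma axis_scalar_sum: "(\<And>i. i \<in> I \<Longrightarrow> axis_scalar (f i)) \<Longrightarrow> axis_scalar (\<lambda>\<omega>. \<Sum>i\<in>I. f i \<omega>)"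
  by (induction I rule: infinite_finite_induct) (auto intro: axis_scalar_const axis_scalar_add)

lemma axis_scalar_stable_proper: "stable_proper f \<Longrightarrow> axis_scalar (\<lambda>\<omega>. f (\<i> * complex_of_real \<omega>))"
proof -
  assume f: "stable_proper f"
  have "continuous_on UNIV (\<lambda>\<omega>. f (\<i> * complex_of_real \<omega>))"
    by (rule stable_proper_analytic[OF f]) (rule axis_continuous_if_analytic)
  then show ?thesis
    unfolding axis_scalar_def using stable_proper_axis_limit[OF f] by metis
qed

definition axis_regular :: "nat \<Rightarrow> nat \<Rightarrow> (complex \<Rightarrow> complex mat) \<Rightarrow> bool" where
  "axis_regular r c F \<longleftrightarrow> (\<forall>\<omega>::real. F (\<i> * complex_of_real \<omega>) \<in> carrier_mat r c) \<and>
     (\<forall>i<r. \<forall>j<c. axis_scalar (\<lambda>\<omega>. F (\<i> * complex_of_real \<omega>) $$ (i, j)))"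

lemma axis_regularD:
  assumes "axis_regular r c F"
  shows "F (\<i> * complex_of_real \<omega>) \<in> carrier_mat r c"
    and "i < r \<Longrightarrow> j < c \<Longrightarrow> axis_scalar (\<lambda>\<omega>. F (\<i> * complex_of_real \<omega>) $$ (i, j))"
  using assms unfolding axis_regular_def by auto

lemma axis_regularI:
  assumes "\<And>\<omega>::real. F (\<i> * complex_of_real \<omega>) \<in> carrier_mat r c"
    and "\<And>i j. i < r \<Longrightarrow> j < c \<Longrightarrow> axis_scalar (\<lambda>\<omega>. f i j \<omega>)"
    and "\<And>i j \<omega>. i < r \<Longrightarrow> j < c \<Longrightarrow> F (\<i> * complex_of_real \<omega>) $$ (i, j) = f i j \<omega>"
  shows "axis_regular r c F"
  using assms by (simp add: axis_regular_def)

lemma axis_regular_const: "M \<in> carrier_mat r c \<Longrightarrow> axis_regular r c (\<lambda>s. M)"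
  by (simp add: axis_regular_def axis_scalar_const)

lemma axis_regular_add:
  assumes F: "axis_regular r c F" and G: "axis_regular r c G"
  shows "axis_regular r c (\<lambda>s. F s + G s)"
proof (rule axis_regularI)
  show "F (\<i> * complex_of_real \<omega>) + G (\<i> * complex_of_real \<omega>) \<in> carrier_mat r c" for \<omega>
    by (rule add_carrier_mat[OF axis_regularD(1)[OF G]])
  show "axis_scalar (\<lambda>\<omega>. F (\<i> * complex_of_real \<omega>) $$ (i, j) + G (\<i> * complex_of_real \<omega>) $$ (i, j))" if "i < r" "j < c" for i j
    by (intro axis_scalar_add axis_regularD(2)[OF F that] axis_regularD(2)[OF G that])
  show "(F (\<i> * complex_of_real \<omega>) + G (\<i> * complex_of_real \<omega>)) $$ (i, j) = F (\<i> * complex_of_real \<omega>) $$ (i, j) + G (\<i> * complex_of_real \<omega>) $$ (i, j)"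
    if "i < r" "j < c" for i j \<omega>
    using axis_regularD(1)[OF G, of \<omega>] that by simp
qed

lemma axis_regular_uminus:
  assumes F: "axis_regular r c F"
  shows "axis_regular r c (\<lambda>s. - F s)"
proof (rule axis_regularI)
  show "- F (\<i> * complex_of_real \<omega>) \<in> carrier_mat r c" for \<omega>
    by (rule uminus_carrier_mat[OF axis_regularD(1)[OF F]])
  show "axis_scalar (\<lambda>\<omega>. - F (\<i> * complex_of_real \<omega>) $$ (i, j))" if "i < r" "j < c" for i j
    by (intro axis_scalar_uminus axis_regularD(2)[OF F that])
  show "(- F (\<i> * complex_of_real \<omega>)) $$ (i, j) = - F (\<i> * complex_of_real \<omega>) $$ (i, j)" if "i < r" "j < c" for i j \<omega>
    using axis_regularD(1)[OF F, of \<omega>] that by simp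
qed

lemma axis_regular_mult:
  assumes F: "axis_regular r k F" and G: "axis_regular k c G"
  shows "axis_regular r c (\<lambda>s. F s * G s)"
proof (rule axis_regularI)
  show "F (\<i> * complex_of_real \<omega>) * G (\<i> * complex_of_real \<omega>) \<in> carrier_mat r c" for \<omega>
    by (rule mult_carrier_mat[OF axis_regularD(1)[OF F] axis_regularD(1)[OF G]])
  show "axis_scalar (\<lambda>\<omega>. \<Sum>l<k. F (\<i> * complex_of_real \<omega>) $$ (i, l) * G (\<i> * complex_of_real \<omega>) $$ (l, j))" if "i < r" "j < c" for i j
    using that by (intro axis_scalar_sum axis_scalar_mult axis_regularD(2)[OF F] axis_regularD(2)[OF G]) auto
  show "(F (\<i> * complex_of_real \<omega>) * G (\<i> * complex_of_real \<omega>)) $$ (i, j)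
     = (\<Sum>l<k. F (\<i> * complex_of_real \<omega>) $$ (i, l) * G (\<i> * complex_of_real \<omega>) $$ (l, j))"
    if "i < r" "j < c" for i j \<omega>
    by (rule mult_mat_sum[OF axis_regularD(1)[OF F] axis_regularD(1)[OF G] that])
qed

lemma paraconj_axis: "paraconj F (\<i> * complex_of_real \<omega>) = (F (\<i> * complex_of_real \<omega>))\<^sup>\<dagger>"
  by (simp add: paraconj_def)

lemma axis_regular_paraconj:
  assumes F: "axis_regular r c F"
  shows "axis_regular c r (paraconj F)"
proof (rule axis_regularI)
  show "paraconj F (\<i> * complex_of_real \<omega>) \<in> carrier_mat c r" for \<omega>
    unfolding paraconj_axis by (rule adjoint_carrier[OF axis_regularD(1)[OF F]])
  show "axis_scalar (\<lambda>\<omega>. cnj (F (\<i> * complex_of_real \<omega>) $$ (j, i)))" if "i < c" "j < r" for i j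
    using that by (intro axis_scalar_cnj axis_regularD(2)[OF F])
  show "paraconj F (\<i> * complex_of_real \<omega>) $$ (i, j) = cnj (F (\<i> * complex_of_real \<omega>) $$ (j, i))" if "i < c" "j < r" for i j \<omega>
    unfolding paraconj_axis using axis_regularD(1)[OF F, of \<omega>] that by (intro adjoint_index) auto
qed

lemma axis_regular_four_block:
  assumes A: "axis_regular r1 c1 A" and B: "axis_regular r1 c2 B" and C: "axis_regular r2 c1 C" and D: "axis_regular r2 c2 D"
  shows "axis_regular (r1 + r2) (c1 + c2) (\<lambda>s. four_block_mat (A s) (B s) (C s) (D s))"
proof (rule axis_regularI)
  show "four_block_mat (A (\<i> * complex_of_real \<omega>)) (B (\<i> * complex_of_real \<omega>)) (C (\<i> * complex_of_real \<omega>)) (D (\<i> * complex_of_real \<omega>))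
      \<in> carrier_mat (r1 + r2) (c1 + c2)" for \<omega>
    by (rule four_block_carrier_mat[OF axis_regularD(1)[OF A] axis_regularD(1)[OF D]])
  let ?f = "\<lambda>i j \<omega>. if i < r1 then if j < c1 then A (\<i> * complex_of_real \<omega>) $$ (i, j) else B (\<i> * complex_of_real \<omega>) $$ (i, j - c1)
      else if j < c1 then C (\<i> * complex_of_real \<omega>) $$ (i - r1, j) else D (\<i> * complex_of_real \<omega>) $$ (i - r1, j - c1)"
  show "axis_scalar (\<lambda>\<omega>. ?f i j \<omega>)" if "i < r1 + r2" "j < c1 + c2" for i j
    using that axis_regularD(2)[OF A, of i j] axis_regularD(2)[OF B, of i "j - c1"]
      axis_regularD(2)[OF C, of "i - r1" j] axis_regularD(2)[OF D, of "i - r1" "j - c1"]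
    by (cases "i < r1"; cases "j < c1") auto
  show "four_block_mat (A (\<i> * complex_of_real \<omega>)) (B (\<i> * complex_of_real \<omega>)) (C (\<i> * complex_of_real \<omega>)) (D (\<i> * complex_of_real \<omega>)) $$ (i, j)
      = ?f i j \<omega>" if "i < r1 + r2" "j < c1 + c2" for i j \<omega>
    using that axis_regularD(1)[OF A, of \<omega>] axis_regularD(1)[OF B, of \<omega>] axis_regularD(1)[OF C, of \<omega>] axis_regularD(1)[OF D, of \<omega>]
    by simp
qed

lemma freq_val_tendsto:
  assumes F: "axis_regular r c F"
  shows "freq_val F \<omega> \<in> carrier_mat r c"
    and "i < r \<Longrightarrow> j < c \<Longrightarrow> ((\<lambda>t. F (\<i> * complex_of_real t) $$ (i, j)) \<longlongrightarrow> freq_val F \<omega> $$ (i, j)) (axis_filter \<omega>)"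
proof -
  have F0: "dim_row (F 0) = r" "dim_col (F 0) = c" using axis_regularD(1)[OF F, of 0] by auto
  have lim: "freq_lim F L \<in> carrier_mat r c" for L
    by (simp add: freq_lim_def F0)
  show "freq_val F \<omega> \<in> carrier_mat r c"
    using lim axis_regularD(1)[OF F] by (cases \<omega>) (auto simp: freq_val_def)
  assume ij: "i < r" "j < c"
  have reg: "axis_scalar (\<lambda>\<omega>. F (\<i> * complex_of_real \<omega>) $$ (i, j))" by (rule axis_regularD(2)[OF F ij])
  have L: "((\<lambda>t. F (\<i> * complex_of_real t) $$ (i, j)) \<longlongrightarrow> freq_lim F Fl $$ (i, j)) Fl"
    if "\<exists>L. ((\<lambda>t. F (\<i> * complex_of_real t) $$ (i, j)) \<longlongrightarrow> L) Fl" "Fl \<noteq> bot" for Fl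
    using that ij tendsto_Lim[OF that(2)] by (auto simp: freq_lim_def F0)
  show "((\<lambda>t. F (\<i> * complex_of_real t) $$ (i, j)) \<longlongrightarrow> freq_val F \<omega> $$ (i, j)) (axis_filter \<omega>)"
  proof (cases \<omega>)
    case (real r)
    have "isCont (\<lambda>t. F (\<i> * complex_of_real t) $$ (i, j)) r"
      using reg by (simp add: axis_scalar_def continuous_on_eq_continuous_at)
    then show ?thesis
      using real tendsto_at_iff_tendsto_nhds[of "\<lambda>t. F (\<i> * complex_of_real t) $$ (i, j)" r]
      by (simp add: freq_val_def axis_filter_def isCont_def)
  next
    case PInf
    then show ?thesis using L[of at_top] reg by (simp add: freq_val_def axis_filter_def axis_scalar_def)
  next
    case MInf
    then show ?thesis using L[of at_bot] reg by (simp add: freq_val_def axis_filter_def axis_scalar_def)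
  qed
qed

lemma mult_mat_vec_tendsto':
  fixes M :: "'a \<Rightarrow> complex mat"
  assumes M: "\<And>t. M t \<in> carrier_mat r n" "M' \<in> carrier_mat r n"
    and Mlim: "\<And>i j. i < r \<Longrightarrow> j < n \<Longrightarrow> ((\<lambda>t. M t $$ (i, j)) \<longlongrightarrow> M' $$ (i, j)) F"
    and x: "\<And>t. x t \<in> carrier_vec n" "x' \<in> carrier_vec n"
    and xlim: "\<And>i. i < n \<Longrightarrow> ((\<lambda>t. x t $ i) \<longlongrightarrow> x' $ i) F" and i: "i < r"
  shows "((\<lambda>t. (M t *\<^sub>v x t) $ i) \<longlongrightarrow> (M' *\<^sub>v x') $ i) F"
  unfolding mult_mat_vec_sum[OF M(1) x(1) i] mult_mat_vec_sum[OF M(2) x(2) i]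
  using i by (intro tendsto_intros Mlim xlim) auto

lemma adjoint_entry_tendsto:
  fixes M :: "'a \<Rightarrow> complex mat"
  assumes M: "\<And>t. M t \<in> carrier_mat r n" "M' \<in> carrier_mat r n"
    and lim: "\<And>i j. i < r \<Longrightarrow> j < n \<Longrightarrow> ((\<lambda>t. M t $$ (i, j)) \<longlongrightarrow> M' $$ (i, j)) F" and ij: "i < n" "j < r"
  shows "((\<lambda>t. (M t)\<^sup>\<dagger> $$ (i, j)) \<longlongrightarrow> M'\<^sup>\<dagger> $$ (i, j)) F"
proof -
  have "(M t)\<^sup>\<dagger> $$ (i, j) = cnj (M t $$ (j, i))" for t using M(1)[of t] ij by (intro adjoint_index) auto
  moreover have "M'\<^sup>\<dagger> $$ (i, j) = cnj (M' $$ (j, i))" using M(2) ij by (intro adjoint_index) auto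
  ultimately show ?thesis using lim ij by (simp add: tendsto_cnj)
qed

lemma cofinite_axis:
  assumes "\<forall>\<^sub>F s in cofinite. P s"
  shows "\<forall>\<^sub>F \<omega> in cofinite. P (\<i> * complex_of_real \<omega>)"
proof -
  have "finite ((\<lambda>\<omega>. \<i> * complex_of_real \<omega>) -` {s. \<not> P s})"
    using assms unfolding eventually_cofinite by (rule finite_vimageI) (simp add: inj_def)
  then show ?thesis by (simp add: eventually_cofinite vimage_def)
qed

lemma cofinite_at:
  assumes "\<forall>\<^sub>F x in cofinite. P x"
  shows "\<forall>\<^sub>F x in at (a :: real). P x"
proof -
  have "open (- ({x. \<not> P x} - {a}))"
    using assms by (intro open_Compl finite_imp_closed finite_Diff) (simp add: eventually_cofinite)
  then show ?thesis
    unfolding eventually_at_topological by (intro exI[of _ "- ({x. \<not> P x} - {a})"]) auto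
qed

text \<open>Exceptional points are isolated, so a limit along the others decides.\<close>

lemma eq_if_cofinitely_eq:
  fixes f g :: "real \<Rightarrow> complex"
  assumes "continuous_on UNIV f" "continuous_on UNIV g" "\<forall>\<^sub>F x in cofinite. f x = g x"
  shows "f x = g x"
proof -
  have "(f \<longlongrightarrow> f x) (at x)" "(g \<longlongrightarrow> g x) (at x)"
    using assms(1,2) by (simp_all add: continuous_on_eq_continuous_at isCont_def)
  moreover have "\<forall>\<^sub>F y in at x. f y = g y" by (rule cofinite_at[OF assms(3)])
  ultimately show ?thesis
    using Lim_transform_eventually tendsto_unique[OF at_neq_bot] by metis
qed

lemma le_if_cofinitely_le:
  fixes f :: "real \<Rightarrow> real"
  assumes "isCont f x" "\<forall>\<^sub>F x in cofinite. f x \<le> c"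
  shows "f x \<le> c"
proof -
  have "(f \<longlongrightarrow> f x) (at x)" using assms(1) by (simp add: isCont_def)
  then show ?thesis by (rule tendsto_upperbound[OF _ cofinite_at[OF assms(2)]]) simp
qed

section \<open>Error spectra and contractions as quadratic forms\<close>

lemma error_psd_form:
  assumes H: "H (\<i> * complex_of_real \<omega>) \<in> carrier_mat n ny"
    and \<Phi>: "\<Phi> (\<i> * complex_of_real \<omega>) \<in> carrier_mat (ny + n) (ny + n)" and u: "u \<in> carrier_vec n"
  shows "(error_psd n \<Phi> H (\<i> * complex_of_real \<omega>) *\<^sub>v u) \<bullet>c u =
      (\<Phi> (\<i> * complex_of_real \<omega>) *\<^sub>v ((H (\<i> * complex_of_real \<omega>))\<^sup>\<dagger> *\<^sub>v u @\<^sub>v u)) \<bullet>c ((H (\<i> * complex_of_real \<omega>))\<^sup>\<dagger> *\<^sub>v u @\<^sub>v u)"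
    and "error_psd n \<Phi> H (\<i> * complex_of_real \<omega>) \<in> carrier_mat n n"
proof -
  let ?s = "\<i> * complex_of_real \<omega>"
  have L: "H ?s @\<^sub>c 1\<^sub>m n \<in> carrier_mat n (ny + n)" by (rule append_cols_carrier[OF H one_carrier_mat])
  have Ladj: "paraconj H ?s @\<^sub>r 1\<^sub>m n = (H ?s @\<^sub>c 1\<^sub>m n)\<^sup>\<dagger>"
    unfolding paraconj_axis adjoint_append_cols[OF H one_carrier_mat] by simp
  note L' = adjoint_carrier[OF L]
  have Lu: "(H ?s @\<^sub>c 1\<^sub>m n)\<^sup>\<dagger> *\<^sub>v u = (H ?s)\<^sup>\<dagger> *\<^sub>v u @\<^sub>v u"
    unfolding adjoint_append_cols[OF H one_carrier_mat] adjoint_one append_rows_mult[OF adjoint_carrier[OF H] one_carrier_mat u]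
    using u by simp
  note Luc = mult_mat_vec_carrier[OF L' u]
  show "error_psd n \<Phi> H ?s \<in> carrier_mat n n"
    unfolding error_psd_def Ladj by (rule mult_carrier_mat[OF mult_carrier_mat[OF L \<Phi>] L'])
  have "error_psd n \<Phi> H ?s *\<^sub>v u = (H ?s @\<^sub>c 1\<^sub>m n) *\<^sub>v (\<Phi> ?s *\<^sub>v ((H ?s @\<^sub>c 1\<^sub>m n)\<^sup>\<dagger> *\<^sub>v u))"
    unfolding error_psd_def Ladj assoc_mult_mat_vec[OF mult_carrier_mat[OF L \<Phi>] L' u] assoc_mult_mat_vec[OF L \<Phi> Luc] ..
  then show "(error_psd n \<Phi> H ?s *\<^sub>v u) \<bullet>c u = (\<Phi> ?s *\<^sub>v ((H ?s)\<^sup>\<dagger> *\<^sub>v u @\<^sub>v u)) \<bullet>c ((H ?s)\<^sup>\<dagger> *\<^sub>v u @\<^sub>v u)"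
    using inner_adjoint[OF L mult_mat_vec_carrier[OF \<Phi> Luc] u] by (simp only: Lu)
qed

lemma smult_one_form: "x \<in> carrier_vec n \<Longrightarrow> ((complex_of_real c \<cdot>\<^sub>m 1\<^sub>m n) *\<^sub>v x) \<bullet>c x = complex_of_real (c * sqnorm x)"
  by (simp add: smult_mat_mult_vec[OF one_carrier_mat] inner_smult_left[of _ n] inner_self)

text \<open>The test vectors \<open>[H11, 1]\<^sup>\<dagger> u\<close> reduce the matrix inequality to scalar ones.\<close>

lemma error_below_iff:
  assumes H: "\<And>\<omega>::real. H (\<i> * complex_of_real \<omega>) \<in> carrier_mat n ny"
    and \<Phi>: "\<And>\<omega>::real. \<Phi> (\<i> * complex_of_real \<omega>) \<in> carrier_mat (ny + n) (ny + n)"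
  shows "error_below n \<Phi> H \<gamma> \<longleftrightarrow> (\<forall>\<omega>::real. \<forall>u \<in> carrier_vec n. u \<noteq> 0\<^sub>v n \<longrightarrow>
    (\<Phi> (\<i> * complex_of_real \<omega>) *\<^sub>v ((H (\<i> * complex_of_real \<omega>))\<^sup>\<dagger> *\<^sub>v u @\<^sub>v u)) \<bullet>c ((H (\<i> * complex_of_real \<omega>))\<^sup>\<dagger> *\<^sub>v u @\<^sub>v u)
      < complex_of_real (\<gamma>\<^sup>2 * sqnorm u))"
proof -
  have "error_psd n \<Phi> H (\<i> * complex_of_real \<omega>) \<prec> complex_of_real (\<gamma>\<^sup>2) \<cdot>\<^sub>m 1\<^sub>m n \<longleftrightarrow> (\<forall>u \<in> carrier_vec n. u \<noteq> 0\<^sub>v n \<longrightarrow>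
    (\<Phi> (\<i> * complex_of_real \<omega>) *\<^sub>v ((H (\<i> * complex_of_real \<omega>))\<^sup>\<dagger> *\<^sub>v u @\<^sub>v u)) \<bullet>c ((H (\<i> * complex_of_real \<omega>))\<^sup>\<dagger> *\<^sub>v u @\<^sub>v u)
      < complex_of_real (\<gamma>\<^sup>2 * sqnorm u))" for \<omega>
    unfolding loewner_less_iff[OF error_psd_form(2)[where n = n and ny = ny and H = H and \<Phi> = \<Phi>, OF H \<Phi> zero_carrier_vec] smult_carrier_mat[OF one_carrier_mat]]
    by (intro ball_cong refl) (simp only: error_psd_form(1)[where n = n and ny = ny and H = H and \<Phi> = \<Phi>, OF H \<Phi>] smult_one_form)
  then show ?thesis by (simp only: error_below_def)
qed

lemma contraction_iff:
  fixes M :: "complex mat"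
  assumes M: "M \<in> carrier_mat n ny"
  shows "M * M\<^sup>\<dagger> \<prec> 1\<^sub>m n \<longleftrightarrow> (\<forall>u \<in> carrier_vec n. u \<noteq> 0\<^sub>v n \<longrightarrow> sqnorm (M\<^sup>\<dagger> *\<^sub>v u) < sqnorm u)"
proof -
  have form: "((M * M\<^sup>\<dagger>) *\<^sub>v u) \<bullet>c u = complex_of_real (sqnorm (M\<^sup>\<dagger> *\<^sub>v u))" if u: "u \<in> carrier_vec n" for u
    unfolding assoc_mult_mat_vec[OF M adjoint_carrier[OF M] u]
      inner_adjoint[OF M mult_mat_vec_carrier[OF adjoint_carrier[OF M] u] u] by (rule inner_self)
  show ?thesis
    unfolding loewner_less_iff[OF mult_carrier_mat[OF M adjoint_carrier[OF M]] one_carrier_mat]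
    by (intro ball_cong refl) (simp add: form inner_self less_complex_def)
qed

text \<open>When the error of \<open>(h, u)\<close> is at most \<open>\<gamma>\<^sup>2\<close>, the first term is not positive and the norm of \<open>h\<close> is smaller than
  that of \<open>u\<close>.\<close>

lemma condition_form:
  assumes F: "F \<in> carrier_mat (ny + n) (ny + n)" and \<theta>: "\<theta> > 0"
    and pos: "pos_def (complex_of_real \<theta> \<cdot>\<^sub>m (F - complex_of_real (\<gamma>\<^sup>2) \<cdot>\<^sub>m lower_id ny n) - signature_mat ny n)"
    and h: "h \<in> carrier_vec ny" and u: "u \<in> carrier_vec n"
  shows "h @\<^sub>v u \<noteq> 0\<^sub>v (ny + n) \<Longrightarrow>
      0 < \<theta> * (Re ((F *\<^sub>v (h @\<^sub>v u)) \<bullet>c (h @\<^sub>v u)) - \<gamma>\<^sup>2 * sqnorm u) - (sqnorm h - sqnorm u)"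
    and "Im ((F *\<^sub>v (h @\<^sub>v u)) \<bullet>c (h @\<^sub>v u)) = 0"
proof -
  define k where "k = h @\<^sub>v u"
  have k: "k \<in> carrier_vec (ny + n)" unfolding k_def by (rule append_carrier_vec[OF h u])
  have E: "lower_id ny n \<in> carrier_mat (ny + n) (ny + n)"
    unfolding lower_id_def by (rule four_block_carrier_mat[OF zero_carrier_mat one_carrier_mat])
  have J: "signature_mat ny n \<in> carrier_mat (ny + n) (ny + n)"
    unfolding signature_mat_def by (rule four_block_carrier_mat[OF one_carrier_mat uminus_carrier_mat[OF one_carrier_mat]])
  have "lower_id ny n *\<^sub>v k = (0\<^sub>m ny ny *\<^sub>v h + 0\<^sub>m ny n *\<^sub>v u) @\<^sub>v (0\<^sub>m n ny *\<^sub>v h + 1\<^sub>m n *\<^sub>v u)"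
    unfolding lower_id_def k_def
    by (rule four_block_mat_mult_vec[OF zero_carrier_mat zero_carrier_mat zero_carrier_mat one_carrier_mat h u])
  then have "lower_id ny n *\<^sub>v k = 0\<^sub>v ny @\<^sub>v u" using h u by simp
  then have Ef: "(lower_id ny n *\<^sub>v k) \<bullet>c k = complex_of_real (sqnorm u)"
    using inner_append[OF zero_carrier_vec u h u] inner_zero_left[OF h] by (simp add: k_def inner_self)
  have nu: "(- 1\<^sub>m n) *\<^sub>v u \<in> carrier_vec n" by simp
  have "signature_mat ny n *\<^sub>v k = (1\<^sub>m ny *\<^sub>v h + 0\<^sub>m ny n *\<^sub>v u) @\<^sub>v (0\<^sub>m n ny *\<^sub>v h + (- 1\<^sub>m n) *\<^sub>v u)"
    unfolding signature_mat_def k_def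
    by (rule four_block_mat_mult_vec[OF one_carrier_mat zero_carrier_mat zero_carrier_mat uminus_carrier_mat[OF one_carrier_mat] h u])
  then have "signature_mat ny n *\<^sub>v k = h @\<^sub>v (- 1\<^sub>m n) *\<^sub>v u" using h u nu by simp
  then have Jf: "(signature_mat ny n *\<^sub>v k) \<bullet>c k = complex_of_real (sqnorm h - sqnorm u)"
    using inner_append[OF h nu h u] inner_neg_one[OF u] by (simp add: k_def inner_self)
  have M1: "F - complex_of_real (\<gamma>\<^sup>2) \<cdot>\<^sub>m lower_id ny n \<in> carrier_mat (ny + n) (ny + n)"
    by (rule minus_carrier_mat[OF smult_carrier_mat[OF E]])
  have M2: "complex_of_real \<theta> \<cdot>\<^sub>m (F - complex_of_real (\<gamma>\<^sup>2) \<cdot>\<^sub>m lower_id ny n) - signature_mat ny n \<in> carrier_mat (ny + n) (ny + n)"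
    by (rule minus_carrier_mat[OF J])
  have sE: "((complex_of_real (\<gamma>\<^sup>2) \<cdot>\<^sub>m lower_id ny n) *\<^sub>v k) \<bullet>c k = complex_of_real (\<gamma>\<^sup>2 * sqnorm u)"
    unfolding smult_mat_mult_vec[OF E k] inner_smult_left[OF mult_mat_vec_carrier[OF E k] k] Ef by simp
  have form: "((complex_of_real \<theta> \<cdot>\<^sub>m (F - complex_of_real (\<gamma>\<^sup>2) \<cdot>\<^sub>m lower_id ny n) - signature_mat ny n) *\<^sub>v k) \<bullet>c k
      = complex_of_real \<theta> * ((F *\<^sub>v k) \<bullet>c k - complex_of_real (\<gamma>\<^sup>2 * sqnorm u)) - complex_of_real (sqnorm h - sqnorm u)"
    unfolding minus_mult_distrib_inner[OF J smult_carrier_mat[OF M1] k] Jf smult_mat_mult_vec[OF M1 k]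
      inner_smult_left[OF mult_mat_vec_carrier[OF M1 k] k] minus_mult_distrib_inner[OF smult_carrier_mat[OF E] F k] sE ..
  show "0 < \<theta> * (Re ((F *\<^sub>v (h @\<^sub>v u)) \<bullet>c (h @\<^sub>v u)) - \<gamma>\<^sup>2 * sqnorm u) - (sqnorm h - sqnorm u)"
    if "h @\<^sub>v u \<noteq> 0\<^sub>v (ny + n)"
  proof -
    have "0 < Re (((complex_of_real \<theta> \<cdot>\<^sub>m (F - complex_of_real (\<gamma>\<^sup>2) \<cdot>\<^sub>m lower_id ny n) - signature_mat ny n) *\<^sub>v k) \<bullet>c k)"
      by (rule pos_def_pos[OF M2 pos k]) (use that in \<open>simp add: k_def\<close>)
    then show ?thesis unfolding form by (simp add: k_def)
  qed
  have "Im (((complex_of_real \<theta> \<cdot>\<^sub>m (F - complex_of_real (\<gamma>\<^sup>2) \<cdot>\<^sub>m lower_id ny n) - signature_mat ny n) *\<^sub>v k) \<bullet>c k) = 0"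
    by (rule hermitian_form_real[OF M2 pos_def_hermitian[OF pos] k])
  then show "Im ((F *\<^sub>v (h @\<^sub>v u)) \<bullet>c (h @\<^sub>v u)) = 0"
    unfolding form using \<theta> by (simp add: k_def)
qed

text \<open>The error bound is known at finite frequencies, and only in the weak form it passes to the limit at the
  infinite ones; strictness is supplied by the condition, which is strict there too.\<close>

lemma contractive_if_error_bounded:
  assumes \<Phi>: "axis_regular (ny + n) (ny + n) \<Phi>" and H: "axis_regular n ny H" and \<theta>: "\<theta> > 0"
    and condition: "\<forall>\<omega>::ereal. pos_def
      (complex_of_real \<theta> \<cdot>\<^sub>m (freq_val \<Phi> \<omega> - complex_of_real (\<gamma>\<^sup>2) \<cdot>\<^sub>m lower_id ny n) - signature_mat ny n)"
    and bound: "\<And>(\<omega>::real) u. u \<in> carrier_vec n \<Longrightarrow>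
      Re ((\<Phi> (\<i> * complex_of_real \<omega>) *\<^sub>v ((H (\<i> * complex_of_real \<omega>))\<^sup>\<dagger> *\<^sub>v u @\<^sub>v u)) \<bullet>c ((H (\<i> * complex_of_real \<omega>))\<^sup>\<dagger> *\<^sub>v u @\<^sub>v u))
      \<le> \<gamma>\<^sup>2 * sqnorm u"
  shows "freq_val H \<omega> * (freq_val H \<omega>)\<^sup>\<dagger> \<prec> 1\<^sub>m n"
  unfolding contraction_iff[OF freq_val_tendsto(1)[OF H]]
proof (intro ballI impI)
  fix u :: "complex vec" assume u: "u \<in> carrier_vec n" "u \<noteq> 0\<^sub>v n"
  note Hc = axis_regularD(1)[OF H] and \<Phi>c = axis_regularD(1)[OF \<Phi>]
  define k where "k t = (H (\<i> * complex_of_real t))\<^sup>\<dagger> *\<^sub>v u @\<^sub>v u" for t :: real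
  define h where "h = (freq_val H \<omega>)\<^sup>\<dagger> *\<^sub>v u"
  have h: "h \<in> carrier_vec ny" unfolding h_def by (rule mult_mat_vec_carrier[OF adjoint_carrier[OF freq_val_tendsto(1)[OF H]] u(1)])
  have ht: "(H (\<i> * complex_of_real t))\<^sup>\<dagger> *\<^sub>v u \<in> carrier_vec ny" for t
    by (rule mult_mat_vec_carrier[OF adjoint_carrier[OF Hc] u(1)])
  have kc: "k t \<in> carrier_vec (ny + n)" for t unfolding k_def by (rule append_carrier_vec[OF ht u(1)])
  have hu: "h @\<^sub>v u \<in> carrier_vec (ny + n)" by (rule append_carrier_vec[OF h u(1)])
  have hlim: "((\<lambda>t. ((H (\<i> * complex_of_real t))\<^sup>\<dagger> *\<^sub>v u) $ i) \<longlongrightarrow> h $ i) (axis_filter \<omega>)" if "i < ny" for i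
    unfolding h_def
    by (rule mult_mat_vec_tendsto'[OF adjoint_carrier[OF Hc] adjoint_carrier[OF freq_val_tendsto(1)[OF H]]
        adjoint_entry_tendsto[OF Hc freq_val_tendsto(1)[OF H] freq_val_tendsto(2)[OF H]] u(1) u(1) tendsto_const that])
  have klim: "((\<lambda>t. k t $ i) \<longlongrightarrow> (h @\<^sub>v u) $ i) (axis_filter \<omega>)" if i: "i < ny + n" for i
  proof (cases "i < ny")
    case True
    have d: "dim_vec ((H (\<i> * complex_of_real t))\<^sup>\<dagger> *\<^sub>v u) = ny" for t using ht[of t] by (rule carrier_vecD)
    have "k t $ i = ((H (\<i> * complex_of_real t))\<^sup>\<dagger> *\<^sub>v u) $ i" for t
      unfolding k_def using True d[of t] u(1) by (subst index_append_vec) auto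
    moreover have "(h @\<^sub>v u) $ i = h $ i" using True h u(1) by (subst index_append_vec) auto
    ultimately show ?thesis using hlim[OF True] by simp
  next
    case False
    have d: "dim_vec ((H (\<i> * complex_of_real t))\<^sup>\<dagger> *\<^sub>v u) = ny" for t using ht[of t] by (rule carrier_vecD)
    have "k t $ i = u $ (i - ny)" for t
      unfolding k_def using False d[of t] u(1) i by (subst index_append_vec) auto
    moreover have "(h @\<^sub>v u) $ i = u $ (i - ny)" using False h u(1) i by (subst index_append_vec) auto
    ultimately show ?thesis by simp
  qed
  have "((\<lambda>t. Re ((\<Phi> (\<i> * complex_of_real t) *\<^sub>v k t) \<bullet>c k t)) \<longlongrightarrow> Re ((freq_val \<Phi> \<omega> *\<^sub>v (h @\<^sub>v u)) \<bullet>c (h @\<^sub>v u))) (axis_filter \<omega>)"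
    by (intro tendsto_Re inner_tendsto[OF mult_mat_vec_tendsto'[OF \<Phi>c freq_val_tendsto(1)[OF \<Phi>] freq_val_tendsto(2)[OF \<Phi>] kc hu klim] klim kc hu])
  then have le: "Re ((freq_val \<Phi> \<omega> *\<^sub>v (h @\<^sub>v u)) \<bullet>c (h @\<^sub>v u)) \<le> \<gamma>\<^sup>2 * sqnorm u"
    by (rule tendsto_upperbound) (use bound[OF u(1)] in \<open>auto simp: k_def\<close>)
  have "h @\<^sub>v u \<noteq> 0\<^sub>v (ny + n)" using append_vec_eq_0[OF h u(1)] u(2) by blast
  then have "0 < \<theta> * (Re ((freq_val \<Phi> \<omega> *\<^sub>v (h @\<^sub>v u)) \<bullet>c (h @\<^sub>v u)) - \<gamma>\<^sup>2 * sqnorm u) - (sqnorm h - sqnorm u)"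
    by (rule condition_form(1)[OF freq_val_tendsto(1)[OF \<Phi>] \<theta> condition[rule_format] h u(1)])
  moreover have "\<theta> * (Re ((freq_val \<Phi> \<omega> *\<^sub>v (h @\<^sub>v u)) \<bullet>c (h @\<^sub>v u)) - \<gamma>\<^sup>2 * sqnorm u) \<le> 0"
    using le \<theta> by (simp add: mult_nonneg_nonpos)
  ultimately show "sqnorm ((freq_val H \<omega>)\<^sup>\<dagger> *\<^sub>v u) < sqnorm u" unfolding h_def[symmetric] by simp
qed

text \<open>The common margin \<open>\<tau>\<close> is the least of finitely many.\<close>

lemma stable_proper_entrywise:
  assumes c: "\<And>s. F s \<in> carrier_mat r c"
    and sp: "\<And>i j. i < r \<Longrightarrow> j < c \<Longrightarrow> stable_proper (\<lambda>s. F s $$ (i, j))"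
  shows "entrywise r c proper_rational_fun F" "entrywise r c stable_fun F"
    "\<exists>\<tau>>0. entrywise r c (\<lambda>f. f analytic_on {s. Re s > - \<tau>}) F" "axis_regular r c F"
proof -
  show "entrywise r c proper_rational_fun F"
    using c stable_proper_proper_rational[OF sp] by (simp add: entrywise_def)
  have "\<exists>\<tau>>0. (\<lambda>s. F s $$ (i, j)) analytic_on {s. Re s > - \<tau>}" if "i < r" "j < c" for i j
    using stable_proper_analytic[OF sp[OF that]] by metis
  then obtain t where t: "\<And>i j. i < r \<Longrightarrow> j < c \<Longrightarrow> t i j > (0::real)"
    "\<And>i j. i < r \<Longrightarrow> j < c \<Longrightarrow> (\<lambda>s. F s $$ (i, j)) analytic_on {s. Re s > - t i j}"
    by metis
  show "entrywise r c stable_fun F"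
    using c stable_fun_if_analytic[OF t] by (simp add: entrywise_def)
  define T where "T = insert 1 ((\<lambda>(i, j). t i j) ` ({..<r} \<times> {..<c}))"
  have T: "finite T" "T \<noteq> {}" by (auto simp: T_def)
  have "Min T > 0" using T t(1) by (subst Min_gr_iff) (auto simp: T_def)
  moreover have "(\<lambda>s. F s $$ (i, j)) analytic_on {s. Re s > - Min T}" if "i < r" "j < c" for i j
  proof (rule analytic_on_subset[OF t(2)[OF that]])
    have "t i j \<in> T" using that by (force simp: T_def)
    then have "Min T \<le> t i j" using T(1) by (rule Min_le[rotated])
    then show "{s. - Min T < Re s} \<subseteq> {s. - t i j < Re s}" by auto
  qed
  ultimately show "\<exists>\<tau>>0. entrywise r c (\<lambda>f. f analytic_on {s. Re s > - \<tau>}) F"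
    using c by (auto simp: entrywise_def)
  show "axis_regular r c F"
    using c axis_scalar_stable_proper[OF sp] by (simp add: axis_regular_def)
qed

lemma block11_carrier: "block11 r c F s \<in> carrier_mat r c"
  by (simp add: block11_def split_block_def Let_def)

lemma block11_index: "i < r \<Longrightarrow> j < c \<Longrightarrow> block11 r c F s $$ (i, j) = F s $$ (i, j)"
  by (simp add: block11_def split_block_def Let_def)

lemma block12_carrier: "F s \<in> carrier_mat (r + r') (c + c') \<Longrightarrow> block12 r c F s \<in> carrier_mat r c'"
  by (auto simp: block12_def split_block_def Let_def)

lemma block12_index:
  "F s \<in> carrier_mat (r + r') (c + c') \<Longrightarrow> i < r \<Longrightarrow> j < c' \<Longrightarrow> block12 r c F s $$ (i, j) = F s $$ (i, c + j)"
  by (auto simp: block12_def split_block_def Let_def add.commute)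

lemma transfer_fun_axis_regular:
  assumes "A \<in> carrier_mat q q" "B \<in> carrier_mat q c" "C \<in> carrier_mat r q" "D \<in> carrier_mat r c" "hurwitz A"
  shows "axis_regular r c (transfer_fun A B C D)"
  by (rule stable_proper_entrywise(4)[OF transfer_fun_carrier[OF assms(2-4)] transfer_fun_stable_proper[OF assms]])

lemma channel_blocks_regular:
  assumes channel: "quantum_channel n nw ny nd q A B C D"
  shows "axis_regular ny n (block11 ny n (transfer_fun A B C D))" "axis_regular ny nw (block12 ny n (transfer_fun A B C D))"
proof -
  let ?G = "transfer_fun A B C D"
  have h: "hurwitz A" and c: "A \<in> carrier_mat q q" "B \<in> carrier_mat q (n + nw)" "C \<in> carrier_mat (ny + nd) q" "D \<in> carrier_mat (ny + nd) (n + nw)"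
    using channel unfolding quantum_channel_def minimal_realization_def realization_def by blast+
  have G: "?G s \<in> carrier_mat (ny + nd) (n + nw)" for s
    by (rule transfer_fun_carrier[OF c(2-4)])
  note reg = axis_regularD(2)[OF transfer_fun_axis_regular[OF c h]]
  show "axis_regular ny n (block11 ny n ?G)"
    by (rule axis_regularI[where f = "\<lambda>i j \<omega>. ?G (\<i> * complex_of_real \<omega>) $$ (i, j)"])
      (auto simp: block11_carrier block11_index intro!: reg)
  show "axis_regular ny nw (block12 ny n ?G)"
    by (rule axis_regularI[where f = "\<lambda>i j \<omega>. ?G (\<i> * complex_of_real \<omega>) $$ (i, n + j)"])
      (auto simp: block12_carrier[where r' = nd, OF G] block12_index[where r' = nd, OF G] intro!: reg)
qed

lemma Phi_axis_regular:
  assumes channel: "quantum_channel n nw ny nd q A B C D"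
    and \<Sigma>u: "\<Sigma>u \<in> carrier_mat n n" and \<Sigma>w: "\<Sigma>w \<in> carrier_mat nw nw"
  shows "axis_regular (ny + n) (ny + n) (Phi n ny (transfer_fun A B C D) \<Sigma>u \<Sigma>w)"
proof -
  let ?G = "transfer_fun A B C D"
  note G11 = channel_blocks_regular(1)[OF channel] and G12 = channel_blocks_regular(2)[OF channel]
  have c: "transpose_mat \<Sigma>u \<in> carrier_mat n n" "transpose_mat \<Sigma>w \<in> carrier_mat nw nw" using \<Sigma>u \<Sigma>w by simp_all
  note Su = axis_regular_const[OF c(1)] and Sw = axis_regular_const[OF c(2)]
  note ISu = axis_regular_const[OF add_carrier_mat[OF c(1), of "1\<^sub>m n"]]
  have "Phi n ny ?G \<Sigma>u \<Sigma>w = (\<lambda>s. four_block_mat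
     (block11 ny n ?G s * transpose_mat \<Sigma>u * paraconj (block11 ny n ?G) s + block12 ny n ?G s * transpose_mat \<Sigma>w * paraconj (block12 ny n ?G) s)
     (- (block11 ny n ?G s * (1\<^sub>m n + transpose_mat \<Sigma>u)))
     (- ((1\<^sub>m n + transpose_mat \<Sigma>u) * paraconj (block11 ny n ?G) s))
     (transpose_mat \<Sigma>u + 2 \<cdot>\<^sub>m 1\<^sub>m n))"
    by (rule ext) (simp add: Phi_def Psi_def)
  then show ?thesis
    using axis_regular_four_block[OF
      axis_regular_add[OF axis_regular_mult[OF axis_regular_mult[OF G11 Su] axis_regular_paraconj[OF G11]]
        axis_regular_mult[OF axis_regular_mult[OF G12 Sw] axis_regular_paraconj[OF G12]]]
      axis_regular_uminus[OF axis_regular_mult[OF G11 ISu]]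
      axis_regular_uminus[OF axis_regular_mult[OF ISu axis_regular_paraconj[OF G11]]]
      axis_regular_const[OF add_carrier_mat[OF smult_carrier_mat[OF one_carrier_mat], of "transpose_mat \<Sigma>u" 2 n]]] by simp
qed

lemma Phi_lower_form:
  assumes channel: "quantum_channel n nw ny nd q A B C D"
    and \<Sigma>u: "\<Sigma>u \<in> carrier_mat n n" and \<Sigma>w: "\<Sigma>w \<in> carrier_mat nw nw" and u: "u \<in> carrier_vec n"
  shows "(Phi n ny (transfer_fun A B C D) \<Sigma>u \<Sigma>w (\<i> * complex_of_real \<omega>) *\<^sub>v (0\<^sub>v ny @\<^sub>v u)) \<bullet>c (0\<^sub>v ny @\<^sub>v u)
    = ((transpose_mat \<Sigma>u + 2 \<cdot>\<^sub>m 1\<^sub>m n) *\<^sub>v u) \<bullet>c u"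
proof -
  let ?s = "\<i> * complex_of_real \<omega>" and ?G = "transfer_fun A B C D"
  note G11 = axis_regularD(1)[OF channel_blocks_regular(1)[OF channel], of \<omega>]
    and G12 = axis_regularD(1)[OF channel_blocks_regular(2)[OF channel], of \<omega>]
  have c: "transpose_mat \<Sigma>u \<in> carrier_mat n n" "transpose_mat \<Sigma>w \<in> carrier_mat nw nw" using \<Sigma>u \<Sigma>w by simp_all
  have S: "transpose_mat \<Sigma>u + 2 \<cdot>\<^sub>m 1\<^sub>m n \<in> carrier_mat n n" by simp
  have IS: "1\<^sub>m n + transpose_mat \<Sigma>u \<in> carrier_mat n n" by (rule add_carrier_mat[OF c(1)])
  have P: "Psi n ny ?G \<Sigma>u \<Sigma>w ?s \<in> carrier_mat ny ny"
    unfolding Psi_def paraconj_axis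
    by (rule add_carrier_mat[OF mult_carrier_mat[OF mult_carrier_mat[OF G12 c(2)] adjoint_carrier[OF G12]]])
  have B: "- (block11 ny n ?G ?s * (1\<^sub>m n + transpose_mat \<Sigma>u)) \<in> carrier_mat ny n"
    by (rule uminus_carrier_mat[OF mult_carrier_mat[OF G11 IS]])
  have C: "- ((1\<^sub>m n + transpose_mat \<Sigma>u) * paraconj (block11 ny n ?G) ?s) \<in> carrier_mat n ny"
    unfolding paraconj_axis by (rule uminus_carrier_mat[OF mult_carrier_mat[OF IS adjoint_carrier[OF G11]]])
  have Su: "(transpose_mat \<Sigma>u + 2 \<cdot>\<^sub>m 1\<^sub>m n) *\<^sub>v u \<in> carrier_vec n" by (rule mult_mat_vec_carrier[OF S u])
  show ?thesis
    unfolding Phi_def four_block_mat_mult_vec[OF P B C S zero_carrier_vec u] mult_mat_zero_vec[OF P] mult_mat_zero_vec[OF C]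
      left_zero_vec[OF Su] left_zero_vec[OF mult_mat_vec_carrier[OF B u]]
      inner_append[OF mult_mat_vec_carrier[OF B u] Su zero_carrier_vec u] inner_zero_right[OF mult_mat_vec_carrier[OF B u]] by simp
qed

section \<open>Every design solves the equalization problem\<close>

lemma Phi_lambda_form:
  assumes \<Phi>: "Phi n ny G \<Sigma>u \<Sigma>w s \<in> carrier_mat (ny + n) (ny + n)" and h: "h \<in> carrier_vec ny" and u: "u \<in> carrier_vec n"
  shows "(Phi_lambda n ny G \<Sigma>u \<Sigma>w lam s *\<^sub>v (h @\<^sub>v u)) \<bullet>c (h @\<^sub>v u)
    = (Phi n ny G \<Sigma>u \<Sigma>w s *\<^sub>v (h @\<^sub>v u)) \<bullet>c (h @\<^sub>v u) + complex_of_real (lam\<^sup>2 * sqnorm u)"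
proof -
  have k: "h @\<^sub>v u \<in> carrier_vec (ny + n)" by (rule append_carrier_vec[OF h u])
  have E: "lower_id ny n \<in> carrier_mat (ny + n) (ny + n)"
    unfolding lower_id_def by (rule four_block_carrier_mat[OF zero_carrier_mat one_carrier_mat])
  note lE = smult_carrier_mat[OF E, of "complex_of_real (lam\<^sup>2)"]
  have "lower_id ny n *\<^sub>v (h @\<^sub>v u) = (0\<^sub>m ny ny *\<^sub>v h + 0\<^sub>m ny n *\<^sub>v u) @\<^sub>v (0\<^sub>m n ny *\<^sub>v h + 1\<^sub>m n *\<^sub>v u)"
    unfolding lower_id_def
    by (rule four_block_mat_mult_vec[OF zero_carrier_mat zero_carrier_mat zero_carrier_mat one_carrier_mat h u])
  then have "lower_id ny n *\<^sub>v (h @\<^sub>v u) = 0\<^sub>v ny @\<^sub>v u" using h u by simp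
  then have "((complex_of_real (lam\<^sup>2) \<cdot>\<^sub>m lower_id ny n) *\<^sub>v (h @\<^sub>v u)) \<bullet>c (h @\<^sub>v u) = complex_of_real (lam\<^sup>2 * sqnorm u)"
    unfolding smult_mat_mult_vec[OF E k] inner_smult_left[OF mult_mat_vec_carrier[OF E k] k]
    using inner_append[OF zero_carrier_vec u h u] inner_zero_left[OF h] by (simp add: inner_self)
  then show ?thesis
    unfolding Phi_lambda_def add_mult_distrib_mat_vec[OF \<Phi> lE k]
      inner_add_left[OF mult_mat_vec_carrier[OF \<Phi> k] mult_mat_vec_carrier[OF lE k] k] by simp
qed

text \<open>The factorization is given up to finitely many points; both sides are continuous on
  the imaginary axis, so it holds at every frequency.\<close>

lemma spectral_factor_on_axis:
  assumes F: "axis_regular r r F" and T: "axis_regular r p T"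
    and factor: "\<forall>\<^sub>F s in cofinite. F s = \<Upsilon> s * paraconj \<Upsilon> s" and eq: "\<forall>\<^sub>F s in cofinite. \<Upsilon> s = T s"
  shows "F (\<i> * complex_of_real \<omega>) = T (\<i> * complex_of_real \<omega>) * (T (\<i> * complex_of_real \<omega>))\<^sup>\<dagger>"
proof -
  note TT = axis_regular_mult[OF T axis_regular_paraconj[OF T]]
  have cof: "\<forall>\<^sub>F \<omega> in cofinite. F (\<i> * complex_of_real \<omega>) = T (\<i> * complex_of_real \<omega>) * paraconj T (\<i> * complex_of_real \<omega>)"
    using cofinite_axis[OF factor] cofinite_axis[OF eq]
    by eventually_elim (simp only: paraconj_axis)
  have "F (\<i> * complex_of_real \<omega>) = T (\<i> * complex_of_real \<omega>) * paraconj T (\<i> * complex_of_real \<omega>)"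
  proof (rule eq_matI)
    note c = axis_regularD(1)[OF F, of \<omega>] axis_regularD(1)[OF TT, of \<omega>]
    fix i j assume "i < dim_row (T (\<i> * complex_of_real \<omega>) * paraconj T (\<i> * complex_of_real \<omega>))"
      "j < dim_col (T (\<i> * complex_of_real \<omega>) * paraconj T (\<i> * complex_of_real \<omega>))"
    then have ij: "i < r" "j < r" using carrier_matD[OF c(2)] by simp_all
    show "F (\<i> * complex_of_real \<omega>) $$ (i, j) = (T (\<i> * complex_of_real \<omega>) * paraconj T (\<i> * complex_of_real \<omega>)) $$ (i, j)"
    proof (rule eq_if_cofinitely_eq)
      show "continuous_on UNIV (\<lambda>\<omega>. F (\<i> * complex_of_real \<omega>) $$ (i, j))"
        using axis_regularD(2)[OF F ij] by (simp add: axis_scalar_def)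
      show "continuous_on UNIV (\<lambda>\<omega>. (T (\<i> * complex_of_real \<omega>) * paraconj T (\<i> * complex_of_real \<omega>)) $$ (i, j))"
        using axis_regularD(2)[OF TT ij] by (simp add: axis_scalar_def)
      show "\<forall>\<^sub>F \<omega> in cofinite. F (\<i> * complex_of_real \<omega>) $$ (i, j) = (T (\<i> * complex_of_real \<omega>) * paraconj T (\<i> * complex_of_real \<omega>)) $$ (i, j)"
        using cof by eventually_elim simp
    qed
  qed (use carrier_matD[OF axis_regularD(1)[OF F, of \<omega>]] carrier_matD[OF axis_regularD(1)[OF TT, of \<omega>]] in simp_all)
  then show ?thesis by (simp only: paraconj_axis)
qed

lemma Phi_lambda_axis_regular:
  assumes "axis_regular (ny + n) (ny + n) (Phi n ny G \<Sigma>u \<Sigma>w)"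
  shows "axis_regular (ny + n) (ny + n) (Phi_lambda n ny G \<Sigma>u \<Sigma>w lam)"
proof -
  have E: "lower_id ny n \<in> carrier_mat (ny + n) (ny + n)"
    unfolding lower_id_def by (rule four_block_carrier_mat[OF zero_carrier_mat one_carrier_mat])
  have "Phi_lambda n ny G \<Sigma>u \<Sigma>w lam = (\<lambda>s. Phi n ny G \<Sigma>u \<Sigma>w s + complex_of_real (lam\<^sup>2) \<cdot>\<^sub>m lower_id ny n)"
    by (rule ext) (simp add: Phi_lambda_def)
  then show ?thesis
    using axis_regular_add[OF assms axis_regular_const[OF smult_carrier_mat[OF E, of "complex_of_real (lam\<^sup>2)"]]] by simp
qed

text \<open>The form of \<open>\<Upsilon> \<Upsilon>\<^sup>\<dagger>\<close> at \<open>[H11, 1]\<^sup>\<dagger> u\<close> is the squared gain that the design bounds; subtracting \<open>lam\<^sup>2\<close> gives the error.\<close>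

lemma (in factor_realization) design_contractive:
  fixes G :: "complex \<Rightarrow> complex mat"
  assumes \<Phi>: "axis_regular (ny + n) (ny + n) (Phi n ny G \<Sigma>u \<Sigma>w)" and h: "hurwitz A"
    and factor: "\<forall>\<^sub>F s in cofinite. Phi_lambda n ny G \<Sigma>u \<Sigma>w lam s = \<Upsilon> s * paraconj \<Upsilon> s"
    and eq: "\<forall>\<^sub>F s in cofinite. \<Upsilon> s = transfer_fun A B (C1 @\<^sub>r C2) (D1 @\<^sub>r D2) s"
    and \<gamma>: "\<gamma>\<^sup>2 = \<gamma>b\<^sup>2 - lam\<^sup>2" and \<theta>: "\<theta> > 0"
    and condition: "\<forall>\<omega>::ereal. pos_def (complex_of_real \<theta> \<cdot>\<^sub>m
      (freq_val (Phi n ny G \<Sigma>u \<Sigma>w) \<omega> - complex_of_real (\<gamma>\<^sup>2) \<cdot>\<^sub>m lower_id ny n) - signature_mat ny n)"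
    and design: "is_design m p n ny m11 A B C1 C2 D1 D2 \<gamma>b A11 B11 C11 J11"
  shows "transfer_fun A11 B11 C11 J11 \<in> contractive_equalizers n ny (Phi n ny G \<Sigma>u \<Sigma>w) \<gamma>"
proof -
  obtain X where X: "X \<in> carrier_mat (m + m11) (m + m11)" "pos_def X"
    and dims: "A11 \<in> carrier_mat m11 m11" "B11 \<in> carrier_mat m11 ny" "C11 \<in> carrier_mat n m11" "J11 \<in> carrier_mat n ny"
    and ineq: "design_inequality m p n ny m11 A B C1 C2 D1 D2 \<gamma>b X (K_mat A11 B11 C11 J11)"
    using design unfolding is_design_def by blast
  define H where "H = transfer_fun A11 B11 C11 J11"
  define T where "T = transfer_fun A B (C1 @\<^sub>r C2) (D1 @\<^sub>r D2)"
  have h11: "hurwitz A11" by (rule design_hurwitz[OF X dims ineq h])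
  note Hent = stable_proper_entrywise[OF transfer_fun_carrier[OF dims(2-4)] transfer_fun_stable_proper[OF dims h11], folded H_def]
  have T: "axis_regular (ny + n) p T"
    unfolding T_def by (rule transfer_fun_axis_regular[OF A B carrier_append_rows[OF C1 C2] carrier_append_rows[OF D1 D2] h])
  note Hc = axis_regularD(1)[OF Hent(4)] and \<Phi>c = axis_regularD(1)[OF \<Phi>] and Tc = axis_regularD(1)[OF T]
  have form: "(Phi n ny G \<Sigma>u \<Sigma>w (\<i> * complex_of_real \<omega>) *\<^sub>v ((H (\<i> * complex_of_real \<omega>))\<^sup>\<dagger> *\<^sub>v u @\<^sub>v u)) \<bullet>c ((H (\<i> * complex_of_real \<omega>))\<^sup>\<dagger> *\<^sub>v u @\<^sub>v u)
      < complex_of_real (\<gamma>\<^sup>2 * sqnorm u)" if u: "u \<in> carrier_vec n" "u \<noteq> 0\<^sub>v n" for \<omega> u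
  proof -
    let ?s = "\<i> * complex_of_real \<omega>"
    define k where "k = (H ?s)\<^sup>\<dagger> *\<^sub>v u @\<^sub>v u"
    have hk: "(H ?s)\<^sup>\<dagger> *\<^sub>v u \<in> carrier_vec ny" by (rule mult_mat_vec_carrier[OF adjoint_carrier[OF Hc] u(1)])
    have k: "k \<in> carrier_vec (ny + n)" unfolding k_def by (rule append_carrier_vec[OF hk u(1)])
    have "(Phi_lambda n ny G \<Sigma>u \<Sigma>w lam ?s *\<^sub>v k) \<bullet>c k = complex_of_real (sqnorm ((T ?s)\<^sup>\<dagger> *\<^sub>v k))"
      unfolding spectral_factor_on_axis[OF Phi_lambda_axis_regular[OF \<Phi>] T factor eq[folded T_def]]
        assoc_mult_mat_vec[OF Tc adjoint_carrier[OF Tc] k] inner_adjoint[OF Tc mult_mat_vec_carrier[OF adjoint_carrier[OF Tc] k] k]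
      by (rule inner_self)
    then have e: "(Phi n ny G \<Sigma>u \<Sigma>w ?s *\<^sub>v k) \<bullet>c k = complex_of_real (sqnorm ((T ?s)\<^sup>\<dagger> *\<^sub>v k) - lam\<^sup>2 * sqnorm u)"
      using Phi_lambda_form[OF \<Phi>c hk u(1), of lam] unfolding k_def[symmetric] by (simp add: algebra_simps)
    have "sqnorm ((T ?s)\<^sup>\<dagger> *\<^sub>v k) < \<gamma>b\<^sup>2 * sqnorm u"
      unfolding T_def k_def H_def by (rule design_frequency_bound[OF X dims ineq h u])
    then show ?thesis
      unfolding k_def[symmetric] e \<gamma> by (simp add: less_complex_def algebra_simps)
  qed
  have below: "error_below n (Phi n ny G \<Sigma>u \<Sigma>w) H \<gamma>"
    by (subst error_below_iff[where ny = ny]) (use Hc \<Phi>c form in blast)+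
  have "freq_val H \<omega> * (freq_val H \<omega>)\<^sup>\<dagger> \<prec> 1\<^sub>m n" for \<omega>
  proof (rule contractive_if_error_bounded[OF \<Phi> Hent(4) \<theta> condition])
    fix \<omega> :: real and u :: "complex vec" assume u: "u \<in> carrier_vec n"
    show "Re ((Phi n ny G \<Sigma>u \<Sigma>w (\<i> * complex_of_real \<omega>) *\<^sub>v ((H (\<i> * complex_of_real \<omega>))\<^sup>\<dagger> *\<^sub>v u @\<^sub>v u)) \<bullet>c ((H (\<i> * complex_of_real \<omega>))\<^sup>\<dagger> *\<^sub>v u @\<^sub>v u))
      \<le> \<gamma>\<^sup>2 * sqnorm u"
    proof (cases "u = 0\<^sub>v n")
      case True
      have "(H (\<i> * complex_of_real \<omega>))\<^sup>\<dagger> *\<^sub>v u @\<^sub>v u = 0\<^sub>v (ny + n)"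
        using mult_mat_zero_vec[OF adjoint_carrier[OF Hc[of \<omega>]]] True by (simp only: append_vec_zero)
      moreover have "sqnorm u = 0" using sqnorm_eq_0[OF u] True by blast
      ultimately show ?thesis
        using inner_zero_right[OF mult_mat_vec_carrier[OF \<Phi>c[of \<omega>] zero_carrier_vec]] by simp
    next
      case False
      then show ?thesis using form[OF u False, of \<omega>] by (simp add: less_complex_def)
    qed
  qed
  then show ?thesis
    unfolding contractive_equalizers_def using Hent below by (simp add: H_def[symmetric])
qed

section \<open>From paraunitary equalizers to strict contractions\<close>

lemma form_along_line:
  fixes t :: real
  assumes M: "M \<in> carrier_mat N N" "M\<^sup>\<dagger> = M" and y: "y \<in> carrier_vec N" and z: "z \<in> carrier_vec N"
  shows "Re ((M *\<^sub>v (y + complex_of_real t \<cdot>\<^sub>v z)) \<bullet>c (y + complex_of_real t \<cdot>\<^sub>v z))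
    = Re ((M *\<^sub>v y) \<bullet>c y) + 2 * t * Re ((M *\<^sub>v z) \<bullet>c y) + t\<^sup>2 * Re ((M *\<^sub>v z) \<bullet>c z)"
proof -
  have tz: "complex_of_real t \<cdot>\<^sub>v z \<in> carrier_vec N" using z by simp
  note My = mult_mat_vec_carrier[OF M(1) y] and Mz = mult_mat_vec_carrier[OF M(1) z]
  have Mtz: "complex_of_real t \<cdot>\<^sub>v (M *\<^sub>v z) \<in> carrier_vec N" using Mz by simp
  have yz: "(M *\<^sub>v y) \<bullet>c z = cnj ((M *\<^sub>v z) \<bullet>c y)"
    unfolding hermitian_inner[OF M y z] by (rule inner_commute[OF y Mz])
  have "(M *\<^sub>v (y + complex_of_real t \<cdot>\<^sub>v z)) \<bullet>c (y + complex_of_real t \<cdot>\<^sub>v z)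
      = (M *\<^sub>v y) \<bullet>c y + complex_of_real t * cnj ((M *\<^sub>v z) \<bullet>c y)
        + (complex_of_real t * ((M *\<^sub>v z) \<bullet>c y) + complex_of_real t * (complex_of_real t * ((M *\<^sub>v z) \<bullet>c z)))"
    unfolding mult_add_distrib_mat_vec[OF M(1) y tz] mult_mat_vec[OF M(1) z]
      inner_add_left[OF My Mtz add_carrier_vec[OF y tz]] inner_add_right[OF My y tz] inner_add_right[OF Mtz y tz]
      inner_smult_left[OF Mz y] inner_smult_right[OF My z] inner_smult_left[OF Mz tz] inner_smult_right[OF Mz z] yz by simp
  then show ?thesis by (simp add: power2_eq_square algebra_simps)
qed

text \<open>\<open>H11\<^sup>\<dagger> u\<close> consists of the first entries of \<open>H\<^sup>\<dagger> (u, 0)\<close>, whose norm is that of \<open>u\<close> wherever \<open>H\<close>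
  is unitary; the finitely many other points are covered by continuity.\<close>

lemma paraunitary_block_contraction:
  assumes H: "axis_regular nf nf H" and n: "n \<le> nf" and ny: "ny \<le> nf"
    and unitary: "\<forall>\<^sub>F s in cofinite. H s * paraconj H s = 1\<^sub>m nf" and u: "u \<in> carrier_vec n"
  shows "sqnorm ((block11 n ny H (\<i> * complex_of_real \<omega>))\<^sup>\<dagger> *\<^sub>v u) \<le> sqnorm u"
proof -
  define g where "g \<omega> = sqnorm ((block11 n ny H (\<i> * complex_of_real \<omega>))\<^sup>\<dagger> *\<^sub>v u)" for \<omega> :: real
  note Hc = axis_regularD(1)[OF H]
  define u' where "u' = u @\<^sub>v 0\<^sub>v (nf - n)"
  have u': "u' \<in> carrier_vec nf"
    unfolding u'_def using append_carrier_vec[OF u zero_carrier_vec[of "nf - n"]] n by simp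
  have entry: "((block11 n ny H s)\<^sup>\<dagger> *\<^sub>v u) $ j = ((H s)\<^sup>\<dagger> *\<^sub>v u') $ j" if j: "j < ny" and Hs: "H s \<in> carrier_mat nf nf" for j s
  proof -
    have adj: "(block11 n ny H s)\<^sup>\<dagger> $$ (j, i) = cnj (H s $$ (i, j))" if "i < n" for i
      using that j block11_carrier[of n ny H s] by (subst adjoint_index) (auto simp: block11_index)
    have adj': "(H s)\<^sup>\<dagger> $$ (j, i) = cnj (H s $$ (i, j))" if "i < nf" for i
      using that j ny Hs by (subst adjoint_index) auto
    have "((block11 n ny H s)\<^sup>\<dagger> *\<^sub>v u) $ j = (\<Sum>i<n. (block11 n ny H s)\<^sup>\<dagger> $$ (j, i) * u $ i)"
      by (rule mult_mat_vec_sum[OF adjoint_carrier[OF block11_carrier] u j])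
    also have "\<dots> = (\<Sum>i<n. cnj (H s $$ (i, j)) * u' $ i)"
      by (rule sum.cong[OF refl]) (use u in \<open>simp add: adj u'_def\<close>)
    also have "\<dots> = (\<Sum>i<nf. cnj (H s $$ (i, j)) * u' $ i)"
      by (rule sum.mono_neutral_left) (use n u in \<open>auto simp: u'_def\<close>)
    also have "\<dots> = (\<Sum>i<nf. (H s)\<^sup>\<dagger> $$ (j, i) * u' $ i)"
      by (rule sum.cong[OF refl]) (simp add: adj')
    also have "\<dots> = ((H s)\<^sup>\<dagger> *\<^sub>v u') $ j"
      using mult_mat_vec_sum[OF adjoint_carrier[OF Hs] u', of j] j ny by simp
    finally show ?thesis .
  qed
  have "\<forall>\<^sub>F \<omega> in cofinite. g \<omega> \<le> sqnorm u"
    using cofinite_axis[OF unitary]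
  proof eventually_elim
    case (elim \<omega>)
    let ?s = "\<i> * complex_of_real \<omega>"
    have Hs: "H ?s \<in> carrier_mat nf nf" by (rule Hc)
    have "complex_of_real (sqnorm ((H ?s)\<^sup>\<dagger> *\<^sub>v u')) = ((H ?s * (H ?s)\<^sup>\<dagger>) *\<^sub>v u') \<bullet>c u'"
      unfolding assoc_mult_mat_vec[OF Hs adjoint_carrier[OF Hs] u']
        inner_adjoint[OF Hs mult_mat_vec_carrier[OF adjoint_carrier[OF Hs] u'] u'] by (rule inner_self[symmetric])
    also have "\<dots> = u' \<bullet>c u'" using elim u' unfolding paraconj_axis by simp
    finally have "sqnorm ((H ?s)\<^sup>\<dagger> *\<^sub>v u') = sqnorm u'" unfolding inner_self of_real_eq_iff .
    also have "sqnorm u' = sqnorm u"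
      unfolding u'_def sqnorm_append using sqnorm_eq_0[of "0\<^sub>v (nf - n)" "nf - n"] by simp
    finally have eq: "sqnorm ((H ?s)\<^sup>\<dagger> *\<^sub>v u') = sqnorm u" .
    have "g \<omega> = (\<Sum>j<ny. (cmod (((H ?s)\<^sup>\<dagger> *\<^sub>v u') $ j))\<^sup>2)"
      unfolding g_def sqnorm_sum[OF mult_mat_vec_carrier[OF adjoint_carrier[OF block11_carrier] u]]
      by (rule sum.cong[OF refl]) (simp only: entry[OF _ Hs] lessThan_iff)
    also have "\<dots> \<le> (\<Sum>j<nf. (cmod (((H ?s)\<^sup>\<dagger> *\<^sub>v u') $ j))\<^sup>2)"
      by (rule sum_mono2) (use ny in auto)
    also have "\<dots> = sqnorm u"
      unfolding eq[symmetric] by (rule sqnorm_sum[OF mult_mat_vec_carrier[OF adjoint_carrier[OF Hs] u'], symmetric])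
    finally show ?case .
  qed
  moreover have "isCont g \<omega>"
  proof -
    have c: "block11 n ny H (\<i> * complex_of_real t) \<in> carrier_mat n ny" for t by (rule block11_carrier)
    have lim: "((\<lambda>t. block11 n ny H (\<i> * complex_of_real t) $$ (i, j)) \<longlongrightarrow> block11 n ny H (\<i> * complex_of_real \<omega>) $$ (i, j)) (at \<omega>)"
      if "i < n" "j < ny" for i j
    proof -
      have "axis_scalar (\<lambda>t. H (\<i> * complex_of_real t) $$ (i, j))"
        using axis_regularD(2)[OF H, of i j] that n ny by simp
      then show ?thesis
        using that by (simp add: block11_index axis_scalar_def continuous_on_eq_continuous_at isCont_def)
    qed
    show ?thesis
      unfolding isCont_def g_def
      by (rule sqnorm_tendsto[OF mult_mat_vec_tendsto'[OF adjoint_carrier[OF c] adjoint_carrier[OF c] adjoint_entry_tendsto[OF c c lim] u u tendsto_const]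
        mult_mat_vec_carrier[OF adjoint_carrier[OF c] u] mult_mat_vec_carrier[OF adjoint_carrier[OF c] u]])
  qed
  ultimately have "g \<omega> \<le> sqnorm u" using le_if_cofinitely_le by blast
  then show ?thesis by (simp add: g_def)
qed

text \<open>Shrinking the block \<open>H11\<close> of a paraunitary \<open>H\<close> makes it strictly contractive; by convexity of the
  error along the segment towards \<open>0\<close> the error grows by an arbitrarily small amount only.\<close>

lemma scaled_block_contractive:
  assumes \<Phi>: "axis_regular (ny + n) (ny + n) \<Phi>"
    and real: "\<And>(\<omega>::real) x. x \<in> carrier_vec (ny + n) \<Longrightarrow> Im ((\<Phi> (\<i> * complex_of_real \<omega>) *\<^sub>v x) \<bullet>c x) = 0"
    and psd: "\<And>(\<omega>::real) h. h \<in> carrier_vec ny \<Longrightarrow> 0 \<le> Re ((\<Phi> (\<i> * complex_of_real \<omega>) *\<^sub>v (h @\<^sub>v 0\<^sub>v n)) \<bullet>c (h @\<^sub>v 0\<^sub>v n))"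
    and lower: "\<And>(\<omega>::real) u. u \<in> carrier_vec n \<Longrightarrow> Re ((\<Phi> (\<i> * complex_of_real \<omega>) *\<^sub>v (0\<^sub>v ny @\<^sub>v u)) \<bullet>c (0\<^sub>v ny @\<^sub>v u)) \<le> c * sqnorm u"
    and H: "H \<in> admissible_equalizers n ny" and below: "error_below n \<Phi> (block11 n ny H) \<gamma>"
    and g: "0 < \<gamma>" "\<gamma> < \<gamma>'"
  shows "contractive_equalizers n ny \<Phi> \<gamma>' \<noteq> {}"
proof -
  obtain nz nf \<tau> where nf: "nf = ny + nz" "n \<le> nf" and rat: "entrywise nf nf rational_fun H"
    and hardy: "entrywise nf nf hardy_inf_fun H" and \<tau>: "\<tau> > 0" "entrywise nf nf (\<lambda>f. f analytic_on {s. Re s > - \<tau>}) H"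
    and unitary: "\<forall>\<^sub>F s in cofinite. paraconj H s * H s = 1\<^sub>m nf \<and> H s * paraconj H s = 1\<^sub>m nf"
    using H unfolding admissible_equalizers_def by blast
  have Hc: "H s \<in> carrier_mat nf nf" for s using rat by (simp add: entrywise_def)
  have Hsp: "stable_proper (\<lambda>s. H s $$ (i, j))" if "i < nf" "j < nf" for i j
    using rat hardy \<tau>(2) that by (intro stable_proper_if_hardy[OF _ \<tau>(1)]) (auto simp: entrywise_def)
  have ny: "ny \<le> nf" using nf by simp
  have Hreg: "axis_regular nf nf H" by (rule stable_proper_entrywise(4)[OF Hc Hsp])
  have "\<forall>\<^sub>F s in cofinite. H s * paraconj H s = 1\<^sub>m nf" using unitary by eventually_elim simp
  note contr = paraunitary_block_contraction[OF Hreg nf(2) ny this]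
  \<comment> \<open>the convexity bound costs at most \<open>\<epsilon> * c\<close>, which has to fit between \<open>\<gamma>\<^sup>2\<close> and \<open>\<gamma>'\<^sup>2\<close>\<close>
  define \<epsilon> where "\<epsilon> = min (1 / 2) ((\<gamma>'\<^sup>2 - \<gamma>\<^sup>2) / (\<bar>c\<bar> + 1))"
  have sq: "\<gamma>\<^sup>2 < \<gamma>'\<^sup>2" using g by (simp add: power_strict_mono)
  have \<epsilon>: "0 < \<epsilon>" using sq by (simp add: \<epsilon>_def)
  have \<epsilon>2: "\<epsilon> \<le> 1 / 2" unfolding \<epsilon>_def by (rule min.cobounded1)
  have "\<epsilon> * (\<bar>c\<bar> + 1) \<le> (\<gamma>'\<^sup>2 - \<gamma>\<^sup>2) / (\<bar>c\<bar> + 1) * (\<bar>c\<bar> + 1)"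
    by (intro mult_right_mono) (auto simp: \<epsilon>_def)
  then have \<epsilon>c: "\<epsilon> * (\<bar>c\<bar> + 1) \<le> \<gamma>'\<^sup>2 - \<gamma>\<^sup>2" by simp
  have "\<epsilon> * c \<le> \<epsilon> * (\<bar>c\<bar> + 1)" using \<epsilon> by (intro mult_left_mono) auto
  then have \<epsilon>c': "\<epsilon> * c \<le> \<gamma>'\<^sup>2 - \<gamma>\<^sup>2" using \<epsilon>c by simp
  define t where "t = 1 - \<epsilon>"
  have t: "0 < t" "t < 1" using \<epsilon> \<epsilon>2 by (auto simp: t_def)
  define K where "K s = complex_of_real t \<cdot>\<^sub>m block11 n ny H s" for s
  have Kc: "K s \<in> carrier_mat n ny" for s unfolding K_def by (rule smult_carrier_mat[OF block11_carrier])
  have Ksp: "stable_proper (\<lambda>s. K s $$ (i, j))" if "i < n" "j < ny" for i j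
  proof -
    have "stable_proper (\<lambda>s. H s $$ (i, j))" using that nf ny by (intro Hsp) auto
    then obtain p q where pq: "\<And>z. 0 \<le> Re z \<Longrightarrow> poly q z \<noteq> 0" "degree p \<le> degree q"
      "\<And>s. poly q s \<noteq> 0 \<Longrightarrow> H s $$ (i, j) = poly p s / poly q s"
      by (rule stable_properE) blast
    have "K s $$ (i, j) = complex_of_real t * H s $$ (i, j)" for s
      using that block11_carrier[of n ny H s] by (simp add: K_def block11_index)
    then show ?thesis
      unfolding stable_proper_def using pq degree_smult_le[of "complex_of_real t" p]
      by (intro exI[of _ "Polynomial.smult (complex_of_real t) p"] exI[of _ q]) auto
  qed
  note Kent = stable_proper_entrywise[where F = K, OF Kc Ksp]
  have Kreg: "axis_regular n ny K" by (rule Kent(4))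
  have adj: "(K s)\<^sup>\<dagger> *\<^sub>v u = complex_of_real t \<cdot>\<^sub>v ((block11 n ny H s)\<^sup>\<dagger> *\<^sub>v u)" if u: "u \<in> carrier_vec n" for s u
  proof -
    have "(K s)\<^sup>\<dagger> = complex_of_real t \<cdot>\<^sub>m (block11 n ny H s)\<^sup>\<dagger>"
    proof (rule eq_matI)
      note d = carrier_matD[OF block11_carrier[of n ny H s]] carrier_matD[OF Kc[of s]]
      fix i j assume "i < dim_row (complex_of_real t \<cdot>\<^sub>m (block11 n ny H s)\<^sup>\<dagger>)" "j < dim_col (complex_of_real t \<cdot>\<^sub>m (block11 n ny H s)\<^sup>\<dagger>)"
      then have ij: "i < ny" "j < n" using d by simp_all
      show "(K s)\<^sup>\<dagger> $$ (i, j) = (complex_of_real t \<cdot>\<^sub>m (block11 n ny H s)\<^sup>\<dagger>) $$ (i, j)"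
        using ij d by (simp add: K_def)
    qed (use carrier_matD[OF block11_carrier[of n ny H s]] carrier_matD[OF Kc[of s]] in simp_all)
    then show ?thesis using smult_mat_mult_vec[OF adjoint_carrier[OF block11_carrier] u] by simp
  qed
  note \<Phi>c = axis_regularD(1)[OF \<Phi>]
  have herm: "(\<Phi> (\<i> * complex_of_real \<omega>))\<^sup>\<dagger> = \<Phi> (\<i> * complex_of_real \<omega>)" for \<omega>
    by (rule hermitian_if_form_real[OF \<Phi>c real])
  have form: "(\<Phi> (\<i> * complex_of_real \<omega>) *\<^sub>v ((K (\<i> * complex_of_real \<omega>))\<^sup>\<dagger> *\<^sub>v u @\<^sub>v u)) \<bullet>c ((K (\<i> * complex_of_real \<omega>))\<^sup>\<dagger> *\<^sub>v u @\<^sub>v u)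
      < complex_of_real (\<gamma>'\<^sup>2 * sqnorm u)" if u: "u \<in> carrier_vec n" "u \<noteq> 0\<^sub>v n" for \<omega> u
  proof -
    let ?s = "\<i> * complex_of_real \<omega>"
    let ?f = "\<lambda>x. Re ((\<Phi> ?s *\<^sub>v x) \<bullet>c x)"
    define h where "h = (block11 n ny H ?s)\<^sup>\<dagger> *\<^sub>v u"
    have h: "h \<in> carrier_vec ny" unfolding h_def by (rule mult_mat_vec_carrier[OF adjoint_carrier[OF block11_carrier] u(1)])
    define y where "y = 0\<^sub>v ny @\<^sub>v u"
    define z where "z = h @\<^sub>v 0\<^sub>v n"
    have y: "y \<in> carrier_vec (ny + n)" unfolding y_def by (rule append_carrier_vec[OF zero_carrier_vec u(1)])
    have z: "z \<in> carrier_vec (ny + n)" unfolding z_def by (rule append_carrier_vec[OF h zero_carrier_vec])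
    have line: "y + complex_of_real r \<cdot>\<^sub>v z = (complex_of_real r \<cdot>\<^sub>v h) @\<^sub>v u" for r
      using h u(1) by (intro eq_vecI) (auto simp: y_def z_def)
    have "h @\<^sub>v u = y + complex_of_real 1 \<cdot>\<^sub>v z" using line[of 1] by simp
    then have f1: "?f (h @\<^sub>v u) = ?f y + 2 * Re ((\<Phi> ?s *\<^sub>v z) \<bullet>c y) + ?f z"
      using form_along_line[OF \<Phi>c herm y z, of \<omega> 1] by simp
    have ft: "?f ((complex_of_real t \<cdot>\<^sub>v h) @\<^sub>v u) = ?f y + 2 * t * Re ((\<Phi> ?s *\<^sub>v z) \<bullet>c y) + t\<^sup>2 * ?f z"
      unfolding line[symmetric] by (rule form_along_line[OF \<Phi>c herm y z])
    have below': "?f (h @\<^sub>v u) < \<gamma>\<^sup>2 * sqnorm u"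
    proof -
      have "\<forall>\<omega>::real. \<forall>u\<in>carrier_vec n. u \<noteq> 0\<^sub>v n \<longrightarrow>
        (\<Phi> (\<i> * complex_of_real \<omega>) *\<^sub>v ((block11 n ny H (\<i> * complex_of_real \<omega>))\<^sup>\<dagger> *\<^sub>v u @\<^sub>v u)) \<bullet>c
          ((block11 n ny H (\<i> * complex_of_real \<omega>))\<^sup>\<dagger> *\<^sub>v u @\<^sub>v u) < complex_of_real (\<gamma>\<^sup>2 * sqnorm u)"
        using below by (subst (asm) error_below_iff[where ny = ny]) (use block11_carrier \<Phi>c in blast)+
      then show ?thesis using u by (simp add: h_def less_complex_def)
    qed
    have "0 \<le> ?f z" unfolding z_def by (rule psd[OF h])
    then have "t * (1 - t) * ?f z \<ge> 0" using t by simp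
    then have "?f ((complex_of_real t \<cdot>\<^sub>v h) @\<^sub>v u) \<le> t * ?f (h @\<^sub>v u) + (1 - t) * ?f y"
      unfolding ft f1 by (simp add: algebra_simps power2_eq_square)
    also have "\<dots> \<le> t * ?f (h @\<^sub>v u) + (1 - t) * (c * sqnorm u)"
      using lower[OF u(1), of \<omega>] t by (intro add_left_mono mult_left_mono) (auto simp: y_def)
    also have "\<dots> < t * (\<gamma>\<^sup>2 * sqnorm u) + (1 - t) * (c * sqnorm u)"
      using below' t by simp
    also have "\<dots> = (\<gamma>\<^sup>2 - \<epsilon> * \<gamma>\<^sup>2 + \<epsilon> * c) * sqnorm u"
      by (simp add: t_def algebra_simps)
    also have "\<dots> \<le> \<gamma>'\<^sup>2 * sqnorm u"
    proof (rule mult_right_mono)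
      have "0 \<le> \<epsilon> * \<gamma>\<^sup>2" using \<epsilon> by simp
      then show "\<gamma>\<^sup>2 - \<epsilon> * \<gamma>\<^sup>2 + \<epsilon> * c \<le> \<gamma>'\<^sup>2" using \<epsilon>c' by simp
    qed simp
    finally have "?f ((complex_of_real t \<cdot>\<^sub>v h) @\<^sub>v u) < \<gamma>'\<^sup>2 * sqnorm u" .
    moreover have "Im ((\<Phi> ?s *\<^sub>v ((complex_of_real t \<cdot>\<^sub>v h) @\<^sub>v u)) \<bullet>c ((complex_of_real t \<cdot>\<^sub>v h) @\<^sub>v u)) = 0"
      by (rule real[OF append_carrier_vec[OF _ u(1)]]) (use h in simp)
    ultimately show ?thesis unfolding adj[OF u(1)] h_def[symmetric] by (simp add: less_complex_def)
  qed
  have below': "error_below n \<Phi> K \<gamma>'"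
    by (subst error_below_iff[where ny = ny]) (use Kc \<Phi>c form in blast)+
  have "freq_val K \<omega> * (freq_val K \<omega>)\<^sup>\<dagger> \<prec> 1\<^sub>m n" for \<omega>
    unfolding contraction_iff[OF freq_val_tendsto(1)[OF Kreg]]
  proof (intro ballI impI)
    fix u :: "complex vec" assume u: "u \<in> carrier_vec n" "u \<noteq> 0\<^sub>v n"
    note Fc = freq_val_tendsto[OF Kreg]
    have "((\<lambda>r. sqnorm ((K (\<i> * complex_of_real r))\<^sup>\<dagger> *\<^sub>v u)) \<longlongrightarrow> sqnorm ((freq_val K \<omega>)\<^sup>\<dagger> *\<^sub>v u)) (axis_filter \<omega>)"
      by (rule sqnorm_tendsto[OF mult_mat_vec_tendsto'[OF adjoint_carrier[OF Kc] adjoint_carrier[OF Fc(1)] adjoint_entry_tendsto[OF Kc Fc(1) Fc(2)] u(1) u(1) tendsto_const]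
        mult_mat_vec_carrier[OF adjoint_carrier[OF Kc] u(1)] mult_mat_vec_carrier[OF adjoint_carrier[OF Fc(1)] u(1)]])
    moreover have "sqnorm ((K (\<i> * complex_of_real r))\<^sup>\<dagger> *\<^sub>v u) \<le> t\<^sup>2 * sqnorm u" for r
      unfolding adj[OF u(1)] sqnorm_smult using contr[OF u(1), of r] by (simp add: mult_left_mono)
    ultimately have "sqnorm ((freq_val K \<omega>)\<^sup>\<dagger> *\<^sub>v u) \<le> t\<^sup>2 * sqnorm u"
      by (intro tendsto_upperbound[of _ _ "axis_filter \<omega>"]) auto
    also have "\<dots> < 1 * sqnorm u"
      using t sqnorm_pos[OF u(1)] u(2) by (intro mult_strict_right_mono) (auto simp: power_less_one_iff)
    finally show "sqnorm ((freq_val K \<omega>)\<^sup>\<dagger> *\<^sub>v u) < sqnorm u" by simp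
  qed
  then have "K \<in> contractive_equalizers n ny \<Phi> \<gamma>'"
    unfolding contractive_equalizers_def using Kent below' by simp
  then show ?thesis by blast
qed

section \<open>The Cayley transform\<close>

text \<open>An involution that exchanges the closed right half-plane, with infinity, and the closed unit disc;
  infinity corresponds to \<open>-1\<close>.\<close>

definition cayley :: "complex \<Rightarrow> complex" where
  "cayley s = (1 - s) / (1 + s)"

text \<open>The numerator of \<open>p \<circ> cayley\<close> over the denominator \<open>(1 + s) ^ d\<close>.\<close>

definition cayley_poly :: "nat \<Rightarrow> complex poly \<Rightarrow> complex poly" where
  "cayley_poly d p = (\<Sum>k\<le>d. Polynomial.smult (coeff p k) ([:1, -1:] ^ k * [:1, 1:] ^ (d - k)))"

lemma poly_cayley_poly_sum: "poly (cayley_poly d p) s = (\<Sum>k\<le>d. coeff p k * ((1 - s) ^ k * (1 + s) ^ (d - k)))"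
  by (simp add: cayley_poly_def poly_sum poly_power)

lemma poly_as_sum: "degree p \<le> d \<Longrightarrow> poly p (z :: complex) = (\<Sum>k\<le>d. coeff p k * z ^ k)"
  unfolding poly_altdef by (rule sum.mono_neutral_left) (auto simp: coeff_eq_0)

lemma poly_cayley_poly:
  assumes "degree p \<le> d" "s \<noteq> -1"
  shows "poly (cayley_poly d p) s = (1 + s) ^ d * poly p (cayley s)"
proof -
  have s: "1 + s \<noteq> 0" using assms(2) by (metis add.commute add_eq_0_iff)
  have "(1 - s) ^ k * (1 + s) ^ (d - k) = (1 + s) ^ d * cayley s ^ k" if "k \<le> d" for k
    using s that by (simp add: cayley_def power_divide power_diff)
  then show ?thesis
    by (simp add: poly_as_sum[OF assms(1)] poly_cayley_poly_sum sum_distrib_left algebra_simps)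
qed

text \<open>The value at the image of infinity is the coefficient of degree \<open>d\<close>, up to a power of \<open>2\<close>.  For the
  denominator of a proper function, with \<open>d\<close> its degree, it does not vanish.\<close>

lemma poly_cayley_poly_minus_one: "poly (cayley_poly d p) (-1) = coeff p d * 2 ^ d"
proof -
  have "poly (cayley_poly d p) (-1) = (\<Sum>k\<le>d. coeff p k * (2 ^ k * 0 ^ (d - k)))"
    by (simp add: poly_cayley_poly_sum)
  also have "\<dots> = (\<Sum>k\<in>{d}. coeff p k * (2 ^ k * 0 ^ (d - k)))"
    by (rule sum.mono_neutral_right) auto
  finally show ?thesis by simp
qed

lemma cayley_cayley: "s \<noteq> -1 \<Longrightarrow> cayley (cayley s) = s"
proof -
  assume "s \<noteq> -1"
  then have s: "1 + s \<noteq> 0" by (metis add.commute add_eq_0_iff)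
  have "1 - cayley s = 2 * s / (1 + s)" "1 + cayley s = 2 / (1 + s)"
    using s by (simp_all add: cayley_def field_simps)
  then show ?thesis using s by (simp add: cayley_def[of "cayley s"])
qed

lemma cayley_neq_minus_one: "cayley s \<noteq> -1" if "s \<noteq> -1"
proof
  assume "cayley s = -1"
  moreover have "1 + s \<noteq> 0" using that by (metis add.commute add_eq_0_iff)
  ultimately show False by (simp add: cayley_def field_simps)
qed

lemma right_half_plane_neq: "0 \<le> Re s \<Longrightarrow> s \<noteq> -1"
  by auto

lemma cayley_norm:
  assumes "0 \<le> Re s"
  shows "cmod (cayley s) \<le> 1"
proof -
  have "(cmod (1 - s))\<^sup>2 \<le> (cmod (1 + s))\<^sup>2"
    using assms unfolding cmod_power2 by (simp add: power2_eq_square algebra_simps)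
  then have "cmod (1 - s) \<le> cmod (1 + s)" by (rule power2_le_imp_le) simp
  moreover have "1 + s \<noteq> 0" using right_half_plane_neq[OF assms] by (metis add.commute add_eq_0_iff)
  ultimately show ?thesis by (simp add: cayley_def norm_divide)
qed

lemma cayley_right_half_plane:
  assumes "cmod z \<le> 1" "z \<noteq> -1"
  shows "0 \<le> Re (cayley z)"
proof -
  have "Re (cayley z) = ((1 - Re z) * (1 + Re z) - Im z * Im z) / (cmod (1 + z))\<^sup>2"
    unfolding cayley_def Re_divide cmod_power2 by (simp add: power2_eq_square)
  moreover have "(cmod z)\<^sup>2 \<le> 1" using assms(1) by (simp add: power_le_one)
  then have "0 \<le> (1 - Re z) * (1 + Re z) - Im z * Im z"
    unfolding cmod_power2 by (simp add: power2_eq_square algebra_simps)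
  ultimately show ?thesis by simp
qed

lemma cayley_axis_norm: "cmod (cayley (\<i> * complex_of_real \<omega>)) = 1"
proof -
  have "cmod (1 - \<i> * complex_of_real \<omega>) = cmod (1 + \<i> * complex_of_real \<omega>)"
    by (simp add: cmod_def)
  moreover have "1 + \<i> * complex_of_real \<omega> \<noteq> 0" by (simp add: complex_eq_iff)
  ultimately show ?thesis by (simp add: cayley_def norm_divide)
qed

lemma cayley_circle:
  assumes "cmod z = 1" "z \<noteq> -1"
  obtains \<omega> :: real where "z = cayley (\<i> * complex_of_real \<omega>)"
proof -
  have "(cmod z)\<^sup>2 = 1" using assms(1) by simp
  then have "(1 - Re z) * (1 + Re z) - Im z * Im z = 0"
    unfolding cmod_power2 by (simp add: power2_eq_square algebra_simps)
  moreover have "Re (cayley z) = ((1 - Re z) * (1 + Re z) - Im z * Im z) / (cmod (1 + z))\<^sup>2"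
    unfolding cayley_def Re_divide cmod_power2 by (simp add: power2_eq_square)
  ultimately have "Re (cayley z) = 0" by simp
  then have "cayley z = \<i> * complex_of_real (Im (cayley z))" by (simp add: complex_eq_iff)
  then show ?thesis using that[of "Im (cayley z)"] cayley_cayley[OF assms(2)] by metis
qed

lemma stable_proper_cayley:
  assumes "stable_proper f"
  obtains a b where "\<And>z. cmod z \<le> 1 \<Longrightarrow> poly b z \<noteq> 0"
    "\<And>s. 0 \<le> Re s \<Longrightarrow> f s = poly a (cayley s) / poly b (cayley s)"
proof -
  obtain p q where pq: "\<And>z. 0 \<le> Re z \<Longrightarrow> poly q z \<noteq> 0" "q \<noteq> 0" "degree p \<le> degree q"
    "\<And>s. poly q s \<noteq> 0 \<Longrightarrow> f s = poly p s / poly q s"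
    using stable_properE[OF assms] by metis
  define d where "d = degree q"
  have "poly (cayley_poly d q) z \<noteq> 0" if "cmod z \<le> 1" for z
  proof (cases "z = -1")
    case True
    then show ?thesis using pq(2) unfolding True poly_cayley_poly_minus_one by (simp add: d_def)
  next
    case False
    have "1 + z \<noteq> 0" using False by (metis add.commute add_eq_0_iff)
    then show ?thesis
      using pq(1)[OF cayley_right_half_plane[OF that False]] poly_cayley_poly[of q d z] False by (simp add: d_def)
  qed
  moreover have "f s = poly (cayley_poly d p) (cayley s) / poly (cayley_poly d q) (cayley s)" if s: "0 \<le> Re s" for s
  proof -
    have s1: "s \<noteq> -1" using s by (rule right_half_plane_neq)
    have c: "cayley s \<noteq> -1" "1 + cayley s \<noteq> 0"
      using cayley_neq_minus_one[OF s1] by (simp_all add: add_eq_0_iff)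
    show ?thesis
      using poly_cayley_poly[of p d "cayley s"] poly_cayley_poly[of q d "cayley s"] c pq(1,3,4) s
      by (simp add: d_def cayley_cayley[OF s1])
  qed
  ultimately show ?thesis using that by blast
qed

lemma cayley_quotient_bounded:
  assumes "\<And>z. cmod z \<le> 1 \<Longrightarrow> poly v z \<noteq> 0"
  obtains b where "\<And>s. 0 \<le> Re s \<Longrightarrow> cmod (poly u (cayley s) / poly v (cayley s)) \<le> b"
proof -
  have "continuous_on (cball 0 1) (\<lambda>z. poly u z / poly v z)"
    using assms by (intro continuous_intros) auto
  then have "compact ((\<lambda>z. poly u z / poly v z) ` cball 0 1)"
    by (rule compact_continuous_image) simp
  then have "bounded ((\<lambda>z. poly u z / poly v z) ` cball 0 1)" by (rule compact_imp_bounded)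
  then obtain b where "\<forall>x \<in> (\<lambda>z. poly u z / poly v z) ` cball 0 1. cmod x \<le> b"
    unfolding bounded_iff by blast
  then have "cmod (poly u z / poly v z) \<le> b" if "cmod z \<le> 1" for z
    using that by simp
  then show ?thesis using that[of b] cayley_norm by simp
qed

text \<open>Boundedness comes from compactness of the disc.\<close>

lemma cayley_quotient_stable:
  fixes u v :: "complex poly"
  assumes v: "\<And>z. cmod z \<le> 1 \<Longrightarrow> poly v z \<noteq> 0"
  defines "f \<equiv> \<lambda>s. poly u (cayley s) / poly v (cayley s)"
  shows "stable_proper f" "hardy_inf_fun f"
proof -
  define d where "d = max (degree u) (degree v)"
  \<comment> \<open>the factor \<open>1 + s\<close> makes the denominator vanish at \<open>s = -1\<close>, where \<open>cayley\<close> has a default value and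
      the quotient need not be right\<close>
  define p where "p = cayley_poly d u * [:1, 1:]"
  define q where "q = cayley_poly d v * [:1, 1:]"
  have val: "f s = poly p s / poly q s" if "s \<noteq> -1" for s
  proof -
    have "1 + s \<noteq> 0" using that by (metis add.commute add_eq_0_iff)
    moreover have "degree u \<le> d" "degree v \<le> d" by (simp_all add: d_def)
    then have "poly p s = (1 + s) ^ d * poly u (cayley s) * (1 + s)" "poly q s = (1 + s) ^ d * poly v (cayley s) * (1 + s)"
      unfolding p_def q_def poly_mult using that by (simp_all add: poly_cayley_poly)
    ultimately show ?thesis by (simp add: f_def)
  qed
  have qnz: "poly q s \<noteq> 0" if "0 \<le> Re s" for s
  proof -
    have s1: "s \<noteq> -1" using that by (rule right_half_plane_neq)
    have "1 + s \<noteq> 0" using s1 by (metis add.commute add_eq_0_iff)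
    moreover have "degree v \<le> d" by (simp add: d_def)
    then have "poly q s = (1 + s) ^ d * poly v (cayley s) * (1 + s)"
      unfolding q_def poly_mult using s1 by (simp add: poly_cayley_poly)
    ultimately show ?thesis using v[OF cayley_norm[OF that]] by simp
  qed
  have q1: "s \<noteq> -1" if "poly q s \<noteq> 0" for s
    using that by (auto simp: q_def)
  obtain b where b: "\<And>s. 0 \<le> Re s \<Longrightarrow> cmod (f s) \<le> b"
    unfolding f_def using cayley_quotient_bounded[OF v, of u] by metis
  have "q \<noteq> 0" using qnz[of 0] by auto
  have "degree p \<le> degree q"
  proof (rule degree_le_if_bounded[OF \<open>q \<noteq> 0\<close>])
    fix x :: real assume "x > 0"
    then have "0 \<le> Re (complex_of_real x)" by simp
    then show "cmod (poly p (complex_of_real x) / poly q (complex_of_real x)) \<le> b"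
      using b[of "complex_of_real x"] val[OF q1[OF qnz]] by metis
  qed
  then show sp: "stable_proper f"
    unfolding stable_proper_def using qnz val q1 by blast
  obtain \<tau> where \<tau>: "\<tau> > 0" "f analytic_on {s. Re s > - \<tau>}" using stable_proper_analytic[OF sp] by metis
  have "f holomorphic_on {s. Re s > 0}"
    using \<tau> by (intro holomorphic_on_subset[OF analytic_imp_holomorphic[OF \<tau>(2)]]) auto
  moreover have "bounded (f ` {s. Re s > 0})"
    unfolding bounded_iff using b by (intro exI[of _ b]) auto
  ultimately show "hardy_inf_fun f" by (simp add: hardy_inf_fun_def)
qed

text \<open>Reflection at the unit circle: there it is conjugation up to the unimodular factor \<open>z ^ d\<close>.\<close>

definition circle_reflect :: "nat \<Rightarrow> complex poly \<Rightarrow> complex poly" where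
  "circle_reflect d p = (\<Sum>k\<le>d. Polynomial.monom (cnj (coeff p k)) (d - k))"

lemma poly_circle_reflect:
  assumes "degree p \<le> d" "cmod z = 1"
  shows "poly (circle_reflect d p) z = z ^ d * cnj (poly p z)"
proof -
  have zz: "z * cnj z = 1" using assms(2) complex_norm_square[of z] by simp
  have "z ^ (d - k) = z ^ d * cnj z ^ k" if "k \<le> d" for k
  proof -
    have "z ^ d * cnj z ^ k = z ^ (d - k) * (z ^ k * cnj z ^ k)"
      using that by (simp flip: power_add)
    also have "z ^ k * cnj z ^ k = (z * cnj z) ^ k" by (simp only: power_mult_distrib)
    finally show ?thesis by (simp add: zz)
  qed
  then show ?thesis
    by (simp add: poly_as_sum[OF assms(1)] circle_reflect_def poly_sum poly_monom sum_distrib_left algebra_simps)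
qed

section \<open>A sum-of-squares factorization on the circle\<close>

text \<open>A geometric sum over the powers of a root of unity other than \<open>1\<close>.\<close>

lemma roots_of_unity_orthogonal:
  fixes u v R :: nat
  assumes R: "R > 0" and uv: "u < v + R" "v < u + R"
  defines "w \<equiv> \<lambda>r. cis (2 * pi * real r / real R)"
  shows "(\<Sum>r<R. w r ^ u * cnj (w r) ^ v) = (if u = v then of_nat R else 0)"
proof -
  have unit: "w r * cnj (w r) = 1" for r by (simp add: w_def cis_cnj cis_mult)
  have pow: "w r = w 1 ^ r" for r
    unfolding w_def Complex.DeMoivre by (rule arg_cong[of _ _ cis]) simp
  define \<rho> where "\<rho> = w 1 ^ u * cnj (w 1) ^ v"
  have powr_term: "w r ^ u * cnj (w r) ^ v = \<rho> ^ r" for r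
    unfolding pow[of r] \<rho>_def by (simp add: power_mult_distrib mult.commute flip: power_mult)
  have wR: "w 1 ^ R = 1" using R by (simp add: w_def Complex.DeMoivre)
  have one: "w 1 ^ m \<noteq> 1" if "0 < m" "m < R" for m
  proof
    assume "w 1 ^ m = 1"
    then have "cis (2 * pi * real m / real R) = cis (2 * pi * real 0 / real R)"
      using pow[of m] by (simp add: w_def)
    have "inj_on (\<lambda>k. cis (2 * pi * real k / real R)) {..<R}"
      using Complex.bij_betw_roots_unity[OF R] by (rule bij_betw_imp_inj_on)
    then have "m = 0" using \<open>cis _ = cis _\<close> by (rule inj_onD) (use that R in simp_all)
    then show False using that by simp
  qed
  show ?thesis
  proof (cases "u = v")
    case True
    have "\<rho> = (w 1 * cnj (w 1)) ^ u" unfolding \<rho>_def True by (simp only: power_mult_distrib)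
    then have "\<rho> = 1" by (simp add: unit)
    then show ?thesis unfolding powr_term using True by simp
  next
    case False
    have "\<rho> \<noteq> 1"
    proof (cases "v < u")
      case True
      have "\<rho> = w 1 ^ (u - v) * (w 1 * cnj (w 1)) ^ v"
        unfolding \<rho>_def using True by (simp add: power_mult_distrib flip: power_add)
      then show ?thesis using one[of "u - v"] True uv by (simp add: unit)
    next
      case F: False
      have "\<rho> = cnj (w 1) ^ (v - u) * (w 1 * cnj (w 1)) ^ u"
        unfolding \<rho>_def using F by (simp add: power_mult_distrib flip: power_add)
      then have "\<rho> = cnj (w 1 ^ (v - u))" by (simp add: unit)
      moreover have "w 1 ^ (v - u) \<noteq> 1" using one[of "v - u"] F False uv by simp
      ultimately show ?thesis by (metis complex_cnj_cnj complex_cnj_one)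
    qed
    moreover have "\<rho> ^ R = 1"
      unfolding \<rho>_def power_mult_distrib power_mult[symmetric]
      unfolding mult.commute[of _ R] power_mult complex_cnj_power[symmetric] wR by simp
    ultimately have "(\<Sum>r<R. \<rho> ^ r) = 0" by (simp add: sum_gp_strict)
    then show ?thesis unfolding powr_term using False by simp
  qed
qed

text \<open>The coefficient of the unnormalised Fejer kernel at the frequency \<open>k - l\<close>.\<close>

lemma diagonal_pairs_card:
  fixes k l M :: nat
  assumes "k < l + M" "l < k + M"
  shows "card {(a, b). a < M \<and> b < M \<and> k + b = l + a} = M - (if k \<le> l then l - k else k - l)"
proof (cases "k \<le> l")
  case True
  have "{(a, b). a < M \<and> b < M \<and> k + b = l + a} = (\<lambda>a. (a, a + (l - k))) ` {..<M - (l - k)}"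
  proof (intro equalityI subsetI)
    fix x assume "x \<in> {(a, b). a < M \<and> b < M \<and> k + b = l + a}"
    then obtain a b where x: "x = (a, b)" "a < M" "b < M" "k + b = l + a" by blast
    then have "b = a + (l - k)" "a < M - (l - k)" using True by linarith+
    then show "x \<in> (\<lambda>a. (a, a + (l - k))) ` {..<M - (l - k)}" using x(1) by blast
  next
    fix x assume "x \<in> (\<lambda>a. (a, a + (l - k))) ` {..<M - (l - k)}"
    then obtain a where x: "x = (a, a + (l - k))" "a < M - (l - k)" by blast
    then have "a < M" "a + (l - k) < M" "k + (a + (l - k)) = l + a" using True by linarith+
    then show "x \<in> {(a, b). a < M \<and> b < M \<and> k + b = l + a}" using x(1) by blast
  qed
  then show ?thesis using True by (simp add: card_image inj_on_def)
next
  case False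
  have "{(a, b). a < M \<and> b < M \<and> k + b = l + a} = (\<lambda>b. (b + (k - l), b)) ` {..<M - (k - l)}"
  proof (intro equalityI subsetI)
    fix x assume "x \<in> {(a, b). a < M \<and> b < M \<and> k + b = l + a}"
    then obtain a b where x: "x = (a, b)" "a < M" "b < M" "k + b = l + a" by blast
    then have "a = b + (k - l)" "b < M - (k - l)" using False by linarith+
    then show "x \<in> (\<lambda>b. (b + (k - l), b)) ` {..<M - (k - l)}" using x(1) by blast
  next
    fix x assume "x \<in> (\<lambda>b. (b + (k - l), b)) ` {..<M - (k - l)}"
    then obtain b where x: "x = (b + (k - l), b)" "b < M - (k - l)" by blast
    then have "b < M" "b + (k - l) < M" "k + b = l + (b + (k - l))" using False by linarith+
    then show "x \<in> {(a, b). a < M \<and> b < M \<and> k + b = l + a}" using x(1) by blast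
  qed
  then show ?thesis using False by (simp add: card_image inj_on_def)
qed

text \<open>The Fejer kernel damps the coefficient of \<open>z ^ k * cnj z ^ l\<close> by \<open>1 - |k - l| / M\<close>; this
  weight undoes the damping.\<close>

definition fejer_weight :: "nat \<Rightarrow> nat \<Rightarrow> nat \<Rightarrow> real" where
  "fejer_weight M k l = real M / (real M - \<bar>real k - real l\<bar>)"

text \<open>Sampling at \<open>2 * M\<close> roots of unity is exact: \<open>D r\<close> is the Dirichlet kernel of degree \<open>M - 1\<close>
  centred at the sampling point, and its squared modulus contributes frequencies below \<open>M\<close>, which
  together with those below \<open>M\<close> of the sampled term do not alias.\<close>

lemma fejer_sampling:
  fixes z :: complex and d M k l :: nat
  assumes z: "cmod z = 1" and kl: "k \<le> d" "l \<le> d" and M: "d < M"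
  defines "w \<equiv> \<lambda>r. cis (2 * pi * real r / real (2 * M))"
  defines "D \<equiv> \<lambda>r. \<Sum>a<M. (z * cnj (w r)) ^ a"
  shows "(\<Sum>r<2 * M. complex_of_real (fejer_weight M k l) * (w r ^ k * cnj (w r) ^ l) * (D r * cnj (D r)))
    = of_nat (2 * M * M) * (z ^ k * cnj z ^ l)"
proof -
  have zz: "z * cnj z = 1" using z complex_norm_square[of z] by simp
  let ?S = "{(a, b). a < M \<and> b < M \<and> k + b = l + a}"
  have expand: "w r ^ k * cnj (w r) ^ l * (D r * cnj (D r))
      = (\<Sum>a<M. \<Sum>b<M. z ^ a * cnj z ^ b * (w r ^ (k + b) * cnj (w r) ^ (l + a)))" for r
  proof -
    have "D r * cnj (D r) = (\<Sum>a<M. \<Sum>b<M. (z * cnj (w r)) ^ a * (cnj z * w r) ^ b)"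
      by (simp add: D_def sum_product)
    then show ?thesis
      by (simp add: sum_distrib_left power_mult_distrib power_add mult_ac)
  qed
  have orth: "(\<Sum>r<2 * M. w r ^ (k + b) * cnj (w r) ^ (l + a)) = (if k + b = l + a then of_nat (2 * M) else 0)"
    if "a < M" "b < M" for a b
    unfolding w_def by (rule roots_of_unity_orthogonal) (use that kl M in linarith)+
  have same: "z ^ a * cnj z ^ b = z ^ k * cnj z ^ l" if "k + b = l + a" for a b
  proof -
    have "z ^ a * cnj z ^ b = z ^ a * cnj z ^ b * (z * cnj z) ^ l" by (simp add: zz)
    also have "\<dots> = z ^ (l + a) * cnj z ^ (b + l)" by (simp add: power_mult_distrib power_add mult_ac)
    also have "\<dots> = z ^ k * cnj z ^ l * (z * cnj z) ^ b"
      unfolding that[symmetric] by (simp add: power_mult_distrib power_add mult_ac)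
    finally show ?thesis by (simp add: zz)
  qed
  have "(\<Sum>r<2 * M. w r ^ k * cnj (w r) ^ l * (D r * cnj (D r)))
      = (\<Sum>a<M. \<Sum>r<2 * M. \<Sum>b<M. z ^ a * cnj z ^ b * (w r ^ (k + b) * cnj (w r) ^ (l + a)))"
    unfolding expand by (rule sum.swap)
  also have "\<dots> = (\<Sum>a<M. \<Sum>b<M. \<Sum>r<2 * M. z ^ a * cnj z ^ b * (w r ^ (k + b) * cnj (w r) ^ (l + a)))"
    by (rule sum.cong[OF refl], rule sum.swap)
  also have "\<dots> = (\<Sum>a<M. \<Sum>b<M. if k + b = l + a then of_nat (2 * M) * (z ^ k * cnj z ^ l) else 0)"
  proof (intro sum.cong refl)
    fix a b assume ab: "a \<in> {..<M}" "b \<in> {..<M}"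
    have "(\<Sum>r<2 * M. z ^ a * cnj z ^ b * (w r ^ (k + b) * cnj (w r) ^ (l + a)))
      = z ^ a * cnj z ^ b * (if k + b = l + a then of_nat (2 * M) else 0)"
      unfolding sum_distrib_left[symmetric] using orth[of a b] ab by simp
    then show "(\<Sum>r<2 * M. z ^ a * cnj z ^ b * (w r ^ (k + b) * cnj (w r) ^ (l + a)))
      = (if k + b = l + a then of_nat (2 * M) * (z ^ k * cnj z ^ l) else 0)"
      using same[of b a] by (simp only: mult.commute split: if_split) simp
  qed
  also have "\<dots> = (\<Sum>x\<in>{..<M} \<times> {..<M}. if x \<in> ?S then of_nat (2 * M) * (z ^ k * cnj z ^ l) else 0)"
    unfolding sum.cartesian_product by (rule sum.cong[OF refl]) (auto split: if_splits)
  also have "\<dots> = (\<Sum>x\<in>({..<M} \<times> {..<M}) \<inter> ?S. of_nat (2 * M) * (z ^ k * cnj z ^ l))"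
    by (rule sum.inter_restrict[symmetric]) simp
  also have "({..<M} \<times> {..<M}) \<inter> ?S = ?S" by auto
  also have "(\<Sum>x\<in>?S. of_nat (2 * M) * (z ^ k * cnj z ^ l)) = of_nat (card ?S) * (of_nat (2 * M) * (z ^ k * cnj z ^ l))"
    by simp
  finally have total: "(\<Sum>r<2 * M. w r ^ k * cnj (w r) ^ l * (D r * cnj (D r))) = of_nat (card ?S) * (of_nat (2 * M) * (z ^ k * cnj z ^ l))" .
  have card: "card ?S = M - (if k \<le> l then l - k else k - l)"
    by (rule diagonal_pairs_card) (use kl M in linarith)+
  have "real (card ?S) = real M - \<bar>real k - real l\<bar>"
    unfolding card using kl M by (auto simp: of_nat_diff)
  moreover have "real M - \<bar>real k - real l\<bar> > 0" using kl M by (simp add: abs_if)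
  ultimately have "fejer_weight M k l * real (card ?S) = real M" by (simp add: fejer_weight_def)
  then have "complex_of_real (fejer_weight M k l * real (card ?S)) = complex_of_real (real M)"
    by (rule arg_cong)
  then have "complex_of_real (fejer_weight M k l) * of_nat (card ?S) = of_nat M"
    unfolding of_real_mult of_real_of_nat_eq .
  then show ?thesis
    unfolding mult.assoc[of "complex_of_real (fejer_weight M k l)"] sum_distrib_left[symmetric] total
    by (simp add: mult.assoc[symmetric])
qed

text \<open>The product of \<open>a\<close> and \<open>cnj b\<close> on the circle, with the damping of its coefficients undone in advance.\<close>

definition weighted_product :: "nat \<Rightarrow> nat \<Rightarrow> complex poly \<Rightarrow> complex poly \<Rightarrow> complex \<Rightarrow> complex" where
  "weighted_product M d a b z =
     (\<Sum>k\<le>d. \<Sum>l\<le>d. coeff a k * cnj (coeff b l) * (complex_of_real (fejer_weight M k l) * (z ^ k * cnj z ^ l)))"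

lemma poly_product_sum:
  assumes "degree a \<le> d" "degree b \<le> d"
  shows "poly a z * cnj (poly b z) = (\<Sum>k\<le>d. \<Sum>l\<le>d. coeff a k * cnj (coeff b l) * (z ^ k * cnj z ^ l))"
  by (simp add: poly_as_sum[OF assms(1)] poly_as_sum[OF assms(2)] sum_product mult_ac)

lemma weighted_product_cnj: "cnj (weighted_product M d a b z) = weighted_product M d b a z"
proof -
  have "cnj (weighted_product M d a b z) = (\<Sum>k\<le>d. \<Sum>l\<le>d. coeff b l * cnj (coeff a k) * (complex_of_real (fejer_weight M l k) * (z ^ l * cnj z ^ k)))"
    by (simp add: weighted_product_def fejer_weight_def abs_minus_commute mult_ac)
  also have "\<dots> = weighted_product M d b a z"
    unfolding weighted_product_def by (rule sum.swap)
  finally show ?thesis .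
qed

lemma weighted_product_tendsto:
  assumes deg: "degree a \<le> d" "degree b \<le> d" and M: "filterlim M at_top F" and \<zeta>: "(\<zeta> \<longlongrightarrow> z) F"
  shows "((\<lambda>x. weighted_product (M x) d a b (\<zeta> x)) \<longlongrightarrow> poly a z * cnj (poly b z)) F"
proof -
  have wt: "((\<lambda>x. fejer_weight (M x) k l) \<longlongrightarrow> 1) F" for k l
  proof -
    define c where "c = \<bar>real k - real l\<bar>"
    have "filterlim (\<lambda>m. - c + real m) at_top sequentially"
      by (rule filterlim_tendsto_add_at_top[OF tendsto_const filterlim_real_sequentially])
    then have "(\<lambda>m. c / (- c + real m)) \<longlonglongrightarrow> 0"
      by (intro tendsto_divide_0[OF tendsto_const] filterlim_at_top_imp_at_infinity)
    from tendsto_add[OF tendsto_const[of 1] this]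
    have "(\<lambda>m. 1 + c / (- c + real m)) \<longlonglongrightarrow> 1" by simp
    moreover have "\<forall>\<^sub>F m in sequentially. 1 + c / (- c + real m) = fejer_weight m k l"
      using filterlim_at_top_dense[THEN iffD1, OF filterlim_real_sequentially, rule_format, of c]
      by eventually_elim (simp add: fejer_weight_def c_def[symmetric] field_simps)
    ultimately have "(\<lambda>m. fejer_weight m k l) \<longlonglongrightarrow> 1" by (rule Lim_transform_eventually)
    then show ?thesis by (rule filterlim_compose[OF _ M])
  qed
  have "((\<lambda>x. weighted_product (M x) d a b (\<zeta> x)) \<longlongrightarrow>
     (\<Sum>k\<le>d. \<Sum>l\<le>d. coeff a k * cnj (coeff b l) * (complex_of_real 1 * (z ^ k * cnj z ^ l)))) F"
    unfolding weighted_product_def by (intro tendsto_intros wt \<zeta>)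
  then show ?thesis by (simp add: poly_product_sum[OF deg])
qed

lemma weighted_product_sampling:
  fixes z :: complex
  assumes z: "cmod z = 1" and deg: "degree a \<le> d" "degree b \<le> d" and M: "d < M"
  defines "w \<equiv> \<lambda>r. cis (2 * pi * real r / real (2 * M))"
  defines "D \<equiv> \<lambda>r. \<Sum>a<M. (z * cnj (w r)) ^ a"
  shows "(\<Sum>r<2 * M. weighted_product M d a b (w r) * (D r * cnj (D r))) = of_nat (2 * M * M) * (poly a z * cnj (poly b z))"
proof -
  have "(\<Sum>r<2 * M. weighted_product M d a b (w r) * (D r * cnj (D r)))
    = (\<Sum>r<2 * M. \<Sum>k\<le>d. \<Sum>l\<le>d. coeff a k * cnj (coeff b l) *
        (complex_of_real (fejer_weight M k l) * (w r ^ k * cnj (w r) ^ l) * (D r * cnj (D r))))"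
    by (simp add: weighted_product_def sum_distrib_right mult.assoc)
  also have "\<dots> = (\<Sum>k\<le>d. \<Sum>r<2 * M. \<Sum>l\<le>d. coeff a k * cnj (coeff b l) *
        (complex_of_real (fejer_weight M k l) * (w r ^ k * cnj (w r) ^ l) * (D r * cnj (D r))))"
    by (rule sum.swap)
  also have "\<dots> = (\<Sum>k\<le>d. \<Sum>l\<le>d. \<Sum>r<2 * M. coeff a k * cnj (coeff b l) *
        (complex_of_real (fejer_weight M k l) * (w r ^ k * cnj (w r) ^ l) * (D r * cnj (D r))))"
    by (rule sum.cong[OF refl], rule sum.swap)
  also have "\<dots> = (\<Sum>k\<le>d. \<Sum>l\<le>d. coeff a k * cnj (coeff b l) * (of_nat (2 * M * M) * (z ^ k * cnj z ^ l)))"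
    unfolding sum_distrib_left[symmetric] using fejer_sampling[OF z _ _ M]
    by (intro sum.cong refl) (simp add: w_def D_def)
  also have "\<dots> = of_nat (2 * M * M) * (poly a z * cnj (poly b z))"
    unfolding poly_product_sum[OF deg] by (simp add: sum_distrib_left mult_ac)
  finally show ?thesis .
qed

text \<open>If \<open>|q|\<^sup>2 - P P\<^sup>\<dagger>\<close> is positive definite on the circle, then by compactness the reweighted
  trigonometric polynomial is still semidefinite for large \<open>M\<close>; factorizing it at the sampling points
  and multiplying by the Dirichlet kernels gives polynomial columns \<open>U\<close> whose sum of squares is
  \<open>|q|\<^sup>2 - P P\<^sup>\<dagger>\<close> exactly.\<close>

lemma circle_sum_of_squares:
  fixes q :: "complex poly" and P :: "nat \<Rightarrow> nat \<Rightarrow> complex poly" and n ny :: nat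
  assumes pos: "\<And>z x. cmod z = 1 \<Longrightarrow> x \<in> carrier_vec n \<Longrightarrow> x \<noteq> 0\<^sub>v n \<Longrightarrow>
    (\<Sum>l<ny. (cmod (\<Sum>i<n. cnj (poly (P i l) z) * x $ i))\<^sup>2) < (cmod (poly q z))\<^sup>2 * sqnorm x"
  obtains N :: nat and U :: "nat \<Rightarrow> nat \<Rightarrow> complex poly" where
    "\<And>z i j. cmod z = 1 \<Longrightarrow> i < n \<Longrightarrow> j < n \<Longrightarrow>
      (\<Sum>t<N. poly (U i t) z * cnj (poly (U j t) z)) =
      (if i = j then poly q z * cnj (poly q z) else 0) - (\<Sum>l<ny. poly (P i l) z * cnj (poly (P j l) z))"
proof -
  define d where "d = Max (insert (degree q) ((\<lambda>(i, l). degree (P i l)) ` ({..<n} \<times> {..<ny})))"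
  have fin: "finite (insert (degree q) ((\<lambda>(i, l). degree (P i l)) ` ({..<n} \<times> {..<ny})))" by simp
  have dq: "degree q \<le> d" unfolding d_def by (rule Max_ge[OF fin]) simp
  have dP: "degree (P i l) \<le> d" if "i < n" "l < ny" for i l
    unfolding d_def by (rule Max_ge[OF fin]) (use that in force)
  define F where "F M z = mat n n (\<lambda>(i, j). (if i = j then weighted_product M d q q z else 0)
     - (\<Sum>l<ny. weighted_product M d (P i l) (P j l) z))" for M z
  define F' where "F' z = mat n n (\<lambda>(i, j). (if i = j then poly q z * cnj (poly q z) else 0)
     - (\<Sum>l<ny. poly (P i l) z * cnj (poly (P j l) z)))" for z
  have Fc: "F M z \<in> carrier_mat n n" "F' z \<in> carrier_mat n n" for M z by (simp_all add: F_def F'_def)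
  have Fherm: "(F M z)\<^sup>\<dagger> = F M z" for M z
    by (rule eq_matI) (auto simp: F_def weighted_product_cnj)
  have F'form: "Re ((F' z *\<^sub>v x) \<bullet>c x) = (cmod (poly q z))\<^sup>2 * sqnorm x - (\<Sum>l<ny. (cmod (\<Sum>i<n. cnj (poly (P i l) z) * x $ i))\<^sup>2)"
    if x: "x \<in> carrier_vec n" for z x
  proof -
    define y where "y l = (\<Sum>j<n. cnj (poly (P j l) z) * x $ j)" for l
    have row: "(F' z *\<^sub>v x) $ i = poly q z * cnj (poly q z) * x $ i - (\<Sum>l<ny. poly (P i l) z * y l)" if i: "i < n" for i
    proof -
      have "(F' z *\<^sub>v x) $ i = (\<Sum>j<n. F' z $$ (i, j) * x $ j)" by (rule mult_mat_vec_sum[OF Fc(2) x i])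
      also have "\<dots> = (\<Sum>j<n. (if i = j then poly q z * cnj (poly q z) * x $ j else 0)
          - (\<Sum>l<ny. poly (P i l) z * (cnj (poly (P j l) z) * x $ j)))"
        by (rule sum.cong[OF refl]) (use i in \<open>auto simp: F'_def left_diff_distrib sum_distrib_right mult.assoc\<close>)
      also have "\<dots> = poly q z * cnj (poly q z) * x $ i - (\<Sum>j<n. \<Sum>l<ny. poly (P i l) z * (cnj (poly (P j l) z) * x $ j))"
        using i by (simp add: sum_subtractf)
      also have "(\<Sum>j<n. \<Sum>l<ny. poly (P i l) z * (cnj (poly (P j l) z) * x $ j)) = (\<Sum>l<ny. poly (P i l) z * y l)"
        unfolding y_def sum_distrib_left by (rule sum.swap)
      finally show ?thesis .
    qed
    have "(F' z *\<^sub>v x) \<bullet>c x = (\<Sum>i<n. poly q z * cnj (poly q z) * (x $ i * cnj (x $ i)) - (\<Sum>l<ny. y l * (poly (P i l) z * cnj (x $ i))))"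
      unfolding inner_sum[OF x] by (rule sum.cong[OF refl]) (simp add: row left_diff_distrib right_diff_distrib sum_distrib_left sum_distrib_right mult_ac del: index_mult_mat_vec)
    also have "\<dots> = poly q z * cnj (poly q z) * (x \<bullet>c x) - (\<Sum>i<n. \<Sum>l<ny. y l * (poly (P i l) z * cnj (x $ i)))"
      by (simp add: sum_subtractf inner_sum[OF x] sum_distrib_left)
    also have "(\<Sum>i<n. \<Sum>l<ny. y l * (poly (P i l) z * cnj (x $ i))) = (\<Sum>l<ny. \<Sum>i<n. y l * (poly (P i l) z * cnj (x $ i)))"
      by (rule sum.swap)
    also have "\<dots> = (\<Sum>l<ny. y l * cnj (y l))"
      by (simp add: y_def sum_distrib_left)
    finally have "(F' z *\<^sub>v x) \<bullet>c x = complex_of_real ((cmod (poly q z))\<^sup>2 * sqnorm x - (\<Sum>l<ny. (cmod (y l))\<^sup>2))"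
      by (simp add: inner_self complex_norm_square del: of_real_power)
    then show ?thesis by (simp add: y_def)
  qed
  \<comment> \<open>otherwise unit vectors and points of the circle on which the form of \<open>F\<close> is not positive accumulate, for
      \<open>M\<close> tending to infinity, at a unit vector on which the form of the limit \<open>F'\<close> is not positive\<close>
  have "\<exists>M>d. \<forall>z. cmod z = 1 \<longrightarrow> pos_semidef (F M z)"
  proof (rule ccontr)
    assume "\<not> ?thesis"
    then have "\<exists>z. cmod z = 1 \<and> \<not> pos_semidef (F (k + Suc d) z)" for k
      by (metis less_add_same_cancel2 add_Suc_right less_Suc_eq_le le_add2)
    then obtain z where z: "\<And>k. cmod (z k) = 1" "\<And>k. \<not> pos_semidef (F (k + Suc d) (z k))"
      by metis
    have "\<exists>x. x \<in> carrier_vec n \<and> sqnorm x = 1 \<and> Re ((F (k + Suc d) (z k) *\<^sub>v x) \<bullet>c x) \<le> 0" for k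
    proof -
      let ?F = "F (k + Suc d) (z k)"
      obtain x where x: "x \<in> carrier_vec n" "\<not> 0 \<le> (?F *\<^sub>v x) \<bullet>c x"
        using z(2)[of k] pos_semidef_iff[OF Fc(1)] by blast
      have "Im ((?F *\<^sub>v x) \<bullet>c x) = 0" by (rule hermitian_form_real[OF Fc(1) Fherm x(1)])
      then have neg: "Re ((?F *\<^sub>v x) \<bullet>c x) < 0" using x(2) by (auto simp: less_eq_complex_def)
      then have "x \<noteq> 0\<^sub>v n" using inner_zero_right[OF mult_mat_vec_carrier[OF Fc(1) zero_carrier_vec]] by force
      then have s: "0 < sqnorm x" using sqnorm_pos[OF x(1)] by blast
      define y where "y = complex_of_real (1 / sqrt (sqnorm x)) \<cdot>\<^sub>v x"
      have yc: "y \<in> carrier_vec n" using x(1) by (simp add: y_def)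
      have "sqnorm y = 1" using s by (simp add: y_def sqnorm_smult norm_divide power_divide)
      moreover have "(?F *\<^sub>v y) \<bullet>c y = complex_of_real (1 / sqnorm x) * ((?F *\<^sub>v x) \<bullet>c x)"
      proof -
        have "complex_of_real (1 / sqrt (sqnorm x)) * complex_of_real (1 / sqrt (sqnorm x)) = complex_of_real (1 / sqnorm x)"
          using s by (simp flip: of_real_mult of_real_divide)
        moreover have "(?F *\<^sub>v y) \<bullet>c y = complex_of_real (1 / sqrt (sqnorm x)) * (complex_of_real (1 / sqrt (sqnorm x)) * ((?F *\<^sub>v x) \<bullet>c x))"
          unfolding y_def mult_mat_vec[OF Fc(1) x(1)] inner_smult_left[OF mult_mat_vec_carrier[OF Fc(1) x(1)] yc[unfolded y_def]]
            inner_smult_right[OF mult_mat_vec_carrier[OF Fc(1) x(1)] x(1)] by simp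
        ultimately show ?thesis by (simp only: mult.assoc[symmetric])
      qed
      then have "Re ((?F *\<^sub>v y) \<bullet>c y) = 1 / sqnorm x * Re ((?F *\<^sub>v x) \<bullet>c x)" by simp
      then have "Re ((?F *\<^sub>v y) \<bullet>c y) \<le> 0" using neg s by (simp add: divide_nonpos_pos)
      ultimately show ?thesis using yc by blast
    qed
    then obtain x where x: "\<And>k. x k \<in> carrier_vec n" "\<And>k. sqnorm (x k) = 1"
      "\<And>k. Re ((F (k + Suc d) (z k) *\<^sub>v x k) \<bullet>c x k) \<le> 0" by metis
    \<comment> \<open>the point of the circle is appended to the vector, so that one subsequence serves both\<close>
    define Y where "Y k = vec (Suc n) (\<lambda>i. if i < n then x k $ i else z k)" for k
    have Y: "cmod (Y k $ i) \<le> 1" if "i < Suc n" for k i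
    proof (cases "i < n")
      case True
      have "(cmod (x k $ i))\<^sup>2 \<le> 1" using cmod_index_le_sqnorm[OF x(1) True, of k] x(2)[of k] by simp
      then have "cmod (x k $ i) \<le> 1" using abs_square_le_1[of "cmod (x k $ i)"] by simp
      then show ?thesis using True that by (simp add: Y_def)
    next
      case False
      then show ?thesis using that z(1)[of k] by (simp add: Y_def)
    qed
    obtain L r where r: "strict_mono (r :: nat \<Rightarrow> nat)" and lim: "\<And>i. i < Suc n \<Longrightarrow> (\<lambda>k. Y (r k) $ i) \<longlonglongrightarrow> L $ i"
      by (rule bounded_vec_subsequence[of "Suc n" Y 1]) (use Y in auto)
    define x' where "x' = vec n (\<lambda>i. L $ i)"
    define z' where "z' = L $ n"
    have x': "x' \<in> carrier_vec n" by (simp add: x'_def)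
    have xlim: "(\<lambda>k. x (r k) $ i) \<longlonglongrightarrow> x' $ i" if "i < n" for i
      using lim[of i] that by (simp add: Y_def x'_def)
    have zlim: "(\<lambda>k. z (r k)) \<longlonglongrightarrow> z'"
      using lim[of n] by (simp add: Y_def z'_def)
    have "(\<lambda>k. cmod (z (r k))) \<longlonglongrightarrow> cmod z'" by (intro tendsto_norm zlim)
    then have z'1: "cmod z' = 1" unfolding z(1) by (rule LIMSEQ_unique[OF _ tendsto_const])
    have "(\<lambda>k. sqnorm (x (r k))) \<longlonglongrightarrow> sqnorm x'" by (rule sqnorm_tendsto[OF xlim x(1) x'])
    then have "sqnorm x' = 1" unfolding x(2) by (rule LIMSEQ_unique[OF _ tendsto_const])
    then have x'0: "x' \<noteq> 0\<^sub>v n" using sqnorm_eq_0[OF x'] by auto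
    have Mlim: "filterlim (\<lambda>k. r k + Suc d) at_top sequentially"
      using filterlim_subseq[OF r] by (rule filterlim_at_top_mono) simp
    have Flim: "(\<lambda>k. F (r k + Suc d) (z (r k)) $$ (i, j)) \<longlonglongrightarrow> F' z' $$ (i, j)" if ij: "i < n" "j < n" for i j
    proof -
      have "(\<lambda>k. (if i = j then weighted_product (r k + Suc d) d q q (z (r k)) else 0)
          - (\<Sum>l<ny. weighted_product (r k + Suc d) d (P i l) (P j l) (z (r k))))
        \<longlonglongrightarrow> (if i = j then poly q z' * cnj (poly q z') else 0) - (\<Sum>l<ny. poly (P i l) z' * cnj (poly (P j l) z'))"
        using ij weighted_product_tendsto[OF dq dq Mlim zlim]
        by (intro tendsto_diff tendsto_sum weighted_product_tendsto[OF _ _ Mlim zlim] dP) auto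
      then show ?thesis unfolding F_def F'_def index_mat(1)[OF ij] prod.case .
    qed
    have "(\<lambda>k. Re ((F (r k + Suc d) (z (r k)) *\<^sub>v x (r k)) \<bullet>c x (r k))) \<longlonglongrightarrow> Re ((F' z' *\<^sub>v x') \<bullet>c x')"
      by (intro tendsto_Re inner_tendsto[OF mult_mat_vec_tendsto'[OF Fc Flim x(1) x' xlim] xlim x(1) x'])
    then have "Re ((F' z' *\<^sub>v x') \<bullet>c x') \<le> 0"
      by (rule tendsto_upperbound) (use x(3) in auto)
    then show False using F'form[OF x', of z'] pos[OF z'1 x' x'0] by simp
  qed
  then obtain M where M: "d < M" and psd: "\<And>z. cmod z = 1 \<Longrightarrow> pos_semidef (F M z)" by blast
  define w where "w r = cis (2 * pi * real r / real (2 * M))" for r :: nat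
  have "\<exists>k V. V \<in> carrier_mat n k \<and> F M (w r) = V * V\<^sup>\<dagger>" for r
    using psd_factorization[OF Fc(1) psd[of "w r"]] by (metis w_def norm_cis)
  then obtain k V where V: "\<And>r. V r \<in> carrier_mat n (k r)" "\<And>r. F M (w r) = V r * (V r)\<^sup>\<dagger>" by metis
  define I where "I = (SIGMA r:{..<2 * M}. {..<k r})"
  have "finite I" by (simp add: I_def)
  then obtain h where h: "bij_betw h {..<card I} I" using ex_bij_betw_nat_finite by (metis lessThan_atLeast0)
  define Dp where "Dp r = (\<Sum>a<M. Polynomial.monom (cnj (w r) ^ a) a)" for r
  have Dp: "poly (Dp r) z = (\<Sum>a<M. (z * cnj (w r)) ^ a)" for r z
    by (simp add: Dp_def poly_sum poly_monom power_mult_distrib mult.commute)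
  define c where "c = complex_of_real (1 / sqrt (real (2 * M * M)))"
  have cc: "c * cnj c = 1 / of_nat (2 * M * M)"
    unfolding c_def by (simp flip: of_real_mult) simp
  \<comment> \<open>one polynomial column for each sampling point \<open>w r\<close> and each column of the factor there\<close>
  define U where "U i t = Polynomial.smult (c * V (fst (h t)) $$ (i, snd (h t))) (Dp (fst (h t)))" for i t
  show ?thesis
  proof (rule that[of U "card I"])
    fix z i j assume z: "cmod z = 1" and ij: "i < n" "j < n"
    let ?D = "\<lambda>r. \<Sum>a<M. (z * cnj (w r)) ^ a"
    have VV: "(\<Sum>a<k r. V r $$ (i, a) * cnj (V r $$ (j, a))) = F M (w r) $$ (i, j)" for r
    proof -
      have "(V r * (V r)\<^sup>\<dagger>) $$ (i, j) = (\<Sum>a<k r. V r $$ (i, a) * (V r)\<^sup>\<dagger> $$ (a, j))"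
        by (rule mult_mat_sum[OF V(1) adjoint_carrier[OF V(1)] ij])
      also have "\<dots> = (\<Sum>a<k r. V r $$ (i, a) * cnj (V r $$ (j, a)))"
        by (rule sum.cong[OF refl]) (use V(1)[of r] ij in simp)
      finally show ?thesis by (simp add: V(2))
    qed
    have "(\<Sum>t<card I. poly (U i t) z * cnj (poly (U j t) z))
      = (\<Sum>t<card I. (\<lambda>(r, a). c * cnj c * (V r $$ (i, a) * cnj (V r $$ (j, a)) * (?D r * cnj (?D r)))) (h t))"
      by (rule sum.cong[OF refl]) (simp add: U_def Dp case_prod_beta mult_ac)
    also have "\<dots> = (\<Sum>(r, a)\<in>I. c * cnj c * (V r $$ (i, a) * cnj (V r $$ (j, a)) * (?D r * cnj (?D r))))"
      by (rule sum.reindex_bij_betw[OF h])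
    also have "\<dots> = (\<Sum>r<2 * M. \<Sum>a<k r. c * cnj c * (V r $$ (i, a) * cnj (V r $$ (j, a)) * (?D r * cnj (?D r))))"
      unfolding I_def by (rule sum.Sigma[symmetric]) auto
    also have "\<dots> = c * cnj c * (\<Sum>r<2 * M. F M (w r) $$ (i, j) * (?D r * cnj (?D r)))"
      by (simp add: sum_distrib_left[symmetric] sum_distrib_right[symmetric] VV)
    also have "(\<Sum>r<2 * M. F M (w r) $$ (i, j) * (?D r * cnj (?D r)))
      = (\<Sum>r<2 * M. (if i = j then weighted_product M d q q (w r) * (?D r * cnj (?D r)) else 0)
          - (\<Sum>l<ny. weighted_product M d (P i l) (P j l) (w r) * (?D r * cnj (?D r))))"
      by (rule sum.cong[OF refl]) (use ij in \<open>simp add: F_def left_diff_distrib sum_distrib_right\<close>)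
    also have "\<dots> = (if i = j then \<Sum>r<2 * M. weighted_product M d q q (w r) * (?D r * cnj (?D r)) else 0)
          - (\<Sum>l<ny. \<Sum>r<2 * M. weighted_product M d (P i l) (P j l) (w r) * (?D r * cnj (?D r)))"
      unfolding sum_subtractf by (subst (2) sum.swap) simp
    also have "\<dots> = (if i = j then of_nat (2 * M * M) * (poly q z * cnj (poly q z)) else 0)
          - (\<Sum>l<ny. of_nat (2 * M * M) * (poly (P i l) z * cnj (poly (P j l) z)))"
      unfolding w_def using weighted_product_sampling[OF z dq dq M] weighted_product_sampling[OF z dP dP M] ij by simp
    also have "\<dots> = of_nat (2 * M * M) * ((if i = j then poly q z * cnj (poly q z) else 0) - (\<Sum>l<ny. poly (P i l) z * cnj (poly (P j l) z)))"
      by (simp add: right_diff_distrib sum_distrib_left)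
    finally show "(\<Sum>t<card I. poly (U i t) z * cnj (poly (U j t) z)) =
      (if i = j then poly q z * cnj (poly q z) else 0) - (\<Sum>l<ny. poly (P i l) z * cnj (poly (P j l) z))"
      unfolding cc using M by simp
  qed
qed

section \<open>Paraunitary completion\<close>

lemma rational_fun_const: "rational_fun (\<lambda>s. c)"
  unfolding rational_fun_def by (intro exI[of _ "[:c:]"] exI[of _ 1]) simp

lemma rational_fun_add:
  assumes "rational_fun f" "rational_fun g"
  shows "rational_fun (\<lambda>s. f s + g s)"
proof -
  obtain p q p' q' where q: "q \<noteq> 0" "q' \<noteq> 0" and f: "\<And>s. poly q s \<noteq> 0 \<Longrightarrow> f s = poly p s / poly q s"
    and g: "\<And>s. poly q' s \<noteq> 0 \<Longrightarrow> g s = poly p' s / poly q' s"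
    using assms unfolding rational_fun_def by metis
  show ?thesis
    unfolding rational_fun_def
    by (intro exI[of _ "p * q' + p' * q"] exI[of _ "q * q'"]) (use q f g in \<open>simp add: field_simps\<close>)
qed

lemma rational_fun_mult:
  assumes "rational_fun f" "rational_fun g"
  shows "rational_fun (\<lambda>s. f s * g s)"
proof -
  obtain p q p' q' where q: "q \<noteq> 0" "q' \<noteq> 0" and f: "\<And>s. poly q s \<noteq> 0 \<Longrightarrow> f s = poly p s / poly q s"
    and g: "\<And>s. poly q' s \<noteq> 0 \<Longrightarrow> g s = poly p' s / poly q' s"
    using assms unfolding rational_fun_def by metis
  show ?thesis
    unfolding rational_fun_def
    by (intro exI[of _ "p * p'"] exI[of _ "q * q'"]) (use q f g in simp)
qed

lemma rational_fun_sum: "(\<And>i. i \<in> I \<Longrightarrow> rational_fun (f i)) \<Longrightarrow> rational_fun (\<lambda>s. \<Sum>i\<in>I. f i s)"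
  by (induction I rule: infinite_finite_induct) (auto intro: rational_fun_add rational_fun_const)

lemma rational_fun_paraconj:
  assumes "rational_fun f"
  shows "rational_fun (\<lambda>s. cnj (f (- cnj s)))"
proof -
  obtain p q where q: "q \<noteq> 0" and f: "\<And>s. poly q s \<noteq> 0 \<Longrightarrow> f s = poly p s / poly q s"
    using assms unfolding rational_fun_def by metis
  define r where "r p = pcompose (map_poly cnj p) [:0, -1:]" for p :: "complex poly"
  have r: "poly (r p) s = cnj (poly p (- cnj s))" for p s
    by (simp add: r_def poly_pcompose)
  have "r q \<noteq> 0"
    using q by (simp add: r_def pcompose_eq_0_iff map_poly_eq_0_iff)
  then show ?thesis
    unfolding rational_fun_def
    by (intro exI[of _ "r p"] exI[of _ "r q"]) (use f in \<open>simp add: r\<close>)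
qed

text \<open>The numerator of \<open>f - c\<close> has infinitely many zeros.\<close>

lemma rational_fun_const_if_axis:
  assumes f: "rational_fun f" and axis: "\<And>\<omega>. f (\<i> * complex_of_real \<omega>) = c"
  shows "\<forall>\<^sub>F s in cofinite. f s = c"
proof -
  obtain p q where q: "q \<noteq> 0" and f: "\<And>s. poly q s \<noteq> 0 \<Longrightarrow> f s = poly p s / poly q s"
    using f unfolding rational_fun_def by metis
  let ?r = "q * (p - Polynomial.smult c q)"
  have "poly ?r (\<i> * complex_of_real \<omega>) = 0" for \<omega>
    using f[of "\<i> * complex_of_real \<omega>"] axis[of \<omega>] by (cases "poly q (\<i> * complex_of_real \<omega>) = 0") (simp_all add: field_simps)
  then have "range (\<lambda>\<omega>. \<i> * complex_of_real \<omega>) \<subseteq> {s. poly ?r s = 0}" by blast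
  moreover have "infinite (range (\<lambda>\<omega>. \<i> * complex_of_real \<omega>))"
    by (subst finite_image_iff) (simp_all add: inj_def infinite_UNIV_char_0)
  ultimately have "?r = 0" using poly_roots_finite finite_subset by blast
  then have p: "p = Polynomial.smult c q" using q by simp
  have "{s. f s \<noteq> c} \<subseteq> {s. poly q s = 0}" using f p by auto
  then have "finite {s. f s \<noteq> c}" using poly_roots_finite[OF q] finite_subset by blast
  then show ?thesis by (simp add: eventually_cofinite)
qed

text \<open>On the axis \<open>paraconj\<close> is the adjoint, and the entries of the products are rational.\<close>

lemma paraunitary_if_unitary_on_axis:
  assumes c: "\<And>s. H s \<in> carrier_mat nf nf"
    and rat: "\<And>i j. i < nf \<Longrightarrow> j < nf \<Longrightarrow> rational_fun (\<lambda>s. H s $$ (i, j))"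
    and axis: "\<And>\<omega>::real. H (\<i> * complex_of_real \<omega>) * (H (\<i> * complex_of_real \<omega>))\<^sup>\<dagger> = 1\<^sub>m nf"
  shows "\<forall>\<^sub>F s in cofinite. paraconj H s * H s = 1\<^sub>m nf \<and> H s * paraconj H s = 1\<^sub>m nf"
proof -
  have pc: "paraconj H s \<in> carrier_mat nf nf" for s by (simp add: paraconj_def c)
  have "\<forall>\<^sub>F s in cofinite. (H s * paraconj H s) $$ (i, j) = 1\<^sub>m nf $$ (i, j)" if ij: "i < nf" "j < nf" for i j
  proof (rule rational_fun_const_if_axis)
    have "(\<lambda>s. (H s * paraconj H s) $$ (i, j)) = (\<lambda>s. \<Sum>l<nf. H s $$ (i, l) * cnj (H (- cnj s) $$ (j, l)))"
    proof
      fix s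
      have "(H s * paraconj H s) $$ (i, j) = (\<Sum>l<nf. H s $$ (i, l) * paraconj H s $$ (l, j))"
        by (rule mult_mat_sum[OF c pc ij])
      also have "\<dots> = (\<Sum>l<nf. H s $$ (i, l) * cnj (H (- cnj s) $$ (j, l)))"
        by (rule sum.cong[OF refl]) (use c[of "- cnj s"] ij in \<open>simp add: paraconj_def\<close>)
      finally show "(H s * paraconj H s) $$ (i, j) = (\<Sum>l<nf. H s $$ (i, l) * cnj (H (- cnj s) $$ (j, l)))" .
    qed
    moreover have "rational_fun (\<lambda>s. \<Sum>l<nf. H s $$ (i, l) * cnj (H (- cnj s) $$ (j, l)))"
      using ij by (intro rational_fun_sum rational_fun_mult rat rational_fun_paraconj) auto
    ultimately show "rational_fun (\<lambda>s. (H s * paraconj H s) $$ (i, j))" by simp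
    show "(H (\<i> * complex_of_real \<omega>) * paraconj H (\<i> * complex_of_real \<omega>)) $$ (i, j) = 1\<^sub>m nf $$ (i, j)" for \<omega>
      by (simp only: paraconj_axis axis)
  qed
  then have "\<forall>\<^sub>F s in cofinite. \<forall>i\<in>{..<nf}. \<forall>j\<in>{..<nf}. (H s * paraconj H s) $$ (i, j) = 1\<^sub>m nf $$ (i, j)"
    by (intro eventually_ball_finite ballI finite_lessThan) (simp only: lessThan_iff)
  then show ?thesis
  proof eventually_elim
    case (elim s)
    have "H s * paraconj H s = 1\<^sub>m nf"
      by (rule eq_matI) (use elim c[of s] pc[of s] in auto)
    then show ?case using mat_mult_left_right_inverse[OF c pc] by blast
  qed
qed

text \<open>A matrix with orthonormal rows is completed to a unitary matrix by its adjoint and by the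
  projection onto the complement of its row space; the phase \<open>\<phi>\<close> is free.\<close>

lemma unitary_completion:
  fixes E :: "complex mat"
  assumes E: "E \<in> carrier_mat n nc" and rows: "E * E\<^sup>\<dagger> = 1\<^sub>m n" and \<phi>: "cmod \<phi> = 1"
  defines "H \<equiv> four_block_mat E (0\<^sub>m n n) (\<phi> \<cdot>\<^sub>m (1\<^sub>m nc - E\<^sup>\<dagger> * E)) (\<phi> \<cdot>\<^sub>m E\<^sup>\<dagger>)"
  shows "H * H\<^sup>\<dagger> = 1\<^sub>m (n + nc)"
proof -
  have Ea: "E\<^sup>\<dagger> \<in> carrier_mat nc n" using E by simp
  have H: "H \<in> carrier_mat (n + nc) (nc + n)" unfolding H_def by (rule four_block_carrier_mat[OF E]) (use Ea in simp)
  have Hc: "H \<in> carrier_mat (n + nc) (n + nc)" using H by (simp add: add.commute)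
  define Q where "Q = 1\<^sub>m nc - E\<^sup>\<dagger> * E"
  have EE: "E\<^sup>\<dagger> * E \<in> carrier_mat nc nc" by (rule mult_carrier_mat[OF Ea E])
  have Q: "Q \<in> carrier_mat nc nc" unfolding Q_def by (rule minus_carrier_mat[OF EE])
  have EQ: "E * Q = 0\<^sub>m n nc"
    unfolding Q_def mult_minus_distrib_mat[OF E one_carrier_mat EE] right_mult_one_mat[OF E]
      assoc_mult_mat[OF E Ea E, symmetric] rows left_mult_one_mat[OF E] by (rule minus_r_inv_mat[OF E])
  have QE: "Q * E\<^sup>\<dagger> = 0\<^sub>m nc n"
    unfolding Q_def minus_mult_distrib_mat[OF one_carrier_mat EE Ea] left_mult_one_mat[OF Ea]
      assoc_mult_mat[OF Ea E Ea] rows right_mult_one_mat[OF Ea] by (rule minus_r_inv_mat[OF Ea])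
  have "Q * Q = Q - E\<^sup>\<dagger> * (E * Q)"
    by (subst (1) Q_def) (simp only: minus_mult_distrib_mat[OF one_carrier_mat EE Q] left_mult_one_mat[OF Q] assoc_mult_mat[OF Ea E Q])
  also have "\<dots> = Q" unfolding EQ right_mult_zero_mat[OF Ea] by (rule eq_matI) (use Q in auto)
  finally have QQ: "Q * Q = Q" .
  have Qa: "Q\<^sup>\<dagger> = Q"
  proof (rule hermitian_if_form_real[OF Q])
    fix x :: "complex vec" assume x: "x \<in> carrier_vec nc"
    have "(Q *\<^sub>v x) \<bullet>c x = x \<bullet>c x - (E *\<^sub>v x) \<bullet>c (E *\<^sub>v x)"
      unfolding Q_def minus_mult_distrib_inner[OF EE one_carrier_mat x] one_mult_mat_vec[OF x]
        assoc_mult_mat_vec[OF Ea E x] inner_adjoint'[OF E mult_mat_vec_carrier[OF E x] x] ..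
    then show "Im ((Q *\<^sub>v x) \<bullet>c x) = 0" by (simp add: inner_self)
  qed
  have sa: "(\<phi> \<cdot>\<^sub>m M)\<^sup>\<dagger> = cnj \<phi> \<cdot>\<^sub>m M\<^sup>\<dagger>" for M :: "complex mat"
    by (rule eq_matI) auto
  have \<phi>\<phi>: "\<phi> * cnj \<phi> = 1" using \<phi> complex_norm_square[of \<phi>] by simp
  have sm: "\<phi> \<cdot>\<^sub>m M * (cnj \<phi> \<cdot>\<^sub>m N) = M * N" if "M \<in> carrier_mat nc k" "N \<in> carrier_mat k nc" for M N :: "complex mat" and k
    unfolding mult_smult_assoc_mat[OF that(1) smult_carrier_mat[OF that(2)]] mult_smult_distrib[OF that]
    by (rule eq_matI) (simp_all add: mult.assoc[symmetric] \<phi>\<phi>)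
  have H': "H\<^sup>\<dagger> = four_block_mat (E\<^sup>\<dagger>) (cnj \<phi> \<cdot>\<^sub>m Q) (0\<^sub>m n n) (cnj \<phi> \<cdot>\<^sub>m E)"
    unfolding H_def Q_def[symmetric] by (subst adjoint_four_block[OF E zero_carrier_mat smult_carrier_mat[OF Q] smult_carrier_mat[OF Ea]]) (simp add: sa Qa)
  have "H * H\<^sup>\<dagger> = four_block_mat (E * E\<^sup>\<dagger> + 0\<^sub>m n n * 0\<^sub>m n n) (E * (cnj \<phi> \<cdot>\<^sub>m Q) + 0\<^sub>m n n * (cnj \<phi> \<cdot>\<^sub>m E))
     (\<phi> \<cdot>\<^sub>m Q * E\<^sup>\<dagger> + \<phi> \<cdot>\<^sub>m E\<^sup>\<dagger> * 0\<^sub>m n n) (\<phi> \<cdot>\<^sub>m Q * (cnj \<phi> \<cdot>\<^sub>m Q) + \<phi> \<cdot>\<^sub>m E\<^sup>\<dagger> * (cnj \<phi> \<cdot>\<^sub>m E))"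
    unfolding H' unfolding H_def Q_def[symmetric]
    by (rule mult_four_block_mat[OF E zero_carrier_mat smult_carrier_mat[OF Q] smult_carrier_mat[OF Ea]
      Ea smult_carrier_mat[OF Q] zero_carrier_mat smult_carrier_mat[OF E]])
  also have "E * E\<^sup>\<dagger> + 0\<^sub>m n n * 0\<^sub>m n n = 1\<^sub>m n" by (simp add: rows)
  also have "E * (cnj \<phi> \<cdot>\<^sub>m Q) + 0\<^sub>m n n * (cnj \<phi> \<cdot>\<^sub>m E) = 0\<^sub>m n nc"
    unfolding mult_smult_distrib[OF E Q] EQ using E by simp
  also have "\<phi> \<cdot>\<^sub>m Q * E\<^sup>\<dagger> + \<phi> \<cdot>\<^sub>m E\<^sup>\<dagger> * 0\<^sub>m n n = 0\<^sub>m nc n"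
    unfolding mult_smult_assoc_mat[OF Q Ea] QE right_mult_zero_mat[OF smult_carrier_mat[OF Ea]] by simp
  also have "\<phi> \<cdot>\<^sub>m Q * (cnj \<phi> \<cdot>\<^sub>m Q) + \<phi> \<cdot>\<^sub>m E\<^sup>\<dagger> * (cnj \<phi> \<cdot>\<^sub>m E) = 1\<^sub>m nc"
  proof -
    have "Q + E\<^sup>\<dagger> * E = 1\<^sub>m nc" unfolding Q_def by (rule eq_matI) (use EE in auto)
    then show ?thesis unfolding sm[OF Q Q] sm[OF Ea E] QQ .
  qed
  finally show ?thesis by simp
qed

text \<open>After division by \<open>q\<close> the rows of \<open>E\<close> are orthonormal on the circle.  The adjoint in the
  completion is realised by reflected polynomials; the phase
  \<open>z ^ L * cnj (q z) / q z\<close> clears the powers of \<open>1 / z\<close> and replaces the denominator \<open>cnj q\<close>,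
  which is not stable, by \<open>q\<close>.\<close>

lemma polynomial_completion:
  fixes q :: "complex poly" and E :: "nat \<Rightarrow> nat \<Rightarrow> complex poly" and n nc :: nat
  assumes q: "\<And>z. cmod z \<le> 1 \<Longrightarrow> poly q z \<noteq> 0"
    and rows: "\<And>z i j. cmod z = 1 \<Longrightarrow> i < n \<Longrightarrow> j < n \<Longrightarrow>
      (\<Sum>c<nc. poly (E i c) z * cnj (poly (E j c) z)) = (if i = j then poly q z * cnj (poly q z) else 0)"
  obtains H where "\<And>s. H s \<in> carrier_mat (n + nc) (n + nc)"
    "\<And>i j. i < n + nc \<Longrightarrow> j < n + nc \<Longrightarrow> stable_proper (\<lambda>s. H s $$ (i, j))"
    "\<And>i j. i < n + nc \<Longrightarrow> j < n + nc \<Longrightarrow> hardy_inf_fun (\<lambda>s. H s $$ (i, j))"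
    "\<And>\<omega>::real. H (\<i> * complex_of_real \<omega>) * (H (\<i> * complex_of_real \<omega>))\<^sup>\<dagger> = 1\<^sub>m (n + nc)"
    "\<And>(\<omega>::real) i j. i < n \<Longrightarrow> j < nc \<Longrightarrow> H (\<i> * complex_of_real \<omega>) $$ (i, j)
      = poly (E i j) (cayley (\<i> * complex_of_real \<omega>)) / poly q (cayley (\<i> * complex_of_real \<omega>))"
proof -
  define L where "L = Max (insert (degree q) ((\<lambda>(i, c). degree (E i c)) ` ({..<n} \<times> {..<nc})))"
  have fin: "finite (insert (degree q) ((\<lambda>(i, c). degree (E i c)) ` ({..<n} \<times> {..<nc})))" by simp
  have Lq: "degree q \<le> L" unfolding L_def by (rule Max_ge[OF fin]) simp
  have LE: "degree (E i c) \<le> L" if "i < n" "c < nc" for i c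
    unfolding L_def by (rule Max_ge[OF fin]) (use that in force)
  let ?R = "circle_reflect L"
  \<comment> \<open>numerators over \<open>q\<^sup>2\<close> of the blocks \<open>E / q\<close>, \<open>0\<close>, \<open>\<phi> (1 - M\<^sup>\<dagger> M)\<close> and \<open>\<phi> M\<^sup>\<dagger>\<close>, where \<open>M = E / q\<close>\<close>
  define u where "u i j = (if i < n then if j < nc then q * E i j else 0
    else if j < nc then (if i - n = j then ?R q * q else 0) - (\<Sum>a<n. ?R (E a (i - n)) * E a j)
    else q * ?R (E (j - nc) (i - n)))" for i j
  define H where "H s = mat (n + nc) (n + nc) (\<lambda>(i, j). poly (u i j) (cayley s) / poly (q * q) (cayley s))" for s
  have H: "H s \<in> carrier_mat (n + nc) (n + nc)" for s by (simp add: H_def)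
  have entry: "(\<lambda>s. H s $$ (i, j)) = (\<lambda>s. poly (u i j) (cayley s) / poly (q * q) (cayley s))"
    if "i < n + nc" "j < n + nc" for i j using that by (simp add: H_def)
  have qq: "poly (q * q) z \<noteq> 0" if "cmod z \<le> 1" for z using q[OF that] by simp
  define M where "M z = mat n nc (\<lambda>(i, j). poly (E i j) z / poly q z)" for z
  have Mc: "M z \<in> carrier_mat n nc" for z by (simp add: M_def)
  have Md: "dim_row (M z) = n" "dim_col (M z) = nc" for z by (simp_all add: M_def)
  have M_rows: "M z * (M z)\<^sup>\<dagger> = 1\<^sub>m n" if z: "cmod z = 1" for z
  proof (rule eq_matI)
    fix i j assume "i < dim_row (1\<^sub>m n)" "j < dim_col (1\<^sub>m n)"
    then have ij: "i < n" "j < n" by simp_all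
    have "(M z * (M z)\<^sup>\<dagger>) $$ (i, j) = (\<Sum>c<nc. M z $$ (i, c) * (M z)\<^sup>\<dagger> $$ (c, j))"
      by (rule mult_mat_sum[OF Mc adjoint_carrier[OF Mc] ij])
    also have "\<dots> = (\<Sum>c<nc. poly (E i c) z * cnj (poly (E j c) z) / (poly q z * cnj (poly q z)))"
      by (rule sum.cong[OF refl]) (use ij in \<open>simp add: M_def\<close>)
    also have "\<dots> = (if i = j then 1 else 0)"
      unfolding sum_divide_distrib[symmetric] rows[OF z ij] using q[of z] z by simp
    finally show "(M z * (M z)\<^sup>\<dagger>) $$ (i, j) = 1\<^sub>m n $$ (i, j)" using ij by simp
  qed (simp_all add: M_def)
  define \<phi> where "\<phi> z = z ^ L * cnj (poly q z) / poly q z" for z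
  have blocks: "H s = four_block_mat (M z) (0\<^sub>m n n) (\<phi> z \<cdot>\<^sub>m (1\<^sub>m nc - (M z)\<^sup>\<dagger> * M z)) (\<phi> z \<cdot>\<^sub>m (M z)\<^sup>\<dagger>)"
    if z: "z = cayley s" "cmod z = 1" for s z
  proof (rule eq_matI)
    have q0: "poly q z \<noteq> 0" "cnj (poly q z) \<noteq> 0" using q[of z] z by simp_all
    have R: "poly (?R q) z = z ^ L * cnj (poly q z)" by (rule poly_circle_reflect[OF Lq z(2)])
    have RE: "poly (?R (E i c)) z = z ^ L * cnj (poly (E i c) z)" if "i < n" "c < nc" for i c
      by (rule poly_circle_reflect[OF LE[OF that] z(2)])
    fix i j
    assume "i < dim_row (four_block_mat (M z) (0\<^sub>m n n) (\<phi> z \<cdot>\<^sub>m (1\<^sub>m nc - (M z)\<^sup>\<dagger> * M z)) (\<phi> z \<cdot>\<^sub>m (M z)\<^sup>\<dagger>))"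
      "j < dim_col (four_block_mat (M z) (0\<^sub>m n n) (\<phi> z \<cdot>\<^sub>m (1\<^sub>m nc - (M z)\<^sup>\<dagger> * M z)) (\<phi> z \<cdot>\<^sub>m (M z)\<^sup>\<dagger>))"
    then have ij: "i < n + nc" "j < nc + n" by (simp_all add: M_def)
    have lhs: "H s $$ (i, j) = poly (u i j) z / (poly q z * poly q z)" using ij z by (simp add: H_def)
    have row: "((M z)\<^sup>\<dagger> * M z) $$ (c, d) = (\<Sum>a<n. cnj (poly (E a c) z) * poly (E a d) z) / (cnj (poly q z) * poly q z)"
      if cd: "c < nc" "d < nc" for c d
    proof -
      have "((M z)\<^sup>\<dagger> * M z) $$ (c, d) = (\<Sum>a<n. (M z)\<^sup>\<dagger> $$ (c, a) * M z $$ (a, d))"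
        by (rule mult_mat_sum[OF adjoint_carrier[OF Mc] Mc cd])
      also have "\<dots> = (\<Sum>a<n. cnj (poly (E a c) z) * poly (E a d) z / (cnj (poly q z) * poly q z))"
        by (rule sum.cong[OF refl]) (use cd in \<open>simp add: M_def\<close>)
      finally show ?thesis by (simp only: sum_divide_distrib)
    qed
    consider "i < n" "j < nc" | "i < n" "\<not> j < nc" | "\<not> i < n" "j < nc" | "\<not> i < n" "\<not> j < nc" by blast
    then show "H s $$ (i, j) = four_block_mat (M z) (0\<^sub>m n n) (\<phi> z \<cdot>\<^sub>m (1\<^sub>m nc - (M z)\<^sup>\<dagger> * M z)) (\<phi> z \<cdot>\<^sub>m (M z)\<^sup>\<dagger>) $$ (i, j)"
    proof cases
      case 1
      then show ?thesis unfolding lhs using q0 by (simp add: u_def M_def)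
    next
      case 2
      then show ?thesis unfolding lhs using ij by (simp add: u_def M_def)
    next
      case 3
      let ?s = "\<Sum>a<n. cnj (poly (E a (i - n)) z) * poly (E a j) z"
      have i: "i - n < nc" using ij 3 by simp
      have "(\<Sum>a<n. poly (?R (E a (i - n))) z * poly (E a j) z) = z ^ L * ?s"
        unfolding sum_distrib_left by (rule sum.cong[OF refl]) (simp add: RE i)
      then have "poly (u i j) z = z ^ L * ((if i - n = j then cnj (poly q z) * poly q z else 0) - ?s)"
        using 3 by (simp add: u_def poly_sum R right_diff_distrib)
      moreover have "four_block_mat (M z) (0\<^sub>m n n) (\<phi> z \<cdot>\<^sub>m (1\<^sub>m nc - (M z)\<^sup>\<dagger> * M z)) (\<phi> z \<cdot>\<^sub>m (M z)\<^sup>\<dagger>) $$ (i, j)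
        = \<phi> z * ((if i - n = j then 1 else 0) - ?s / (cnj (poly q z) * poly q z))"
        using 3 i ij by (simp add: row Md del: index_mult_mat(1))
      ultimately show ?thesis unfolding lhs \<phi>_def using q0 by (simp add: divide_simps)
    next
      case 4
      have ji: "j - nc < n" "i - n < nc" using ij 4 by auto
      have "poly (u i j) z = poly q z * (z ^ L * cnj (poly (E (j - nc) (i - n)) z))"
        using 4 by (simp add: u_def RE[OF ji])
      moreover have "four_block_mat (M z) (0\<^sub>m n n) (\<phi> z \<cdot>\<^sub>m (1\<^sub>m nc - (M z)\<^sup>\<dagger> * M z)) (\<phi> z \<cdot>\<^sub>m (M z)\<^sup>\<dagger>) $$ (i, j)
        = \<phi> z * (cnj (poly (E (j - nc) (i - n)) z) / cnj (poly q z))"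
        using 4 ji ij by (simp add: M_def del: index_mult_mat(1))
      ultimately show ?thesis unfolding lhs \<phi>_def using q0 by (simp add: field_simps)
    qed
  qed (use Mc[of z] in \<open>simp_all add: H_def add.commute\<close>)
  show ?thesis
  proof (rule that[of H])
    show "H s \<in> carrier_mat (n + nc) (n + nc)" for s by (rule H)
    show "stable_proper (\<lambda>s. H s $$ (i, j))" if "i < n + nc" "j < n + nc" for i j
      unfolding entry[OF that] by (rule cayley_quotient_stable(1)[OF qq])
    show "hardy_inf_fun (\<lambda>s. H s $$ (i, j))" if "i < n + nc" "j < n + nc" for i j
      unfolding entry[OF that] by (rule cayley_quotient_stable(2)[OF qq])
    fix \<omega> :: real
    let ?s = "\<i> * complex_of_real \<omega>"
    have z: "cmod (cayley ?s) = 1" by (rule cayley_axis_norm)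
    have "cmod (\<phi> (cayley ?s)) = 1" using q[of "cayley ?s"] z by (simp add: \<phi>_def norm_mult norm_divide norm_power)
    then show "H ?s * (H ?s)\<^sup>\<dagger> = 1\<^sub>m (n + nc)"
      unfolding blocks[OF refl z] by (rule unitary_completion[OF Mc M_rows[OF z]])
    show "H ?s $$ (i, j) = poly (E i j) (cayley ?s) / poly q (cayley ?s)" if "i < n" "j < nc" for i j
      unfolding blocks[OF refl z] using that by (simp add: M_def)
  qed
qed

lemma cayley_axis_limit: "((\<lambda>\<omega>. cayley (\<i> * complex_of_real \<omega>)) \<longlongrightarrow> -1) at_top"
proof -
  have "((\<lambda>s. poly [:1, -1:] s / poly [:1, 1:] s) \<longlongrightarrow> (-1 :: complex)) at_infinity"
    using quotient_tendsto_at_infinity[of "[:1, 1:]" "[:1, -1:]"] by simp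
  moreover have "(\<lambda>s. poly [:1, -1:] s / poly [:1, 1:] s) = cayley"
    by (simp add: fun_eq_iff cayley_def)
  ultimately have "(cayley \<longlongrightarrow> -1) at_infinity" by simp
  then show ?thesis by (rule filterlim_compose[OF _ axis_at_infinity(1)])
qed

lemma sum_lessThan_add:
  fixes m k :: nat
  shows "(\<Sum>c<m + k. f c) = (\<Sum>c<m. f c) + (\<Sum>t<k. f (m + t) :: complex)"
  by (induction k) (simp_all add: add.assoc)

text \<open>In the coordinate \<open>cayley s\<close> the entries become polynomials \<open>P\<close> over a common denominator \<open>q\<close>
  without roots in the closed disc.\<close>

lemma stable_proper_common_denominator:
  fixes F :: "complex \<Rightarrow> complex mat"
  assumes sp: "\<And>i j. i < r \<Longrightarrow> j < c \<Longrightarrow> stable_proper (\<lambda>s. F s $$ (i, j))"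
  obtains P q where "\<And>z. cmod z \<le> 1 \<Longrightarrow> poly q z \<noteq> 0"
    "\<And>i j s. i < r \<Longrightarrow> j < c \<Longrightarrow> 0 \<le> Re s \<Longrightarrow> F s $$ (i, j) = poly (P i j) (cayley s) / poly q (cayley s)"
proof -
  have "\<exists>a b. (\<forall>z. cmod z \<le> 1 \<longrightarrow> poly b z \<noteq> 0) \<and> (\<forall>s. 0 \<le> Re s \<longrightarrow> F s $$ (i, j) = poly a (cayley s) / poly b (cayley s))"
    if "i < r" "j < c" for i j
    using stable_proper_cayley[OF sp[OF that]] by metis
  then obtain a b where b: "\<And>i j z. i < r \<Longrightarrow> j < c \<Longrightarrow> cmod z \<le> 1 \<Longrightarrow> poly (b i j) z \<noteq> 0"
    and a: "\<And>i j s. i < r \<Longrightarrow> j < c \<Longrightarrow> 0 \<le> Re s \<Longrightarrow> F s $$ (i, j) = poly (a i j) (cayley s) / poly (b i j) (cayley s)"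
    by metis
  let ?I = "{..<r} \<times> {..<c}"
  let ?b = "\<lambda>x. b (fst x) (snd x)"
  show ?thesis
  proof (rule that[of "\<Prod>x\<in>?I. ?b x" "\<lambda>i j. a i j * (\<Prod>x\<in>?I - {(i, j)}. ?b x)"])
    show q0: "poly (\<Prod>x\<in>?I. ?b x) z \<noteq> 0" if "cmod z \<le> 1" for z
      unfolding poly_prod using b that by (auto simp: prod_zero_iff)
    fix i j s assume ij: "i < r" "j < c" and s: "0 \<le> Re (s :: complex)"
    let ?z = "cayley s"
    have "poly (\<Prod>x\<in>?I - {(i, j)}. ?b x) ?z \<noteq> 0"
      unfolding poly_prod using b cayley_norm[OF s] by (auto simp: prod_zero_iff)
    moreover have "(\<Prod>x\<in>?I. ?b x) = b i j * (\<Prod>x\<in>?I - {(i, j)}. ?b x)"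
      by (subst prod.remove[of ?I "(i, j)"]) (use ij in auto)
    ultimately show "F s $$ (i, j) = poly (a i j * (\<Prod>x\<in>?I - {(i, j)}. ?b x)) ?z / poly (\<Prod>x\<in>?I. ?b x) ?z"
      by (simp add: a[OF ij s])
  qed
qed

text \<open>A strict contraction on the extended axis is a block of a paraunitary matrix: factorize
  \<open>1 - H11 H11\<^sup>\<dagger>\<close> to extend \<open>H11\<close> by further columns to a matrix with orthonormal rows, and complete it.\<close>

lemma contractive_completion:
  assumes c: "\<And>s. H11 s \<in> carrier_mat n ny"
    and sp: "\<And>i j. i < n \<Longrightarrow> j < ny \<Longrightarrow> stable_proper (\<lambda>s. H11 s $$ (i, j))"
    and contractive: "\<And>\<omega>::ereal. freq_val H11 \<omega> * (freq_val H11 \<omega>)\<^sup>\<dagger> \<prec> 1\<^sub>m n"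
  obtains H where "H \<in> admissible_equalizers n ny"
    "\<And>\<omega>::real. block11 n ny H (\<i> * complex_of_real \<omega>) = H11 (\<i> * complex_of_real \<omega>)"
proof -
  obtain P q where q: "\<And>z. cmod z \<le> 1 \<Longrightarrow> poly q z \<noteq> 0"
    and P: "\<And>i j s. i < n \<Longrightarrow> j < ny \<Longrightarrow> 0 \<le> Re s \<Longrightarrow> H11 s $$ (i, j) = poly (P i j) (cayley s) / poly q (cayley s)"
    using stable_proper_common_denominator[of n ny H11, OF sp] by metis
  have regular: "axis_regular n ny H11" by (rule stable_proper_entrywise(4)[OF c sp])
  \<comment> \<open>the point \<open>-1\<close> of the circle carries the value at infinity, so strictness there is also available\<close>
  have "\<exists>\<omega>::ereal. \<forall>i<n. \<forall>j<ny. freq_val H11 \<omega> $$ (i, j) = poly (P i j) z / poly q z" if z: "cmod z = 1" for z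
  proof (cases "z = -1")
    case True
    have "freq_val H11 PInfty $$ (i, j) = poly (P i j) z / poly q z" if ij: "i < n" "j < ny" for i j
    proof (rule tendsto_unique)
      show "((\<lambda>t. H11 (\<i> * complex_of_real t) $$ (i, j)) \<longlongrightarrow> freq_val H11 PInfty $$ (i, j)) at_top"
        using freq_val_tendsto(2)[OF regular ij, of PInfty] by (simp add: axis_filter_def)
      have "((\<lambda>t. poly (P i j) (cayley (\<i> * complex_of_real t)) / poly q (cayley (\<i> * complex_of_real t))) \<longlongrightarrow> poly (P i j) z / poly q z) at_top"
        unfolding True by (intro tendsto_divide tendsto_poly cayley_axis_limit q) simp
      then show "((\<lambda>t. H11 (\<i> * complex_of_real t) $$ (i, j)) \<longlongrightarrow> poly (P i j) z / poly q z) at_top"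
        by (simp add: P[OF ij])
    qed simp
    then show ?thesis by blast
  next
    case False
    then obtain \<omega> :: real where \<omega>: "z = cayley (\<i> * complex_of_real \<omega>)" by (rule cayley_circle[OF z])
    show ?thesis
      by (rule exI[of _ "ereal \<omega>"]) (simp add: freq_val_def P \<omega>)
  qed
  note freq_val = this
  have strict: "(\<Sum>l<ny. (cmod (\<Sum>i<n. cnj (poly (P i l) z) * x $ i))\<^sup>2) < (cmod (poly q z))\<^sup>2 * sqnorm x"
    if z: "cmod z = 1" and x: "x \<in> carrier_vec n" "x \<noteq> 0\<^sub>v n" for z x
  proof -
    obtain \<omega> where \<omega>: "\<And>i j. i < n \<Longrightarrow> j < ny \<Longrightarrow> freq_val H11 \<omega> $$ (i, j) = poly (P i j) z / poly q z"
      using freq_val[OF z] by blast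
    let ?M = "freq_val H11 \<omega>"
    have M: "?M \<in> carrier_mat n ny" by (rule freq_val_tendsto(1)[OF regular])
    have q0: "poly q z \<noteq> 0" using q z by simp
    have "cmod (poly q z) ^ 2 * (cmod ((?M\<^sup>\<dagger> *\<^sub>v x) $ l))\<^sup>2 = (cmod (\<Sum>i<n. cnj (poly (P i l) z) * x $ i))\<^sup>2" if l: "l < ny" for l
    proof -
      have "(?M\<^sup>\<dagger> *\<^sub>v x) $ l = (\<Sum>i<n. ?M\<^sup>\<dagger> $$ (l, i) * x $ i)"
        by (rule mult_mat_vec_sum[OF adjoint_carrier[OF M] x(1) l])
      also have "\<dots> = (\<Sum>i<n. cnj (poly (P i l) z) * x $ i / cnj (poly q z))"
        by (rule sum.cong[OF refl]) (use M l in \<open>simp add: \<omega>\<close>)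
      finally have "(?M\<^sup>\<dagger> *\<^sub>v x) $ l = (\<Sum>i<n. cnj (poly (P i l) z) * x $ i) / cnj (poly q z)"
        by (simp only: sum_divide_distrib)
      then show ?thesis using q0 by (simp add: norm_divide power_divide)
    qed
    then have "(\<Sum>l<ny. (cmod (\<Sum>i<n. cnj (poly (P i l) z) * x $ i))\<^sup>2) = (cmod (poly q z))\<^sup>2 * sqnorm (?M\<^sup>\<dagger> *\<^sub>v x)"
      unfolding sqnorm_sum[OF mult_mat_vec_carrier[OF adjoint_carrier[OF M] x(1)]] sum_distrib_left
      by (intro sum.cong refl) simp
    also have "\<dots> < (cmod (poly q z))\<^sup>2 * sqnorm x"
      using contractive[of \<omega>] x q0 unfolding contraction_iff[OF M] by simp
    finally show ?thesis .
  qed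
  obtain N :: nat and U :: "nat \<Rightarrow> nat \<Rightarrow> complex poly" where U: "\<And>z i j. cmod z = 1 \<Longrightarrow> i < n \<Longrightarrow> j < n \<Longrightarrow>
      (\<Sum>t<N. poly (U i t) z * cnj (poly (U j t) z)) =
      (if i = j then poly q z * cnj (poly q z) else 0) - (\<Sum>l<ny. poly (P i l) z * cnj (poly (P j l) z))"
  proof (rule circle_sum_of_squares[where n = n and ny = ny and P = P and q = q, OF strict])
    fix N :: nat and U :: "nat \<Rightarrow> nat \<Rightarrow> complex poly"
    assume U: "\<And>z i j. cmod z = 1 \<Longrightarrow> i < n \<Longrightarrow> j < n \<Longrightarrow>
      (\<Sum>t<N. poly (U i t) z * cnj (poly (U j t) z)) =
      (if i = j then poly q z * cnj (poly q z) else 0) - (\<Sum>l<ny. poly (P i l) z * cnj (poly (P j l) z))"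
    show thesis by (rule that[OF U])
  qed
  define E where "E i c = (if c < ny then P i c else U i (c - ny))" for i c
  have rows: "(\<Sum>c<ny + N. poly (E i c) z * cnj (poly (E j c) z)) = (if i = j then poly q z * cnj (poly q z) else 0)"
    if "cmod z = 1" "i < n" "j < n" for z i j
    unfolding sum_lessThan_add using U[OF that] by (simp add: E_def)
  let ?nf = "n + (ny + N)"
  obtain H where H: "\<And>s. H s \<in> carrier_mat ?nf ?nf"
    "\<And>i j. i < ?nf \<Longrightarrow> j < ?nf \<Longrightarrow> stable_proper (\<lambda>s. H s $$ (i, j))"
    "\<And>i j. i < ?nf \<Longrightarrow> j < ?nf \<Longrightarrow> hardy_inf_fun (\<lambda>s. H s $$ (i, j))"
    "\<And>\<omega>::real. H (\<i> * complex_of_real \<omega>) * (H (\<i> * complex_of_real \<omega>))\<^sup>\<dagger> = 1\<^sub>m ?nf"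
    "\<And>(\<omega>::real) i j. i < n \<Longrightarrow> j < ny + N \<Longrightarrow> H (\<i> * complex_of_real \<omega>) $$ (i, j)
      = poly (E i j) (cayley (\<i> * complex_of_real \<omega>)) / poly q (cayley (\<i> * complex_of_real \<omega>))"
    by (rule polynomial_completion[OF q rows]) auto
  have rational: "rational_fun (\<lambda>s. H s $$ (i, j))" if "i < ?nf" "j < ?nf" for i j
    using stable_proper_proper_rational[OF H(2)[OF that]] unfolding proper_rational_fun_def rational_fun_def by blast
  show ?thesis
  proof (rule that[of H])
    have "entrywise ?nf ?nf rational_fun H" "entrywise ?nf ?nf hardy_inf_fun H"
      using H(1,3) rational by (simp_all add: entrywise_def)
    then show "H \<in> admissible_equalizers n ny"
      unfolding admissible_equalizers_def
      using stable_proper_entrywise[OF H(1,2)] paraunitary_if_unitary_on_axis[OF H(1) rational H(4)]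
      by (intro CollectI exI[of _ "n + N"] exI[of _ ?nf] conjI) simp_all
    show "block11 n ny H (\<i> * complex_of_real \<omega>) = H11 (\<i> * complex_of_real \<omega>)" for \<omega>
      by (rule eq_matI) (use c[of "\<i> * complex_of_real \<omega>"] block11_carrier[of n ny H "\<i> * complex_of_real \<omega>"] in
        \<open>simp_all add: block11_index H(5) P E_def\<close>)
  qed
qed

section \<open>The two optimal values and the design\<close>

text \<open>The infima agree when every element of the larger set is approached from above by the smaller one.\<close>

lemma cInf_eq_if_approximated:
  fixes S T :: "real set"
  assumes ne: "S \<noteq> {}" and sub: "S \<subseteq> T" and low: "\<And>x. x \<in> T \<Longrightarrow> 0 < x"
    and approx: "\<And>x y. x \<in> T \<Longrightarrow> x < y \<Longrightarrow> y \<in> S"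
  shows "Inf S = Inf T"
proof (rule antisym)
  have bdd: "bdd_below T" using low by (intro bdd_belowI[of _ 0]) (simp add: less_imp_le)
  then have bddS: "bdd_below S" using sub by (rule bdd_below_mono)
  show "Inf T \<le> Inf S" by (rule cInf_superset_mono[OF ne bdd sub])
  show "Inf S \<le> Inf T"
  proof (rule cInf_greatest)
    show "T \<noteq> {}" using ne sub by blast
    fix x assume x: "x \<in> T"
    show "Inf S \<le> x"
    proof (rule dense_ge)
      fix y assume "x < y"
      then show "Inf S \<le> y" using cInf_lower[OF approx[OF x] bddS] by simp
    qed
  qed
qed

text \<open>The error spectrum on the axis depends on \<open>H\<close> through the values of its block there.\<close>

lemma contractive_equalizer_completion:
  assumes \<Phi>: "axis_regular (ny + n) (ny + n) \<Phi>" and H11: "H11 \<in> contractive_equalizers n ny \<Phi> \<gamma>"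
  shows "\<exists>H \<in> admissible_equalizers n ny. error_below n \<Phi> (block11 n ny H) \<gamma>"
proof -
  obtain \<tau> where \<tau>: "\<tau> > 0" "entrywise n ny (\<lambda>f. f analytic_on {s. Re s > - \<tau>}) H11"
    using H11 unfolding contractive_equalizers_def by blast
  have c: "H11 s \<in> carrier_mat n ny" for s using \<tau>(2) by (simp add: entrywise_def)
  have sp: "stable_proper (\<lambda>s. H11 s $$ (i, j))" if "i < n" "j < ny" for i j
    by (rule stable_proper_if_proper[OF _ \<tau>(1)])
      (use H11 \<tau>(2) that in \<open>simp_all add: contractive_equalizers_def entrywise_def\<close>)
  have contr: "freq_val H11 \<omega> * (freq_val H11 \<omega>)\<^sup>\<dagger> \<prec> 1\<^sub>m n" for \<omega>
    using H11 by (simp add: contractive_equalizers_def)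
  obtain H where H: "H \<in> admissible_equalizers n ny"
    "\<And>\<omega>::real. block11 n ny H (\<i> * complex_of_real \<omega>) = H11 (\<i> * complex_of_real \<omega>)"
    using contractive_completion[OF c sp contr] by metis
  have "error_below n \<Phi> H11 \<gamma>" using H11 by (simp add: contractive_equalizers_def)
  then have "error_below n \<Phi> (block11 n ny H) \<gamma>"
    unfolding error_below_def error_psd_def by (simp add: paraconj_axis H(2))
  then show ?thesis using H(1) by blast
qed

text \<open>One inclusion of the feasible levels is the completion; the other holds up to an arbitrarily small increase
  of the level.\<close>

lemma gamma_opt_contractive_eq:
  assumes \<Phi>: "axis_regular (ny + n) (ny + n) \<Phi>"
    and real: "\<And>(\<omega>::real) x. x \<in> carrier_vec (ny + n) \<Longrightarrow> Im ((\<Phi> (\<i> * complex_of_real \<omega>) *\<^sub>v x) \<bullet>c x) = 0"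
    and psd: "\<And>(\<omega>::real) h. h \<in> carrier_vec ny \<Longrightarrow> 0 \<le> Re ((\<Phi> (\<i> * complex_of_real \<omega>) *\<^sub>v (h @\<^sub>v 0\<^sub>v n)) \<bullet>c (h @\<^sub>v 0\<^sub>v n))"
    and lower: "\<And>(\<omega>::real) u. u \<in> carrier_vec n \<Longrightarrow> Re ((\<Phi> (\<i> * complex_of_real \<omega>) *\<^sub>v (0\<^sub>v ny @\<^sub>v u)) \<bullet>c (0\<^sub>v ny @\<^sub>v u)) \<le> c * sqnorm u"
    and ne: "\<gamma> > 0" "contractive_equalizers n ny \<Phi> \<gamma> \<noteq> {}"
  shows "gamma_opt_contractive n ny \<Phi> = gamma_opt n ny \<Phi>"
  unfolding gamma_opt_contractive_def gamma_opt_def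
proof (rule cInf_eq_if_approximated)
  show "{\<gamma>. \<gamma> > 0 \<and> contractive_equalizers n ny \<Phi> \<gamma> \<noteq> {}} \<noteq> {}" using ne by blast
  show "{\<gamma>. \<gamma> > 0 \<and> contractive_equalizers n ny \<Phi> \<gamma> \<noteq> {}} \<subseteq>
      {\<gamma>. \<gamma> > 0 \<and> (\<exists>H \<in> admissible_equalizers n ny. error_below n \<Phi> (block11 n ny H) \<gamma>)}"
    using contractive_equalizer_completion[OF \<Phi>] by blast
  fix x y assume x: "x \<in> {\<gamma>. \<gamma> > 0 \<and> (\<exists>H \<in> admissible_equalizers n ny. error_below n \<Phi> (block11 n ny H) \<gamma>)}" and y: "x < y"
  then obtain H where H: "0 < x" "H \<in> admissible_equalizers n ny" "error_below n \<Phi> (block11 n ny H) x" by blast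
  have "contractive_equalizers n ny \<Phi> y \<noteq> {}"
    by (rule scaled_block_contractive[OF \<Phi> real psd lower H(2,3,1) y])
  then show "y \<in> {\<gamma>. \<gamma> > 0 \<and> contractive_equalizers n ny \<Phi> \<gamma> \<noteq> {}}" using H(1) y by simp
qed simp

theorem theorem3:
  fixes n nw ny nd q m p m11 :: nat
    and A B C D \<Sigma>u \<Sigma>w :: "complex mat"
    and A\<Upsilon> B\<Upsilon> C1\<Upsilon> C2\<Upsilon> D1\<Upsilon> D2\<Upsilon> Nc :: "complex mat"
    and \<Upsilon> G \<Phi> :: "complex \<Rightarrow> complex mat"
    and lam \<gamma>b \<theta> \<gamma> :: real
  assumes channel: "quantum_channel n nw ny nd q A B C D"
    and G: "G = transfer_fun A B C D"
    and \<Sigma>u: "\<Sigma>u \<in> carrier_mat n n" "pos_def \<Sigma>u"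
    and \<Sigma>w: "\<Sigma>w \<in> carrier_mat nw nw" "pos_def \<Sigma>w"
    and \<Phi>: "\<Phi> = Phi n ny G \<Sigma>u \<Sigma>w"
    and lam: "lam \<ge> 0"
    and factor: "spectral_factor (ny + n) p (Phi_lambda n ny G \<Sigma>u \<Sigma>w lam) \<Upsilon>"
    and C1\<Upsilon>: "C1\<Upsilon> \<in> carrier_mat ny m" and C2\<Upsilon>: "C2\<Upsilon> \<in> carrier_mat n m"
    and D1\<Upsilon>: "D1\<Upsilon> \<in> carrier_mat ny p" and D2\<Upsilon>: "D2\<Upsilon> \<in> carrier_mat n p"
    and realization: "minimal_realization m (ny + n) p A\<Upsilon> B\<Upsilon> (C1\<Upsilon> @\<^sub>r C2\<Upsilon>) (D1\<Upsilon> @\<^sub>r D2\<Upsilon>) \<Upsilon>"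
    and hurwitz: "hurwitz A\<Upsilon>"
    and Nc: "full_rank_kernel_mat (C1\<Upsilon> @\<^sub>c D1\<Upsilon>) Nc"
    and \<gamma>b: "\<gamma>b > 0"
    and feasible: "lmi_feasible m p n m11 A\<Upsilon> B\<Upsilon> C2\<Upsilon> D2\<Upsilon> Nc lam \<gamma>b"
    and \<gamma>: "\<gamma> = sqrt (\<gamma>b\<^sup>2 - lam\<^sup>2)"
    and \<theta>: "\<theta> > 0"
    and condition: "\<forall>\<omega>::ereal. pos_def
      (complex_of_real \<theta> \<cdot>\<^sub>m (freq_val \<Phi> \<omega> - complex_of_real (\<gamma>\<^sup>2) \<cdot>\<^sub>m lower_id ny n) - signature_mat ny n)"
  shows "\<gamma> > 0 \<and>
    contractive_equalizers n ny \<Phi> \<gamma> \<noteq> {} \<and>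
    \<gamma> \<ge> gamma_opt_contractive n ny \<Phi> \<and>
    gamma_opt_contractive n ny \<Phi> = gamma_opt n ny \<Phi> \<and>
    (\<exists>A11 B11 C11 J11. is_design m p n ny m11 A\<Upsilon> B\<Upsilon> C1\<Upsilon> C2\<Upsilon> D1\<Upsilon> D2\<Upsilon> \<gamma>b A11 B11 C11 J11) \<and>
    (\<forall>A11 B11 C11 J11. is_design m p n ny m11 A\<Upsilon> B\<Upsilon> C1\<Upsilon> C2\<Upsilon> D1\<Upsilon> D2\<Upsilon> \<gamma>b A11 B11 C11 J11 \<longrightarrow>
      transfer_fun A11 B11 C11 J11 \<in> contractive_equalizers n ny \<Phi> \<gamma>)"
proof -
  have real\<Upsilon>: "A\<Upsilon> \<in> carrier_mat m m" "B\<Upsilon> \<in> carrier_mat m p"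
    "\<forall>\<^sub>F s in cofinite. \<Upsilon> s = transfer_fun A\<Upsilon> B\<Upsilon> (C1\<Upsilon> @\<^sub>r C2\<Upsilon>) (D1\<Upsilon> @\<^sub>r D2\<Upsilon>) s"
    using realization unfolding minimal_realization_def realization_def by blast+
  interpret factor_realization m p n ny m11 A\<Upsilon> B\<Upsilon> C1\<Upsilon> C2\<Upsilon> D1\<Upsilon> D2\<Upsilon>
    by unfold_locales (use real\<Upsilon> C1\<Upsilon> C2\<Upsilon> D1\<Upsilon> D2\<Upsilon> in auto)
  have gap: "\<gamma>b\<^sup>2 - lam\<^sup>2 > 0" using feasible by (simp add: lmi_feasible_def)
  then have \<gamma>0: "\<gamma> > 0" and \<gamma>2: "\<gamma>\<^sup>2 = \<gamma>b\<^sup>2 - lam\<^sup>2" by (simp_all add: \<gamma>)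
  have regular: "axis_regular (ny + n) (ny + n) \<Phi>"
    unfolding \<Phi> G by (rule Phi_axis_regular[OF channel \<Sigma>u(1) \<Sigma>w(1)])
  have designs: "transfer_fun A11 B11 C11 J11 \<in> contractive_equalizers n ny \<Phi> \<gamma>"
    if "is_design m p n ny m11 A\<Upsilon> B\<Upsilon> C1\<Upsilon> C2\<Upsilon> D1\<Upsilon> D2\<Upsilon> \<gamma>b A11 B11 C11 J11" for A11 B11 C11 J11
    unfolding \<Phi>
    by (rule design_contractive[OF _ hurwitz _ real\<Upsilon>(3) \<gamma>2 \<theta> _ that, of G \<Sigma>u \<Sigma>w])
      (use regular factor condition in \<open>simp_all add: \<Phi> spectral_factor_def\<close>)
  obtain A11 B11 C11 J11 where design: "is_design m p n ny m11 A\<Upsilon> B\<Upsilon> C1\<Upsilon> C2\<Upsilon> D1\<Upsilon> D2\<Upsilon> \<gamma>b A11 B11 C11 J11"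
    using design_exists[OF Nc feasible] by blast
  have nonempty: "contractive_equalizers n ny \<Phi> \<gamma> \<noteq> {}" using designs[OF design] by blast
  have bdd: "bdd_below {\<gamma>. \<gamma> > 0 \<and> contractive_equalizers n ny \<Phi> \<gamma> \<noteq> {}}"
    by (rule bdd_belowI[of _ 0]) simp
  have below: "gamma_opt_contractive n ny \<Phi> \<le> \<gamma>"
    unfolding gamma_opt_contractive_def by (rule cInf_lower[OF _ bdd]) (use \<gamma>0 nonempty in blast)
  have carrier: "\<Phi> (\<i> * complex_of_real \<omega>) \<in> carrier_mat (ny + n) (ny + n)" for \<omega>
    by (rule axis_regularD(1)[OF regular])
  have cond: "pos_def (complex_of_real \<theta> \<cdot>\<^sub>m (\<Phi> (\<i> * complex_of_real \<omega>) - complex_of_real (\<gamma>\<^sup>2) \<cdot>\<^sub>m lower_id ny n) - signature_mat ny n)" for \<omega>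
    using condition[rule_format, of "ereal \<omega>"] by (simp add: freq_val_def)
  have real: "Im ((\<Phi> (\<i> * complex_of_real \<omega>) *\<^sub>v x) \<bullet>c x) = 0" if x: "x \<in> carrier_vec (ny + n)" for \<omega> x
    by (rule append_vec_cases[OF x]) (simp only: condition_form(2)[OF carrier \<theta> cond])
  \<comment> \<open>the condition at \<open>(h, 0)\<close>\<close>
  have psd: "0 \<le> Re ((\<Phi> (\<i> * complex_of_real \<omega>) *\<^sub>v (h @\<^sub>v 0\<^sub>v n)) \<bullet>c (h @\<^sub>v 0\<^sub>v n))" if h: "h \<in> carrier_vec ny" for \<omega> h
  proof (cases "h = 0\<^sub>v ny")
    case True
    then show ?thesis
      using mult_mat_zero_vec[OF carrier[of \<omega>]] by (simp add: append_vec_zero[symmetric] inner_zero_left)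
  next
    case False
    then have "h @\<^sub>v 0\<^sub>v n \<noteq> 0\<^sub>v (ny + n)" using append_vec_eq_0[OF h zero_carrier_vec, of n] by blast
    from condition_form(1)[OF carrier[of \<omega>] \<theta> cond h zero_carrier_vec this]
    have "0 < \<theta> * Re ((\<Phi> (\<i> * complex_of_real \<omega>) *\<^sub>v (h @\<^sub>v 0\<^sub>v n)) \<bullet>c (h @\<^sub>v 0\<^sub>v n)) - sqnorm h"
      by (simp add: sqnorm_def)
    then have "0 < \<theta> * Re ((\<Phi> (\<i> * complex_of_real \<omega>) *\<^sub>v (h @\<^sub>v 0\<^sub>v n)) \<bullet>c (h @\<^sub>v 0\<^sub>v n))"
      using sqnorm_nonneg[of h] by linarith
    then show ?thesis using \<theta> by (simp add: zero_less_mult_iff)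
  qed
  let ?S = "transpose_mat \<Sigma>u + 2 \<cdot>\<^sub>m 1\<^sub>m n"
  have S: "?S \<in> carrier_mat n n" using \<Sigma>u(1) by simp
  \<comment> \<open>Finsler's lemma with the identity gives an upper bound for a single form\<close>
  have "\<exists>c. \<forall>u\<in>carrier_vec n. u \<noteq> 0\<^sub>v n \<longrightarrow> Re ((?S *\<^sub>v u) \<bullet>c u) < c * sqnorm (1\<^sub>m n *\<^sub>v u)"
    by (rule finsler[OF S one_carrier_mat[of n]]) (simp, blast)
  then obtain c where c: "\<And>u. u \<in> carrier_vec n \<Longrightarrow> u \<noteq> 0\<^sub>v n \<Longrightarrow> Re ((?S *\<^sub>v u) \<bullet>c u) < c * sqnorm (1\<^sub>m n *\<^sub>v u)"
    by blast
  have lower: "Re ((\<Phi> (\<i> * complex_of_real \<omega>) *\<^sub>v (0\<^sub>v ny @\<^sub>v u)) \<bullet>c (0\<^sub>v ny @\<^sub>v u)) \<le> c * sqnorm u"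
    if u: "u \<in> carrier_vec n" for \<omega> u
  proof (cases "u = 0\<^sub>v n")
    case True
    then show ?thesis
      using mult_mat_zero_vec[OF carrier[of \<omega>]] by (simp add: append_vec_zero[symmetric] inner_zero_left sqnorm_def)
  next
    case False
    then show ?thesis
      unfolding \<Phi> G Phi_lower_form[OF channel \<Sigma>u(1) \<Sigma>w(1) u] using c[OF u] u by simp
  qed
  have "gamma_opt_contractive n ny \<Phi> = gamma_opt n ny \<Phi>"
    by (rule gamma_opt_contractive_eq[OF regular real psd lower \<gamma>0 nonempty])
  then show ?thesis using \<gamma>0 nonempty below design designs by blast
qed

end
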